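(* Assume the hypotheses [Convexity], [Dynamics], [Running cost], [Terminal cost] and [Inner ball] stated in the context, that $g$ is locally semiconcave, that $V$ is (real-valued and) continuous, and that $H^0$ is $C^{1,1}$ on $\mathbb{R}^d\times(\mathbb{R}^d\setminus\{0\})$. For every $x\in\partial\mathcal S^*_1$ let $\mathbf n(x)$ be the unit proximal normal vector to $\overline{\mathcal S^c}$ at $x$. If the set $$\partial\mathcal S^{*,0}_{1}=\left\{x\in\partial\mathcal S^*_1:\max_{\omega\in U}\{\mathbf n(x)\cdot f(x,\omega)\}=0\right\}$$ is countably $\mathcal H^{d-2}$-rectifiable and $\mathbf n$ is locally Lipschitz on $\partial\mathcal S^{*,0}_1$, then the singular set $$\Sigma_V=\{x\in\mathcal S^c: V\text{ is not differentiable at }x\}$$ is countably $\mathcal H^{d-1}$-rectifiable.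
   Context: Setting. $U\subset\mathbb{R}^m$ is nonempty and compact, $\mathcal S\subseteq\mathbb{R}^d$ is nonempty and closed (the target), $\mathcal S^c=\mathbb{R}^d\setminus\mathcal S$, and $f:\mathbb{R}^d\times U\to\mathbb{R}^d$, $r:\mathbb{R}^d\times U\to\mathbb{R}$, $g:\mathbb{R}^d\to\mathbb{R}$ are given. For $x\in\mathbb{R}^d$ and a measurable control $u:[0,\infty)\to U$, $y^{x,u}$ is the Carath\'eodory solution of $y'(s)=f(y(s),u(s))$, $y(0)=x$, and $\tau^{x,u}=\min\{t\ge 0:y^{x,u}(t)\in\mathcal S\}$ ($+\infty$ if $\mathcal S$ is never reached). The value function is $V(x)=\inf_u\big(\int_0^{\tau^{x,u}}r(y^{x,u}(s),u(s))\,ds+g(y^{x,u}(\tau^{x,u}))\big)$, the infimum being over measurable controls with $\tau^{x,u}<\infty$. Here $V$ is understood to be finite and continuous on $\mathbb{R}^d$ (so every point can be steered to $\mathcal S$). $H^0(x,p)=\max_{\omega\in U}\{-p\cdot f(x,\omega)\}$. $C^{1,1}$ means differentiable with locally Lipschitz gradient. Hypotheses (with constants $N,L,r_0,\rho_0>0$). [Convexity] For every $x$ the set $\{(v,\lambda)\in\mathbb{R}^d\times\mathbb{R}:\exists\omega\in U,\ v=f(x,\omega),\ \lambda\ge r(x,\omega)\}$ is convex. [Dynamics] $f$ is continuous, $|f|<N$; $D_xf$ exists everywhere and is continuous in $(x,u)$; $|f(y,\omega)-f(x,\omega)|\le L|y-x|$ and $|D_xf(y,\omega)-D_xf(x,\omega)|\le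 L|y-x|$ for all $x,y\in\mathbb{R}^d$, $\omega\in U$. [Running cost] $r$ is continuous and differentiable in $x$, $D_xr$ is continuous, $|r(y,\omega)-r(x,\omega)|+|D_xr(y,\omega)-D_xr(x,\omega)|\le L|y-x|$ for all $x,y,\omega$, and $r(x,\omega)\ge r_0$ for all $x,\omega$. [Terminal cost] There are a neighborhood $\mathcal N$ of $\partial\mathcal S$ and $0\le G<r_0/N$ with $|g(y)-g(x)|\le G|y-x|$ for $x,y\in\mathcal N$. [Inner ball] For every $x\in\partial\mathcal S$ there is a unit $\xi_x\in N^P_{\overline{\mathcal S^c}}(x)$ with $\xi_x\cdot(y-x)\le\frac1{2\rho_0}|y-x|^2$ for all $y\in\overline{\mathcal S^c}$. Notions. For a closed set $Q$ and $x\in Q$, $v\in N^P_Q(x)$ (proximal normal) iff there is $\sigma\ge0$ with $v\cdot(y-x)\le\sigma|y-x|^2$ for all $y\in Q$. $g$ is locally semiconcave if every point has a ball $B$ and $c>0$ with $(1-\lambda)g(x_0)+\lambda g(x_1)-g((1-\lambda)x_0+\lambda x_1)\le c\lambda(1-\lambda)|x_0-x_1|^2$ for $x_0,x_1\in B$, $\lambda\in[0,1]$. The reachable boundary $\partial\mathcal S^*$ is the set of $x^*\in\partial\mathcal S$ for which there are $\delta>0$ and points $x_n^*\in\partial\mathcal S$ with $x_n^*\to x^*$ such that each $x_n^*=y^{x_n,u_n}(\tau^{x_n,u_n})$ for some $x_n$ and control $u_n$ with $\delta\le\tau^{x_n,u_n}<\infty$. $\partial\mathcal S_1^*=\{x\in\partial\mathcal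 S^*:\dim N^P_{\overline{\mathcal S^c}}(x)=1\}$; at such points the normal cone is the half line $\{s\,\mathbf n(x):s\ge0\}$. A set is countably $\mathcal H^{k}$-rectifiable if, up to an $\mathcal H^k$-null set, it is contained in a countable union of Lipschitz images of subsets of $\mathbb{R}^k$. *)

theory Defs
  imports "HOL-Analysis.Analysis"
begin

section \<open>Hausdorff measure and rectifiability\<close>

definition hausdorff_content :: "nat \<Rightarrow> real \<Rightarrow> 'a::metric_space set \<Rightarrow> ennreal" where
  "hausdorff_content k \<delta> E =
     (INF C \<in> {C :: nat \<Rightarrow> 'a set. E \<subseteq> (\<Union>i. C i) \<and> (\<forall>i. bounded (C i) \<and> diameter (C i) \<le> \<delta>)}.
        \<Sum>i. if C i = {} then 0 else ennreal (unit_ball_vol (real k) * (diameter (C i) / 2) ^ k))"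
  (* The empty set must contribute 0 also for k = 0, where (diameter _ / 2) ^ 0 = 1;
     with this, the 0-dimensional measure is the counting measure. *)

definition hausdorff_measure :: "nat \<Rightarrow> 'a::metric_space set \<Rightarrow> ennreal" where
  "hausdorff_measure k E = (SUP \<delta> \<in> {0<..}. hausdorff_content k \<delta> E)"

(* The library's R^k with k a term is topspace (Euclidean_space k), the functions
   nat => real vanishing from index k on; L2_set over {..<k} is the Euclidean norm there. *)
definition lipschitz_from_Rk :: "nat \<Rightarrow> (nat \<Rightarrow> real) set \<Rightarrow> ((nat \<Rightarrow> real) \<Rightarrow> 'a::metric_space) \<Rightarrow> bool" where
  "lipschitz_from_Rk k A \<phi> \<longleftrightarrow>
     A \<subseteq> topspace (Euclidean_space k) \<and>
     (\<exists>C\<ge>0. \<forall>a\<in>A. \<forall>b\<in>A. dist (\<phi> a) (\<phi> b) \<le> C * L2_set (\<lambda>i. a i - b i) {..<k})"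

definition countably_rectifiable :: "nat \<Rightarrow> 'a::metric_space set \<Rightarrow> bool" where
  "countably_rectifiable k E \<longleftrightarrow>
     (\<exists>A \<phi>. (\<forall>i::nat. lipschitz_from_Rk k (A i) (\<phi> i)) \<and>
            hausdorff_measure k (E - (\<Union>i. \<phi> i ` A i)) = 0)"

section \<open>Regularity and nonsmooth analysis\<close>

definition locally_lipschitz_on :: "'a::metric_space set \<Rightarrow> ('a \<Rightarrow> 'b::metric_space) \<Rightarrow> bool" where
  "locally_lipschitz_on A h \<longleftrightarrow> (\<forall>x\<in>A. \<exists>\<epsilon>>0. \<exists>C. C-lipschitz_on (ball x \<epsilon> \<inter> A) h)"

definition C11_on :: "'a::real_inner set \<Rightarrow> ('a \<Rightarrow> real) \<Rightarrow> bool" where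
  "C11_on W h \<longleftrightarrow> (\<exists>Dh. (\<forall>z\<in>W. GDERIV h z :> Dh z) \<and> locally_lipschitz_on W Dh)"

definition locally_semiconcave :: "('a::real_normed_vector \<Rightarrow> real) \<Rightarrow> bool" where
  "locally_semiconcave g \<longleftrightarrow>
     (\<forall>z. \<exists>\<epsilon>>0. \<exists>c>0. \<forall>x0\<in>ball z \<epsilon>. \<forall>x1\<in>ball z \<epsilon>. \<forall>\<theta>\<in>{0..1}.
        (1 - \<theta>) * g x0 + \<theta> * g x1 - g ((1 - \<theta>) *\<^sub>R x0 + \<theta> *\<^sub>R x1)
          \<le> c * \<theta> * (1 - \<theta>) * (norm (x0 - x1))\<^sup>2)"

definition proximal_normal :: "'a::real_inner set \<Rightarrow> 'a \<Rightarrow> 'a set" where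
  "proximal_normal Q x = {v. \<exists>\<sigma>\<ge>0. \<forall>y\<in>Q. v \<bullet> (y - x) \<le> \<sigma> * (norm (y - x))\<^sup>2}"

section \<open>The control problem\<close>

text \<open>Functions on \<open>\<real>\<^sup>d \<times> U\<close> are curried total functions; only their values for controls in
  \<open>U\<close> are ever used.\<close>

definition admissible_control :: "(real^'m) set \<Rightarrow> (real \<Rightarrow> real^'m) \<Rightarrow> bool" where
  "admissible_control U u \<longleftrightarrow>
     u \<in> borel_measurable (lebesgue_on {0..}) \<and> (\<forall>t\<ge>0. u t \<in> U)"

(* Integral form of y' = f(y,u) a.e., y(0) = x, with y locally absolutely continuous. *)
definition caratheodory_solution ::
  "(real^'d \<Rightarrow> real^'m \<Rightarrow> real^'d) \<Rightarrow> real^'d \<Rightarrow> (real \<Rightarrow> real^'m) \<Rightarrow> (real \<Rightarrow> real^'d) \<Rightarrow> bool" where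
  "caratheodory_solution f x u y \<longleftrightarrow>
     (\<forall>t\<ge>0. set_integrable lebesgue {0..t} (\<lambda>s. f (y s) (u s)) \<and>
            y t = x + (LINT s:{0..t}|lebesgue. f (y s) (u s)))"

(* T is the minimum of {t \<ge> 0. y t \<in> S}; no such T exists iff the hitting time is infinite
   (for closed S and continuous y). *)
definition is_hitting_time :: "(real^'d) set \<Rightarrow> (real \<Rightarrow> real^'d) \<Rightarrow> real \<Rightarrow> bool" where
  "is_hitting_time S y T \<longleftrightarrow> 0 \<le> T \<and> y T \<in> S \<and> (\<forall>t. 0 \<le> t \<and> y t \<in> S \<longrightarrow> T \<le> t)"

definition value_function ::
  "(real^'m) set \<Rightarrow> (real^'d) set \<Rightarrow> (real^'d \<Rightarrow> real^'m \<Rightarrow> real^'d) \<Rightarrow>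
   (real^'d \<Rightarrow> real^'m \<Rightarrow> real) \<Rightarrow> (real^'d \<Rightarrow> real) \<Rightarrow> real^'d \<Rightarrow> ereal" where
  "value_function U S f r g x =
     Inf {ereal ((LINT s:{0..T}|lebesgue. r (y s) (u s)) + g (y T)) | u y T.
            admissible_control U u \<and> caratheodory_solution f x u y \<and> is_hitting_time S y T}"

(* A maximum under the standing assumptions (U nonempty and compact, f continuous). *)
definition H0 :: "(real^'m) set \<Rightarrow> (real^'d \<Rightarrow> real^'m \<Rightarrow> real^'d) \<Rightarrow> real^'d \<Rightarrow> real^'d \<Rightarrow> real" where
  "H0 U f x p = (SUP \<omega>\<in>U. - (p \<bullet> f x \<omega>))"

section \<open>Standing assumptions\<close>

definition convexity_condition where
  "convexity_condition (U :: (real^'m) set) (f :: real^'d \<Rightarrow> real^'m \<Rightarrow> real^'d) r \<longleftrightarrow>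
     (\<forall>x. convex {(v, l :: real). \<exists>\<omega>\<in>U. v = f x \<omega> \<and> l \<ge> r x \<omega>})"

definition dynamics_condition where
  "dynamics_condition (U :: (real^'m) set) (f :: real^'d \<Rightarrow> real^'m \<Rightarrow> real^'d) N L \<longleftrightarrow>
     continuous_on (UNIV \<times> U) (\<lambda>(x, \<omega>). f x \<omega>) \<and>
     (\<forall>x. \<forall>\<omega>\<in>U. norm (f x \<omega>) < N) \<and>
     (\<forall>x y. \<forall>\<omega>\<in>U. norm (f y \<omega> - f x \<omega>) \<le> L * norm (y - x)) \<and>
     (\<exists>Df :: real^'d \<Rightarrow> real^'m \<Rightarrow> ((real^'d) \<Rightarrow>\<^sub>L (real^'d)).
        (\<forall>x. \<forall>\<omega>\<in>U. ((\<lambda>z. f z \<omega>) has_derivative blinfun_apply (Df x \<omega>)) (at x)) \<and>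
        continuous_on (UNIV \<times> U) (\<lambda>(x, \<omega>). Df x \<omega>) \<and>
        (\<forall>x y. \<forall>\<omega>\<in>U. norm (Df y \<omega> - Df x \<omega>) \<le> L * norm (y - x)))"

definition running_cost_condition where
  "running_cost_condition (U :: (real^'m) set) (r :: real^'d \<Rightarrow> real^'m \<Rightarrow> real) L r0 \<longleftrightarrow>
     continuous_on (UNIV \<times> U) (\<lambda>(x, \<omega>). r x \<omega>) \<and>
     (\<forall>x. \<forall>\<omega>\<in>U. r0 \<le> r x \<omega>) \<and>
     (\<exists>Dr :: real^'d \<Rightarrow> real^'m \<Rightarrow> real^'d.
        (\<forall>x. \<forall>\<omega>\<in>U. GDERIV (\<lambda>z. r z \<omega>) x :> Dr x \<omega>) \<and>
        continuous_on (UNIV \<times> U) (\<lambda>(x, \<omega>). Dr x \<omega>) \<and>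
        (\<forall>x y. \<forall>\<omega>\<in>U. \<bar>r y \<omega> - r x \<omega>\<bar> + norm (Dr y \<omega> - Dr x \<omega>) \<le> L * norm (y - x)))"

definition terminal_cost_condition where
  "terminal_cost_condition (S :: (real^'d) set) (g :: real^'d \<Rightarrow> real) N r0 \<longleftrightarrow>
     (\<exists>W G. open W \<and> frontier S \<subseteq> W \<and> 0 \<le> G \<and> G < r0 / N \<and>
            (\<forall>x\<in>W. \<forall>y\<in>W. \<bar>g y - g x\<bar> \<le> G * norm (y - x)))"

definition inner_ball_condition where
  "inner_ball_condition (S :: (real^'d) set) \<rho>0 \<longleftrightarrow>
     (\<forall>x\<in>frontier S. \<exists>\<xi>\<in>proximal_normal (closure (- S)) x. norm \<xi> = 1 \<and>
        (\<forall>y\<in>closure (- S). \<xi> \<bullet> (y - x) \<le> 1 / (2 * \<rho>0) * (norm (y - x))\<^sup>2))"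

section \<open>The reachable boundary\<close>

definition reachable_boundary ::
  "(real^'m) set \<Rightarrow> (real^'d) set \<Rightarrow> (real^'d \<Rightarrow> real^'m \<Rightarrow> real^'d) \<Rightarrow> (real^'d) set" where
  "reachable_boundary U S f =
     {z \<in> frontier S. \<exists>\<delta>>0. \<exists>z' :: nat \<Rightarrow> real^'d.
        (\<forall>n. z' n \<in> frontier S) \<and> z' \<longlonglongrightarrow> z \<and>
        (\<forall>n. \<exists>x u y T. admissible_control U u \<and> caratheodory_solution f x u y \<and>
                       is_hitting_time S y T \<and> \<delta> \<le> T \<and> z' n = y T)}"

definition reachable_boundary1 ::
  "(real^'m) set \<Rightarrow> (real^'d) set \<Rightarrow> (real^'d \<Rightarrow> real^'m \<Rightarrow> real^'d) \<Rightarrow> (real^'d) set" where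
  "reachable_boundary1 U S f =
     {z \<in> reachable_boundary U S f. dim (proximal_normal (closure (- S)) z) = 1}"

(* nu stands for a field of unit vectors with proximal_normal (closure (- S)) z the half line
   spanned by nu z for every z in reachable_boundary1 (dim = 1 alone would also allow a full line).
   The supremum is a maximum, as in H0. For d = 1 the set is empty under the standing
   assumptions, so that the truncated dimension d - 2 = 0 is harmless for it. *)
definition reachable_boundary10 ::
  "(real^'m) set \<Rightarrow> (real^'d) set \<Rightarrow> (real^'d \<Rightarrow> real^'m \<Rightarrow> real^'d) \<Rightarrow>
   (real^'d \<Rightarrow> real^'d) \<Rightarrow> (real^'d) set" where
  "reachable_boundary10 U S f \<nu> =
     {z \<in> reachable_boundary1 U S f. (SUP \<omega>\<in>U. \<nu> z \<bullet> f z \<omega>) = 0}"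

end

theory Submission
  imports Defs
begin

text \<open>Near-optimal trajectories from \<open>x\<close> accumulate at an exit time \<open>T\<close> and an exit point \<open>xs\<close>. For
  every proximal normal \<open>v\<close> at \<open>xs\<close>, transporting a combination of \<open>v\<close> and a supergradient of \<open>g\<close> backwards
  along the adjoint equation produces a proximal normal of uniform quality to the hypograph of \<open>V\<close>
  at \<open>x\<close>. Points where the hypograph has two independent proximal normals are rectifiable: some normal
  \<open>w\<close> in the triangle they span puts \<open>(x, V x) + w\<close> on one of countably many coordinate planes of
  codimension two, and \<open>p + w \<mapsto> p\<close> is Lipschitz on normals of fixed quality. At the
  remaining points of non-differentiability the normal is horizontal, so the extremal is abnormal and is
  an approximate solution of the Hamiltonian system of \<open>H0\<close>. As \<open>H0\<close> has a locally Lipschitz gradient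
  away from zero covectors, \<open>x\<close> is a Lipschitz function of \<open>(T, xs, v)\<close>; and these triples are at most
  \<open>d - 1\<close> dimensional, since either \<open>v\<close> is the normal \<open>\<nu> xs\<close> at a tangential exit point, or \<open>xs\<close>
  is a corner of the target and the triangle argument applies to it again.\<close>

text \<open>The obstacle is that \<open>V\<close> is only continuous: it may have no supergradient
  at a point, so normals to the hypograph take their place, and infinite slope appears as a normal
  with last component \<open>\<mu> = 0\<close>. What each point outside \<open>S\<close> does have
  is a normal of length bounded below and of quality locally uniform in the point. For this reason
  the estimates depend on a few bounds collected in one number \<open>M\<close>, never on a
  particular control. The inequality \<open>G * N < r0\<close> makes
  \<open>r + \<zeta> \<bullet> f\<close> positive, so near the exit time trades against cost at a
  rate bounded away from zero; this lets a deviated trajectory be prolonged or stopped early, and it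
  keeps the multiplier \<open>\<mu>\<close> below 1. Limits are taken only of exit times, exit
  points and initial covectors, which live in finite dimension. Dimension count: the hypograph lies
  in dimension d + 1 and a corner costs two coordinates; a corner of the target costs two of the d
  coordinates of \<open>xs + v\<close>, tangential exit points fill d - 2 dimensions, and in both of
  these cases the exit time gives one dimension back.\<close>

section \<open>Inequalities for functions of one variable\<close>

text \<open>With n equal steps the increments add up to at most n * C * ((b - a) / n)^2, which tends
  to 0. This replaces differentiation almost everywhere in \<open>duality\<close>, where the arcs
  are known only through their integrals over intervals.\<close>

lemma quadratic_increments_decreasing:
  fixes D :: "real \<Rightarrow> real"
  assumes ab: "a \<le> b"
    and inc: "\<And>s t. a \<le> s \<Longrightarrow> s \<le> t \<Longrightarrow> t \<le> b \<Longrightarrow> D t - D s \<le> C * (t - s)\<^sup>2"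
  shows "D b \<le> D a"
proof (rule field_le_epsilon)
  fix e :: real assume e: "e > 0"
  obtain n :: nat where n: "real n > \<bar>C\<bar> * (b - a)\<^sup>2 / e" "n > 0"
  proof -
    obtain n where "real n > \<bar>C\<bar> * (b - a)\<^sup>2 / e" using reals_Archimedean2 by blast
    then have "real (Suc n) > \<bar>C\<bar> * (b - a)\<^sup>2 / e" by simp
    then show thesis using that by blast
  qed
  define h where "h = (b - a) / real n"
  have h0: "h \<ge> 0" using ab by (simp add: h_def)
  have nh: "real n * h = b - a" using n by (simp add: h_def)
  have "k \<le> n \<Longrightarrow> D (a + real k * h) - D a \<le> real k * (C * h\<^sup>2)" for k
  proof (induction k)
    case 0 then show ?case by simp
  next
    case (Suc k)
    have "real (Suc k) * h \<le> real n * h" using Suc.prems h0 by (intro mult_right_mono) auto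
    then have "D (a + real (Suc k) * h) - D (a + real k * h)
        \<le> C * ((a + real (Suc k) * h) - (a + real k * h))\<^sup>2"
      using h0 nh by (intro inc) (auto simp: algebra_simps)
    also have "(a + real (Suc k) * h) - (a + real k * h) = h" by (simp add: algebra_simps)
    finally show ?case using Suc by (simp add: algebra_simps)
  qed
  from this[of n] have "D b - D a \<le> real n * (C * h\<^sup>2)" using nh by simp
  also have "\<dots> \<le> real n * (\<bar>C\<bar> * h\<^sup>2)" by (intro mult_left_mono mult_right_mono) auto
  also have "\<dots> = \<bar>C\<bar> * (b - a)\<^sup>2 / real n" using n by (simp add: h_def power2_eq_square field_simps)
  also have "\<dots> \<le> e" using n e by (simp add: field_simps)
  finally show "D b \<le> D a + e" by simp
qed

lemma gronwall:
  fixes \<phi> :: "real \<Rightarrow> real"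
  assumes cont: "continuous_on {a..b} \<phi>" and K: "K \<ge> 0"
    and le: "\<And>t. a \<le> t \<Longrightarrow> t \<le> b \<Longrightarrow> \<phi> t \<le> A + K * integral {a..t} \<phi>"
    and t: "a \<le> t" "t \<le> b"
  shows "\<phi> t \<le> A * exp (K * (t - a))"
proof -
  define I where "I = (\<lambda>t. integral {a..t} \<phi>)"
  define E where "E = (\<lambda>t. exp (- K * (t - a)) * (A + K * I t))"
  have dI: "(I has_vector_derivative \<phi> s) (at s within {a..b})" if "s \<in> {a..b}" for s
    unfolding I_def using integral_has_vector_derivative[OF cont that] .
  have dE: "(E has_real_derivative
      exp (- K * (s - a)) * (K * \<phi> s) - K * exp (- K * (s - a)) * (A + K * I s)) (at s within {a..b})"
    if "s \<in> {a..b}" for s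
    unfolding E_def
    using dI[OF that, folded has_real_derivative_iff_has_vector_derivative]
    by (auto intro!: derivative_eq_intros simp: algebra_simps)
  have "E t \<le> E a"
  proof (rule DERIV_nonpos_imp_decreasing_open[OF t(1)])
    show "\<exists>y. (E has_real_derivative y) (at s) \<and> y \<le> 0" if "a < s" "s < t" for s
    proof -
      have s: "s \<in> {a..b}" using that t by auto
      have "(E has_real_derivative
        exp (- K * (s - a)) * (K * \<phi> s) - K * exp (- K * (s - a)) * (A + K * I s)) (at s within {a<..<t})"
        using dE[OF s] by (rule DERIV_subset) (use t in auto)
      then have 1: "(E has_real_derivative
        exp (- K * (s - a)) * (K * \<phi> s) - K * exp (- K * (s - a)) * (A + K * I s)) (at s)"
        using that by (simp add: at_within_open[where S="{a<..<t}"])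
      have "exp (- K * (s - a)) * (K * \<phi> s) - K * exp (- K * (s - a)) * (A + K * I s)
          = (K * exp (- K * (s - a))) * (\<phi> s - (A + K * I s))" by (simp add: algebra_simps)
      also have "\<dots> \<le> 0" using le[of s] s K by (intro mult_nonneg_nonpos) (auto simp: I_def)
      finally show ?thesis using 1 by blast
    qed
    have "continuous_on {a..b} E" by (rule DERIV_continuous_on) (rule dE)
    then show "continuous_on {a..t} E" by (rule continuous_on_subset) (use t in auto)
  qed
  then have "exp (- K * (t - a)) * (A + K * I t) \<le> A" by (simp add: E_def I_def)
  then have "exp (K * (t - a)) * (exp (- K * (t - a)) * (A + K * I t)) \<le> exp (K * (t - a)) * A"
    by (intro mult_left_mono) auto
  also have "exp (K * (t - a)) * (exp (- K * (t - a)) * (A + K * I t))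
      = (exp (K * (t - a)) * exp (- K * (t - a))) * (A + K * I t)" by (simp only: mult.assoc)
  also have "exp (K * (t - a)) * exp (- K * (t - a)) = 1" by (subst exp_add[symmetric]) simp
  finally have "A + K * I t \<le> A * exp (K * (t - a))" by (simp add: mult.commute)
  then show ?thesis using le[OF t] by (simp add: I_def)
qed

lemma gronwall_backward:
  fixes \<phi> :: "real \<Rightarrow> real"
  assumes cont: "continuous_on {a..b} \<phi>" and K: "K \<ge> 0"
    and le: "\<And>t. a \<le> t \<Longrightarrow> t \<le> b \<Longrightarrow> \<phi> t \<le> A + K * integral {t..b} \<phi>"
    and t: "a \<le> t" "t \<le> b"
  shows "\<phi> t \<le> A * exp (K * (b - t))"
proof -
  have "(\<phi> \<circ> uminus) (-t) \<le> A * exp (K * (- t - (-b)))"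
  proof (rule gronwall[where b="-a"])
    show "continuous_on {-b..-a} (\<phi> \<circ> uminus)"
      by (rule continuous_on_compose) (auto intro!: continuous_intros continuous_on_subset[OF cont])
    show "(\<phi> \<circ> uminus) s \<le> A + K * integral {-b..s} (\<phi> \<circ> uminus)" if "-b \<le> s" "s \<le> -a" for s
      using le[of "-s"] that Henstock_Kurzweil_Integration.integral_reflect_real[of "b" "-s" \<phi>] by (simp add: o_def)
  qed (use K t in auto)
  then show ?thesis by simp
qed

section \<open>Arcs and Caratheodory equations\<close>

text \<open>Integral form of "y has derivative y' almost everywhere". Differences, shifts,
  reflections and concatenations of solutions then reduce to rules for integrals over
  intervals.\<close>

definition arc_on :: "real \<Rightarrow> real \<Rightarrow> (real \<Rightarrow> 'a::euclidean_space) \<Rightarrow> (real \<Rightarrow> 'a) \<Rightarrow> bool" where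
  "arc_on a b y y' \<longleftrightarrow> (\<forall>s t. a \<le> s \<longrightarrow> s \<le> t \<longrightarrow> t \<le> b \<longrightarrow> (y' has_integral (y t - y s)) {s..t})"

lemma arc_onD: "arc_on a b y y' \<Longrightarrow> a \<le> s \<Longrightarrow> s \<le> t \<Longrightarrow> t \<le> b \<Longrightarrow> (y' has_integral (y t - y s)) {s..t}"
  by (auto simp: arc_on_def)

lemma arc_on_subset: "arc_on a b y y' \<Longrightarrow> a \<le> c \<Longrightarrow> d \<le> b \<Longrightarrow> arc_on c d y y'"
  by (auto simp: arc_on_def)

lemma arc_on_diff: "arc_on a b y y' \<Longrightarrow> arc_on a b z z' \<Longrightarrow> arc_on a b (\<lambda>t. y t - z t) (\<lambda>t. y' t - z' t)"
  unfolding arc_on_def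
proof (intro allI impI)
  fix s t assume "\<forall>s t. a \<le> s \<longrightarrow> s \<le> t \<longrightarrow> t \<le> b \<longrightarrow> (y' has_integral y t - y s) {s..t}"
    "\<forall>s t. a \<le> s \<longrightarrow> s \<le> t \<longrightarrow> t \<le> b \<longrightarrow> (z' has_integral z t - z s) {s..t}"
    "a \<le> s" "s \<le> t" "t \<le> b"
  then have "((\<lambda>t. y' t - z' t) has_integral (y t - y s) - (z t - z s)) {s..t}"
    by (intro has_integral_diff) auto
  then show "((\<lambda>t. y' t - z' t) has_integral (y t - z t) - (y s - z s)) {s..t}"
    by (simp add: algebra_simps)
qed

lemma arc_on_Pair:
  assumes "arc_on a b y y'" "arc_on a b z z'"
  shows "arc_on a b (\<lambda>t. (y t, z t)) (\<lambda>t. (y' t, z' t))"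
  unfolding arc_on_def
proof (intro allI impI)
  fix s t assume st: "a \<le> s" "s \<le> t" "t \<le> b"
  have 1: "((\<lambda>t. (y' t, 0) :: 'a \<times> 'b) has_integral (y t - y s, 0)) {s..t}"
    using has_integral_linear[OF arc_onD[OF assms(1) st], of "\<lambda>x. (x, 0)"]
    by (simp add: o_def bounded_linear_Pair bounded_linear_ident bounded_linear_zero)
  have 2: "((\<lambda>t. (0, z' t) :: 'a \<times> 'b) has_integral (0, z t - z s)) {s..t}"
    using has_integral_linear[OF arc_onD[OF assms(2) st], of "\<lambda>x. (0, x)"]
    by (simp add: o_def bounded_linear_Pair bounded_linear_ident bounded_linear_zero)
  show "((\<lambda>t. (y' t, z' t)) has_integral (y t, z t) - (y s, z s)) {s..t}"
    using has_integral_add[OF 1 2] by simp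
qed

lemma arc_on_shift:
  assumes "arc_on a b y y'"
  shows "arc_on (a - c) (b - c) (\<lambda>t. y (t + c)) (\<lambda>t. y' (t + c))"
  unfolding arc_on_def
proof (intro allI impI)
  fix s t assume st: "a - c \<le> s" "s \<le> t" "t \<le> b - c"
  have "(y' has_integral (y (t + c) - y (s + c))) {s+c..t+c}"
    using st by (intro arc_onD[OF assms]) auto
  then show "((\<lambda>t. y' (t + c)) has_integral y (t + c) - y (s + c)) {s..t}"
    using has_integral_shift_real_ivl[of y' _ "s + c" "t + c" c] by (simp add: add.commute)
qed

lemma arc_on_join:
  assumes "arc_on a b y y'" "arc_on b c y y'" "a \<le> b" "b \<le> c"
  shows "arc_on a c y y'"
  unfolding arc_on_def
proof (intro allI impI)
  fix s t assume st: "a \<le> s" "s \<le> t" "t \<le> c"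
  consider "t \<le> b" | "b \<le> s" | "s \<le> b" "b \<le> t" by linarith
  then show "(y' has_integral y t - y s) {s..t}"
  proof cases
    case 3
    have "(y' has_integral (y b - y s) + (y t - y b)) {s..t}"
      by (rule has_integral_combine[OF 3 arc_onD[OF assms(1)] arc_onD[OF assms(2)]]) (use st 3 in auto)
    then show ?thesis by simp
  qed (use st assms in \<open>auto intro: arc_onD\<close>)
qed

text \<open>The derivatives may differ at \<open>b\<close>: a control switched at time
  \<open>b\<close> already has its new value there, and a single point does not affect the
  integral.\<close>

lemma arc_on_cong:
  assumes "arc_on a b y y'" "\<And>t. a \<le> t \<Longrightarrow> t \<le> b \<Longrightarrow> z t = y t" "\<And>t. a \<le> t \<Longrightarrow> t < b \<Longrightarrow> z' t = y' t"
  shows "arc_on a b z z'"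
  unfolding arc_on_def
proof (intro allI impI)
  fix s t assume st: "a \<le> s" "s \<le> t" "t \<le> b"
  have "(y' has_integral z t - z s) {s..t}" using arc_onD[OF assms(1) st] assms(2) st by simp
  then show "(z' has_integral z t - z s) {s..t}"
    by (rule has_integral_spike_finite[where S="{b}", rotated 2]) (use st assms(3) in auto)
qed

lemma has_integral_norm_le:
  fixes h :: "real \<Rightarrow> 'a::euclidean_space"
  assumes "(h has_integral I) {s..t}" "s \<le> t" "\<And>x. x \<in> {s..t} \<Longrightarrow> norm (h x) \<le> B"
  shows "norm I \<le> B * (t - s)"
proof -
  have "B \<ge> 0" by (rule order_trans[OF norm_ge_zero assms(3)[of s]]) (use assms(2) in auto)
  then have "norm I \<le> B * Henstock_Kurzweil_Integration.content (cbox s t)"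
    by (intro has_integral_bound) (use assms in auto)
  then show ?thesis using assms(2) by simp
qed

lemma arc_on_lipschitz:
  assumes "arc_on a b y y'" "\<And>x. x \<in> {a..b} \<Longrightarrow> norm (y' x) \<le> B" "s \<in> {a..b}" "t \<in> {a..b}"
  shows "norm (y t - y s) \<le> B * \<bar>t - s\<bar>"
proof -
  have *: "norm (y t - y s) \<le> B * (t - s)" if "s \<le> t" "s \<in> {a..b}" "t \<in> {a..b}" for s t
    by (rule has_integral_norm_le[OF arc_onD[OF assms(1)]]) (use that assms(2) in auto)
  show ?thesis
    using *[of s t] *[of t s] assms(3,4) norm_minus_commute[of "y t" "y s"] by (cases "s \<le> t") auto
qed

lemma arc_on_continuous:
  assumes "arc_on a b y y'" "\<And>x. x \<in> {a..b} \<Longrightarrow> norm (y' x) \<le> B"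
  shows "continuous_on {a..b} y"
proof (cases "a \<le> b")
  case True
  have B: "B \<ge> 0" by (rule order_trans[OF norm_ge_zero assms(2)[of a]]) (use True in auto)
  have "B-lipschitz_on {a..b} y"
    by (rule lipschitz_onI) (use arc_on_lipschitz[OF assms] B in \<open>auto simp: dist_norm dist_real_def\<close>)
  then show ?thesis by (rule lipschitz_on_continuous_on)
qed auto

lemma arc_norm_le_forward:
  assumes arc: "arc_on a b y y'" and K: "K \<ge> 0" "B \<ge> 0" and c: "continuous_on {a..b} y"
    and d: "\<And>x. x \<in> {a..b} \<Longrightarrow> norm (y' x) \<le> B + K * norm (y x)" and t: "t \<in> {a..b}"
  shows "norm (y t) \<le> (norm (y a) + B * (b - a)) * exp (K * (t - a))"
proof -
  have cn: "continuous_on {a..b} (\<lambda>t. norm (y t))" using c by (intro continuous_intros)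
  show ?thesis
  proof (rule gronwall[OF cn K(1)])
    fix t assume t: "a \<le> t" "t \<le> b"
    have ca: "continuous_on {a..t} (\<lambda>t. norm (y t))" using cn by (rule continuous_on_subset) (use t in auto)
    have i: "(\<lambda>x. B + K * norm (y x)) integrable_on {a..t}"
      by (intro integrable_continuous_real continuous_intros ca)
    have "norm (integral {a..t} y') \<le> integral {a..t} (\<lambda>x. B + K * norm (y x))"
      using arc_onD[OF arc, of a t] t d i by (intro integral_norm_bound_integral) auto
    also have "integral {a..t} y' = y t - y a" using arc_onD[OF arc, of a t] t by (auto intro: integral_unique)
    also have "integral {a..t} (\<lambda>x. B + K * norm (y x)) = B * (t - a) + K * integral {a..t} (\<lambda>x. norm (y x))"
      using t by (subst integral_add) (auto intro!: integrable_continuous_real continuous_intros ca)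
    finally have "norm (y t - y a) \<le> B * (t - a) + K * integral {a..t} (\<lambda>x. norm (y x))" .
    moreover have "B * (t - a) \<le> B * (b - a)" using t K by (intro mult_left_mono) auto
    ultimately show "norm (y t) \<le> norm (y a) + B * (b - a) + K * integral {a..t} (\<lambda>x. norm (y x))"
      using norm_triangle_sub[of "y t" "y a"] by linarith
  qed (use t in auto)
qed

lemma arc_on_reflect:
  assumes "arc_on a b y y'"
  shows "arc_on (-b) (-a) (\<lambda>t. y (-t)) (\<lambda>t. - y' (-t))"
  unfolding arc_on_def
proof (intro allI impI)
  fix s t assume st: "-b \<le> s" "s \<le> t" "t \<le> -a"
  have "(y' has_integral (y (-s) - y (-t))) {-t..-s}" using st by (intro arc_onD[OF assms]) auto
  then have "((\<lambda>x. y' (-x)) has_integral (y (-s) - y (-t))) {s..t}"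
    using has_integral_reflect_real[of y' _ "-s" "-t"] by simp
  from has_integral_neg[OF this]
  show "((\<lambda>x. - y' (-x)) has_integral (y (-t) - y (-s))) {s..t}" by simp
qed

lemma arc_norm_le_backward:
  assumes arc: "arc_on a b y y'" and K: "K \<ge> 0" "B \<ge> 0" and c: "continuous_on {a..b} y"
    and d: "\<And>x. x \<in> {a..b} \<Longrightarrow> norm (y' x) \<le> B + K * norm (y x)" and t: "t \<in> {a..b}"
  shows "norm (y t) \<le> (norm (y b) + B * (b - a)) * exp (K * (b - t))"
proof -
  have "continuous_on {-b..-a} (y \<circ> uminus)"
    by (rule continuous_on_compose) (auto intro!: continuous_intros continuous_on_subset[OF c])
  then have "norm (y (- (-t))) \<le> (norm (y (- (-b))) + B * (-a - (-b))) * exp (K * (-t - (-b)))"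
    by (intro arc_norm_le_forward[OF arc_on_reflect[OF arc] K]) (use d t in \<open>auto simp: o_def\<close>)
  then show ?thesis by simp
qed

lemma arc_on_integral:
  assumes y: "\<And>t. t \<ge> 0 \<Longrightarrow> t \<le> T \<Longrightarrow> h integrable_on {0..t} \<and> y t = x + integral {0..t} h"
  shows "arc_on 0 T y h"
  unfolding arc_on_def
proof (intro allI impI)
  fix s t assume st: "0 \<le> s" "s \<le> t" "t \<le> T"
  have i: "h integrable_on {s..t}"
    by (rule integrable_subinterval_real[of h 0 t]) (use y[of t] st in auto)
  have "integral {0..s} h + integral {s..t} h = integral {0..t} h"
    using st y[of t] by (intro Henstock_Kurzweil_Integration.integral_combine) auto
  then have "integral {s..t} h = integral {0..t} h - integral {0..s} h" by (metis add_diff_cancel_left')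
  also have "\<dots> = y t - y s" using y[of t] y[of s] st by simp
  finally have "integral {s..t} h = y t - y s" .
  then show "(h has_integral (y t - y s)) {s..t}" using i by (metis integrable_integral)
qed

text \<open>Banach's fixed point theorem in a Bielecki norm: a bounded continuous \<phi> stands for
  the curve \<open>exp (M * s) *\<^sub>R \<phi> s\<close>, and this weight makes the integral
  operator a contraction on the whole half line at once.\<close>

lemma caratheodory_exists:
  fixes F :: "real \<Rightarrow> 'a::euclidean_space \<Rightarrow> 'a"
  assumes meas: "\<And>y. continuous_on UNIV y \<Longrightarrow> (\<lambda>s. F s (y s)) \<in> borel_measurable (lebesgue_on {0..})"
    and K: "K \<ge> 0" "B \<ge> 0"
    and bd: "\<And>s x. s \<ge> 0 \<Longrightarrow> norm (F s x) \<le> B + K * norm x"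
    and lip: "\<And>s x y. s \<ge> 0 \<Longrightarrow> norm (F s x - F s y) \<le> K * norm (x - y)"
  shows "\<exists>y. continuous_on UNIV y \<and> y 0 = x \<and>
           (\<forall>T. arc_on 0 T y (\<lambda>s. F s (y s)) \<and> (\<lambda>s. F s (y s)) absolutely_integrable_on {0..T})"
proof -
  \<comment> \<open>Twice \<open>K\<close> gives the contraction factor 1/2; the summand 1 keeps
    \<open>M\<close> positive when \<open>K = 0\<close>.\<close>
  define M where "M = 2 * K + 1"
  have M: "M > 0" "K / M \<le> 1/2" using K by (auto simp: M_def)
  define Y where "Y = (\<lambda>(\<phi> :: real \<Rightarrow>\<^sub>C 'a) s. exp (M * s) *\<^sub>R apply_bcontfun \<phi> s)"
  define H where "H = (\<lambda>\<phi> s. F s (Y \<phi> s))"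
  have Yc: "continuous_on UNIV (Y \<phi>)" for \<phi>
    unfolding Y_def by (intro continuous_intros) auto
  have Hm: "H \<phi> \<in> borel_measurable (lebesgue_on {0..})" for \<phi>
    unfolding H_def by (rule meas[OF Yc])
  have Hb: "norm (H \<phi> s) \<le> (B + K * norm \<phi>) * exp (M * s)" if "s \<ge> 0" for \<phi> s
  proof -
    have "norm (H \<phi> s) \<le> B + K * (exp (M * s) * norm (apply_bcontfun \<phi> s))"
      using bd[OF that, of "Y \<phi> s"] by (simp add: H_def Y_def)
    also have "\<dots> \<le> B * exp (M * s) + K * (exp (M * s) * norm \<phi>)"
    proof (rule add_mono)
      have "1 \<le> exp (M * s)" using M that by simp
      then have "B * 1 \<le> B * exp (M * s)" using K by (intro mult_left_mono)
      then show "B \<le> B * exp (M * s)" by simp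
      show "K * (exp (M * s) * norm (apply_bcontfun \<phi> s)) \<le> K * (exp (M * s) * norm \<phi>)"
        using K by (intro mult_left_mono norm_bounded) auto
    qed
    finally show ?thesis by (simp add: algebra_simps)
  qed
  have Hi: "H \<phi> absolutely_integrable_on {0..t}" for \<phi> t
  proof (rule measurable_bounded_by_integrable_imp_absolutely_integrable)
    show "H \<phi> \<in> borel_measurable (lebesgue_on {0..t})"
      by (rule measurable_restrict_mono[OF Hm]) auto
    show "(\<lambda>s. (B + K * norm \<phi>) * exp (M * s)) integrable_on {0..t}"
      by (intro integrable_continuous_real continuous_intros)
  qed (use Hb in auto)
  have Hint: "H \<phi> integrable_on {0..t}" for \<phi> t
    using Hi set_lebesgue_integral_eq_integral(1) by blast
  have expint: "((\<lambda>s. c * exp (M * s)) has_integral (c * ((exp (M * t) - 1) / M))) {0..t}" if "t \<ge> 0" for c t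
  proof -
    have "((\<lambda>s. exp (M * s)) has_integral (exp (M * t) / M - exp (M * 0) / M)) {0..t}"
      by (rule fundamental_theorem_of_calculus[OF that])
         (use M in \<open>auto intro!: derivative_eq_intros simp flip: has_real_derivative_iff_has_vector_derivative\<close>)
    from has_integral_mult_right[OF this, of c] show ?thesis by (simp add: diff_divide_distrib)
  qed
  have exp_bound: "c * ((exp (M * t) - 1) / M) \<le> exp (M * t) * (c / M)" if "c \<ge> 0" for c t
    using that M by (simp add: field_simps)
  \<comment> \<open>The integral operator in weighted form. Elements of the Banach space are
    functions on the whole line, so the image is extended to negative times by its value at
    0.\<close>
  define I where "I = (\<lambda>\<phi> t. exp (- M * max 0 t) *\<^sub>R (x + integral {0..max 0 t} (H \<phi>)))"
  have Ic: "continuous_on UNIV (I \<phi>)" for \<phi>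
  proof (rule continuous_at_imp_continuous_on, rule ballI)
    fix t :: real
    have "continuous_on {0..max 0 (t+1)} (\<lambda>t. integral {0..t} (H \<phi>))"
      by (rule indefinite_integral_continuous_1[OF Hint])
    then have "continuous_on {..<t+1} (\<lambda>t. integral {0..max 0 t} (H \<phi>))"
      by (rule continuous_on_compose2[where f="max 0"]) (auto intro!: continuous_intros)
    then have "continuous_on {..<t+1} (I \<phi>)"
      unfolding I_def by (intro continuous_intros)
    then show "isCont (I \<phi>) t"
      by (simp add: continuous_on_eq_continuous_at)
  qed
  have expm: "exp (- M * t) * exp (M * t) = 1" for t by (subst exp_add[symmetric]) simp
  have Ib: "norm (I \<phi> t) \<le> norm x + (B + K * norm \<phi>) / M" for \<phi> t
  proof -
    define t' where "t' = max 0 t"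
    have t': "t' \<ge> 0" by (simp add: t'_def)
    have "norm (integral {0..t'} (H \<phi>)) \<le> integral {0..t'} (\<lambda>s. (B + K * norm \<phi>) * exp (M * s))"
      using expint[OF t'] Hb by (intro integral_norm_bound_integral Hint) auto
    also have "\<dots> \<le> exp (M * t') * ((B + K * norm \<phi>) / M)"
      using exp_bound[of "B + K * norm \<phi>" t'] K integral_unique[OF expint[OF t']] by simp
    finally have *: "norm (integral {0..t'} (H \<phi>)) \<le> exp (M * t') * ((B + K * norm \<phi>) / M)" .
    have "norm (I \<phi> t) \<le> exp (- M * t') * (norm x + norm (integral {0..t'} (H \<phi>)))"
      unfolding I_def t'_def[symmetric] by (simp add: norm_triangle_ineq)
    also have "\<dots> \<le> exp (- M * t') * norm x + exp (- M * t') * (exp (M * t') * ((B + K * norm \<phi>) / M))"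
      unfolding distrib_left using * by (intro add_mono mult_left_mono) auto
    also have "\<dots> = exp (- M * t') * norm x + ((B + K * norm \<phi>) / M)"
      unfolding mult.assoc[symmetric] expm by simp
    also have "exp (- M * t') * norm x \<le> norm x" using M t' by (intro mult_left_le_one_le) auto
    finally show ?thesis by simp
  qed
  have Imem: "I \<phi> \<in> bcontfun" for \<phi> by (rule bcontfun_normI[OF Ic Ib])
  define A where "A = (\<lambda>\<phi>. Bcontfun (I \<phi>))"
  have Aapp: "apply_bcontfun (A \<phi>) = I \<phi>" for \<phi>
    unfolding A_def by (rule Bcontfun_inverse[OF Imem])
  have contr: "dist (A \<phi>) (A \<psi>) \<le> (1/2) * dist \<phi> \<psi>" for \<phi> \<psi>
  proof (rule dist_bound)
    fix t :: real
    define t' where "t' = max 0 t"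
    have t': "t' \<ge> 0" by (simp add: t'_def)
    have "norm (integral {0..t'} (\<lambda>s. H \<phi> s - H \<psi> s)) \<le> integral {0..t'} (\<lambda>s. (K * dist \<phi> \<psi>) * exp (M * s))"
    proof (rule integral_norm_bound_integral)
      show "norm (H \<phi> s - H \<psi> s) \<le> (K * dist \<phi> \<psi>) * exp (M * s)" if "s \<in> {0..t'}" for s
      proof -
        have "Y \<phi> s - Y \<psi> s = exp (M * s) *\<^sub>R (apply_bcontfun \<phi> s - apply_bcontfun \<psi> s)"
          by (simp add: Y_def algebra_simps)
        then have "norm (Y \<phi> s - Y \<psi> s) \<le> exp (M * s) * dist \<phi> \<psi>"
          using dist_bounded[of \<phi> s \<psi>] by (simp add: dist_norm)
        then have "K * norm (Y \<phi> s - Y \<psi> s) \<le> K * (exp (M * s) * dist \<phi> \<psi>)"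
          using K by (intro mult_left_mono)
        moreover have "norm (H \<phi> s - H \<psi> s) \<le> K * norm (Y \<phi> s - Y \<psi> s)"
          unfolding H_def by (rule lip) (use that in auto)
        ultimately show ?thesis by (simp add: mult.commute mult.left_commute)
      qed
    qed (use expint[OF t'] Hint in \<open>auto intro: integrable_diff\<close>)
    also have "\<dots> \<le> exp (M * t') * ((K * dist \<phi> \<psi>) / M)"
      using exp_bound[of "K * dist \<phi> \<psi>" t'] K integral_unique[OF expint[OF t']] by simp
    finally have *: "norm (integral {0..t'} (\<lambda>s. H \<phi> s - H \<psi> s)) \<le> exp (M * t') * ((K * dist \<phi> \<psi>) / M)" .
    have "I \<phi> t - I \<psi> t = exp (- M * t') *\<^sub>R integral {0..t'} (\<lambda>s. H \<phi> s - H \<psi> s)"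
      unfolding I_def t'_def[symmetric]
      by (subst integral_diff) (auto intro: Hint simp: algebra_simps)
    then have "dist (I \<phi> t) (I \<psi> t) = exp (- M * t') * norm (integral {0..t'} (\<lambda>s. H \<phi> s - H \<psi> s))"
      by (simp add: dist_norm)
    also have "\<dots> \<le> exp (- M * t') * (exp (M * t') * ((K * dist \<phi> \<psi>) / M))"
      using * by (intro mult_left_mono) auto
    also have "\<dots> = (K / M) * dist \<phi> \<psi>" unfolding mult.assoc[symmetric] expm by simp
    also have "\<dots> \<le> (1/2) * dist \<phi> \<psi>" using M by (intro mult_right_mono) auto
    finally show "dist (apply_bcontfun (A \<phi>) t) (apply_bcontfun (A \<psi>) t) \<le> (1/2) * dist \<phi> \<psi>"
      by (simp add: Aapp)
  qed
  have "\<exists>!\<phi>. A \<phi> = \<phi>" by (rule banach_fix_type[of "1/2"]) (use contr in auto)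
  then obtain \<phi> where \<phi>: "A \<phi> = \<phi>" by blast
  have Yeq: "Y \<phi> t = x + integral {0..t} (H \<phi>)" if "t \<ge> 0" for t
  proof -
    have "apply_bcontfun \<phi> t = I \<phi> t" using Aapp[of \<phi>] \<phi> by simp
    then have "Y \<phi> t = (exp (M * t) * exp (- M * t)) *\<^sub>R (x + integral {0..t} (H \<phi>))"
      using that by (simp add: Y_def I_def max_def)
    then show ?thesis using expm[of t] by (simp add: mult.commute)
  qed
  have "arc_on 0 T (Y \<phi>) (H \<phi>)" for T
    by (rule arc_on_integral[where x=x]) (use Yeq Hint in auto)
  moreover have "Y \<phi> 0 = x" using Yeq[of 0] by simp
  ultimately show ?thesis using Yc Hi unfolding H_def by blast
qed

lemma derivative_norm_le_lipschitz:
  fixes f :: "'a::real_normed_vector \<Rightarrow> 'b::real_normed_vector"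
  assumes d: "(f has_derivative A) (at x)" and lip: "\<And>z. norm (f z - f x) \<le> L * norm (z - x)"
  shows "norm (A h) \<le> L * norm h"
proof (cases "h = 0")
  case True
  then show ?thesis using d by (simp add: has_derivative_linear linear_0)
next
  case False
  have lin: "linear A" using d by (rule has_derivative_linear)
  show ?thesis
  proof (rule field_le_epsilon)
    fix e :: real assume e: "e > 0"
    define e' where "e' = e / norm h"
    have e': "e' > 0" using e False by (simp add: e'_def)
    obtain \<delta> where \<delta>: "\<delta> > 0" "\<And>z. norm (z - x) < \<delta> \<Longrightarrow> norm (f z - f x - A (z - x)) \<le> e' * norm (z - x)"
      using d e' unfolding has_derivative_at_alt by blast
    define t where "t = \<delta> / (2 * norm h)"
    have t: "t > 0" using \<delta> False by (simp add: t_def)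
    have th: "norm (t *\<^sub>R h) < \<delta>" using \<delta> False by (simp add: t_def)
    have "norm (A (t *\<^sub>R h)) \<le> norm (f (x + t *\<^sub>R h) - f x) + norm (f (x + t *\<^sub>R h) - f x - A (t *\<^sub>R h))"
      using norm_triangle_ineq4[of "f (x + t *\<^sub>R h) - f x" "f (x + t *\<^sub>R h) - f x - A (t *\<^sub>R h)"] by simp
    also have "\<dots> \<le> L * norm (t *\<^sub>R h) + e' * norm (t *\<^sub>R h)"
      using lip[of "x + t *\<^sub>R h"] \<delta>(2)[of "x + t *\<^sub>R h"] th by simp
    finally have "t * norm (A h) \<le> t * (L * norm h + e' * norm h)"
      using t lin by (simp add: linear_scale algebra_simps)
    then have "norm (A h) \<le> L * norm h + e' * norm h" using t by simp
    then show "norm (A h) \<le> L * norm h + e" using False by (simp add: e'_def)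
  qed
qed

lemma continuous_control_measurable:
  fixes h :: "'a::euclidean_space \<Rightarrow> 'b::euclidean_space \<Rightarrow> 'c::euclidean_space"
  assumes h: "continuous_on (UNIV \<times> U) (\<lambda>(x, \<omega>). h x \<omega>)" and U: "compact U"
    and u: "u \<in> borel_measurable (lebesgue_on A)" "\<And>t. t \<in> A \<Longrightarrow> u t \<in> U" and A: "A \<in> sets lebesgue"
    and y: "continuous_on A y"
  shows "(\<lambda>s. h (y s) (u s)) \<in> borel_measurable (lebesgue_on A)"
proof -
  have ym: "y \<in> borel_measurable (lebesgue_on A)"
    by (rule continuous_imp_measurable_on_sets_lebesgue[OF y A])
  have "(\<lambda>s. (y s, u s)) \<in> borel_measurable (lebesgue_on A)"
    using ym u(1) by measurable
  then have 1: "(\<lambda>s. (y s, u s)) \<in> measurable (lebesgue_on A) (restrict_space borel (UNIV \<times> U))"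
    by (rule measurable_restrict_space2[rotated]) (use u(2) in auto)
  have "(\<lambda>(x, \<omega>). h x \<omega>) \<in> borel_measurable (restrict_space borel (UNIV \<times> U))"
    by (rule borel_measurable_continuous_on_restrict[OF h])
  from measurable_comp[OF 1 this] show ?thesis by (simp add: o_def)
qed

section \<open>The exit problem and dynamic programming\<close>

lemma measurable_lebesgue_on_shift:
  fixes u :: "real \<Rightarrow> 'a::euclidean_space"
  assumes u: "u \<in> borel_measurable (lebesgue_on A)" and A: "A \<in> sets lebesgue" "B \<in> sets lebesgue"
    and sub: "\<And>t. t \<in> B \<Longrightarrow> t + c \<in> A"
  shows "(\<lambda>t. u (t + c)) \<in> borel_measurable (lebesgue_on B)"
proof -
  have "(\<lambda>t. if t \<in> A then u t else 0) \<in> borel_measurable lebesgue"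
    using u borel_measurable_if[OF A(1), of u] by simp
  moreover have "(\<lambda>t::real. t + c) \<in> lebesgue \<rightarrow>\<^sub>M lebesgue"
    using lebesgue_affine_measurable[where c="\<lambda>_::real. 1" and t=c] by (simp add: add.commute)
  ultimately have "(\<lambda>t. if t + c \<in> A then u (t + c) else 0) \<in> borel_measurable lebesgue"
    by (rule measurable_compose[rotated, where f="\<lambda>t. t + c"])
  then have "(\<lambda>t. if t + c \<in> A then u (t + c) else 0) \<in> borel_measurable (lebesgue_on B)"
    by (rule measurable_restrict_space1)
  then show ?thesis
    by (rule measurable_cong[THEN iffD1, rotated]) (use sub in \<open>auto simp: space_restrict_space\<close>)
qed

text \<open>The witnesses hidden in the existential conditions, \<open>Df\<close>,
  \<open>Dr\<close>, \<open>W\<close> and \<open>G\<close>, become parameters, so that one choice of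
  them serves all estimates.\<close>

locale exit_problem =
  fixes U :: "(real^'m) set" and S :: "(real^'d) set"
    and f :: "real^'d \<Rightarrow> real^'m \<Rightarrow> real^'d"
    and r :: "real^'d \<Rightarrow> real^'m \<Rightarrow> real"
    and g V :: "real^'d \<Rightarrow> real"
    and N L r0 G :: real and W :: "(real^'d) set"
    and Df :: "real^'d \<Rightarrow> real^'m \<Rightarrow> ((real^'d) \<Rightarrow>\<^sub>L (real^'d))"
    and Dr :: "real^'d \<Rightarrow> real^'m \<Rightarrow> real^'d"
  assumes U_ne: "U \<noteq> {}" and U_compact: "compact U"
    and S_ne: "S \<noteq> {}" and S_closed: "closed S"
    and N_pos: "N > 0" and L_pos: "L > 0" and r0_pos: "r0 > 0"
    and f_cont: "continuous_on (UNIV \<times> U) (\<lambda>(x, \<omega>). f x \<omega>)"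
    and f_bound: "\<And>x \<omega>. \<omega> \<in> U \<Longrightarrow> norm (f x \<omega>) \<le> N"
    and f_lip: "\<And>x y \<omega>. \<omega> \<in> U \<Longrightarrow> norm (f y \<omega> - f x \<omega>) \<le> L * norm (y - x)"
    and Df: "\<And>x \<omega>. \<omega> \<in> U \<Longrightarrow> ((\<lambda>z. f z \<omega>) has_derivative blinfun_apply (Df x \<omega>)) (at x)"
    and Df_cont: "continuous_on (UNIV \<times> U) (\<lambda>(x, \<omega>). Df x \<omega>)"
    and Df_lip: "\<And>x y \<omega>. \<omega> \<in> U \<Longrightarrow> norm (Df y \<omega> - Df x \<omega>) \<le> L * norm (y - x)"
    and r_cont: "continuous_on (UNIV \<times> U) (\<lambda>(x, \<omega>). r x \<omega>)"
    and r_ge: "\<And>x \<omega>. \<omega> \<in> U \<Longrightarrow> r0 \<le> r x \<omega>"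
    and r_lip: "\<And>x y \<omega>. \<omega> \<in> U \<Longrightarrow> \<bar>r y \<omega> - r x \<omega>\<bar> \<le> L * norm (y - x)"
    and Dr: "\<And>x \<omega>. \<omega> \<in> U \<Longrightarrow> GDERIV (\<lambda>z. r z \<omega>) x :> Dr x \<omega>"
    and Dr_cont: "continuous_on (UNIV \<times> U) (\<lambda>(x, \<omega>). Dr x \<omega>)"
    and Dr_lip: "\<And>x y \<omega>. \<omega> \<in> U \<Longrightarrow> norm (Dr y \<omega> - Dr x \<omega>) \<le> L * norm (y - x)"
    and W_open: "open W" and W: "frontier S \<subseteq> W" and G_nonneg: "G \<ge> 0" and G_small: "G * N < r0"
    and g_lip: "\<And>x y. x \<in> W \<Longrightarrow> y \<in> W \<Longrightarrow> \<bar>g y - g x\<bar> \<le> G * norm (y - x)"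
    and V_eq: "\<And>x. value_function U S f r g x = ereal (V x)"
    and V_cont: "continuous_on UNIV V"
begin

definition traj :: "real^'d \<Rightarrow> (real \<Rightarrow> real^'m) \<Rightarrow> (real \<Rightarrow> real^'d) \<Rightarrow> bool" where
  "traj x u y \<longleftrightarrow> admissible_control U u \<and> caratheodory_solution f x u y"

abbreviation cost :: "real \<Rightarrow> (real \<Rightarrow> real^'m) \<Rightarrow> (real \<Rightarrow> real^'d) \<Rightarrow> real" where
  "cost T u y \<equiv> integral {0..T} (\<lambda>s. r (y s) (u s)) + g (y T)"

lemma admissible_in_U: "admissible_control U u \<Longrightarrow> t \<ge> 0 \<Longrightarrow> u t \<in> U"
  by (simp add: admissible_control_def)

lemma traj_in_U: "traj x u y \<Longrightarrow> t \<ge> 0 \<Longrightarrow> u t \<in> U"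
  by (simp add: traj_def admissible_in_U)

lemma admissible_measurable:
  assumes u: "admissible_control U u" and y: "continuous_on {a..b} y" and a: "0 \<le> a"
    and h: "continuous_on (UNIV \<times> U) (\<lambda>(x::'x::euclidean_space, \<omega>). h x \<omega> :: 'y::euclidean_space)"
  shows "(\<lambda>s. h (y s) (u s)) \<in> borel_measurable (lebesgue_on {a..b})"
proof (rule continuous_control_measurable[OF h U_compact])
  show "u \<in> borel_measurable (lebesgue_on {a..b})"
    by (rule measurable_restrict_mono[where A="{0..}"]) (use u a in \<open>auto simp: admissible_control_def\<close>)
qed (use u y a in \<open>auto simp: admissible_control_def\<close>)

lemma admissible_integrable:
  assumes u: "admissible_control U u" and y: "continuous_on {a..b} y" and a: "0 \<le> a"
    and h: "continuous_on (UNIV \<times> U) (\<lambda>(x::'x::euclidean_space, \<omega>). h x \<omega> :: 'y::euclidean_space)"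
  shows "(\<lambda>s. h (y s) (u s)) absolutely_integrable_on {a..b}"
proof -
  have "compact ((\<lambda>(x, \<omega>). h x \<omega>) ` (y ` {a..b} \<times> U))"
    by (intro compact_continuous_image compact_Times U_compact continuous_on_subset[OF h] y) auto
  then obtain B where B: "\<And>z. z \<in> (\<lambda>(x, \<omega>). h x \<omega>) ` (y ` {a..b} \<times> U) \<Longrightarrow> norm z \<le> B"
    using compact_imp_bounded bounded_iff by metis
  show ?thesis
  proof (rule measurable_bounded_by_integrable_imp_absolutely_integrable[where g="\<lambda>_. B"])
    show "norm (h (y s) (u s)) \<le> B" if "s \<in> {a..b}" for s
      by (rule B) (use that a admissible_in_U[OF u, of s] in force)
  qed (use admissible_measurable[OF assms] in auto)
qed

lemma admissible_integrable':
  assumes "admissible_control U u" "continuous_on {a..b} y" "0 \<le> a"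
    and "continuous_on (UNIV \<times> U) (\<lambda>(x::'x::euclidean_space, \<omega>). h x \<omega> :: 'y::euclidean_space)"
  shows "(\<lambda>s. h (y s) (u s)) integrable_on {a..b}"
  using set_lebesgue_integral_eq_integral(1)[OF admissible_integrable[OF assms]] .

lemma traj_arc:
  assumes "traj x u y"
  shows "arc_on 0 T y (\<lambda>s. f (y s) (u s))" "y 0 = x"
proof -
  have *: "(\<lambda>s. f (y s) (u s)) integrable_on {0..t} \<and> y t = x + integral {0..t} (\<lambda>s. f (y s) (u s))"
    if "t \<ge> 0" for t
    using assms that set_lebesgue_integral_eq_integral[of "{0..t}" "\<lambda>s. f (y s) (u s)"]
    unfolding traj_def caratheodory_solution_def by auto
  then show "arc_on 0 T y (\<lambda>s. f (y s) (u s))" by (intro arc_on_integral) auto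
  show "y 0 = x" using *[of 0] by simp
qed

lemma traj_lip:
  assumes "traj x u y" "0 \<le> s" "0 \<le> t"
  shows "norm (y t - y s) \<le> N * \<bar>t - s\<bar>"
  by (rule arc_on_lipschitz[OF traj_arc(1)[OF assms(1), of "max s t"]])
    (use assms f_bound traj_in_U[OF assms(1)] in auto)

lemma traj_continuous: "traj x u y \<Longrightarrow> 0 \<le> a \<Longrightarrow> continuous_on {a..b} y"
  by (rule continuous_on_subset[OF arc_on_continuous[OF traj_arc(1)[of x u y b], of N]])
     (auto intro: f_bound traj_in_U)

lemma traj_integrable:
  assumes "traj x u y" "0 \<le> a"
    and "continuous_on (UNIV \<times> U) (\<lambda>(x, \<omega>). h x \<omega> :: 'y::euclidean_space)"
  shows "(\<lambda>s. h (y s) (u s)) integrable_on {a..b}"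
  by (rule admissible_integrable') (use assms traj_continuous in \<open>auto simp: traj_def\<close>)

lemma traj_r_integrable: "traj x u y \<Longrightarrow> 0 \<le> a \<Longrightarrow> (\<lambda>s. r (y s) (u s)) integrable_on {a..b}"
  by (rule traj_integrable[OF _ _ r_cont])

lemma trajI:
  assumes u: "admissible_control U u" and y: "y 0 = x" "\<And>T. T \<ge> 0 \<Longrightarrow> arc_on 0 T y (\<lambda>s. f (y s) (u s))"
  shows "traj x u y"
  unfolding traj_def caratheodory_solution_def
proof (intro conjI allI impI u)
  fix t :: real assume t: "t \<ge> 0"
  have c: "continuous_on {0..t} y"
    by (rule arc_on_continuous[OF y(2)[OF t], of N]) (auto intro: f_bound admissible_in_U u)
  show i: "set_integrable lebesgue {0..t} (\<lambda>s. f (y s) (u s))"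
    by (rule admissible_integrable[OF u c _ f_cont]) auto
  have "integral {0..t} (\<lambda>s. f (y s) (u s)) = y t - y 0"
    using arc_onD[OF y(2)[OF t], of 0 t] t by (auto intro: integral_unique)
  then show "y t = x + (LINT s:{0..t}|lebesgue. f (y s) (u s))"
    using set_lebesgue_integral_eq_integral(2)[OF i] y(1) by simp
qed

lemma traj_exists:
  assumes u: "admissible_control U u"
  shows "\<exists>y. traj x u y"
proof -
  have "\<exists>y. continuous_on UNIV y \<and> y 0 = x \<and>
           (\<forall>T. arc_on 0 T y (\<lambda>s. f (y s) (u s)) \<and> (\<lambda>s. f (y s) (u s)) absolutely_integrable_on {0..T})"
  proof (rule caratheodory_exists[where K=L and B=N])
    show "(\<lambda>s. f (y s) (u s)) \<in> borel_measurable (lebesgue_on {0..})" if "continuous_on UNIV y" for y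
      by (rule continuous_control_measurable[OF f_cont U_compact])
        (use u that continuous_on_subset in \<open>auto simp: admissible_control_def\<close>)
    show "norm (f x (u s)) \<le> N + L * norm x" if "s \<ge> 0" for s x
      using f_bound[OF admissible_in_U[OF u that], of x] L_pos by (simp add: add_increasing2)
    show "norm (f x (u s) - f y (u s)) \<le> L * norm (x - y)" if "s \<ge> 0" for s x y
      using f_lip[OF admissible_in_U[OF u that]] .
  qed (use L_pos N_pos in auto)
  then show ?thesis using trajI[OF u] by blast
qed

lemma admissible_const: "\<omega> \<in> U \<Longrightarrow> admissible_control U (\<lambda>_. \<omega>)"
  by (simp add: admissible_control_def)

lemma admissible_shift:
  assumes "admissible_control U u" "c \<ge> 0"
  shows "admissible_control U (\<lambda>s. u (s + c))"
  using assms measurable_lebesgue_on_shift[of u "{0..}" "{0..}" c] unfolding admissible_control_def by simp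

lemma admissible_switch:
  assumes u: "admissible_control U u" "admissible_control U u2" and c: "c \<ge> 0"
  shows "admissible_control U (\<lambda>s. if s < c then u s else u2 (s - c))"
  unfolding admissible_control_def
proof
  have 1: "(\<lambda>t. if t \<in> {0..} then u t else 0) \<in> borel_measurable lebesgue"
    using u(1) borel_measurable_if[of "{0..}" u] by (simp add: admissible_control_def)
  have 2: "(\<lambda>t. if t \<in> {c..} then u2 (t + -c) else 0) \<in> borel_measurable lebesgue"
    using measurable_lebesgue_on_shift[of u2 "{0..}" "{c..}" "-c"] u(2)
      borel_measurable_if[of "{c..}" "\<lambda>t. u2 (t + -c)"] by (simp add: admissible_control_def)
  have "(\<lambda>s. if s < c then if s \<in> {0..} then u s else 0 else if s \<in> {c..} then u2 (s + -c) else 0)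
      \<in> borel_measurable lebesgue"
    by (rule measurable_If[OF 1 2]) simp
  then have "(\<lambda>s. if s < c then if s \<in> {0..} then u s else 0 else if s \<in> {c..} then u2 (s + -c) else 0)
      \<in> borel_measurable (lebesgue_on {0..})" by (rule measurable_restrict_space1)
  then show "(\<lambda>s. if s < c then u s else u2 (s - c)) \<in> borel_measurable (lebesgue_on {0..})"
    by (rule measurable_cong[THEN iffD1, rotated]) (auto simp: space_restrict_space)
qed (use u c in \<open>auto simp: admissible_control_def\<close>)

lemma traj_shift:
  assumes t: "traj x u y" and c: "c \<ge> 0"
  shows "traj (y c) (\<lambda>s. u (s + c)) (\<lambda>s. y (s + c))"
proof (rule trajI)
  show "admissible_control U (\<lambda>s. u (s + c))" using t c by (intro admissible_shift) (auto simp: traj_def)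
  show "arc_on 0 T (\<lambda>s. y (s + c)) (\<lambda>s. f (y (s + c)) (u (s + c)))" for T
    using arc_on_shift[OF traj_arc(1)[OF t, of "T + c"], of c] c by (auto elim: arc_on_subset)
qed simp

lemma traj_switch:
  assumes t: "traj x u y" and t2: "traj (y c) u2 y2" and c: "c \<ge> 0"
  shows "traj x (\<lambda>s. if s < c then u s else u2 (s - c)) (\<lambda>s. if s < c then y s else y2 (s - c))"
    (is "traj x ?u ?y")
proof (rule trajI)
  show "admissible_control U ?u" using t t2 c by (intro admissible_switch) (auto simp: traj_def)
  show "?y 0 = x" using traj_arc(2)[OF t] traj_arc(2)[OF t2] c by auto
  fix T :: real assume T: "T \<ge> 0"
  have 1: "arc_on 0 c ?y (\<lambda>s. f (?y s) (?u s))"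
    by (rule arc_on_cong[OF traj_arc(1)[OF t]]) (use traj_arc(2)[OF t2] in auto)
  have "arc_on (0 - -c) (T - -c) (\<lambda>s. y2 (s + -c)) (\<lambda>s. f (y2 (s + -c)) (u2 (s + -c)))"
    by (rule arc_on_shift[OF traj_arc(1)[OF t2]])
  then have "arc_on c (T + c) (\<lambda>s. y2 (s - c)) (\<lambda>s. f (y2 (s - c)) (u2 (s - c)))" by simp
  then have 2: "arc_on c (T + c) ?y (\<lambda>s. f (?y s) (?u s))"
    by (rule arc_on_cong) auto
  show "arc_on 0 T ?y (\<lambda>s. f (?y s) (?u s))"
    by (rule arc_on_subset[OF arc_on_join[OF 1 2]]) (use c T in auto)
qed

lemma hitting_time_exists:
  assumes t: "traj x u y" and x: "x \<notin> S" and \<tau>: "\<tau> \<ge> 0" "y \<tau> \<in> S"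
  obtains T where "is_hitting_time S y T" "0 < T" "T \<le> \<tau>" "y T \<in> frontier S"
proof -
  define Z where "Z = {s \<in> {0..\<tau>}. y s \<in> S}"
  have "closed Z" unfolding Z_def
    using continuous_closed_preimage[OF traj_continuous[OF t, of 0 \<tau>] _ S_closed] by (simp add: vimage_def Int_def conj_commute)
  moreover have "bounded Z" by (rule bounded_subset[of "{0..\<tau>}"]) (auto simp: Z_def)
  ultimately have "compact Z" by (simp add: compact_eq_bounded_closed)
  moreover have "\<tau> \<in> Z" using \<tau> by (simp add: Z_def)
  ultimately obtain T where T: "T \<in> Z" "\<And>s. s \<in> Z \<Longrightarrow> T \<le> s"
    using compact_attains_inf[of Z] by blast
  have h: "is_hitting_time S y T" unfolding is_hitting_time_def
  proof (intro conjI allI impI)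
    fix s assume s: "0 \<le> s \<and> y s \<in> S"
    show "T \<le> s" using T(1) T(2)[of s] s by (cases "s \<le> \<tau>") (auto simp: Z_def)
  qed (use T in \<open>auto simp: Z_def\<close>)
  have pos: "0 < T" using T(1) x traj_arc(2)[OF t] by (cases "T = 0") (auto simp: Z_def)
  have "y T \<in> closure (- S)"
  proof (rule closure_approachable[THEN iffD2], intro allI impI)
    fix e :: real assume e: "e > 0"
    \<comment> \<open>Just before the first hitting time the trajectory is outside \<open>S\<close>,
      and speed at most \<open>N\<close> keeps this point within \<open>e / 2\<close> of
      \<open>y T\<close>.\<close>
    define s where "s = max 0 (T - e / (2 * N))"
    have s: "0 \<le> s" "s < T" "T - s \<le> e / (2 * N)" using pos e N_pos by (auto simp: s_def)
    have "y s \<notin> S" using h s unfolding is_hitting_time_def by force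
    moreover have "norm (y T - y s) < e"
    proof -
      have "norm (y T - y s) \<le> N * \<bar>T - s\<bar>" by (rule traj_lip[OF t]) (use s pos in auto)
      also have "\<dots> \<le> N * (e / (2 * N))" using s N_pos by (intro mult_left_mono) auto
      also have "\<dots> < e" using N_pos e by simp
      finally show ?thesis .
    qed
    ultimately show "\<exists>z\<in>- S. dist z (y T) < e" by (auto simp: dist_norm norm_minus_commute intro!: bexI[of _ "y s"])
  qed
  moreover have "y T \<in> S" using T by (simp add: Z_def)
  ultimately have "y T \<in> frontier S"
    using closure_subset[of S] by (auto simp: frontier_closures)
  then show ?thesis using that h pos T by (auto simp: Z_def)
qed

lemma hitting_point_frontier:
  assumes "traj x u y" "x \<notin> S" "is_hitting_time S y T"
  shows "y T \<in> frontier S" "T > 0"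
proof -
  obtain T' where T': "is_hitting_time S y T'" "0 < T'" "T' \<le> T" "y T' \<in> frontier S"
    using hitting_time_exists[of x u y T] assms by (auto simp: is_hitting_time_def)
  then have "T = T'" using assms(3) by (auto simp: is_hitting_time_def intro: antisym)
  then show "y T \<in> frontier S" "T > 0" using T' by auto
qed

lemma cost_eq:
  assumes "traj x u y"
  shows "(LINT s:{0..T}|lebesgue. r (y s) (u s)) + g (y T) = cost T u y"
  using set_lebesgue_integral_eq_integral(2)[OF admissible_integrable[OF _ traj_continuous[OF assms] _ r_cont], of u 0 T]
    assms by (simp add: traj_def)

lemma V_le:
  assumes t: "traj x u y" and h: "is_hitting_time S y T"
  shows "V x \<le> cost T u y"
proof -
  have "value_function U S f r g x \<le> ereal (cost T u y)"
    unfolding value_function_def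
    by (rule Inf_lower) (use t h cost_eq[OF t] in \<open>auto simp: traj_def intro!: exI[of _ u] exI[of _ y] exI[of _ T]\<close>)
  then show ?thesis using V_eq by simp
qed

lemma V_approx:
  assumes "e > 0"
  obtains u y T where "traj x u y" "is_hitting_time S y T" "cost T u y < V x + e"
proof -
  have "value_function U S f r g x < ereal (V x + e)" using V_eq assms by simp
  then show ?thesis
    unfolding value_function_def Inf_less_iff using that cost_eq
    by (force simp: traj_def)
qed

lemma r_integral_ge:
  assumes t: "traj x u y" and s: "0 \<le> s" "s \<le> t"
  shows "r0 * (t - s) \<le> integral {s..t} (\<lambda>s. r (y s) (u s))"
proof -
  have "integral {s..t} (\<lambda>_. r0) \<le> integral {s..t} (\<lambda>s. r (y s) (u s))"
    by (rule integral_le) (use s r_ge traj_in_U[OF t] traj_r_integrable[OF t] in auto)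
  then show ?thesis using s by (simp add: mult.commute)
qed

lemma r_integral_combine:
  assumes "traj x u y" "0 \<le> s" "s \<le> t"
  shows "integral {0..s} (\<lambda>s. r (y s) (u s)) + integral {s..t} (\<lambda>s. r (y s) (u s)) = integral {0..t} (\<lambda>s. r (y s) (u s))"
  by (rule Henstock_Kurzweil_Integration.integral_combine) (use assms traj_r_integrable in auto)

text \<open>Since \<open>G * N < r0\<close>, waiting inside \<open>S\<close> never pays: stopping at the first hitting time beats
  stopping at any later time spent in \<open>S\<close> near the boundary.\<close>

lemma V_le_stopping:
  assumes t: "traj x u y" and x: "x \<notin> S" and \<tau>: "\<tau> \<ge> 0" "y \<tau> \<in> S" "y \<tau> \<in> W"
  shows "V x \<le> cost \<tau> u y"
proof -
  obtain T where T: "is_hitting_time S y T" "0 < T" "T \<le> \<tau>" "y T \<in> frontier S"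
    using hitting_time_exists[OF t x \<tau>(1,2)] .
  have "g (y T) - g (y \<tau>) \<le> G * norm (y T - y \<tau>)" using g_lip[of "y \<tau>" "y T"] T W \<tau> by auto
  also have "\<dots> \<le> G * (N * \<bar>T - \<tau>\<bar>)" using traj_lip[OF t, of \<tau> T] T \<tau> G_nonneg by (intro mult_left_mono) auto
  also have "\<dots> = (G * N) * (\<tau> - T)" using T by simp
  also have "\<dots> \<le> r0 * (\<tau> - T)" using T G_small by (intro mult_right_mono) auto
  also have "\<dots> \<le> integral {T..\<tau>} (\<lambda>s. r (y s) (u s))" using r_integral_ge[OF t, of T \<tau>] T by simp
  finally show ?thesis using V_le[OF t T(1)] r_integral_combine[OF t, of T \<tau>] T by simp
qed

text \<open>The trajectory up to \<open>c\<close> is continued by an \<open>e\<close>-optimal one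
  from \<open>y c\<close>. Only times strictly before \<open>c\<close> must avoid \<open>S\<close>,
  so \<open>y c\<close> itself may be an exit point; the continuation then has hitting time
  0.\<close>

lemma dynamic_programming:
  assumes t: "traj x u y" and c: "c \<ge> 0" and no: "\<And>s. 0 \<le> s \<Longrightarrow> s < c \<Longrightarrow> y s \<notin> S"
  shows "V x \<le> integral {0..c} (\<lambda>s. r (y s) (u s)) + V (y c)"
proof (rule field_le_epsilon)
  fix e :: real assume "e > 0"
  then obtain u2 y2 T where *: "traj (y c) u2 y2" "is_hitting_time S y2 T" "cost T u2 y2 < V (y c) + e"
    by (rule V_approx)
  let ?u = "\<lambda>s. if s < c then u s else u2 (s - c)" and ?y = "\<lambda>s. if s < c then y s else y2 (s - c)"
  have T: "T \<ge> 0" using * by (simp add: is_hitting_time_def)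
  have tr: "traj x ?u ?y" by (rule traj_switch[OF t *(1) c])
  have hit: "is_hitting_time S ?y (c + T)"
    unfolding is_hitting_time_def
  proof (intro conjI allI impI)
    fix s assume s: "0 \<le> s \<and> ?y s \<in> S"
    then have "s \<ge> c" using no[of s] by (force split: if_splits)
    moreover from this have "y2 (s - c) \<in> S" using s by simp
    ultimately have "T \<le> s - c" using *(2) unfolding is_hitting_time_def by simp
    then show "c + T \<le> s" by simp
  qed (use * c in \<open>auto simp: is_hitting_time_def\<close>)
  have 1: "integral {0..c} (\<lambda>s. r (?y s) (?u s)) = integral {0..c} (\<lambda>s. r (y s) (u s))"
    by (rule integral_spike[of "{c}"]) auto
  have 2: "integral {c..c+T} (\<lambda>s. r (?y s) (?u s)) = integral {0..T} (\<lambda>s. r (y2 s) (u2 s))"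
  proof -
    have "((\<lambda>s. r (y2 s) (u2 s)) has_integral integral {0..T} (\<lambda>s. r (y2 s) (u2 s))) {0..T}"
      using traj_r_integrable[OF *(1)] by (simp add: integrable_integral)
    then have "((\<lambda>s. r (y2 (s + -c)) (u2 (s + -c))) has_integral integral {0..T} (\<lambda>s. r (y2 s) (u2 s))) {0 - -c..T - -c}"
      by (rule has_integral_shift_real_ivl)
    then have "((\<lambda>s. r (y2 (s - c)) (u2 (s - c))) has_integral integral {0..T} (\<lambda>s. r (y2 s) (u2 s))) {c..c+T}"
      by (simp add: add.commute)
    then have "((\<lambda>s. r (?y s) (?u s)) has_integral integral {0..T} (\<lambda>s. r (y2 s) (u2 s))) {c..c+T}"
      by (rule has_integral_eq[rotated]) auto
    then show ?thesis by (rule integral_unique)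
  qed
  have "V x \<le> cost (c + T) ?u ?y" by (rule V_le[OF tr hit])
  also have "\<dots> = integral {0..c} (\<lambda>s. r (y s) (u s)) + cost T u2 y2"
    using r_integral_combine[OF tr c, of "c + T"] 1 2 T by simp
  finally show "V x \<le> integral {0..c} (\<lambda>s. r (y s) (u s)) + V (y c) + e" using * by simp
qed

end

section \<open>Adjoint arcs and duality\<close>

context exit_problem
begin

lemma Df_norm: "\<omega> \<in> U \<Longrightarrow> norm (Df x \<omega> h) \<le> L * norm h"
  by (rule derivative_norm_le_lipschitz[OF Df f_lip])

lemma Dr_norm:
  assumes "\<omega> \<in> U" shows "norm (Dr x \<omega>) \<le> L"
proof (cases "Dr x \<omega> = 0")
  case True then show ?thesis using L_pos by simp
next
  case False
  have "norm (inner (Dr x \<omega>) (Dr x \<omega>)) \<le> L * norm (Dr x \<omega>)"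
    using derivative_norm_le_lipschitz[OF Dr[OF assms, of x, unfolded gderiv_def], where L=L and h="Dr x \<omega>"] r_lip[OF assms]
    by simp
  then have "norm (Dr x \<omega>) * norm (Dr x \<omega>) \<le> L * norm (Dr x \<omega>)"
    by (simp add: power2_norm_eq_inner[symmetric] power2_eq_square)
  then show ?thesis using False by simp
qed

lemma f_taylor:
  assumes \<omega>: "\<omega> \<in> U"
  shows "norm (f y \<omega> - f x \<omega> - Df x \<omega> (y - x)) \<le> L * (norm (y - x))\<^sup>2"
proof -
  have "norm (f y \<omega> - f x \<omega> - Df x \<omega> (y - x)) \<le> norm (y - x) * (L * norm (y - x))"
  proof (rule differentiable_bound_linearization[where S="closed_segment x y" and f'="\<lambda>x. blinfun_apply (Df x \<omega>)"])
    show "x + t *\<^sub>R (y - x) \<in> closed_segment x y" if "t \<in> {0..1}" for t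
      using that by (auto simp: closed_segment_def algebra_simps intro!: exI[of _ t])
    show "((\<lambda>y. f y \<omega>) has_derivative blinfun_apply (Df z \<omega>)) (at z within closed_segment x y)" for z
      using Df[OF \<omega>] by (rule has_derivative_at_withinI)
    show "onorm (blinfun_apply (Df z \<omega>) - blinfun_apply (Df x \<omega>)) \<le> L * norm (y - x)"
      if z: "z \<in> closed_segment x y" for z
    proof -
      have "norm (Df z \<omega> - Df x \<omega>) \<le> L * norm (z - x)" by (rule Df_lip[OF \<omega>])
      also have "\<dots> \<le> L * norm (y - x)"
        using L_pos segment_bound1[OF z] by (simp add: norm_minus_commute)
      finally show ?thesis
        by (simp add: norm_blinfun.rep_eq minus_blinfun.rep_eq fun_diff_def)
    qed
  qed simp
  then show ?thesis by (simp add: power2_eq_square algebra_simps)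
qed

lemma r_taylor:
  assumes \<omega>: "\<omega> \<in> U"
  shows "\<bar>r y \<omega> - r x \<omega> - Dr x \<omega> \<bullet> (y - x)\<bar> \<le> L * (norm (y - x))\<^sup>2"
proof -
  have "norm (r y \<omega> - r x \<omega> - inner (y - x) (Dr x \<omega>)) \<le> norm (y - x) * (L * norm (y - x))"
  proof (rule differentiable_bound_linearization[where S="closed_segment x y" and f'="\<lambda>x h. inner h (Dr x \<omega>)"])
    show "x + t *\<^sub>R (y - x) \<in> closed_segment x y" if "t \<in> {0..1}" for t
      using that by (auto simp: closed_segment_def algebra_simps intro!: exI[of _ t])
    show "((\<lambda>y. r y \<omega>) has_derivative (\<lambda>h. inner h (Dr z \<omega>))) (at z within closed_segment x y)" for z
      using Dr[OF \<omega>] unfolding gderiv_def by (rule has_derivative_at_withinI)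
    show "onorm ((\<lambda>h. inner h (Dr z \<omega>)) - (\<lambda>h. inner h (Dr x \<omega>))) \<le> L * norm (y - x)"
      if z: "z \<in> closed_segment x y" for z
    proof (rule onorm_le)
      fix h
      have "norm (((\<lambda>h. inner h (Dr z \<omega>)) - (\<lambda>h. inner h (Dr x \<omega>))) h) = norm (inner h (Dr z \<omega> - Dr x \<omega>))"
        by (simp add: inner_diff_right)
      also have "\<dots> \<le> norm h * norm (Dr z \<omega> - Dr x \<omega>)" by (simp add: Cauchy_Schwarz_ineq2)
      also have "\<dots> \<le> norm h * (L * norm (y - x))"
      proof (rule mult_left_mono)
        have "norm (Dr z \<omega> - Dr x \<omega>) \<le> L * norm (z - x)" by (rule Dr_lip[OF \<omega>])
        also have "\<dots> \<le> L * norm (y - x)"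
          using L_pos segment_bound1[OF z] by (simp add: norm_minus_commute)
        finally show "norm (Dr z \<omega> - Dr x \<omega>) \<le> L * norm (y - x)" .
      qed simp
      finally show "norm (((\<lambda>h. inner h (Dr z \<omega>)) - (\<lambda>h. inner h (Dr x \<omega>))) h) \<le> L * norm (y - x) * norm h"
        by (simp add: mult.commute)
    qed
  qed simp
  then show ?thesis by (simp add: power2_eq_square inner_commute algebra_simps)
qed

text \<open>The transpose of the Jacobian \<open>Df x \<omega>\<close>, written out in the standard
  basis.\<close>

definition DfT :: "real^'d \<Rightarrow> real^'m \<Rightarrow> real^'d \<Rightarrow> real^'d" where
  "DfT x \<omega> q = (\<Sum>b\<in>Basis. (q \<bullet> Df x \<omega> b) *\<^sub>R b)"

lemma DfT_inner: "DfT x \<omega> q \<bullet> h = q \<bullet> Df x \<omega> h"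
proof -
  have "q \<bullet> Df x \<omega> h = q \<bullet> Df x \<omega> (\<Sum>b\<in>Basis. (h \<bullet> b) *\<^sub>R b)" by (simp add: euclidean_representation)
  also have "\<dots> = (\<Sum>b\<in>Basis. (h \<bullet> b) * (q \<bullet> Df x \<omega> b))"
    by (simp add: blinfun.sum_right blinfun.scaleR_right inner_sum_right)
  also have "\<dots> = (\<Sum>b\<in>Basis. ((q \<bullet> Df x \<omega> b) *\<^sub>R b) \<bullet> h)"
    by (intro sum.cong) (auto simp: inner_commute[of h])
  finally show ?thesis unfolding DfT_def inner_sum_left by simp
qed

lemma DfT_norm: assumes "\<omega> \<in> U" shows "norm (DfT x \<omega> q) \<le> L * norm q"
proof (cases "DfT x \<omega> q = 0")
  case False
  have "norm (DfT x \<omega> q) * norm (DfT x \<omega> q) = DfT x \<omega> q \<bullet> DfT x \<omega> q"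
    by (simp add: power2_norm_eq_inner[symmetric] power2_eq_square)
  also have "\<dots> = q \<bullet> Df x \<omega> (DfT x \<omega> q)" by (rule DfT_inner)
  also have "\<dots> \<le> norm q * norm (Df x \<omega> (DfT x \<omega> q))" by (rule norm_cauchy_schwarz)
  also have "\<dots> \<le> norm q * (L * norm (DfT x \<omega> q))" by (intro mult_left_mono Df_norm assms) auto
  finally show ?thesis using False by (simp add: mult.assoc[symmetric] mult.commute)
qed (use L_pos in auto)

lemma DfT_diff: "DfT x \<omega> p - DfT x \<omega> q = DfT x \<omega> (p - q)"
  by (simp add: DfT_def inner_diff_left sum_subtractf scaleR_diff_left)

lemma DfT_minus: "DfT x \<omega> (- q) = - DfT x \<omega> q"
  by (simp add: DfT_def sum_negf)

text \<open>Right side of the adjoint equation: minus the gradient in x of the unmaximized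
  Hamiltonian q . f(x,\<omega>) - \<mu> r(x,\<omega>).\<close>

definition Q' :: "real \<Rightarrow> real^'d \<Rightarrow> real^'m \<Rightarrow> real^'d \<Rightarrow> real^'d" where
  "Q' \<mu> x \<omega> q = \<mu> *\<^sub>R Dr x \<omega> - DfT x \<omega> q"

lemma Q'_norm: "\<omega> \<in> U \<Longrightarrow> \<bar>\<mu>\<bar> \<le> 1 \<Longrightarrow> norm (Q' \<mu> x \<omega> q) \<le> L + L * norm q"
proof -
  assume \<omega>: "\<omega> \<in> U" and \<mu>: "\<bar>\<mu>\<bar> \<le> 1"
  have "norm (Q' \<mu> x \<omega> q) \<le> norm (\<mu> *\<^sub>R Dr x \<omega>) + norm (DfT x \<omega> q)" unfolding Q'_def by (rule norm_triangle_ineq4)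
  moreover have "\<bar>\<mu>\<bar> * norm (Dr x \<omega>) \<le> 1 * L" using \<mu> Dr_norm[OF \<omega>] by (intro mult_mono) auto
  ultimately show ?thesis using DfT_norm[OF \<omega>, of x q] by simp
qed

lemma Q'_norm0: "\<omega> \<in> U \<Longrightarrow> 0 \<le> \<mu> \<Longrightarrow> norm (Q' \<mu> x \<omega> q) \<le> \<mu> * L + L * norm q"
proof -
  assume \<omega>: "\<omega> \<in> U" and \<mu>: "0 \<le> \<mu>"
  have "norm (Q' \<mu> x \<omega> q) \<le> norm (\<mu> *\<^sub>R Dr x \<omega>) + norm (DfT x \<omega> q)" unfolding Q'_def by (rule norm_triangle_ineq4)
  moreover have "\<mu> * norm (Dr x \<omega>) \<le> \<mu> * L" using \<mu> Dr_norm[OF \<omega>] by (intro mult_left_mono) auto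
  ultimately show ?thesis using DfT_norm[OF \<omega>, of x q] \<mu> by simp
qed

text \<open>Continuity is required explicitly because the bound on the right side involves
  \<open>q\<close> itself, so \<open>arc_on_continuous\<close> cannot supply it beforehand.\<close>

definition adjoint_arc :: "real \<Rightarrow> real \<Rightarrow> (real \<Rightarrow> real^'m) \<Rightarrow> (real \<Rightarrow> real^'d) \<Rightarrow> (real \<Rightarrow> real^'d) \<Rightarrow> bool" where
  "adjoint_arc \<mu> T u y q \<longleftrightarrow> continuous_on {0..T} q \<and> arc_on 0 T q (\<lambda>s. Q' \<mu> (y s) (u s) (q s))"

lemma Q'_cont:
  "continuous_on (UNIV \<times> U) (\<lambda>(x, \<omega>). (\<lambda>z \<omega>. Q' \<mu> (fst z) \<omega> (snd z)) x \<omega>)"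
proof -
  have 1: "continuous_on (UNIV \<times> U) (\<lambda>z :: ((real^'d) \<times> (real^'d)) \<times> (real^'m). Df (fst (fst z)) (snd z))"
    by (rule continuous_on_compose2[OF Df_cont, where f="\<lambda>z. (fst (fst z), snd z)", simplified split_beta fst_conv snd_conv])
      (auto intro!: continuous_intros)
  have 2: "continuous_on (UNIV \<times> U) (\<lambda>z :: ((real^'d) \<times> (real^'d)) \<times> (real^'m). Dr (fst (fst z)) (snd z))"
    by (rule continuous_on_compose2[OF Dr_cont, where f="\<lambda>z. (fst (fst z), snd z)", simplified split_beta fst_conv snd_conv])
      (auto intro!: continuous_intros)
  show ?thesis unfolding split_beta Q'_def DfT_def
    by (intro continuous_intros 1 2)
qed

lemma adjoint_exists:
  assumes t: "traj x u y" and T: "T \<ge> 0" and \<mu>: "0 \<le> \<mu>" "\<mu> \<le> 1"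
  shows "\<exists>q. adjoint_arc \<mu> T u y q \<and> q T = w"
proof -
  \<comment> \<open>The equation is solved backwards from \<open>T\<close>. Clamping at 0 freezes
    the coefficients after reversed time \<open>T\<close>, so that the field is defined on the whole
    half line.\<close>
  let ?m = "\<lambda>s. max 0 (T - s)"
  let ?F = "\<lambda>s q. - Q' \<mu> (y (?m s)) (u (?m s)) q"
  have U: "u (?m s) \<in> U" for s using traj_in_U[OF t] by simp
  have "\<exists>p. continuous_on UNIV p \<and> p 0 = w \<and>
           (\<forall>T. arc_on 0 T p (\<lambda>s. ?F s (p s)) \<and> (\<lambda>s. ?F s (p s)) absolutely_integrable_on {0..T})"
  proof (rule caratheodory_exists[where K=L and B=L])
    fix p :: "real \<Rightarrow> real^'d" assume p: "continuous_on UNIV p"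
    have yc: "continuous_on {0..T} (\<lambda>s. (y s, p (T - s)))"
      by (intro continuous_intros traj_continuous[OF t] continuous_on_compose2[OF p]) auto
    \<comment> \<open>Measurability of the time-reversed coefficients is obtained by way of
      integrability, which survives reflection and shift.\<close>
    have "(\<lambda>s. - Q' \<mu> (y s) (u s) (p (T - s))) integrable_on {0..T}"
      using integrable_neg[OF admissible_integrable'[OF _ yc _ Q'_cont[of \<mu>], of u]] t by (auto simp: traj_def)
    then have "(\<lambda>s. - Q' \<mu> (y (-s)) (u (-s)) (p (T + s))) integrable_on {-T..0}"
      using Henstock_Kurzweil_Integration.integrable_reflect_real[of "\<lambda>s. - Q' \<mu> (y s) (u s) (p (T - s))" T 0] by simp
    then have "(\<lambda>s. - Q' \<mu> (y (-(s + -T))) (u (-(s + -T))) (p (T + (s + -T)))) integrable_on {-T - -T..0 - -T}"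
      by (rule integrable_shift_real_ivl)
    then have "(\<lambda>s. - Q' \<mu> (y (T - s)) (u (T - s)) (p s)) integrable_on {0..T}" by simp
    then have "(\<lambda>s. - Q' \<mu> (y (T - s)) (u (T - s)) (p s)) \<in> borel_measurable (lebesgue_on {0..T})"
      by (rule integrable_imp_measurable)
    then have 1: "(\<lambda>s. if s \<in> {0..T} then - Q' \<mu> (y (T - s)) (u (T - s)) (p s) else 0) \<in> borel_measurable lebesgue"
      by (subst borel_measurable_if) auto
    have "continuous_on UNIV (\<lambda>s. - Q' \<mu> (y 0) (u 0) (p s))"
      unfolding Q'_def DfT_def by (intro continuous_intros p)
    then have 2: "(\<lambda>s. - Q' \<mu> (y 0) (u 0) (p s)) \<in> borel_measurable lebesgue"
      using continuous_imp_measurable_on_sets_lebesgue[of UNIV "\<lambda>s. - Q' \<mu> (y 0) (u 0) (p s)"]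
      unfolding lebesgue_on_UNIV_eq by simp
    have "(\<lambda>s. if s \<le> T then (if s \<in> {0..T} then - Q' \<mu> (y (T - s)) (u (T - s)) (p s) else 0)
        else - Q' \<mu> (y 0) (u 0) (p s)) \<in> borel_measurable lebesgue"
      by (rule measurable_If[OF 1 2]) simp
    then have "(\<lambda>s. if s \<le> T then (if s \<in> {0..T} then - Q' \<mu> (y (T - s)) (u (T - s)) (p s) else 0)
        else - Q' \<mu> (y 0) (u 0) (p s)) \<in> borel_measurable (lebesgue_on {0..})"
      by (rule measurable_restrict_space1)
    then show "(\<lambda>s. ?F s (p s)) \<in> borel_measurable (lebesgue_on {0..})"
      by (rule measurable_cong[THEN iffD1, rotated]) (auto simp: space_restrict_space max_def)
  next
    show "norm (?F s q) \<le> L + L * norm q" for s q using Q'_norm[OF U, of \<mu>] \<mu> by simp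
    show "norm (?F s p - ?F s q) \<le> L * norm (p - q)" for s p q
    proof -
      have "?F s p - ?F s q = DfT (y (?m s)) (u (?m s)) (p - q)"
        by (simp add: Q'_def DfT_diff[symmetric])
      then show ?thesis using DfT_norm[OF U[of s], of "y (?m s)" "p - q"] by (simp only:)
    qed
  qed (use L_pos in auto)
  then obtain p where p: "continuous_on UNIV p" "p 0 = w" "arc_on 0 T p (\<lambda>s. ?F s (p s))" by blast
  have "arc_on (-T) 0 (\<lambda>s. p (-s)) (\<lambda>s. - ?F (-s) (p (-s)))" using arc_on_reflect[OF p(3)] by simp
  then have "arc_on (-T - -T) (0 - -T) (\<lambda>s. p (-(s + -T))) (\<lambda>s. - ?F (-(s + -T)) (p (-(s + -T))))"
    by (rule arc_on_shift)
  then have a: "arc_on 0 T (\<lambda>s. p (T - s)) (\<lambda>s. - ?F (T - s) (p (T - s)))" by simp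
  have "arc_on 0 T (\<lambda>s. p (T - s)) (\<lambda>s. Q' \<mu> (y s) (u s) (p (T - s)))"
    by (rule arc_on_cong[OF a]) (auto simp: max_def)
  moreover have "continuous_on {0..T} (\<lambda>s. p (T - s))"
    by (intro continuous_on_compose2[OF p(1)] continuous_intros) auto
  ultimately show ?thesis using p(2) unfolding adjoint_arc_def by (intro exI[of _ "\<lambda>s. p (T - s)"]) simp
qed

text \<open>Gronwall in both time directions. The first bound makes initial covectors precompact;
  the second prevents initial covector and \<mu> from being small together unless the terminal
  covector is small, and for \<mu> = 0 it keeps a nonzero covector from ever vanishing.\<close>

lemma adjoint_bounds:
  assumes q: "adjoint_arc \<mu> T u y q" and \<mu>: "0 \<le> \<mu>" and u: "traj x u y" and t: "t \<in> {0..T}"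
  shows "norm (q t) \<le> (norm (q T) + \<mu> * L * T) * exp (L * T)"
    and "norm (q T) \<le> (norm (q t) + \<mu> * L * T) * exp (L * T)"
proof -
  have a: "arc_on 0 T q (\<lambda>s. Q' \<mu> (y s) (u s) (q s))" "continuous_on {0..T} q"
    using q by (auto simp: adjoint_arc_def)
  have b: "norm (Q' \<mu> (y s) (u s) (q s)) \<le> \<mu> * L + L * norm (q s)" if "s \<in> {0..T}" for s
    using that Q'_norm0[OF traj_in_U[OF u]] \<mu> by auto
  have "norm (q t) \<le> (norm (q T) + \<mu> * L * (T - 0)) * exp (L * (T - t))"
    by (rule arc_norm_le_backward[OF a(1) _ _ a(2)]) (use b t L_pos \<mu> in auto)
  also have "\<dots> \<le> (norm (q T) + \<mu> * L * T) * exp (L * T)"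
    using t L_pos \<mu> by (intro mult_mono) auto
  finally show "norm (q t) \<le> (norm (q T) + \<mu> * L * T) * exp (L * T)" .
  have "norm (q T) \<le> (norm (q t) + \<mu> * L * (T - t)) * exp (L * (T - t))"
    by (rule arc_norm_le_forward[OF arc_on_subset[OF a(1)] _ _ continuous_on_subset[OF a(2)]])
      (use b t L_pos \<mu> in auto)
  also have "\<dots> \<le> (norm (q t) + \<mu> * L * T) * exp (L * T)"
    using t L_pos \<mu> by (intro mult_mono add_mono mult_left_mono) auto
  finally show "norm (q T) \<le> (norm (q t) + \<mu> * L * T) * exp (L * T)" .
qed

lemma traj_dist:
  assumes t: "traj x u y" "traj z u' y'" and T: "s \<in> {0..T}" and eq: "\<And>s. 0 \<le> s \<Longrightarrow> s < T \<Longrightarrow> u' s = u s"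
  shows "norm (y' s - y s) \<le> norm (z - x) * exp (L * T)"
proof -
  have b: "arc_on 0 T y' (\<lambda>s. f (y' s) (u s))"
    by (rule arc_on_cong[OF traj_arc(1)[OF t(2)]]) (use eq in auto)
  have "norm (y' s - y s) \<le> (norm (y' 0 - y 0) + 0 * (T - 0)) * exp (L * (s - 0))"
    by (rule arc_norm_le_forward[OF arc_on_diff[OF b traj_arc(1)[OF t(1)]]])
      (use L_pos T f_lip traj_in_U[OF t(1)] traj_continuous[OF t(1)] traj_continuous[OF t(2)] in \<open>auto intro!: continuous_intros\<close>)
  also have "\<dots> \<le> norm (z - x) * exp (L * T)"
    using traj_arc(2)[OF t(1)] traj_arc(2)[OF t(2)] T L_pos by (auto intro!: mult_left_mono)
  finally show ?thesis .
qed

text \<open>The adjoint equation cancels the first-order terms in the derivative of q . (y' - y)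
  minus \<mu> times the excess running cost. What is left are Taylor remainders of size (Q + 1) L
  |y' - y|^2, and Gronwall bounds |y' - y| by exp(L T) |z - x|.\<close>

lemma duality:
  assumes t: "traj x u y" "traj z u' y'" and T: "T \<ge> 0" and eq: "\<And>s. 0 \<le> s \<Longrightarrow> s < T \<Longrightarrow> u' s = u s"
    and q: "adjoint_arc \<mu> T u y q" and \<mu>: "0 \<le> \<mu>" "\<mu> \<le> 1"
    and Q: "\<And>s. s \<in> {0..T} \<Longrightarrow> norm (q s) \<le> Q"
  shows "q 0 \<bullet> (z - x) - (Q + 1) * L * (exp (L * T))\<^sup>2 * T * (norm (z - x))\<^sup>2
      \<le> q T \<bullet> (y' T - y T) - \<mu> * integral {0..T} (\<lambda>s. r (y' s) (u s) - r (y s) (u s))"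
proof -
  define e where "e = (\<lambda>s. y' s - y s)"
  define e' where "e' = (\<lambda>s. f (y' s) (u s) - f (y s) (u s))"
  define q' where "q' = (\<lambda>s. Q' \<mu> (y s) (u s) (q s))"
  define b' where "b' = (\<lambda>s. r (y' s) (u s) - r (y s) (u s))"
  define B where "B = (\<lambda>t. integral {0..t} b')"
  define Q1 where "Q1 = L + L * Q"
  define c where "c = (Q + 1) * L * (exp (L * T))\<^sup>2 * (norm (z - x))\<^sup>2"
  have U: "u s \<in> U" if "s \<ge> 0" for s using traj_in_U[OF t(1) that] .
  have Q0: "Q \<ge> 0" by (rule order_trans[OF norm_ge_zero Q[of 0]]) (use T in auto)
  have ay': "arc_on 0 T y' (\<lambda>s. f (y' s) (u s))"
    by (rule arc_on_cong[OF traj_arc(1)[OF t(2)]]) (use eq in auto)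
  have ae: "arc_on 0 T e e'"
    unfolding e_def e'_def by (rule arc_on_diff[OF ay' traj_arc(1)[OF t(1)]])
  have aq: "arc_on 0 T q q'" using q by (simp add: adjoint_arc_def q'_def)
  have ne': "norm (e' s) \<le> 2 * N" if "s \<in> {0..T}" for s
    using norm_triangle_ineq4[of "f (y' s) (u s)" "f (y s) (u s)"] f_bound[OF U[of s], of "y' s"] f_bound[OF U[of s], of "y s"] that
    by (simp add: e'_def)
  have nq': "norm (q' s) \<le> Q1" if "s \<in> {0..T}" for s
  proof -
    have "norm (q' s) \<le> L + L * norm (q s)" unfolding q'_def using that U \<mu> by (intro Q'_norm) auto
    also have "\<dots> \<le> Q1" using Q[OF that] L_pos by (simp add: Q1_def)
    finally show ?thesis .
  qed
  have Q1: "Q1 \<ge> 0" using L_pos Q0 by (simp add: Q1_def)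
  have ib: "b' integrable_on {s..t}" if "s \<ge> 0" "t \<le> T" for s t
  proof -
    have "(\<lambda>s. r (y' s) (u s)) integrable_on {s..t}"
      by (rule admissible_integrable'[OF _ _ _ r_cont])
         (use t that traj_continuous in \<open>auto simp: traj_def\<close>)
    then show ?thesis unfolding b'_def using traj_r_integrable[OF t(1)] that by (intro integrable_diff) auto
  qed
  have ne: "norm (e s) \<le> norm (z - x) * exp (L * T)" if "s \<in> {0..T}" for s
    unfolding e_def by (rule traj_dist[OF t that eq])
  have pw: "q' s \<bullet> e s + q s \<bullet> e' s - \<mu> * b' s \<ge> - c" if s: "s \<in> {0..T}" for s
  proof -
    have Us: "u s \<in> U" using U s by auto
    have 1: "\<mu> * (b' s - Dr (y s) (u s) \<bullet> e s) \<le> L * (norm (e s))\<^sup>2"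
    proof -
      have "b' s - Dr (y s) (u s) \<bullet> e s \<le> L * (norm (e s))\<^sup>2"
        using r_taylor[OF Us, of "y' s" "y s"] by (simp add: b'_def e_def)
      then have "\<mu> * (b' s - Dr (y s) (u s) \<bullet> e s) \<le> \<mu> * (L * (norm (e s))\<^sup>2)" using \<mu> by (intro mult_left_mono)
      also have "\<dots> \<le> L * (norm (e s))\<^sup>2" using \<mu> L_pos by (intro mult_left_le_one_le) auto
      finally show ?thesis .
    qed
    have 2: "- (q s \<bullet> (e' s - Df (y s) (u s) (e s))) \<le> Q * (L * (norm (e s))\<^sup>2)"
    proof -
      have "- (q s \<bullet> (e' s - Df (y s) (u s) (e s))) \<le> norm (q s) * norm (e' s - Df (y s) (u s) (e s))"
        using Cauchy_Schwarz_ineq2[of "q s" "e' s - Df (y s) (u s) (e s)"] by linarith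
      also have "\<dots> \<le> Q * (L * (norm (e s))\<^sup>2)"
        using f_taylor[OF Us, of "y' s" "y s"] Q[OF s] Q0
        by (intro mult_mono) (auto simp: e'_def e_def)
      finally show ?thesis .
    qed
    have "q' s \<bullet> e s + q s \<bullet> e' s - \<mu> * b' s
        = - (\<mu> * (b' s - Dr (y s) (u s) \<bullet> e s)) + q s \<bullet> (e' s - Df (y s) (u s) (e s))"
      by (simp add: q'_def Q'_def inner_diff_left inner_diff_right DfT_inner algebra_simps)
    also have "\<dots> \<ge> - ((Q + 1) * L * (norm (e s))\<^sup>2)" using 1 2 by (simp add: algebra_simps)
    finally have 3: "q' s \<bullet> e s + q s \<bullet> e' s - \<mu> * b' s \<ge> - ((Q + 1) * L * (norm (e s))\<^sup>2)" .
    have "(norm (e s))\<^sup>2 \<le> (norm (z - x) * exp (L * T))\<^sup>2" using ne[OF s] by (intro power_mono) auto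
    then have "(Q + 1) * L * (norm (e s))\<^sup>2 \<le> (Q + 1) * L * (norm (z - x) * exp (L * T))\<^sup>2"
      using Q0 L_pos by (intro mult_left_mono) auto
    then show ?thesis using 3 by (simp add: c_def power_mult_distrib algebra_simps)
  qed
  \<comment> \<open>The product rule is replaced by increments that are correct up to second order
    in the step \<open>h\<close>: freezing \<open>e s\<close> and \<open>q s\<close> in the
    integrand costs \<open>4 * N * Q1 * h^2\<close>, the product of the two increments another
    \<open>2 * N * Q1 * h^2\<close>.\<close>
  define D where "D = (\<lambda>t. - (q t \<bullet> e t - \<mu> * B t) - c * t)"
  have "D T \<le> D 0"
  proof (rule quadratic_increments_decreasing[OF T, where C="6 * N * Q1"])
    fix s t :: real assume st: "0 \<le> s" "s \<le> t" "t \<le> T"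
    define h where "h = t - s"
    have h: "h \<ge> 0" using st by (simp add: h_def)
    have de: "norm (e \<tau> - e s) \<le> 2 * N * h" if "\<tau> \<in> {s..t}" for \<tau>
    proof -
      have "norm (e \<tau> - e s) \<le> 2 * N * \<bar>\<tau> - s\<bar>" by (rule arc_on_lipschitz[OF ae ne']) (use that st in auto)
      also have "\<dots> \<le> 2 * N * h" using that N_pos by (intro mult_left_mono) (auto simp: h_def)
      finally show ?thesis .
    qed
    have dq: "norm (q \<tau> - q s) \<le> Q1 * h" if "\<tau> \<in> {s..t}" for \<tau>
    proof -
      have "norm (q \<tau> - q s) \<le> Q1 * \<bar>\<tau> - s\<bar>" by (rule arc_on_lipschitz[OF aq nq']) (use that st in auto)
      also have "\<dots> \<le> Q1 * h" using that Q1 by (intro mult_left_mono) (auto simp: h_def)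
      finally show ?thesis .
    qed
    have i1: "((\<lambda>\<tau>. q' \<tau> \<bullet> e s) has_integral ((q t - q s) \<bullet> e s)) {s..t}"
      using has_integral_linear[OF arc_onD[OF aq st] bounded_linear_inner_left[of "e s"]] by (simp add: o_def)
    have i2: "((\<lambda>\<tau>. q s \<bullet> e' \<tau>) has_integral (q s \<bullet> (e t - e s))) {s..t}"
      using has_integral_linear[OF arc_onD[OF ae st] bounded_linear_inner_right[of "q s"]] by (simp add: o_def)
    have "B t - B s = integral {s..t} b'"
      unfolding B_def using Henstock_Kurzweil_Integration.integral_combine[OF st(1,2) ib[of 0 t]] st by simp
    then have i3: "((\<lambda>\<tau>. \<mu> * b' \<tau>) has_integral (\<mu> * (B t - B s))) {s..t}"
      using has_integral_mult_right[OF integrable_integral[OF ib[of s t]], of \<mu>] st by simp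
    have i: "((\<lambda>\<tau>. q' \<tau> \<bullet> e s + q s \<bullet> e' \<tau> - \<mu> * b' \<tau>) has_integral
        ((q t - q s) \<bullet> e s + q s \<bullet> (e t - e s) - \<mu> * (B t - B s))) {s..t}"
      by (intro has_integral_diff has_integral_add i1 i2 i3)
    have "((\<lambda>\<tau>. - c - 4 * N * Q1 * h) has_integral (t - s) *\<^sub>R (- c - 4 * N * Q1 * h)) {s..t}"
      using has_integral_const_real[of "- c - 4 * N * Q1 * h" s t] st by simp
    then have "(t - s) *\<^sub>R (- c - 4 * N * Q1 * h) \<le> (q t - q s) \<bullet> e s + q s \<bullet> (e t - e s) - \<mu> * (B t - B s)"
    proof (rule has_integral_le[OF _ i])
      fix \<tau> assume \<tau>: "\<tau> \<in> {s..t}"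
      have \<tau>': "\<tau> \<in> {0..T}" using \<tau> st by auto
      have "q' \<tau> \<bullet> (e \<tau> - e s) \<le> norm (q' \<tau>) * norm (e \<tau> - e s)" by (rule norm_cauchy_schwarz)
      also have "\<dots> \<le> Q1 * (2 * N * h)" using nq'[OF \<tau>'] de[OF \<tau>] Q1 by (intro mult_mono) auto
      finally have a1: "q' \<tau> \<bullet> e s \<ge> q' \<tau> \<bullet> e \<tau> - 2 * N * Q1 * h" by (simp add: inner_diff_right algebra_simps)
      have "(q \<tau> - q s) \<bullet> e' \<tau> \<le> norm (q \<tau> - q s) * norm (e' \<tau>)" by (rule norm_cauchy_schwarz)
      also have "\<dots> \<le> (Q1 * h) * (2 * N)" using ne'[OF \<tau>'] dq[OF \<tau>] Q1 h by (intro mult_mono) auto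
      finally have a2: "q s \<bullet> e' \<tau> \<ge> q \<tau> \<bullet> e' \<tau> - 2 * N * Q1 * h" by (simp add: inner_diff_left algebra_simps)
      show "- c - 4 * N * Q1 * h \<le> q' \<tau> \<bullet> e s + q s \<bullet> e' \<tau> - \<mu> * b' \<tau>" using a1 a2 pw[OF \<tau>'] by simp
    qed
    then have 1: "- c * h - 4 * N * Q1 * h\<^sup>2 \<le> (q t - q s) \<bullet> e s + q s \<bullet> (e t - e s) - \<mu> * (B t - B s)"
      by (simp add: h_def[symmetric] power2_eq_square algebra_simps)
    have "- ((q t - q s) \<bullet> (e t - e s)) \<le> norm (q t - q s) * norm (e t - e s)"
      using Cauchy_Schwarz_ineq2[of "q t - q s" "e t - e s"] by linarith
    also have "\<dots> \<le> (Q1 * h) * (2 * N * h)" using dq[of t] de[of t] st Q1 h by (intro mult_mono) auto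
    finally have 2: "- ((q t - q s) \<bullet> (e t - e s)) \<le> 2 * N * Q1 * h\<^sup>2" by (simp add: power2_eq_square algebra_simps)
    have "D t - D s = - ((q t - q s) \<bullet> e s + q s \<bullet> (e t - e s) - \<mu> * (B t - B s)) - (q t - q s) \<bullet> (e t - e s) - c * h"
      by (simp add: D_def h_def inner_diff_left inner_diff_right algebra_simps)
    also have "\<dots> \<le> 6 * N * Q1 * h\<^sup>2" using 1 2 by (simp add: algebra_simps)
    finally show "D t - D s \<le> 6 * N * Q1 * (t - s)\<^sup>2" by (simp add: h_def)
  qed
  moreover have "y 0 = x" "y' 0 = z" using traj_arc(2)[OF t(1)] traj_arc(2)[OF t(2)] by auto
  ultimately show ?thesis by (simp add: D_def B_def b'_def c_def e_def algebra_simps)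
qed

end

section \<open>Upper estimates of the value function\<close>

context exit_problem
begin

text \<open>\<open>v\<close> is a proximal normal to the closure of the complement of \<open>S\<close> at the boundary point \<open>xs\<close>,
  \<open>\<zeta>\<close> a proximal supergradient of \<open>g\<close> there, and \<open>\<mu>\<close> balances the two so that the Hamiltonian vanishes
  for the terminal covector \<open>(1 - \<mu>) v - \<mu> \<zeta>\<close>; \<open>\<mu> = 0\<close> is the abnormal case.\<close>

definition terminal_data :: "real \<Rightarrow> real^'d \<Rightarrow> real^'d \<Rightarrow> real^'d \<Rightarrow> real \<Rightarrow> bool" where
  "terminal_data M xs v \<zeta> \<mu> \<longleftrightarrow> xs \<in> frontier S \<and> norm v \<le> M \<and> norm \<zeta> \<le> G \<and> 0 \<le> \<mu> \<and> \<mu> \<le> 1 \<and>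
     (\<forall>p. p \<notin> S \<longrightarrow> v \<bullet> (p - xs) \<le> M * (norm (p - xs))\<^sup>2) \<and>
     (\<forall>p\<in>ball xs (1 / M). p \<in> W \<and> g p \<le> g xs + \<zeta> \<bullet> (p - xs) + M * (norm (p - xs))\<^sup>2) \<and>
     (\<forall>\<omega>\<in>U. (1 - \<mu>) * (v \<bullet> f xs \<omega>) \<le> \<mu> * (r xs \<omega> + \<zeta> \<bullet> f xs \<omega>)) \<and>
     (\<exists>\<omega>\<in>U. (1 - \<mu>) * (v \<bullet> f xs \<omega>) = \<mu> * (r xs \<omega> + \<zeta> \<bullet> f xs \<omega>))"

text \<open>By \<open>G_small\<close> the bound is positive. It is the least rate at which running
  cost plus linearized terminal cost increases with time.\<close>

lemma running_terminal_ge: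
  assumes "\<omega> \<in> U" "norm \<zeta> \<le> G"
  shows "r0 - G * N \<le> r x \<omega> + \<zeta> \<bullet> f x \<omega>"
proof -
  have "- (\<zeta> \<bullet> f x \<omega>) \<le> norm \<zeta> * norm (f x \<omega>)" using Cauchy_Schwarz_ineq2[of \<zeta> "f x \<omega>"] by linarith
  also have "\<dots> \<le> G * N" using assms f_bound[OF assms(1)] G_nonneg by (intro mult_mono) auto
  finally show ?thesis using r_ge[OF assms(1), of x] by simp
qed

lemma running_terminal_lip:
  assumes "\<omega> \<in> U" "norm \<zeta> \<le> G"
  shows "\<bar>(r p \<omega> + \<zeta> \<bullet> f p \<omega>) - (r x \<omega> + \<zeta> \<bullet> f x \<omega>)\<bar> \<le> (1 + G) * L * norm (p - x)"
proof -
  have "\<bar>\<zeta> \<bullet> (f p \<omega> - f x \<omega>)\<bar> \<le> norm \<zeta> * norm (f p \<omega> - f x \<omega>)" by (rule Cauchy_Schwarz_ineq2)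
  also have "\<dots> \<le> G * (L * norm (p - x))" using assms f_lip[OF assms(1)] G_nonneg by (intro mult_mono) auto
  finally show ?thesis using r_lip[OF assms(1), of p x] by (simp add: inner_diff_right algebra_simps)
qed

lemma normal_velocity_lip:
  assumes "\<omega> \<in> U" "norm v \<le> M" "0 \<le> \<mu>" "\<mu> \<le> 1"
  shows "\<bar>(1 - \<mu>) * (v \<bullet> f p \<omega>) - (1 - \<mu>) * (v \<bullet> f x \<omega>)\<bar> \<le> M * L * norm (p - x)"
proof -
  have M: "M \<ge> 0" using assms(2) norm_ge_zero[of v] by linarith
  have 1: "\<bar>v \<bullet> (f p \<omega> - f x \<omega>)\<bar> \<le> M * (L * norm (p - x))"
    by (rule order_trans[OF Cauchy_Schwarz_ineq2]) (use assms f_lip[OF assms(1)] M in \<open>intro mult_mono; auto\<close>)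
  have "\<bar>(1 - \<mu>) * (v \<bullet> f p \<omega>) - (1 - \<mu>) * (v \<bullet> f x \<omega>)\<bar> = (1 - \<mu>) * \<bar>v \<bullet> (f p \<omega> - f x \<omega>)\<bar>"
    using assms by (simp add: inner_diff_right abs_mult[symmetric] right_diff_distrib[symmetric] abs_mult)
  also have "\<dots> \<le> \<bar>v \<bullet> (f p \<omega> - f x \<omega>)\<bar>" using assms by (intro mult_left_le_one_le) auto
  finally show ?thesis using 1 by simp
qed

lemma traj_inner_integral:
  assumes "traj x u y" "0 \<le> s" "s \<le> t"
  shows "((\<lambda>\<tau>. w \<bullet> f (y \<tau>) (u \<tau>)) has_integral (w \<bullet> (y t - y s))) {s..t}"
  using has_integral_linear[OF arc_onD[OF traj_arc(1)[OF assms(1)] assms(2,3) order_refl] bounded_linear_inner_right[of w]]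
  by (simp add: o_def)

lemma traj_r_has_integral:
  assumes t: "traj x u y" and st: "0 \<le> s" "s \<le> t"
  shows "((\<lambda>\<tau>. r (y \<tau>) (u \<tau>)) has_integral
    (integral {0..t} (\<lambda>\<tau>. r (y \<tau>) (u \<tau>)) - integral {0..s} (\<lambda>\<tau>. r (y \<tau>) (u \<tau>)))) {s..t}"
proof -
  have "integral {s..t} (\<lambda>\<tau>. r (y \<tau>) (u \<tau>))
      = integral {0..t} (\<lambda>\<tau>. r (y \<tau>) (u \<tau>)) - integral {0..s} (\<lambda>\<tau>. r (y \<tau>) (u \<tau>))"
    using r_integral_combine[OF t st] by linarith
  then show ?thesis using integrable_integral[OF traj_r_integrable[OF t st(1), of t]] by simp
qed

text \<open>The value function is estimated from above by steering a nearby initial point \<open>z\<close> with the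
  control of a given trajectory. If the budget left over at the end, \<open>\<alpha>'\<close>, is positive it is spent on
  a control maximizing the Hamiltonian at \<open>xs\<close>; if it is negative the steering is stopped earlier.\<close>

lemma value_upper_estimate:
  assumes M: "M \<ge> 1"
  obtains C \<rho> where "C > 0" "\<rho> > 0"
    "\<And>x u y T \<mu> q xs v \<zeta> z a \<eta>. traj x u y \<Longrightarrow> 0 < T \<Longrightarrow> T \<le> M \<Longrightarrow> terminal_data M xs v \<zeta> \<mu> \<Longrightarrow>
      adjoint_arc \<mu> T u y q \<Longrightarrow> q T = (1 - \<mu>) *\<^sub>R v - \<mu> *\<^sub>R \<zeta> \<Longrightarrow> norm (y T - xs) \<le> \<eta> \<Longrightarrow> z \<notin> S \<Longrightarrow>
      (norm (z - x))\<^sup>2 + a\<^sup>2 + \<eta> \<le> \<rho> \<Longrightarrow> C * sqrt ((norm (z - x))\<^sup>2 + a\<^sup>2 + \<eta>) \<le> T \<Longrightarrow>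
      C * ((norm (z - x))\<^sup>2 + a\<^sup>2 + \<eta>) < q 0 \<bullet> (z - x) + \<mu> * a \<Longrightarrow>
      V z \<le> cost T u y + a"
proof -
  define \<kappa> where "\<kappa> = r0 - G * N"
  have \<kappa>: "\<kappa> > 0" using G_small by (simp add: \<kappa>_def)
  note GL = G_nonneg L_pos N_pos
  define A where "A = exp (L * M)"
  have A: "A \<ge> 1" using M GL by (simp add: A_def)
  define Q where "Q = (M + G + L * M) * A"
  have Q: "Q \<ge> 0" using M GL A by (simp add: Q_def)
  \<comment> \<open>With \<open>m\<close> the scale introduced below: \<open>K1\<close> is the
    remainder of \<open>duality\<close>, \<open>K2\<close> bounds the end point deviation
    \<open>E\<close>, \<open>K3\<close> the budget \<open>\<alpha>\<close>, \<open>K5\<close> the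
    change of the exit time, \<open>K6\<close> the distance to \<open>xs\<close> during that change,
    and \<open>K7\<close>, \<open>K8\<close> the errors of evaluating
    \<open>r + \<zeta> \<bullet> f\<close> and \<open>v \<bullet> f\<close> at \<open>xs\<close>.
    \<open>K4\<close> is a reserve withheld from the budget. \<open>C\<close> collects everything
    that enters at order m^2, and \<open>K5\<close> so that the exit time can be moved back without
    becoming negative.\<close>
  define K1 where "K1 = (Q + 1) * L * A\<^sup>2 * M"
  define K2 where "K2 = A + 1"
  define K3 where "K3 = 1 + M * L * A + G * (A + 1)"
  define K5 where "K5 = (K3 + 1) / \<kappa>"
  define K6 where "K6 = K2 + N * K5"
  define K7 where "K7 = K5 * ((1 + G) * L * K6)"
  define K8 where "K8 = K5 * (M * L * K6)"
  define K4 where "K4 = K7 + M * K6\<^sup>2 + G"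
  define C where "C = K1 + M + G + K4 + K8 + K7 + M * K6\<^sup>2 + K5 + 1"
  have K1: "K1 \<ge> 0" using Q M GL A by (simp add: K1_def)
  have K2: "K2 \<ge> 1" using A by (simp add: K2_def)
  have K3: "K3 \<ge> 0" using M GL A by (simp add: K3_def)
  have K5: "K5 \<ge> 0" using K3 \<kappa> by (simp add: K5_def)
  have K6: "K6 \<ge> 1" using K2 K5 GL by (simp add: K6_def add_increasing2)
  have K7: "K7 \<ge> 0" using K5 K6 GL by (simp add: K7_def)
  have K8: "K8 \<ge> 0" using K5 K6 GL M by (simp add: K8_def)
  have MK6: "M * K6\<^sup>2 \<ge> 0" using M by simp
  have K4: "K4 \<ge> 0" using K7 MK6 GL by (simp add: K4_def)
  have C: "C > 0" "C \<ge> K5" using K1 M GL K4 K8 K7 MK6 K5 unfolding C_def by linarith+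
  \<comment> \<open>The three bounds give \<open>m\<^sup>2 \<le> m\<close>, a reserve
    \<open>K4 * m\<^sup>2 \<le> m\<close>, and end points inside the ball of radius
    \<open>1 / M\<close> on which the supergradient inequality holds.\<close>
  define m0 where "m0 = min 1 (min (1 / (K4 + 1)) (1 / (2 * M * K6)))"
  have m0: "m0 > 0" using K4 M K6 by (simp add: m0_def)
  show ?thesis
  proof (rule that[OF C(1), of "m0\<^sup>2"])
    show "m0\<^sup>2 > 0" using m0 by simp
    fix x u y T \<mu> q xs v \<zeta> z a \<eta>
    assume t: "traj x u y" and T: "0 < T" "T \<le> M" and td: "terminal_data M xs v \<zeta> \<mu>"
      and q: "adjoint_arc \<mu> T u y q" and qT: "q T = (1 - \<mu>) *\<^sub>R v - \<mu> *\<^sub>R \<zeta>" and \<eta>: "norm (y T - xs) \<le> \<eta>"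
      and z: "z \<notin> S" and D: "(norm (z - x))\<^sup>2 + a\<^sup>2 + \<eta> \<le> m0\<^sup>2"
      and DT: "C * sqrt ((norm (z - x))\<^sup>2 + a\<^sup>2 + \<eta>) \<le> T"
      and big: "C * ((norm (z - x))\<^sup>2 + a\<^sup>2 + \<eta>) < q 0 \<bullet> (z - x) + \<mu> * a"
    define d where "d = norm (z - x)"
    \<comment> \<open>The common scale: \<open>d\<close> and \<open>\<bar>a\<bar>\<close> are of
      order m, whereas the end point error \<eta> counts as m^2.\<close>
    define m where "m = sqrt (d\<^sup>2 + a\<^sup>2 + \<eta>)"
    have \<eta>0: "\<eta> \<ge> 0" using \<eta> norm_ge_zero[of "y T - xs"] by linarith
    have m2: "m\<^sup>2 = d\<^sup>2 + a\<^sup>2 + \<eta>" using \<eta>0 by (simp add: m_def)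
    have m: "m \<ge> 0" using \<eta>0 by (simp add: m_def)
    have "m\<^sup>2 \<le> m0\<^sup>2" using D m2 by (simp add: d_def)
    then have "m \<le> m0" by (rule power2_le_imp_le) (use m0 in simp)
    then have m1: "m \<le> 1" "m \<le> 1 / (K4 + 1)" "m \<le> 1 / (2 * M * K6)" by (auto simp: m0_def)
    have mK4: "K4 * m \<le> 1"
    proof -
      have "(K4 + 1) * m \<le> 1" using m1(2) K4 by (simp add: field_simps)
      then show ?thesis using m by (simp add: algebra_simps)
    qed
    have mK6: "K6 * m < 1 / M"
    proof -
      have "K6 * m \<le> K6 * (1 / (2 * M * K6))" using m1(3) K6 by (intro mult_left_mono) auto
      also have "\<dots> = 1 / (2 * M)" using K6 by simp
      also have "\<dots> < 1 / M" using M by (simp add: field_simps)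
      finally show ?thesis .
    qed
    have d: "d \<ge> 0" by (simp add: d_def)
    have "d\<^sup>2 \<le> m\<^sup>2" "\<bar>a\<bar>\<^sup>2 \<le> m\<^sup>2" using \<eta>0 m2 by auto
    then have "d \<le> m" and a: "\<bar>a\<bar> \<le> m" using m by (blast intro: power2_le_imp_le)+
    note d = d this(1)
    have \<eta>m: "\<eta> \<le> m\<^sup>2" "\<eta> \<le> m"
    proof -
      show "\<eta> \<le> m\<^sup>2" using m2 by simp
      also have "m\<^sup>2 \<le> m" using m m1(1) by (simp add: power2_eq_square mult_left_le)
      finally show "\<eta> \<le> m" .
    qed
    from td have xs: "xs \<in> frontier S" and v: "norm v \<le> M" and \<zeta>: "norm \<zeta> \<le> G" and \<mu>: "0 \<le> \<mu>" "\<mu> \<le> 1"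
      and vS: "\<And>p. p \<notin> S \<Longrightarrow> v \<bullet> (p - xs) \<le> M * (norm (p - xs))\<^sup>2"
      and gz: "\<And>p. p \<in> ball xs (1 / M) \<Longrightarrow> p \<in> W \<and> g p \<le> g xs + \<zeta> \<bullet> (p - xs) + M * (norm (p - xs))\<^sup>2"
      and max: "\<And>\<omega>. \<omega> \<in> U \<Longrightarrow> (1 - \<mu>) * (v \<bullet> f xs \<omega>) \<le> \<mu> * (r xs \<omega> + \<zeta> \<bullet> f xs \<omega>)"
      by (auto simp: terminal_data_def)
    from td obtain \<omega>s where \<omega>s: "\<omega>s \<in> U" "(1 - \<mu>) * (v \<bullet> f xs \<omega>s) = \<mu> * (r xs \<omega>s + \<zeta> \<bullet> f xs \<omega>s)"
      by (auto simp: terminal_data_def)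
    define u' where "u' = (\<lambda>s. if s < T then u s else \<omega>s)"
    have "admissible_control U u'"
      using admissible_switch[of u "\<lambda>_. \<omega>s" T] t \<omega>s T by (simp add: traj_def admissible_const u'_def)
    then obtain y' where t': "traj z u' y'" using traj_exists by blast
    have eq: "u' s = u s" if "0 \<le> s" "s < T" for s using that by (simp add: u'_def)
    have expA: "exp (L * T) \<le> A" using T GL by (simp add: A_def)
    define e where "e = y' T - y T"
    have ne: "norm (y' s - y s) \<le> A * d" if "s \<in> {0..T}" for s
    proof -
      have "norm (y' s - y s) \<le> norm (z - x) * exp (L * T)" by (rule traj_dist[OF t t' that eq])
      also have "\<dots> \<le> d * A" using expA by (simp add: d_def mult_left_mono)
      finally show ?thesis by (simp add: mult.commute)
    qed
    define E where "E = y' T - xs"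
    have "norm E \<le> norm (y' T - y T) + norm (y T - xs)" unfolding E_def
      using norm_triangle_ineq[of "y' T - y T" "y T - xs"] by simp
    then have nE: "norm E \<le> A * d + \<eta>" using ne[of T] \<eta> T by simp
    also have "\<dots> \<le> A * m + m" using d A \<eta>m by (intro add_mono mult_left_mono) auto
    finally have nE2: "norm E \<le> K2 * m" by (simp add: K2_def algebra_simps)
    define \<beta> where "\<beta> = integral {0..T} (\<lambda>s. r (y' s) (u s) - r (y s) (u s))"
    have ir': "(\<lambda>s. r (y' s) (u s)) integrable_on {0..T}"
      by (rule admissible_integrable'[OF _ _ _ r_cont]) (use t t' traj_continuous in \<open>auto simp: traj_def\<close>)
    have ir: "(\<lambda>s. r (y s) (u s)) integrable_on {0..T}" by (rule traj_r_integrable[OF t]) simp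
    have \<beta>_eq: "\<beta> = integral {0..T} (\<lambda>s. r (y' s) (u' s)) - integral {0..T} (\<lambda>s. r (y s) (u s))"
    proof -
      have "integral {0..T} (\<lambda>s. r (y' s) (u' s)) = integral {0..T} (\<lambda>s. r (y' s) (u s))"
        by (rule integral_spike[of "{T}"]) (use eq in auto)
      then show ?thesis unfolding \<beta>_def using integral_diff[OF ir' ir] by simp
    qed
    have n\<beta>: "\<bar>\<beta>\<bar> \<le> M * L * A * m"
    proof -
      have "norm \<beta> \<le> (L * (A * m)) * (T - 0)"
      proof (rule has_integral_norm_le)
        show "((\<lambda>s. r (y' s) (u s) - r (y s) (u s)) has_integral \<beta>) {0..T}"
          unfolding \<beta>_def by (intro integrable_integral integrable_diff ir ir')
        fix s assume s: "s \<in> {0..T}"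
        have "\<bar>r (y' s) (u s) - r (y s) (u s)\<bar> \<le> L * norm (y' s - y s)"
          by (rule r_lip) (use s traj_in_U[OF t] in auto)
        also have "\<dots> \<le> L * (A * m)"
          using order_trans[OF ne[OF s] mult_left_mono[OF d(2)]] A GL by (intro mult_left_mono) auto
        finally show "norm (r (y' s) (u s) - r (y s) (u s)) \<le> L * (A * m)" by simp
      qed (use T in auto)
      also have "\<dots> \<le> (L * (A * m)) * M" using T A GL m by (intro mult_left_mono) auto
      finally show ?thesis by (simp add: algebra_simps)
    qed
    \<comment> \<open>The budget left at time \<open>T\<close>: the allowance \<open>a\<close> minus
      the excess running cost \<beta> minus the linearized change of terminal cost.\<close>
    define \<alpha> where "\<alpha> = a - \<beta> - \<zeta> \<bullet> E"
    have n\<alpha>: "\<bar>\<alpha>\<bar> \<le> K3 * m"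
    proof -
      have "\<bar>\<zeta> \<bullet> E\<bar> \<le> norm \<zeta> * norm E" by (rule Cauchy_Schwarz_ineq2)
      also have "\<dots> \<le> G * (K2 * m)" using \<zeta> nE2 GL by (intro mult_mono) auto
      finally have "\<bar>\<zeta> \<bullet> E\<bar> \<le> G * (A + 1) * m" by (simp add: K2_def)
      then have "\<bar>\<alpha>\<bar> \<le> m + M * L * A * m + G * (A + 1) * m" using a n\<beta> by (simp add: \<alpha>_def)
      then show ?thesis by (simp add: K3_def algebra_simps)
    qed
    \<comment> \<open>The reserve pays for the error \<open>K7\<close> made while spending the
      budget, for the curvature term of \<open>g\<close>, and for replacing \<open>g (y T)\<close>
      by \<open>g xs\<close>.\<close>
    define \<alpha>' where "\<alpha>' = \<alpha> - K4 * m\<^sup>2"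
    have n\<alpha>': "\<bar>\<alpha>'\<bar> \<le> (K3 + 1) * m"
    proof -
      have "K4 * m\<^sup>2 \<le> m" using mult_right_mono[OF mK4 m] by (simp add: power2_eq_square)
      moreover have "K4 * m\<^sup>2 \<ge> 0" using K4 by simp
      ultimately show ?thesis using n\<alpha> by (simp add: \<alpha>'_def algebra_simps)
    qed
    then have \<alpha>'K5: "\<bar>\<alpha>'\<bar> / \<kappa> \<le> K5 * m" using \<kappa> by (simp add: K5_def field_simps)
    have start: "(1 - \<mu>) * (v \<bullet> E) + \<mu> * \<alpha> > (C - K1 - M - G) * m\<^sup>2"
    proof -
      have Qb: "norm (q s) \<le> Q" if "s \<in> {0..T}" for s
      proof -
        have nq: "norm (q T) \<le> M + G"
        proof -
          have "norm (q T) \<le> norm ((1 - \<mu>) *\<^sub>R v) + norm (\<mu> *\<^sub>R \<zeta>)" unfolding qT by (rule norm_triangle_ineq4)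
          moreover have "(1 - \<mu>) * norm v \<le> norm v" "\<mu> * norm \<zeta> \<le> norm \<zeta>" using \<mu> by (auto intro!: mult_left_le_one_le)
          ultimately show ?thesis using v \<zeta> \<mu> by simp
        qed
        have "norm (q s) \<le> (norm (q T) + \<mu> * L * T) * exp (L * T)"
          by (rule adjoint_bounds(1)[OF q \<mu>(1) t that])
        also have "\<dots> \<le> (M + G + L * M) * A"
        proof (rule mult_mono[OF add_mono[OF nq] expA])
          have "\<mu> * (L * T) \<le> L * T" using \<mu> GL T by (intro mult_left_le_one_le) auto
          also have "\<dots> \<le> L * M" using T GL by simp
          finally show "\<mu> * L * T \<le> L * M" by (simp add: mult.assoc)
        qed (use M GL in auto)
        finally show ?thesis by (simp add: Q_def)
      qed
      have "q 0 \<bullet> (z - x) - (Q + 1) * L * (exp (L * T))\<^sup>2 * T * (norm (z - x))\<^sup>2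
          \<le> q T \<bullet> (y' T - y T) - \<mu> * integral {0..T} (\<lambda>s. r (y' s) (u s) - r (y s) (u s))"
        by (rule duality[OF t t' _ eq q \<mu> Qb]) (use T in auto)
      moreover have "(Q + 1) * L * (exp (L * T))\<^sup>2 * T * (norm (z - x))\<^sup>2 \<le> K1 * m\<^sup>2"
        unfolding K1_def using Q GL T expA d M
        by (intro mult_mono power_mono) (auto simp: d_def)
      ultimately have 1: "q 0 \<bullet> (z - x) - K1 * m\<^sup>2 \<le> q T \<bullet> e - \<mu> * \<beta>" by (simp add: e_def \<beta>_def)
      have nv: "\<bar>q T \<bullet> (y T - xs)\<bar> \<le> (M + G) * m\<^sup>2"
      proof -
        have "norm (q T) \<le> norm ((1 - \<mu>) *\<^sub>R v) + norm (\<mu> *\<^sub>R \<zeta>)" unfolding qT by (rule norm_triangle_ineq4)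
        moreover have "(1 - \<mu>) * norm v \<le> norm v" "\<mu> * norm \<zeta> \<le> norm \<zeta>" using \<mu> by (auto intro!: mult_left_le_one_le)
        ultimately have "norm (q T) \<le> M + G" using v \<zeta> \<mu> by simp
        then have "norm (q T) * norm (y T - xs) \<le> (M + G) * m\<^sup>2"
          using \<eta> \<eta>m M GL by (intro mult_mono) auto
        then show ?thesis using Cauchy_Schwarz_ineq2[of "q T" "y T - xs"] by linarith
      qed
      \<comment> \<open>The terms in \<zeta> cancel, so what \<open>duality\<close> transports from
        time 0 is exactly progress along \<open>v\<close> plus weighted budget.\<close>
      have "(1 - \<mu>) * (v \<bullet> E) + \<mu> * \<alpha> = q T \<bullet> E + \<mu> * (a - \<beta>)"
        unfolding qT \<alpha>_def by (simp add: inner_diff_left algebra_simps)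
      also have "q T \<bullet> E = q T \<bullet> e + q T \<bullet> (y T - xs)" by (simp add: E_def e_def inner_diff_right)
      finally have "(1 - \<mu>) * (v \<bullet> E) + \<mu> * \<alpha> \<ge> q 0 \<bullet> (z - x) + \<mu> * a - (K1 + M + G) * m\<^sup>2"
        using 1 nv by (simp add: algebra_simps)
      moreover have "C * m\<^sup>2 < q 0 \<bullet> (z - x) + \<mu> * a" using big m2 by (simp add: d_def)
      ultimately show ?thesis by (simp add: algebra_simps)
    qed
    have near: "norm (y' s - xs) \<le> K6 * m" if "s \<ge> 0" "\<bar>s - T\<bar> \<le> K5 * m" for s
    proof -
      have "norm (y' s - xs) \<le> norm (y' s - y' T) + norm E"
        unfolding E_def using norm_triangle_ineq[of "y' s - y' T" "y' T - xs"] by simp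
      moreover have "norm (y' s - y' T) \<le> N * \<bar>s - T\<bar>" by (rule traj_lip[OF t']) (use that T in auto)
      moreover have "N * \<bar>s - T\<bar> \<le> N * (K5 * m)" using that GL by (intro mult_left_mono) auto
      ultimately show ?thesis using nE2 by (simp add: K6_def algebra_simps)
    qed
    \<comment> \<open>Both signs of the budget reduce to this: a stopping time at which at most
      \<alpha>' has been spent (\<open>R\<close>) while (1 - \<mu>) v has gained at least \<mu>
      \<alpha>' (\<open>vv\<close>), each up to order m^2.\<close>
    have final: "V z \<le> cost T u y + a"
      if \<tau>: "\<tau> \<ge> 0" "\<bar>\<tau> - T\<bar> \<le> K5 * m"
        and R: "integral {0..\<tau>} (\<lambda>s. r (y' s) (u' s)) - integral {0..T} (\<lambda>s. r (y' s) (u' s)) + \<zeta> \<bullet> (y' \<tau> - y' T) \<le> \<alpha>' + K7 * m\<^sup>2"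
        and vv: "(1 - \<mu>) * (v \<bullet> (y' \<tau> - y' T)) \<ge> \<mu> * \<alpha>' - (K7 + K8) * m\<^sup>2" for \<tau>
    proof -
      define Et where "Et = y' \<tau> - xs"
      have Et: "Et = E + (y' \<tau> - y' T)" by (simp add: Et_def E_def)
      have nEt: "norm Et \<le> K6 * m" using near[OF \<tau>] by (simp add: Et_def)
      have nEt2: "M * (norm Et)\<^sup>2 \<le> M * K6\<^sup>2 * m\<^sup>2"
      proof -
        have "(norm Et)\<^sup>2 \<le> (K6 * m)\<^sup>2" using nEt by (intro power_mono) auto
        then have "M * (norm Et)\<^sup>2 \<le> M * (K6 * m)\<^sup>2" using M by (intro mult_left_mono) auto
        then show ?thesis by (simp add: power_mult_distrib)
      qed
      have inb: "y' \<tau> \<in> ball xs (1 / M)" using nEt mK6 by (simp add: Et_def dist_norm norm_minus_commute)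
      have inT: "y T \<in> ball xs (1 / M)"
      proof -
        have "m \<le> K6 * m" using K6 m by (simp add: mult_le_cancel_right1)
        then show ?thesis using \<eta> \<eta>m(2) mK6 by (simp add: dist_norm norm_minus_commute)
      qed
      have "(1 - \<mu>) * (v \<bullet> Et) = ((1 - \<mu>) * (v \<bullet> E) + \<mu> * \<alpha>) - \<mu> * \<alpha> + (1 - \<mu>) * (v \<bullet> (y' \<tau> - y' T))"
        unfolding Et by (simp add: inner_add_right algebra_simps)
      moreover have "\<mu> * \<alpha>' \<ge> \<mu> * \<alpha> - K4 * m\<^sup>2"
      proof -
        have "\<mu> * (K4 * m\<^sup>2) \<le> K4 * m\<^sup>2" using \<mu> K4 by (intro mult_left_le_one_le) auto
        then show ?thesis by (simp add: \<alpha>'_def right_diff_distrib)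
      qed
      ultimately have "(1 - \<mu>) * (v \<bullet> Et) > (C - K1 - M - G) * m\<^sup>2 - K4 * m\<^sup>2 - (K7 + K8) * m\<^sup>2"
        using start vv by linarith
      also have "(C - K1 - M - G) * m\<^sup>2 - K4 * m\<^sup>2 - (K7 + K8) * m\<^sup>2 = (M * K6\<^sup>2 + K5 + 1) * m\<^sup>2"
        by (simp add: C_def algebra_simps)
      finally have "(M * K6\<^sup>2 + K5 + 1) * m\<^sup>2 < (1 - \<mu>) * (v \<bullet> Et)" .
      moreover have "M * K6\<^sup>2 * m\<^sup>2 \<le> (M * K6\<^sup>2 + K5 + 1) * m\<^sup>2" using K5 by (intro mult_right_mono) auto
      ultimately have 1: "(1 - \<mu>) * (v \<bullet> Et) > M * K6\<^sup>2 * m\<^sup>2" by linarith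
      have 2: "M * K6\<^sup>2 * m\<^sup>2 \<ge> 0" using M by simp
      have "v \<bullet> Et > M * (norm Et)\<^sup>2"
      proof -
        have "v \<bullet> Et > 0"
        proof (rule ccontr)
          assume "\<not> v \<bullet> Et > 0"
          then have "(1 - \<mu>) * (v \<bullet> Et) \<le> 0" using \<mu> by (intro mult_nonneg_nonpos) auto
          then show False using 1 2 by linarith
        qed
        then have "(1 - \<mu>) * (v \<bullet> Et) \<le> v \<bullet> Et" using \<mu> by (intro mult_left_le_one_le) auto
        then show ?thesis using 1 nEt2 by linarith
      qed
      then have inS: "y' \<tau> \<in> S" using vS[of "y' \<tau>"] by (force simp: Et_def)
      have "V z \<le> cost \<tau> u' y'" by (rule V_le_stopping[OF t' z \<tau>(1) inS]) (use gz[OF inb] in auto)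
      moreover have "g (y' \<tau>) \<le> g xs + \<zeta> \<bullet> Et + M * K6\<^sup>2 * m\<^sup>2" using gz[OF inb] nEt2 by (simp add: Et_def)
      moreover have "g xs \<le> g (y T) + G * m\<^sup>2"
      proof -
        have "\<bar>g xs - g (y T)\<bar> \<le> G * norm (xs - y T)" using g_lip[of "y T" xs] gz[OF inT] xs W by auto
        also have "\<dots> \<le> G * m\<^sup>2" using \<eta> \<eta>m GL by (intro mult_left_mono) (auto simp: norm_minus_commute)
        finally show ?thesis by simp
      qed
      moreover have "\<zeta> \<bullet> Et = \<zeta> \<bullet> E + \<zeta> \<bullet> (y' \<tau> - y' T)" unfolding Et by (simp add: inner_add_right)
      moreover have "\<alpha>' + K7 * m\<^sup>2 = a - \<beta> - \<zeta> \<bullet> E - M * K6\<^sup>2 * m\<^sup>2 - G * m\<^sup>2"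
        by (simp add: \<alpha>'_def \<alpha>_def K4_def algebra_simps)
      ultimately show ?thesis using R \<beta>_eq by simp
    qed
    have K7m: "\<theta> * ((1 + G) * L * (K6 * m)) \<le> K7 * m\<^sup>2" "\<theta> * (M * L * (K6 * m)) \<le> K8 * m\<^sup>2"
      if "\<theta> \<le> K5 * m" for \<theta>
    proof -
      have "\<theta> * ((1 + G) * L * (K6 * m)) \<le> (K5 * m) * ((1 + G) * L * (K6 * m))"
        using that GL K6 m by (intro mult_right_mono) auto
      then show "\<theta> * ((1 + G) * L * (K6 * m)) \<le> K7 * m\<^sup>2" by (simp add: K7_def power2_eq_square algebra_simps)
      have "\<theta> * (M * L * (K6 * m)) \<le> (K5 * m) * (M * L * (K6 * m))"
        using that GL K6 m M by (intro mult_right_mono) auto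
      then show "\<theta> * (M * L * (K6 * m)) \<le> K8 * m\<^sup>2" by (simp add: K8_def power2_eq_square algebra_simps)
    qed
    show "V z \<le> cost T u y + a"
    proof (cases "\<alpha>' \<ge> 0")
      case True
      \<comment> \<open>Under the maximizing control the budget is spent at rate about
        \<open>k\<close>, and by the equality clause of \<open>terminal_data\<close> (1 - \<mu>) v
        gains at rate about \<mu> k.\<close>
      define k where "k = r xs \<omega>s + \<zeta> \<bullet> f xs \<omega>s"
      have k: "k \<ge> \<kappa>" using running_terminal_ge[OF \<omega>s(1) \<zeta>] by (simp add: k_def \<kappa>_def)
      define \<theta> where "\<theta> = \<alpha>' / k"
      have \<theta>: "\<theta> \<ge> 0" "\<theta> * k = \<alpha>'" using True k \<kappa> by (auto simp: \<theta>_def)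
      have "\<theta> \<le> \<bar>\<alpha>'\<bar> / \<kappa>" unfolding \<theta>_def using True k \<kappa> by (simp add: frac_le)
      then have \<theta>5: "\<theta> \<le> K5 * m" using \<alpha>'K5 by simp
      have I: "((\<lambda>s. r (y' s) (u' s)) has_integral
          (integral {0..T+\<theta>} (\<lambda>s. r (y' s) (u' s)) - integral {0..T} (\<lambda>s. r (y' s) (u' s)))) {T..T+\<theta>}"
        by (rule traj_r_has_integral[OF t']) (use T \<theta> in auto)
      have nr: "norm (y' s - xs) \<le> K6 * m" if "s \<in> {T..T+\<theta>}" for s
        by (rule near) (use that T \<theta> \<theta>5 in auto)
      have u's: "u' s = \<omega>s" if "s \<in> {T..T+\<theta>}" for s using that by (simp add: u'_def)
      show ?thesis
      proof (rule final[of "T + \<theta>"])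
        show "integral {0..T+\<theta>} (\<lambda>s. r (y' s) (u' s)) - integral {0..T} (\<lambda>s. r (y' s) (u' s)) + \<zeta> \<bullet> (y' (T+\<theta>) - y' T) \<le> \<alpha>' + K7 * m\<^sup>2"
        proof -
          have "integral {0..T+\<theta>} (\<lambda>s. r (y' s) (u' s)) - integral {0..T} (\<lambda>s. r (y' s) (u' s)) + \<zeta> \<bullet> (y' (T+\<theta>) - y' T)
              \<le> (T + \<theta> - T) *\<^sub>R (k + (1 + G) * L * (K6 * m))"
          proof (rule has_integral_le)
            show "((\<lambda>s. r (y' s) (u' s) + \<zeta> \<bullet> f (y' s) (u' s)) has_integral
              (integral {0..T+\<theta>} (\<lambda>s. r (y' s) (u' s)) - integral {0..T} (\<lambda>s. r (y' s) (u' s)) + \<zeta> \<bullet> (y' (T+\<theta>) - y' T))) {T..T+\<theta>}"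
              by (intro has_integral_add I traj_inner_integral[OF t']) (use T \<theta> in auto)
            show "((\<lambda>s. k + (1 + G) * L * (K6 * m)) has_integral (T + \<theta> - T) *\<^sub>R (k + (1 + G) * L * (K6 * m))) {T..T+\<theta>}"
              using has_integral_const_real[of "k + (1 + G) * L * (K6 * m)" T "T+\<theta>"] \<theta> by simp
            fix s assume s: "s \<in> {T..T+\<theta>}"
            have "(1 + G) * L * norm (y' s - xs) \<le> (1 + G) * L * (K6 * m)" using nr[OF s] GL by (intro mult_left_mono) auto
            then show "r (y' s) (u' s) + \<zeta> \<bullet> f (y' s) (u' s) \<le> k + (1 + G) * L * (K6 * m)"
              using running_terminal_lip[OF \<omega>s(1) \<zeta>, of "y' s" xs] u's[OF s] by (simp add: k_def)
          qed
          also have "\<dots> = \<alpha>' + \<theta> * ((1 + G) * L * (K6 * m))" using \<theta> by (simp add: algebra_simps)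
          also have "\<dots> \<le> \<alpha>' + K7 * m\<^sup>2" using K7m(1)[OF \<theta>5] by simp
          finally show ?thesis .
        qed
        show "\<mu> * \<alpha>' - (K7 + K8) * m\<^sup>2 \<le> (1 - \<mu>) * (v \<bullet> (y' (T+\<theta>) - y' T))"
        proof -
          have "(T + \<theta> - T) *\<^sub>R (\<mu> * k - M * L * (K6 * m)) \<le> (1 - \<mu>) * (v \<bullet> (y' (T+\<theta>) - y' T))"
          proof (rule has_integral_le)
            show "((\<lambda>s. \<mu> * k - M * L * (K6 * m)) has_integral (T + \<theta> - T) *\<^sub>R (\<mu> * k - M * L * (K6 * m))) {T..T+\<theta>}"
              using has_integral_const_real[of "\<mu> * k - M * L * (K6 * m)" T "T+\<theta>"] \<theta> by simp
            show "((\<lambda>s. (1 - \<mu>) * (v \<bullet> f (y' s) (u' s))) has_integral (1 - \<mu>) * (v \<bullet> (y' (T+\<theta>) - y' T))) {T..T+\<theta>}"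
              by (intro has_integral_mult_right traj_inner_integral[OF t']) (use T \<theta> in auto)
            fix s assume s: "s \<in> {T..T+\<theta>}"
            have "M * L * norm (y' s - xs) \<le> M * L * (K6 * m)" using nr[OF s] GL M by (intro mult_left_mono) auto
            then show "\<mu> * k - M * L * (K6 * m) \<le> (1 - \<mu>) * (v \<bullet> f (y' s) (u' s))"
              using normal_velocity_lip[OF \<omega>s(1) v \<mu>, of "y' s" xs] \<omega>s(2) u's[OF s] by (simp add: k_def)
          qed
          moreover have "(T + \<theta> - T) *\<^sub>R (\<mu> * k - M * L * (K6 * m)) = \<mu> * \<alpha>' - \<theta> * (M * L * (K6 * m))"
            using \<theta> by (simp add: algebra_simps)
          moreover have "K7 * m\<^sup>2 \<ge> 0" using K7 by simp
          ultimately show ?thesis using K7m(2)[OF \<theta>5] distrib_right[of K7 K8 "m\<^sup>2"] by linarith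
        qed
      qed (use T \<theta> \<theta>5 in auto)
    next
      case False
      \<comment> \<open>Accumulated running plus linearized terminal cost. It grows at rate at least
        \<kappa>, so going back by at most (- \<alpha>') / \<kappa> recovers the overspent amount
        exactly.\<close>
      define I where "I = (\<lambda>t. integral {0..t} (\<lambda>s. r (y' s) (u' s)) + \<zeta> \<bullet> (y' t - y' 0))"
      have Ii: "((\<lambda>s. r (y' s) (u' s) + \<zeta> \<bullet> f (y' s) (u' s)) has_integral (I b - I c)) {c..b}" if "0 \<le> c" "c \<le> b" for b c
      proof -
        have "((\<lambda>s. r (y' s) (u' s)) has_integral
            (integral {0..b} (\<lambda>s. r (y' s) (u' s)) - integral {0..c} (\<lambda>s. r (y' s) (u' s)))) {c..b}"
          by (rule traj_r_has_integral[OF t' that])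
        from has_integral_add[OF this traj_inner_integral[OF t' that, of \<zeta>]]
        show ?thesis by (simp add: I_def inner_diff_right algebra_simps)
      qed
      have pw: "r (y' s) (u' s) + \<zeta> \<bullet> f (y' s) (u' s) \<ge> \<kappa>" if "s \<ge> 0" for s
        using running_terminal_ge[OF traj_in_U[OF t' that] \<zeta>] by (simp add: \<kappa>_def)
      have low: "\<kappa> * (b - c) \<le> I b - I c" if "0 \<le> c" "c \<le> b" for b c
      proof -
        have "(b - c) *\<^sub>R \<kappa> \<le> I b - I c"
          by (rule has_integral_le[OF _ Ii[OF that]])
             (use has_integral_const_real[of \<kappa> c b] that pw in auto)
        then show ?thesis by (simp add: mult.commute)
      qed
      define \<tau>0 where "\<tau>0 = T - (- \<alpha>') / \<kappa>"
      have KT: "K5 * m \<le> T"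
        using DT C(2) m mult_right_mono[OF C(2) m] by (simp add: m_def d_def)
      have \<tau>0: "0 \<le> \<tau>0" "\<tau>0 \<le> T" "T - \<tau>0 \<le> K5 * m" "\<kappa> * (T - \<tau>0) = - \<alpha>'"
      proof -
        have "(- \<alpha>') / \<kappa> \<le> K5 * m" using False \<alpha>'K5 by simp
        moreover have "(- \<alpha>') / \<kappa> \<ge> 0" by (rule divide_nonneg_pos) (use False \<kappa> in auto)
        ultimately show "0 \<le> \<tau>0" "\<tau>0 \<le> T" "T - \<tau>0 \<le> K5 * m" using KT by (auto simp: \<tau>0_def)
        show "\<kappa> * (T - \<tau>0) = - \<alpha>'" using \<kappa> by (simp add: \<tau>0_def)
      qed
      have contI: "continuous_on {\<tau>0..T} I"
        unfolding I_def
        by (intro continuous_intros continuous_on_subset[OF indefinite_integral_continuous_1[OF traj_r_integrable[OF t', of 0 T]]]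
            traj_continuous[OF t'])
          (use \<tau>0 in auto)
      have "\<exists>\<tau>. \<tau>0 \<le> \<tau> \<and> \<tau> \<le> T \<and> I \<tau> = I T + \<alpha>'"
        by (rule IVT'[OF _ _ _ contI]) (use low[of \<tau>0 T] \<tau>0 False in auto)
      then obtain \<tau> where \<tau>: "\<tau>0 \<le> \<tau>" "\<tau> \<le> T" "I \<tau> = I T + \<alpha>'" by blast
      define \<theta> where "\<theta> = T - \<tau>"
      have \<theta>: "0 \<le> \<theta>" "\<theta> \<le> K5 * m" using \<tau> \<tau>0 by (auto simp: \<theta>_def)
      have \<tau>pos: "\<tau> \<ge> 0" using \<tau> \<tau>0 by simp
      have nr: "norm (y' s - xs) \<le> K6 * m" if "s \<in> {\<tau>..T}" for s
        by (rule near) (use that \<tau>pos \<theta> in \<open>auto simp: \<theta>_def\<close>)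
      show ?thesis
      proof (rule final[of \<tau>])
        have "integral {0..\<tau>} (\<lambda>s. r (y' s) (u' s)) - integral {0..T} (\<lambda>s. r (y' s) (u' s)) + \<zeta> \<bullet> (y' \<tau> - y' T) = \<alpha>'"
          using \<tau>(3) by (simp add: I_def inner_diff_right)
        moreover have "K7 * m\<^sup>2 \<ge> 0" using K7 by simp
        ultimately show "integral {0..\<tau>} (\<lambda>s. r (y' s) (u' s)) - integral {0..T} (\<lambda>s. r (y' s) (u' s)) + \<zeta> \<bullet> (y' \<tau> - y' T)
            \<le> \<alpha>' + K7 * m\<^sup>2" by simp
        let ?c = "(1 + G) * L * (K6 * m) + M * L * (K6 * m)"
        \<comment> \<open>On the omitted piece the control is arbitrary; the inequality clause of
          \<open>terminal_data\<close>, valid for every control value, limits the progress along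
          \<open>v\<close> that is lost.\<close>
        have "(1 - \<mu>) * (v \<bullet> (y' T - y' \<tau>)) \<le> \<mu> * (I T - I \<tau>) + (T - \<tau>) *\<^sub>R ?c"
        proof (rule has_integral_le)
          show "((\<lambda>s. (1 - \<mu>) * (v \<bullet> f (y' s) (u' s))) has_integral (1 - \<mu>) * (v \<bullet> (y' T - y' \<tau>))) {\<tau>..T}"
            by (intro has_integral_mult_right traj_inner_integral[OF t']) (use \<tau> \<tau>pos in auto)
          show "((\<lambda>s. \<mu> * (r (y' s) (u' s) + \<zeta> \<bullet> f (y' s) (u' s)) + ?c) has_integral
              \<mu> * (I T - I \<tau>) + (T - \<tau>) *\<^sub>R ?c) {\<tau>..T}"
            by (intro has_integral_add has_integral_mult_right Ii \<tau>pos \<tau>(2))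
              (use has_integral_const_real[of ?c \<tau> T] \<tau> in simp)
          fix s assume s: "s \<in> {\<tau>..T}"
          have Us: "u' s \<in> U" using traj_in_U[OF t'] s \<tau>pos by auto
          have 1: "M * L * norm (y' s - xs) \<le> M * L * (K6 * m)" using nr[OF s] GL M by (intro mult_left_mono) auto
          have 2: "(1 + G) * L * norm (y' s - xs) \<le> (1 + G) * L * (K6 * m)" using nr[OF s] GL by (intro mult_left_mono) auto
          have "\<mu> * ((r xs (u' s) + \<zeta> \<bullet> f xs (u' s)) - (r (y' s) (u' s) + \<zeta> \<bullet> f (y' s) (u' s)))
             \<le> \<mu> * ((1 + G) * L * (K6 * m))"
            using running_terminal_lip[OF Us \<zeta>, of "y' s" xs] 2 \<mu> by (intro mult_left_mono) auto
          also have "\<dots> \<le> (1 + G) * L * (K6 * m)" using \<mu> GL K6 m by (intro mult_left_le_one_le) auto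
          finally show "(1 - \<mu>) * (v \<bullet> f (y' s) (u' s)) \<le> \<mu> * (r (y' s) (u' s) + \<zeta> \<bullet> f (y' s) (u' s)) + ?c"
            using normal_velocity_lip[OF Us v \<mu>, of "y' s" xs] max[OF Us] 1 by (simp add: right_diff_distrib)
        qed
        moreover have "(T - \<tau>) *\<^sub>R ?c \<le> (K7 + K8) * m\<^sup>2"
          using K7m[OF \<theta>(2)] by (simp add: \<theta>_def distrib_left distrib_right)
        moreover have "I T - I \<tau> = - \<alpha>'" using \<tau>(3) by simp
        moreover have "(1 - \<mu>) * (v \<bullet> (y' \<tau> - y' T)) = - ((1 - \<mu>) * (v \<bullet> (y' T - y' \<tau>)))"
          by (simp add: inner_diff_right algebra_simps)
        ultimately show "\<mu> * \<alpha>' - (K7 + K8) * m\<^sup>2 \<le> (1 - \<mu>) * (v \<bullet> (y' \<tau> - y' T))"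
          by simp
      qed (use \<tau>pos \<tau> \<theta> in \<open>auto simp: \<theta>_def\<close>)
    qed
  qed
qed

end

section \<open>Semiconcavity and uniform supergradients\<close>

definition semiconcave_on :: "'a::real_normed_vector set \<Rightarrow> real \<Rightarrow> ('a \<Rightarrow> real) \<Rightarrow> bool" where
  "semiconcave_on A c g \<longleftrightarrow> (\<forall>x0\<in>A. \<forall>x1\<in>A. \<forall>\<theta>\<in>{0..1}.
     (1 - \<theta>) * g x0 + \<theta> * g x1 - g ((1 - \<theta>) *\<^sub>R x0 + \<theta> *\<^sub>R x1) \<le> c * \<theta> * (1 - \<theta>) * (norm (x0 - x1))\<^sup>2)"

lemma semiconcave_on_subset:
  assumes "semiconcave_on A c g" "B \<subseteq> A" "c \<le> c'"
  shows "semiconcave_on B c' g"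
  unfolding semiconcave_on_def
proof (intro ballI)
  fix x0 x1 \<theta> assume x: "x0 \<in> B" "x1 \<in> B" "\<theta> \<in> {0..1::real}"
  then have "(1 - \<theta>) * g x0 + \<theta> * g x1 - g ((1 - \<theta>) *\<^sub>R x0 + \<theta> *\<^sub>R x1) \<le> c * \<theta> * (1 - \<theta>) * (norm (x0 - x1))\<^sup>2"
    using assms(1,2) unfolding semiconcave_on_def by blast
  also have "\<dots> \<le> c' * \<theta> * (1 - \<theta>) * (norm (x0 - x1))\<^sup>2"
    using assms(3) x by (intro mult_right_mono) auto
  finally show "(1 - \<theta>) * g x0 + \<theta> * g x1 - g ((1 - \<theta>) *\<^sub>R x0 + \<theta> *\<^sub>R x1) \<le> c' * \<theta> * (1 - \<theta>) * (norm (x0 - x1))\<^sup>2" .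
qed

text \<open>Subtracting \<open>c * (p \<bullet> p)\<close> makes \<open>g\<close> concave on the
  ball; a hyperplane separating the strict hypograph from the point \<open>(z, h z)\<close> then
  yields a supergradient.\<close>

lemma semiconcave_supergradient:
  fixes g :: "'a::euclidean_space \<Rightarrow> real"
  assumes sc: "semiconcave_on (ball z \<epsilon>) c g" and \<epsilon>: "\<epsilon> > 0"
  shows "\<exists>\<zeta>. \<forall>p\<in>ball z \<epsilon>. g p \<le> g z + \<zeta> \<bullet> (p - z) + c * (norm (p - z))\<^sup>2"
proof -
  define h where "h = (\<lambda>p. g p - c * (p \<bullet> p))"
  define A where "A = {(p, t) | p t. p \<in> ball z \<epsilon> \<and> t < h p}"
  have hc: "(1 - \<theta>) * h x0 + \<theta> * h x1 \<le> h ((1 - \<theta>) *\<^sub>R x0 + \<theta> *\<^sub>R x1)"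
    if "x0 \<in> ball z \<epsilon>" "x1 \<in> ball z \<epsilon>" "0 \<le> \<theta>" "\<theta> \<le> 1" for x0 x1 \<theta>
  proof -
    have "(1 - \<theta>) * g x0 + \<theta> * g x1 - g ((1 - \<theta>) *\<^sub>R x0 + \<theta> *\<^sub>R x1) \<le> c * \<theta> * (1 - \<theta>) * (norm (x0 - x1))\<^sup>2"
      using sc that by (auto simp: semiconcave_on_def)
    moreover have "(1 - \<theta>) * (x0 \<bullet> x0) + \<theta> * (x1 \<bullet> x1)
        - ((1 - \<theta>) *\<^sub>R x0 + \<theta> *\<^sub>R x1) \<bullet> ((1 - \<theta>) *\<^sub>R x0 + \<theta> *\<^sub>R x1) = \<theta> * (1 - \<theta>) * (norm (x0 - x1))\<^sup>2"
      unfolding power2_norm_eq_inner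
      by (simp add: inner_add_left inner_add_right inner_diff_left inner_diff_right inner_commute[of x1 x0] algebra_simps)
    then have "c * ((1 - \<theta>) * (x0 \<bullet> x0) + \<theta> * (x1 \<bullet> x1)
        - ((1 - \<theta>) *\<^sub>R x0 + \<theta> *\<^sub>R x1) \<bullet> ((1 - \<theta>) *\<^sub>R x0 + \<theta> *\<^sub>R x1)) = c * \<theta> * (1 - \<theta>) * (norm (x0 - x1))\<^sup>2"
      by (simp only: mult.assoc)
    moreover have "(1 - \<theta>) * h x0 + \<theta> * h x1 - h ((1 - \<theta>) *\<^sub>R x0 + \<theta> *\<^sub>R x1)
      = ((1 - \<theta>) * g x0 + \<theta> * g x1 - g ((1 - \<theta>) *\<^sub>R x0 + \<theta> *\<^sub>R x1))
        - c * ((1 - \<theta>) * (x0 \<bullet> x0) + \<theta> * (x1 \<bullet> x1)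
        - ((1 - \<theta>) *\<^sub>R x0 + \<theta> *\<^sub>R x1) \<bullet> ((1 - \<theta>) *\<^sub>R x0 + \<theta> *\<^sub>R x1))"
      unfolding h_def by (simp only: right_diff_distrib left_diff_distrib distrib_left distrib_right mult.left_commute mult.commute mult.assoc)
    ultimately show ?thesis by linarith
  qed
  have "convex A"
    unfolding convex_alt
  proof (intro ballI allI impI)
    fix x y and \<theta> :: real assume xy: "x \<in> A" "y \<in> A" and \<theta>: "0 \<le> \<theta> \<and> \<theta> \<le> 1"
    obtain p t q s where x: "x = (p, t)" "p \<in> ball z \<epsilon>" "t < h p" and y: "y = (q, s)" "q \<in> ball z \<epsilon>" "s < h q"
      using xy by (auto simp: A_def)
    have 1: "(1 - \<theta>) *\<^sub>R p + \<theta> *\<^sub>R q \<in> ball z \<epsilon>"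
      using convex_ball[of z \<epsilon>] x(2) y(2) \<theta> unfolding convex_alt by blast
    have "(1 - \<theta>) * t + \<theta> * s < (1 - \<theta>) * h p + \<theta> * h q"
    proof (cases "\<theta> = 0")
      case False
      then have "\<theta> * s < \<theta> * h q" using \<theta> y(3) by (intro mult_strict_left_mono) auto
      moreover have "(1 - \<theta>) * t \<le> (1 - \<theta>) * h p" using \<theta> x(3) by (intro mult_left_mono) auto
      ultimately show ?thesis by simp
    qed (use x in simp)
    also have "\<dots> \<le> h ((1 - \<theta>) *\<^sub>R p + \<theta> *\<^sub>R q)" using hc[OF x(2) y(2)] \<theta> by blast
    finally show "(1 - \<theta>) *\<^sub>R x + \<theta> *\<^sub>R y \<in> A" using 1 x(1) y(1) by (auto simp: A_def)
  qed
  moreover have "A \<inter> {(z, h z)} = {}" by (auto simp: A_def)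
  moreover have "A \<noteq> {}"
  proof -
    have "(z, h z - 1) \<in> A" using \<epsilon> by (simp add: A_def)
    then show ?thesis by blast
  qed
  ultimately obtain a b where ab: "a \<noteq> 0" "\<forall>x\<in>A. a \<bullet> x \<le> b" "\<forall>x\<in>{(z, h z)}. b \<le> a \<bullet> x"
    using separating_hyperplane_sets[of A "{(z, h z)}"] by auto
  obtain a1 a2 where a: "a = (a1, a2)" by (cases a)
  have sep: "a1 \<bullet> p + a2 * t \<le> a1 \<bullet> z + a2 * h z" if "p \<in> ball z \<epsilon>" "t < h p" for p t
  proof -
    have "(p, t) \<in> A" using that by (simp add: A_def)
    then have "a \<bullet> (p, t) \<le> a \<bullet> (z, h z)" using ab(2,3) by force
    then show ?thesis by (simp add: a)
  qed
  \<comment> \<open>The hyperplane is not vertical because \<open>z\<close> is interior to the ball: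
    a vertical one would be violated a little further in direction \<open>a1\<close>.\<close>
  have a2: "a2 > 0"
  proof -
    have "a2 * (h z - 1) \<le> a2 * h z" using sep[of z "h z - 1"] \<epsilon> by simp
    then have "a2 \<ge> 0" by (simp add: algebra_simps)
    moreover have "a2 \<noteq> 0"
    proof
      assume 0: "a2 = 0"
      then have a1: "a1 \<noteq> 0" using ab(1) a by (auto simp: zero_prod_def)
      define p where "p = z + (\<epsilon> / (2 * norm a1)) *\<^sub>R a1"
      have "p \<in> ball z \<epsilon>" using \<epsilon> a1 by (simp add: p_def dist_norm)
      then have "a1 \<bullet> p \<le> a1 \<bullet> z" using sep[of p "h p - 1"] 0 by simp
      then have "(\<epsilon> / (2 * norm a1)) * (a1 \<bullet> a1) \<le> 0" by (simp add: p_def inner_add_right)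
      moreover have "(\<epsilon> / (2 * norm a1)) * (a1 \<bullet> a1) > 0" using \<epsilon> a1 by (intro mult_pos_pos) auto
      ultimately show False by linarith
    qed
    ultimately show ?thesis by simp
  qed
  define \<zeta>h where "\<zeta>h = - (1 / a2) *\<^sub>R a1"
  have sup: "h p \<le> h z + \<zeta>h \<bullet> (p - z)" if "p \<in> ball z \<epsilon>" for p
  proof (rule dense_le)
    fix t assume t: "t < h p"
    have "a2 * t \<le> a2 * (h z + \<zeta>h \<bullet> (p - z))"
      using sep[OF that t] a2 by (simp add: \<zeta>h_def inner_diff_right algebra_simps)
    then show "t \<le> h z + \<zeta>h \<bullet> (p - z)" using a2 by simp
  qed
  show ?thesis
  proof (intro exI ballI)
    fix p assume "p \<in> ball z \<epsilon>"
    have "(norm (p - z))\<^sup>2 = p \<bullet> p - 2 * (z \<bullet> p) + z \<bullet> z"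
      by (simp add: power2_norm_eq_inner inner_diff_left inner_diff_right inner_commute[of p z])
    then have "c * (norm (p - z))\<^sup>2 = c * (p \<bullet> p - 2 * (z \<bullet> p) + z \<bullet> z)" by (rule arg_cong)
    then show "g p \<le> g z + (\<zeta>h + (2 * c) *\<^sub>R z) \<bullet> (p - z) + c * (norm (p - z))\<^sup>2"
      using sup[OF \<open>p \<in> ball z \<epsilon>\<close>] by (simp add: h_def inner_diff_right inner_add_left algebra_simps)
  qed
qed

lemma supergradient_norm_le:
  fixes g :: "'a::euclidean_space \<Rightarrow> real"
  assumes sup: "\<And>p. p \<in> ball z \<epsilon> \<Longrightarrow> g p \<le> g z + \<zeta> \<bullet> (p - z) + c * (norm (p - z))\<^sup>2"
    and lip: "\<And>p. p \<in> ball z \<epsilon> \<Longrightarrow> \<bar>g p - g z\<bar> \<le> G * norm (p - z)" and \<epsilon>: "\<epsilon> > 0" and G: "G \<ge> 0"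
  shows "norm \<zeta> \<le> G"
proof (cases "\<zeta> = 0")
  case False
  define n where "n = norm \<zeta>"
  have n: "n > 0" using False by (simp add: n_def)
  show ?thesis
  proof (rule field_le_epsilon)
    fix e :: real assume e: "e > 0"
    \<comment> \<open>The test point lies against \<zeta>, at a distance that stays in the ball and
      makes the quadratic term at most \<open>e\<close> times that distance.\<close>
    define t where "t = min (\<epsilon> / 2) (e / (\<bar>c\<bar> + 1)) / n"
    have "min (\<epsilon> / 2) (e / (\<bar>c\<bar> + 1)) > 0" using \<epsilon> e by simp
    then have t: "t > 0" using n by (simp add: t_def)
    have tn: "t * n = min (\<epsilon> / 2) (e / (\<bar>c\<bar> + 1))" using n by (simp add: t_def)
    define p where "p = z - t *\<^sub>R \<zeta>"
    have np: "norm (p - z) = t * n" using t by (simp add: p_def n_def)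
    have inb: "p \<in> ball z \<epsilon>" using np tn \<epsilon> by (simp add: dist_norm norm_minus_commute)
    have "- (G * (t * n)) \<le> g p - g z" using lip[OF inb] np by simp
    also have "\<dots> \<le> \<zeta> \<bullet> (p - z) + c * (t * n)\<^sup>2" using sup[OF inb] np by simp
    also have "\<zeta> \<bullet> (p - z) = - (t * n * n)" by (simp add: p_def n_def power2_norm_eq_inner[symmetric] power2_eq_square)
    finally have "(t * n) * n \<le> (t * n) * (G + c * (t * n))" by (simp add: power2_eq_square algebra_simps)
    then have "n \<le> G + c * (t * n)" using t n by simp
    also have "c * (t * n) \<le> (\<bar>c\<bar> + 1) * (e / (\<bar>c\<bar> + 1))" using tn t n \<epsilon> e by (intro mult_mono) auto
    also have "\<dots> = e" by simp
    finally show "norm \<zeta> \<le> G + e" by (simp add: n_def)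
  qed
qed (use G in simp)

lemma continuous_on_slice:
  assumes "continuous_on (UNIV \<times> U) (\<lambda>(x, \<omega>). h x \<omega>)"
  shows "continuous_on U (h x)"
proof -
  have "continuous_on U (\<lambda>\<omega>. (x, \<omega>))" by (intro continuous_on_Pair continuous_on_const continuous_on_id)
  from continuous_on_compose2[OF assms this] show ?thesis by auto
qed

context exit_problem
begin

text \<open>A finite subcover by half balls. \<open>M\<close> dominates every curvature constant and
  every \<open>2 / \<epsilon> z\<close>, so the same number serves as curvature and as inverse
  radius.\<close>

lemma uniform_supergradient:
  assumes sc: "locally_semiconcave g" and K: "compact K" "K \<subseteq> W"
  obtains M where "M \<ge> 1"
    "\<And>xs. xs \<in> K \<Longrightarrow> \<exists>\<zeta>. norm \<zeta> \<le> G \<and> (\<forall>p\<in>ball xs (1 / M). p \<in> W \<and> g p \<le> g xs + \<zeta> \<bullet> (p - xs) + M * (norm (p - xs))\<^sup>2)"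
proof -
  have "\<exists>\<epsilon> c. \<epsilon> > 0 \<and> semiconcave_on (ball z \<epsilon>) c g \<and> ball z \<epsilon> \<subseteq> W" if z: "z \<in> K" for z
  proof -
    obtain \<epsilon> c where 1: "\<epsilon> > 0" "semiconcave_on (ball z \<epsilon>) c g"
      using sc unfolding locally_semiconcave_def semiconcave_on_def by meson
    obtain \<epsilon>2 where 2: "\<epsilon>2 > 0" "ball z \<epsilon>2 \<subseteq> W" using W_open z K open_contains_ball by blast
    have "semiconcave_on (ball z (min \<epsilon> \<epsilon>2)) c g" by (rule semiconcave_on_subset[OF 1(2)]) auto
    then show ?thesis using 1 2 by (intro exI[of _ "min \<epsilon> \<epsilon>2"] exI[of _ c]) auto
  qed
  then obtain \<epsilon> c where ec: "\<And>z. z \<in> K \<Longrightarrow> \<epsilon> z > 0 \<and> semiconcave_on (ball z (\<epsilon> z)) (c z) g \<and> ball z (\<epsilon> z) \<subseteq> W"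
    by metis
  obtain F where F: "F \<subseteq> K" "finite F" "K \<subseteq> (\<Union>z\<in>F. ball z (\<epsilon> z / 2))"
    by (rule compactE_image[OF K(1), of K "\<lambda>z. ball z (\<epsilon> z / 2)"]) (use ec in auto)
  define M where "M = 1 + (\<Sum>z\<in>F. \<bar>c z\<bar> + 2 / \<epsilon> z)"
  have pos: "0 \<le> \<bar>c z\<bar> + 2 / \<epsilon> z" if "z \<in> F" for z
  proof -
    have "\<epsilon> z > 0" using ec that F(1) by blast
    then show ?thesis by simp
  qed
  have Mge: "\<bar>c z\<bar> + 2 / \<epsilon> z \<le> M" if "z \<in> F" for z
    using member_le_sum[of z F "\<lambda>z. \<bar>c z\<bar> + 2 / \<epsilon> z"] pos that F(2) by (auto simp: M_def)
  have M1: "M \<ge> 1" using sum_nonneg[OF pos, of F] by (simp add: M_def)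
  show ?thesis
  proof (rule that[OF M1])
    fix xs assume "xs \<in> K"
    then obtain z where z: "z \<in> F" "dist z xs < \<epsilon> z / 2" using F by force
    have ez: "\<epsilon> z > 0" using ec z F by blast
    have "2 / \<epsilon> z \<le> M" using Mge[OF z(1)] by simp
    then have Me: "1 / M \<le> \<epsilon> z / 2" using ez M1 by (simp add: field_simps)
    have sub: "ball xs (1 / M) \<subseteq> ball z (\<epsilon> z)"
    proof
      fix p assume "p \<in> ball xs (1 / M)"
      then have "dist xs p < \<epsilon> z / 2" using Me by simp
      then show "p \<in> ball z (\<epsilon> z)" using z(2) dist_triangle[of z p xs] by simp
    qed
    have "semiconcave_on (ball xs (1 / M)) M g"
    proof (rule semiconcave_on_subset)
      show "semiconcave_on (ball z (\<epsilon> z)) (c z) g" using ec z F by blast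
      have "2 / \<epsilon> z > 0" using ez by simp
      then show "c z \<le> M" using Mge[OF z(1)] by linarith
    qed (rule sub)
    then have "\<exists>\<zeta>. \<forall>p\<in>ball xs (1 / M). g p \<le> g xs + \<zeta> \<bullet> (p - xs) + M * (norm (p - xs))\<^sup>2"
      by (rule semiconcave_supergradient) (use M1 in simp)
    then obtain \<zeta> where \<zeta>: "\<And>p. p \<in> ball xs (1 / M) \<Longrightarrow> g p \<le> g xs + \<zeta> \<bullet> (p - xs) + M * (norm (p - xs))\<^sup>2"
      by blast
    have inW: "ball xs (1 / M) \<subseteq> W" using sub ec z F by blast
    have "norm \<zeta> \<le> G"
    proof (rule supergradient_norm_le[OF \<zeta>])
      fix p assume "p \<in> ball xs (1 / M)"
      moreover have "xs \<in> ball xs (1 / M)" using M1 by simp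
      ultimately show "\<bar>g p - g xs\<bar> \<le> G * norm (p - xs)" using inW g_lip by blast
    qed (use M1 G_nonneg in auto)
    then show "\<exists>\<zeta>. norm \<zeta> \<le> G \<and> (\<forall>p\<in>ball xs (1 / M). p \<in> W \<and> g p \<le> g xs + \<zeta> \<bullet> (p - xs) + M * (norm (p - xs))\<^sup>2)"
      using \<zeta> inW by blast
  qed
qed

text \<open>The weights must be in the ratio 1 - \<mu> : \<mu> = 1 : l, where l is the maximum over
  \<open>U\<close> of v . f divided by the positive quantity r + \<zeta> . f; hypothesis
  \<open>h\<close> makes l nonnegative. Normalizing gives \<mu> = l / (1 + l).\<close>

lemma terminal_data_exists:
  assumes xs: "xs \<in> frontier S" and v: "norm v \<le> M" "\<And>p. p \<notin> S \<Longrightarrow> v \<bullet> (p - xs) \<le> M * (norm (p - xs))\<^sup>2"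
    and \<zeta>: "norm \<zeta> \<le> G" "\<And>p. p \<in> ball xs (1 / M) \<Longrightarrow> p \<in> W \<and> g p \<le> g xs + \<zeta> \<bullet> (p - xs) + M * (norm (p - xs))\<^sup>2"
    and h: "\<exists>\<omega>\<in>U. 0 \<le> v \<bullet> f xs \<omega>"
  shows "\<exists>\<mu><1. terminal_data M xs v \<zeta> \<mu>"
proof -
  define k where "k = (\<lambda>\<omega>. v \<bullet> f xs \<omega>)"
  define m where "m = (\<lambda>\<omega>. r xs \<omega> + \<zeta> \<bullet> f xs \<omega>)"
  have m: "m \<omega> > 0" if "\<omega> \<in> U" for \<omega>
    using running_terminal_ge[OF that \<zeta>(1), of xs] G_small by (simp add: m_def)
  have fc: "continuous_on U (f xs)"
    by (rule continuous_on_slice[OF f_cont])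
  have rc: "continuous_on U (r xs)"
    by (rule continuous_on_slice[OF r_cont])
  have "continuous_on U (\<lambda>\<omega>. k \<omega> / m \<omega>)"
    unfolding k_def m_def using m by (intro continuous_intros fc rc) (fastforce simp: m_def)
  then obtain \<omega>s where \<omega>s: "\<omega>s \<in> U" "\<And>\<omega>. \<omega> \<in> U \<Longrightarrow> k \<omega> / m \<omega> \<le> k \<omega>s / m \<omega>s"
    using continuous_attains_sup[OF U_compact U_ne] by blast
  define l where "l = k \<omega>s / m \<omega>s"
  have l: "l \<ge> 0"
  proof -
    obtain \<omega> where "\<omega> \<in> U" "0 \<le> k \<omega>" using h by (auto simp: k_def)
    then show ?thesis using \<omega>s(2)[of \<omega>] m[of \<omega>] by (force simp: l_def intro: order_trans[rotated] divide_nonneg_pos)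
  qed
  define \<mu> where "\<mu> = l / (1 + l)"
  have \<mu>: "0 \<le> \<mu>" "\<mu> < 1" "1 - \<mu> = 1 / (1 + l)" using l by (auto simp: \<mu>_def field_simps)
  have iff: "(1 - \<mu>) * k \<omega> \<le> \<mu> * m \<omega> \<longleftrightarrow> k \<omega> / m \<omega> \<le> l" "(1 - \<mu>) * k \<omega> = \<mu> * m \<omega> \<longleftrightarrow> k \<omega> / m \<omega> = l"
    if "\<omega> \<in> U" for \<omega>
  proof -
    have "\<mu> = (1 - \<mu>) * l" unfolding \<mu>(3) by (simp add: \<mu>_def)
    then have e: "\<mu> * m \<omega> = (1 - \<mu>) * (l * m \<omega>)" by (metis mult.assoc)
    show "(1 - \<mu>) * k \<omega> \<le> \<mu> * m \<omega> \<longleftrightarrow> k \<omega> / m \<omega> \<le> l" "(1 - \<mu>) * k \<omega> = \<mu> * m \<omega> \<longleftrightarrow> k \<omega> / m \<omega> = l"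
      unfolding e using \<mu>(2) m[OF that] by (simp_all add: pos_divide_le_eq divide_eq_eq)
  qed
  have "terminal_data M xs v \<zeta> \<mu>"
    unfolding terminal_data_def using xs v \<zeta> \<mu> iff \<omega>s by (auto simp: k_def m_def l_def intro!: bexI[of _ \<omega>s])
  then show ?thesis using \<mu> by blast
qed

lemma terminal_data_mono:
  assumes td: "terminal_data M xs v \<zeta> \<mu>" and M: "1 \<le> M" "M \<le> M'"
  shows "terminal_data M' xs v \<zeta> \<mu>"
proof -
  have "1 / M' \<le> 1 / M" using M by (simp add: frac_le)
  then have sub: "p \<in> ball xs (1 / M)" if "p \<in> ball xs (1 / M')" for p using that by auto
  have le: "M * (norm p)\<^sup>2 \<le> M' * (norm p)\<^sup>2" for p :: "real^'d" using M by (intro mult_right_mono) auto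
  have 1: "v \<bullet> (p - xs) \<le> M' * (norm (p - xs))\<^sup>2" if "p \<notin> S" for p
    using td that le[of "p - xs"] unfolding terminal_data_def by force
  have 2: "p \<in> W \<and> g p \<le> g xs + \<zeta> \<bullet> (p - xs) + M' * (norm (p - xs))\<^sup>2" if "p \<in> ball xs (1 / M')" for p
  proof -
    have "p \<in> W \<and> g p \<le> g xs + \<zeta> \<bullet> (p - xs) + M * (norm (p - xs))\<^sup>2"
      using td sub[OF that] unfolding terminal_data_def by blast
    then show ?thesis using le[of "p - xs"] by linarith
  qed
  have 3: "norm v \<le> M'" using td M unfolding terminal_data_def by linarith
  show ?thesis using td 1 2 3 unfolding terminal_data_def by blast
qed

section \<open>Minimizing sequences and their exit points\<close>

definition near_opt :: "real \<Rightarrow> real^'d \<Rightarrow> real \<Rightarrow> real^'d \<Rightarrow> (real \<Rightarrow> real^'m) \<Rightarrow> (real \<Rightarrow> real^'d) \<Rightarrow> real \<Rightarrow> bool" where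
  "near_opt \<kappa> x T xs u y \<tau> \<longleftrightarrow> traj x u y \<and> is_hitting_time S y \<tau> \<and> \<bar>\<tau> - T\<bar> \<le> \<kappa> \<and> norm (y \<tau> - xs) \<le> \<kappa> \<and>
     cost \<tau> u y \<le> V x + \<kappa>"

text \<open>Times and end points of minimizing sequences replace optimal controls throughout.\<close>

definition limit_end :: "real^'d \<Rightarrow> real \<Rightarrow> real^'d \<Rightarrow> bool" where
  "limit_end x T xs \<longleftrightarrow> (\<forall>\<kappa>>0. \<exists>u y \<tau>. near_opt \<kappa> x T xs u y \<tau>)"

text \<open>Running cost accumulates at rate at least \<open>r0\<close>, while travelling at speed
  \<open>N\<close> can lower the terminal cost, compared with the reference point \<open>x0\<close>,
  at rate at most \<open>G * N\<close>. A bound on the cost therefore bounds the hitting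
  time.\<close>

lemma hitting_time_bound:
  assumes t: "traj x u y" and x: "x \<notin> S" and h: "is_hitting_time S y T" and x0: "x0 \<in> frontier S"
  shows "(r0 - G * N) * T \<le> cost T u y - g x0 + G * norm (x - x0)"
proof -
  note hp = hitting_point_frontier[OF t x h]
  have "r0 * T \<le> integral {0..T} (\<lambda>s. r (y s) (u s))" using r_integral_ge[OF t, of 0 T] hp by simp
  moreover have "g x0 - g (y T) \<le> G * norm (x0 - y T)"
    by (rule order_trans[OF abs_ge_self g_lip]) (use hp x0 W in auto)
  moreover have "G * norm (x0 - y T) \<le> G * (norm (x - x0) + N * T)"
  proof (rule mult_left_mono[OF _ G_nonneg])
    have "norm (y T - x) \<le> N * T" using traj_lip[OF t, of 0 T] traj_arc(2)[OF t] hp by simp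
    then show "norm (x0 - y T) \<le> norm (x - x0) + N * T"
      using norm_triangle_ineq4[of "x - x0" "x - y T"] by (simp add: norm_minus_commute)
  qed
  ultimately show ?thesis by (simp add: algebra_simps)
qed

text \<open>Only the pairs (hitting time, hitting point) of a minimizing sequence are extracted;
  \<open>hitting_time_bound\<close> and the speed bound keep them in a compact set.\<close>

lemma limit_end_exists:
  assumes x: "x \<notin> S" and x0: "x0 \<in> frontier S"
  obtains T xs where "limit_end x T xs" "xs \<in> frontier S" "T \<ge> 0"
    "(r0 - G * N) * T \<le> V x - g x0 + G * norm (x - x0)" "norm (xs - x) \<le> N * T"
proof -
  define good where "good n u y T \<longleftrightarrow> traj x u y \<and> is_hitting_time S y T \<and> cost T u y < V x + 1 / real (Suc n)"
    for n u y T
  have "\<exists>u y T. good n u y T" for n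
  proof -
    have "1 / real (Suc n) > 0" by simp
    then obtain u y T where "traj x u y" "is_hitting_time S y T" "cost T u y < V x + 1 / real (Suc n)"
      by (rule V_approx)
    then show ?thesis unfolding good_def by blast
  qed
  then obtain u y \<tau> where "\<And>n. good n (u n) (y n) (\<tau> n)" by metis
  then have seq: "\<And>n. traj x (u n) (y n)" "\<And>n. is_hitting_time S (y n) (\<tau> n)"
    "\<And>n. cost (\<tau> n) (u n) (y n) < V x + 1 / real (Suc n)" unfolding good_def by blast+
  have \<kappa>: "r0 - G * N > 0" using G_small by simp
  have tb: "(r0 - G * N) * \<tau> n \<le> V x + 1 / real (Suc n) - g x0 + G * norm (x - x0)" for n
    using hitting_time_bound[OF seq(1)[of n] x seq(2)[of n] x0] seq(3)[of n] by simp
  have \<tau>0: "\<tau> n \<ge> 0" for n using seq(2)[of n] by (simp add: is_hitting_time_def)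
  define B where "B = (V x + 1 - g x0 + G * norm (x - x0)) / (r0 - G * N)"
  have \<tau>B: "\<tau> n \<le> B" for n
  proof -
    have "1 / real (Suc n) \<le> 1" by simp
    then have "(r0 - G * N) * \<tau> n \<le> V x + 1 - g x0 + G * norm (x - x0)" using tb[of n] by linarith
    then show ?thesis using \<kappa> by (simp add: B_def pos_le_divide_eq mult.commute)
  qed
  have yb: "norm (y n (\<tau> n) - x) \<le> N * \<tau> n" for n
    using traj_lip[OF seq(1)[of n], of 0 "\<tau> n"] traj_arc(2)[OF seq(1)[of n]] \<tau>0[of n] by simp
  have "compact ({0..B} \<times> cball x (N * B))" by (intro compact_Times compact_cball compact_Icc)
  moreover have "\<forall>n. (\<tau> n, y n (\<tau> n)) \<in> {0..B} \<times> cball x (N * B)"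
  proof
    fix n
    have "N * \<tau> n \<le> N * B" using \<tau>B[of n] N_pos by simp
    then show "(\<tau> n, y n (\<tau> n)) \<in> {0..B} \<times> cball x (N * B)"
      using yb[of n] \<tau>0[of n] \<tau>B[of n] by (simp add: dist_norm norm_minus_commute)
  qed
  ultimately obtain l s where l: "strict_mono s" "((\<lambda>n. (\<tau> n, y n (\<tau> n))) \<circ> s) \<longlonglongrightarrow> l"
    unfolding compact_def by meson
  obtain T xs where Txs: "l = (T, xs)" by (cases l)
  have l1: "(\<lambda>n. \<tau> (s n)) \<longlonglongrightarrow> T" using tendsto_fst[OF l(2)] Txs by (simp add: o_def)
  have l2: "(\<lambda>n. y (s n) (\<tau> (s n))) \<longlonglongrightarrow> xs" using tendsto_snd[OF l(2)] Txs by (simp add: o_def)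
  have l3: "(\<lambda>n. 1 / real (Suc (s n))) \<longlonglongrightarrow> 0"
    using LIMSEQ_subseq_LIMSEQ[OF LIMSEQ_inverse_real_of_nat l(1)] by (simp add: o_def inverse_eq_divide)
  show ?thesis
  proof (rule that)
    show "limit_end x T xs" unfolding limit_end_def
    proof (intro allI impI)
      fix \<kappa> :: real assume "\<kappa> > 0"
      have "\<forall>\<^sub>F n in sequentially. dist (\<tau> (s n)) T < \<kappa>" using l1 \<open>\<kappa> > 0\<close> by (rule tendstoD)
      moreover have "\<forall>\<^sub>F n in sequentially. dist (y (s n) (\<tau> (s n))) xs < \<kappa>" using l2 \<open>\<kappa> > 0\<close> by (rule tendstoD)
      moreover have "\<forall>\<^sub>F n in sequentially. dist (1 / real (Suc (s n))) 0 < \<kappa>" using l3 \<open>\<kappa> > 0\<close> by (rule tendstoD)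
      ultimately have "\<forall>\<^sub>F n in sequentially. near_opt \<kappa> x T xs (u (s n)) (y (s n)) (\<tau> (s n))"
      proof eventually_elim
        case (elim n)
        then show ?case using seq(1)[of "s n"] seq(2)[of "s n"] seq(3)[of "s n"]
          by (simp add: near_opt_def dist_norm)
      qed
      then show "\<exists>u y \<tau>. near_opt \<kappa> x T xs u y \<tau>"
        using eventually_happens'[OF sequentially_bot] by blast
    qed
    show "xs \<in> frontier S"
      by (rule closed_sequentially[OF frontier_closed _ l2]) (use hitting_point_frontier[OF seq(1) x seq(2)] in auto)
    show "T \<ge> 0" by (rule LIMSEQ_le_const[OF l1]) (use \<tau>0 in auto)
    show "(r0 - G * N) * T \<le> V x - g x0 + G * norm (x - x0)"
    proof (rule LIMSEQ_le)
      show "(\<lambda>n. (r0 - G * N) * \<tau> (s n)) \<longlonglongrightarrow> (r0 - G * N) * T" by (intro tendsto_intros l1)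
      show "(\<lambda>n. V x + 1 / real (Suc (s n)) - g x0 + G * norm (x - x0)) \<longlonglongrightarrow> V x - g x0 + G * norm (x - x0)"
        using tendsto_add[OF tendsto_diff[OF tendsto_add[OF tendsto_const[of "V x"] l3] tendsto_const[of "g x0"]]
          tendsto_const[of "G * norm (x - x0)"]] by simp
    qed (use tb in auto)
    show "norm (xs - x) \<le> N * T"
      by (rule LIMSEQ_le[OF tendsto_norm[OF tendsto_diff[OF l2 tendsto_const]] tendsto_mult[OF tendsto_const l1]])
        (use yb in auto)
  qed
qed

text \<open>If every velocity at \<open>xs\<close> had v-component at most -h < 0, then a time t
  before the exit a trajectory would be outside \<open>S\<close> at v-height about t h above
  \<open>xs\<close>, which the proximal inequality forbids: it allows only order t^2.\<close>

lemma normal_velocity_nonneg: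
  assumes le: "limit_end x T xs" and x: "x \<notin> S" and T: "T > 0" and M: "M \<ge> 1" and vM: "norm v \<le> M"
    and v: "\<And>p. p \<notin> S \<Longrightarrow> v \<bullet> (p - xs) \<le> M * (norm (p - xs))\<^sup>2"
  shows "\<exists>\<omega>\<in>U. 0 \<le> v \<bullet> f xs \<omega>"
proof (rule ccontr)
  assume neg: "\<not> ?thesis"
  have fc: "continuous_on U (f xs)"
    by (rule continuous_on_slice[OF f_cont])
  have "continuous_on U (\<lambda>\<omega>. v \<bullet> f xs \<omega>)" by (intro continuous_intros fc)
  then obtain \<omega>s where \<omega>s: "\<omega>s \<in> U" "\<And>\<omega>. \<omega> \<in> U \<Longrightarrow> v \<bullet> f xs \<omega> \<le> v \<bullet> f xs \<omega>s"
    using continuous_attains_sup[OF U_compact U_ne] by blast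
  define h where "h = - (v \<bullet> f xs \<omega>s)"
  have h: "h > 0" using neg \<omega>s(1) by (auto simp: h_def not_le)
  define c where "c = M + M * L * (N + 1) + M * (N + 1)\<^sup>2"
  have c: "c > 0" using M L_pos N_pos by (simp add: c_def add_pos_pos)
  \<comment> \<open>The near-optimality tolerance is taken as t^2, so that the end point error joins
    the other second-order errors in \<open>c\<close>; the last bound then turns h \<le> c t into h
    \<le> h / 2.\<close>
  define t where "t = min 1 (min (T / 2) (h / (2 * c)))"
  have t: "t \<le> 1" "2 * t \<le> T" "t \<le> h / (2 * c)" unfolding t_def by linarith+
  have "h / (2 * c) > 0" using h c by simp
  then have t0: "t > 0" using T by (simp add: t_def)
  note t = t0 t
  have t2: "t\<^sup>2 > 0" "t\<^sup>2 \<le> t" using t by (auto simp: power2_eq_square mult_left_le)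
  obtain u y \<tau> where no: "near_opt (t\<^sup>2) x T xs u y \<tau>" using le t2 unfolding limit_end_def by blast
  then have tr: "traj x u y" and hit: "is_hitting_time S y \<tau>" and \<tau>: "\<bar>\<tau> - T\<bar> \<le> t\<^sup>2" and yx: "norm (y \<tau> - xs) \<le> t\<^sup>2"
    by (auto simp: near_opt_def)
  have \<tau>t: "\<tau> \<ge> t" using \<tau> t2 t by linarith
  define p where "p = y (\<tau> - t)"
  have pS: "p \<notin> S"
  proof
    assume "p \<in> S"
    then have "\<tau> \<le> \<tau> - t" using hit \<tau>t unfolding is_hitting_time_def p_def by simp
    then show False using t by simp
  qed
  have near: "norm (y s - xs) \<le> (N + 1) * t" if "s \<in> {\<tau>-t..\<tau>}" for s
  proof -
    have "norm (y s - y \<tau>) \<le> N * \<bar>s - \<tau>\<bar>" by (rule traj_lip[OF tr]) (use that \<tau>t t in auto)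
    also have "\<dots> \<le> N * t" using that N_pos by (intro mult_left_mono) auto
    finally show ?thesis using norm_triangle_ineq[of "y s - y \<tau>" "y \<tau> - xs"] yx t2 by (simp add: algebra_simps)
  qed
  have "v \<bullet> (y \<tau> - p) \<le> (\<tau> - (\<tau> - t)) *\<^sub>R (- h + M * L * ((N + 1) * t))"
  proof (rule has_integral_le)
    show "((\<lambda>s. v \<bullet> f (y s) (u s)) has_integral v \<bullet> (y \<tau> - p)) {\<tau>-t..\<tau>}"
      unfolding p_def by (rule traj_inner_integral[OF tr]) (use \<tau>t t in auto)
    show "((\<lambda>s. - h + M * L * ((N + 1) * t)) has_integral (\<tau> - (\<tau> - t)) *\<^sub>R (- h + M * L * ((N + 1) * t))) {\<tau>-t..\<tau>}"
      using has_integral_const_real[of "- h + M * L * ((N + 1) * t)" "\<tau>-t" \<tau>] t by simp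
    fix s assume s: "s \<in> {\<tau>-t..\<tau>}"
    have Us: "u s \<in> U" using traj_in_U[OF tr] s \<tau>t by auto
    have "v \<bullet> f (y s) (u s) - v \<bullet> f xs (u s) \<le> M * L * norm (y s - xs)"
      using normal_velocity_lip[OF Us vM, of 0 "y s" xs] by simp
    also have "\<dots> \<le> M * L * ((N + 1) * t)" using near[OF s] M L_pos by (intro mult_left_mono) auto
    finally show "v \<bullet> f (y s) (u s) \<le> - h + M * L * ((N + 1) * t)" using \<omega>s(2)[OF Us] by (simp add: h_def)
  qed
  then have 1: "v \<bullet> (y \<tau> - p) \<le> - (t * h) + M * L * (N + 1) * t\<^sup>2" by (simp add: power2_eq_square algebra_simps)
  have "v \<bullet> (p - xs) \<le> M * (norm (p - xs))\<^sup>2" by (rule v[OF pS])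
  also have "\<dots> \<le> M * ((N + 1) * t)\<^sup>2"
    using near[of "\<tau> - t"] t M by (intro mult_left_mono power_mono) (auto simp: p_def)
  finally have 2: "v \<bullet> (p - xs) \<le> M * (N + 1)\<^sup>2 * t\<^sup>2" by (simp add: power_mult_distrib)
  have "- (v \<bullet> (y \<tau> - xs)) \<le> norm v * norm (y \<tau> - xs)" using Cauchy_Schwarz_ineq2[of v "y \<tau> - xs"] by linarith
  also have "\<dots> \<le> M * t\<^sup>2" using vM yx M by (intro mult_mono) auto
  finally have 3: "- (v \<bullet> (y \<tau> - xs)) \<le> M * t\<^sup>2" .
  have "v \<bullet> (y \<tau> - xs) = v \<bullet> (y \<tau> - p) + v \<bullet> (p - xs)" by (simp add: inner_diff_right)
  then have "t * h \<le> c * t\<^sup>2" using 1 2 3 by (simp add: c_def algebra_simps)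
  then have "h \<le> c * t" using t by (simp add: power2_eq_square)
  also have "\<dots> \<le> c * (h / (2 * c))" using t c by (intro mult_left_mono) auto
  also have "\<dots> = h / 2" using c by simp
  finally show False using h by simp
qed

end

section \<open>Proximal normals to the hypograph\<close>

text \<open>Proximal normals with their constant exposed: for fixed \<sigma> the inequality survives
  limits of base points and of normals, and any two normals at a point share the larger of their
  constants.\<close>

definition pnormal :: "'a::real_inner set \<Rightarrow> real \<Rightarrow> 'a \<Rightarrow> 'a set" where
  "pnormal Q \<sigma> x = {v. \<forall>y\<in>Q. v \<bullet> (y - x) \<le> \<sigma> * (norm (y - x))\<^sup>2}"

abbreviation hypograph :: "('a \<Rightarrow> real) \<Rightarrow> ('a \<times> real) set" where
  "hypograph V \<equiv> {(z, t). t \<le> V z}"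

lemma norm_Pair_power2: "(norm (a, b))\<^sup>2 = (norm a)\<^sup>2 + (norm b)\<^sup>2"
  by (simp add: norm_Pair)

lemma pnormal_hypograph_iff:
  "(q, \<mu>) \<in> pnormal (hypograph V) \<sigma> (x, V x) \<longleftrightarrow>
     (\<forall>z a. a \<le> V z - V x \<longrightarrow> q \<bullet> (z - x) + \<mu> * a \<le> \<sigma> * ((norm (z - x))\<^sup>2 + a\<^sup>2))" (is "?l \<longleftrightarrow> ?r")
proof
  assume l: ?l
  show ?r
  proof (intro allI impI)
    fix z a assume "a \<le> V z - V x"
    then have "(z, V x + a) \<in> hypograph V" by simp
    then have "(q, \<mu>) \<bullet> ((z, V x + a) - (x, V x)) \<le> \<sigma> * (norm ((z, V x + a) - (x, V x)))\<^sup>2"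
      using l unfolding pnormal_def by blast
    then show "q \<bullet> (z - x) + \<mu> * a \<le> \<sigma> * ((norm (z - x))\<^sup>2 + a\<^sup>2)" by (simp add: norm_Pair_power2)
  qed
next
  assume r: ?r
  show ?l unfolding pnormal_def
  proof (intro CollectI ballI)
    fix Y assume "Y \<in> hypograph V"
    then obtain z t where Y: "Y = (z, t)" "t \<le> V z" by auto
    then have "q \<bullet> (z - x) + \<mu> * (t - V x) \<le> \<sigma> * ((norm (z - x))\<^sup>2 + (t - V x)\<^sup>2)" using r by simp
    then show "(q, \<mu>) \<bullet> (Y - (x, V x)) \<le> \<sigma> * (norm (Y - (x, V x)))\<^sup>2" by (simp add: Y norm_Pair_power2)
  qed
qed

text \<open>The hypograph contains the vertical ray below \<open>(x, V x)\<close>; a test point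
  slightly below excludes a negative last component.\<close>

lemma pnormal_hypograph_nonneg:
  assumes "(q, \<mu>) \<in> pnormal (hypograph V) \<sigma> (x, V x)"
  shows "\<mu> \<ge> 0"
proof (rule ccontr)
  assume "\<not> \<mu> \<ge> 0"
  define s where "s = - \<mu> / (2 * (\<bar>\<sigma>\<bar> + 1))"
  have s: "s > 0" using \<open>\<not> \<mu> \<ge> 0\<close> by (auto simp: s_def intro!: divide_neg_pos)
  have "\<mu> * (- s) \<le> \<sigma> * (- s)\<^sup>2"
    using assms s unfolding pnormal_hypograph_iff by (auto dest!: spec[of _ x] spec[of _ "-s"])
  then have "(- \<mu>) * s \<le> (\<sigma> * s) * s" by (simp add: power2_eq_square)
  then have "- \<mu> \<le> \<sigma> * s" using s by (rule mult_right_le_imp_le)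
  also have "\<sigma> * s \<le> (\<bar>\<sigma>\<bar> + 1) * s" using s by (intro mult_right_mono) auto
  also have "\<dots> = - \<mu> / 2"
  proof -
    have "a * (m / (2 * a)) = m / 2" if "a > 0" for a m :: real using that by (simp add: field_simps)
    from this[of "\<bar>\<sigma>\<bar> + 1" "- \<mu>"] show ?thesis unfolding s_def by linarith
  qed
  finally show False using \<open>\<not> \<mu> \<ge> 0\<close> by simp
qed

text \<open>Read \<open>k\<close> as an increment of \<open>V\<close>, \<open>d\<close> as the
  distance between the two points, and \<open>X\<close> as the deviation from a linear function of
  slope at most \<open>B\<close>. Smallness of \<open>k\<close> absorbs the term k^2 into the left
  side, which leaves a lower bound for \<open>d\<close>: a deviation of slope \<open>e\<close>
  cannot occur arbitrarily near.\<close>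

lemma slope_bound:
  fixes \<mu> X \<sigma> d k B e :: real
  assumes ineq: "\<mu> * X \<le> \<sigma> * (d\<^sup>2 + k\<^sup>2)" and k: "\<bar>k\<bar> \<le> X + B * d" and X: "e * d \<le> X" and pos: "d > 0" "e > 0" "\<mu> > 0" "\<sigma> \<ge> 0" "B \<ge> 0"
    and small: "\<sigma> * \<bar>k\<bar> * (1 + B / e) \<le> \<mu> / 2"
  shows "e * \<mu> \<le> 2 * \<sigma> * d"
proof -
  have X0: "X \<ge> 0" using X pos by (meson mult_pos_pos less_imp_le order_trans)
  have "B * d = (B / e) * (e * d)" using pos by simp
  also have "\<dots> \<le> (B / e) * X" using X pos by (intro mult_left_mono) auto
  finally have k2: "\<bar>k\<bar> \<le> (1 + B / e) * X" using k by (simp add: distrib_right)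
  have "\<sigma> * k\<^sup>2 = (\<sigma> * \<bar>k\<bar>) * \<bar>k\<bar>" by (simp add: power2_eq_square)
  also have "\<dots> \<le> (\<sigma> * \<bar>k\<bar>) * ((1 + B / e) * X)" using pos k2 by (intro mult_left_mono) auto
  also have "\<dots> = (\<sigma> * \<bar>k\<bar> * (1 + B / e)) * X" by (simp add: mult.assoc)
  also have "\<dots> \<le> (\<mu> / 2) * X" using small X0 by (intro mult_right_mono)
  finally have "\<mu> * X / 2 \<le> \<sigma> * d\<^sup>2" using ineq by (simp add: distrib_left)
  moreover have "\<mu> * (e * d) \<le> \<mu> * X" using X pos by (intro mult_left_mono) auto
  ultimately have "(e * \<mu>) * d \<le> (2 * \<sigma> * d) * d" by (simp add: power2_eq_square algebra_simps)
  then show ?thesis using pos by simp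
qed

text \<open>If all proximal normals to the hypograph at \<open>x\<close> lie on one non-horizontal line, then, by
  compactness, nearby normals of uniform quality converge to it, which bounds \<open>V\<close> from below.\<close>

lemma hypograph_unique_normal_differentiable:
  fixes V :: "'a::euclidean_space \<Rightarrow> real"
  assumes cont: "continuous_on UNIV V"
    and n: "(q, \<mu>) \<in> pnormal (hypograph V) \<sigma> (x, V x)" and \<mu>: "\<mu> > 0"
    and unique: "\<And>P \<sigma>. P \<in> pnormal (hypograph V) \<sigma> (x, V x) \<Longrightarrow> \<exists>t. P = t *\<^sub>R (q, \<mu>)"
    and unif: "\<rho> > 0" "c > 0" "\<And>y. y \<in> ball x \<rho> \<Longrightarrow> \<exists>P\<in>pnormal (hypograph V) \<sigma>0 (y, V y). c \<le> norm P \<and> norm P \<le> B"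
  shows "V differentiable (at x)"
proof -
  define p where "p = - (1 / \<mu>) *\<^sub>R q"
  have \<mu>p: "\<mu> * (p \<bullet> h) = - (q \<bullet> h)" for h using \<mu> by (simp add: p_def)
  have contx: "isCont V x" using cont by (simp add: continuous_on_eq_continuous_at)
  have upper: "\<exists>d>0. \<forall>y. norm (y - x) < d \<longrightarrow> V y - V x - p \<bullet> (y - x) \<le> e * norm (y - x)" if e: "e > 0" for e
  proof -
    define \<sigma>1 where "\<sigma>1 = \<bar>\<sigma>\<bar> + 1"
    have \<sigma>1: "\<sigma>1 > 0" "\<sigma> \<le> \<sigma>1" by (auto simp: \<sigma>1_def)
    \<comment> \<open>The tolerance for the increment of \<open>V\<close> that meets the smallness
      hypothesis of \<open>slope_bound\<close> with equality.\<close>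
    define \<kappa> where "\<kappa> = \<mu> / (2 * \<sigma>1 * (1 + norm p / e))"
    have pe: "1 + norm p / e > 0" using e by (simp add: add_pos_nonneg)
    have \<kappa>: "\<kappa> > 0" using \<mu> \<sigma>1 pe by (simp add: \<kappa>_def)
    obtain d0 where d0: "d0 > 0" "\<And>y. dist y x < d0 \<Longrightarrow> dist (V y) (V x) < \<kappa>"
      using contx \<kappa> unfolding continuous_at_eps_delta by (auto simp: dist_norm)
    define d where "d = min d0 (e * \<mu> / (2 * \<sigma>1))"
    have "d > 0" using d0 e \<mu> \<sigma>1 by (simp add: d_def)
    moreover have "V y - V x - p \<bullet> (y - x) \<le> e * norm (y - x)" if y: "norm (y - x) < d" for y
    proof (rule ccontr)
      assume neg: "\<not> ?thesis"
      define k where "k = V y - V x"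
      define X where "X = k - p \<bullet> (y - x)"
      have yx: "y \<noteq> x" using neg by auto
      have k\<kappa>: "\<bar>k\<bar> < \<kappa>" using d0(2)[of y] y by (simp add: d_def k_def dist_norm)
      have "q \<bullet> (y - x) + \<mu> * k \<le> \<sigma> * ((norm (y - x))\<^sup>2 + k\<^sup>2)"
        using n unfolding pnormal_hypograph_iff by (simp add: k_def)
      also have "\<dots> \<le> \<sigma>1 * ((norm (y - x))\<^sup>2 + k\<^sup>2)" using \<sigma>1 by (intro mult_right_mono) auto
      finally have 1: "\<mu> * X \<le> \<sigma>1 * ((norm (y - x))\<^sup>2 + k\<^sup>2)" by (simp add: X_def right_diff_distrib \<mu>p)
      have pyx: "\<bar>p \<bullet> (y - x)\<bar> \<le> norm p * norm (y - x)" by (rule Cauchy_Schwarz_ineq2)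
      have X: "e * norm (y - x) < X" using neg by (simp add: X_def k_def)
      then have "X \<ge> 0" using e by (smt (verit) mult_nonneg_nonneg norm_ge_zero)
      then have 2: "\<bar>k\<bar> \<le> X + norm p * norm (y - x)" using pyx by (simp add: X_def abs_if split: if_splits)
      have "\<sigma>1 * \<bar>k\<bar> * (1 + norm p / e) \<le> \<sigma>1 * \<kappa> * (1 + norm p / e)"
        using k\<kappa> \<sigma>1 pe by (intro mult_right_mono mult_left_mono) auto
      also have "\<dots> = \<mu> / 2"
      proof -
        have "a * (m / (2 * a * b)) * b = m / 2" if "a > 0" "b > 0" for a b m :: real
          using that by (simp add: field_simps)
        then show ?thesis unfolding \<kappa>_def using \<sigma>1(1) pe by blast
      qed
      finally have "e * \<mu> \<le> 2 * \<sigma>1 * norm (y - x)"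
        by (intro slope_bound[OF 1 2]) (use X yx e \<mu> \<sigma>1 in auto)
      moreover have "norm (y - x) < e * \<mu> / (2 * \<sigma>1)" using y by (simp add: d_def)
      ultimately show False using \<sigma>1 by (simp add: field_simps)
    qed
    ultimately show ?thesis by blast
  qed
  \<comment> \<open>The normal at \<open>x\<close> bounds \<open>V\<close> only from above. Here the
    roles are exchanged: the normal based at a nearby bad point \<open>y n\<close> is tested at
    \<open>x\<close>, and its slope \<open>pn n\<close> converges to \<open>p\<close>.\<close>
  have lower: "\<exists>d>0. \<forall>y. norm (y - x) < d \<longrightarrow> - (V y - V x - p \<bullet> (y - x)) \<le> e * norm (y - x)" if e: "e > 0" for e
  proof (rule ccontr)
    assume neg: "\<not> ?thesis"
    have "\<exists>y. norm (y - x) < min \<rho> (1 / real (Suc n)) \<and> \<not> - (V y - V x - p \<bullet> (y - x)) \<le> e * norm (y - x)" for n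
    proof -
      have "min \<rho> (1 / real (Suc n)) > 0" using unif by simp
      then show ?thesis using neg by blast
    qed
    then obtain y where y: "\<And>n. norm (y n - x) < min \<rho> (1 / real (Suc n))"
      "\<And>n. \<not> - (V (y n) - V x - p \<bullet> (y n - x)) \<le> e * norm (y n - x)" by metis
    have "\<exists>P\<in>pnormal (hypograph V) \<sigma>0 (y n, V (y n)). c \<le> norm P \<and> norm P \<le> B" for n
      by (rule unif(3)) (use y(1)[of n] in \<open>simp add: dist_norm norm_minus_commute\<close>)
    then obtain P where P: "\<And>n. P n \<in> pnormal (hypograph V) \<sigma>0 (y n, V (y n))" "\<And>n. c \<le> norm (P n)" "\<And>n. norm (P n) \<le> B"
      by metis
    have "compact (cball (0::'a \<times> real) B)" by simp
    moreover have "\<forall>n. P n \<in> cball 0 B" using P(3) by simp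
    ultimately obtain l s where s: "strict_mono s" "(P \<circ> s) \<longlonglongrightarrow> l" unfolding compact_def by meson
    have yx: "y \<longlonglongrightarrow> x"
    proof (rule Lim_null_comparison[THEN Lim_null[THEN iffD2]])
      show "\<forall>\<^sub>F n in sequentially. norm (y n - x) \<le> 1 / real (Suc n)"
        using y(1) by (intro always_eventually) (auto simp: less_imp_le)
      show "(\<lambda>n. 1 / real (Suc n)) \<longlonglongrightarrow> 0" using LIMSEQ_inverse_real_of_nat by (simp add: inverse_eq_divide)
    qed
    have ysx: "(\<lambda>n. y (s n)) \<longlonglongrightarrow> x" using LIMSEQ_subseq_LIMSEQ[OF yx s(1)] by (simp add: o_def)
    have Vsx: "(\<lambda>n. V (y (s n))) \<longlonglongrightarrow> V x" by (rule isCont_tendsto_compose[OF contx ysx])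
    have Pl: "(\<lambda>n. P (s n)) \<longlonglongrightarrow> l" using s(2) by (simp add: o_def)
    have "l \<in> pnormal (hypograph V) \<sigma>0 (x, V x)"
      unfolding pnormal_def
    proof (intro CollectI ballI)
      fix Y assume "Y \<in> hypograph V"
      then have "P (s n) \<bullet> (Y - (y (s n), V (y (s n)))) \<le> \<sigma>0 * (norm (Y - (y (s n), V (y (s n)))))\<^sup>2" for n
        using P(1)[of "s n"] unfolding pnormal_def by blast
      moreover have "(\<lambda>n. P (s n) \<bullet> (Y - (y (s n), V (y (s n))))) \<longlonglongrightarrow> l \<bullet> (Y - (x, V x))"
        by (intro tendsto_intros Pl ysx Vsx)
      moreover have "(\<lambda>n. \<sigma>0 * (norm (Y - (y (s n), V (y (s n)))))\<^sup>2) \<longlonglongrightarrow> \<sigma>0 * (norm (Y - (x, V x)))\<^sup>2"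
        by (intro tendsto_intros ysx Vsx)
      ultimately show "l \<bullet> (Y - (x, V x)) \<le> \<sigma>0 * (norm (Y - (x, V x)))\<^sup>2"
        by (blast intro: LIMSEQ_le)
    qed
    with unique obtain t where t: "l = t *\<^sub>R (q, \<mu>)" by blast
    \<comment> \<open>The lower bound on lengths rules out the zero limit; the sign of the last
      component then gives t > 0, so the limit normal is not horizontal either.\<close>
    have "c \<le> norm l" by (rule LIMSEQ_le_const[OF tendsto_norm[OF Pl]]) (use P(2) in auto)
    then have "t \<noteq> 0" using unif(2) t by auto
    moreover have "t * \<mu> \<ge> 0"
      using pnormal_hypograph_nonneg[of "t *\<^sub>R q" "t * \<mu>" V \<sigma>0 x] \<open>l \<in> _\<close> t by simp
    ultimately have tpos: "t > 0" using \<mu> by (simp add: zero_le_mult_iff)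
    define qn where "qn = (\<lambda>n. fst (P (s n)))"
    define \<mu>n where "\<mu>n = (\<lambda>n. snd (P (s n)))"
    have qn: "qn \<longlonglongrightarrow> t *\<^sub>R q" using tendsto_fst[OF Pl] t by (simp add: qn_def)
    have \<mu>n: "\<mu>n \<longlonglongrightarrow> t * \<mu>" using tendsto_snd[OF Pl] t by (simp add: \<mu>n_def)
    define pn where "pn = (\<lambda>n. - (1 / \<mu>n n) *\<^sub>R qn n)"
    have t\<mu>: "t * \<mu> > 0" using tpos \<mu> by simp
    have "pn \<longlonglongrightarrow> - (1 / (t * \<mu>)) *\<^sub>R (t *\<^sub>R q)"
      unfolding pn_def by (intro tendsto_intros qn \<mu>n) (use t\<mu> in auto)
    also have "- (1 / (t * \<mu>)) *\<^sub>R (t *\<^sub>R q) = p" using tpos by (simp add: p_def)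
    finally have pn: "pn \<longlonglongrightarrow> p" .
    define h where "h = (\<lambda>n. V x - V (y (s n)))"
    define d where "d = (\<lambda>n. norm (y (s n) - x))"
    define \<sigma>1 where "\<sigma>1 = \<bar>\<sigma>0\<bar> + 1"
    have \<sigma>1: "\<sigma>1 > 0" "\<sigma>0 \<le> \<sigma>1" by (auto simp: \<sigma>1_def)
    have h0: "h \<longlonglongrightarrow> 0" unfolding h_def using tendsto_diff[OF tendsto_const[of "V x"] Vsx] by simp
    have d0: "d \<longlonglongrightarrow> 0" unfolding d_def using tendsto_norm[OF tendsto_diff[OF ysx tendsto_const[of x]]] by simp
    have "\<forall>\<^sub>F n in sequentially. dist (pn n) p < e / 2" using pn e by (intro tendstoD) auto
    moreover have "\<forall>\<^sub>F n in sequentially. \<mu>n n > t * \<mu> / 2"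
      by (rule order_tendstoD(1)[OF \<mu>n]) (use t\<mu> in linarith)
    moreover have "\<forall>\<^sub>F n in sequentially. \<sigma>1 * \<bar>h n\<bar> * (1 + (norm p + e / 2) / (e / 2)) < t * \<mu> / 4"
    proof (rule order_tendstoD(2))
      show "(\<lambda>n. \<sigma>1 * \<bar>h n\<bar> * (1 + (norm p + e / 2) / (e / 2))) \<longlonglongrightarrow> \<sigma>1 * \<bar>0\<bar> * (1 + (norm p + e / 2) / (e / 2))"
        by (intro tendsto_intros h0)
    qed (use t\<mu> in simp)
    moreover have "\<forall>\<^sub>F n in sequentially. 2 * \<sigma>1 * d n < (e / 2) * (t * \<mu> / 2)"
    proof (rule order_tendstoD(2))
      show "(\<lambda>n. 2 * \<sigma>1 * d n) \<longlonglongrightarrow> 2 * \<sigma>1 * 0" by (intro tendsto_intros d0)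
    qed (use t\<mu> e in simp)
    ultimately have "\<forall>\<^sub>F n in sequentially. False"
    proof eventually_elim
      case (elim n)
      let ?y = "y (s n)"
      have \<mu>npos: "\<mu>n n > 0" using elim t\<mu> by linarith
      have dpos: "d n > 0"
      proof -
        have "?y \<noteq> x" using y(2)[of "s n"] by auto
        then show ?thesis by (simp add: d_def)
      qed
      define X where "X = h n + pn n \<bullet> (?y - x)"
      have "(qn n, \<mu>n n) \<in> pnormal (hypograph V) \<sigma>0 (?y, V ?y)" using P(1)[of "s n"] by (simp add: qn_def \<mu>n_def)
      then have "qn n \<bullet> (x - ?y) + \<mu>n n * h n \<le> \<sigma>0 * ((norm (x - ?y))\<^sup>2 + (h n)\<^sup>2)"
        unfolding pnormal_hypograph_iff by (simp add: h_def)
      also have "\<dots> \<le> \<sigma>1 * ((d n)\<^sup>2 + (h n)\<^sup>2)" using \<sigma>1 unfolding d_def norm_minus_commute[of x]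
        by (intro mult_right_mono) auto
      also have "qn n \<bullet> (x - ?y) + \<mu>n n * h n = \<mu>n n * X"
      proof -
        have "\<mu>n n * (pn n \<bullet> (?y - x)) = - (qn n \<bullet> (?y - x))" using \<mu>npos by (simp add: pn_def)
        then show ?thesis by (simp add: X_def distrib_left inner_diff_right)
      qed
      finally have 1: "\<mu>n n * X \<le> \<sigma>1 * ((d n)\<^sup>2 + (h n)\<^sup>2)" .
      have pd: "norm (pn n - p) \<le> e / 2" using elim by (simp add: dist_norm)
      have "\<bar>(pn n - p) \<bullet> (?y - x)\<bar> \<le> norm (pn n - p) * d n" unfolding d_def by (rule Cauchy_Schwarz_ineq2)
      also have "\<dots> \<le> (e / 2) * d n" using pd dpos by (intro mult_right_mono) auto
      finally have "h n + p \<bullet> (?y - x) \<le> X + (e / 2) * d n"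
        unfolding X_def inner_diff_left[of "pn n" p] by linarith
      moreover have "h n + p \<bullet> (?y - x) > e * d n" using y(2)[of "s n"] by (simp add: h_def d_def)
      ultimately have X: "(e / 2) * d n \<le> X" by (simp add: field_simps)
      have pnB: "norm (pn n) \<le> norm p + e / 2" using pd norm_triangle_sub[of "pn n" p] by linarith
      have "\<bar>pn n \<bullet> (?y - x)\<bar> \<le> norm (pn n) * d n" unfolding d_def by (rule Cauchy_Schwarz_ineq2)
      also have "\<dots> \<le> (norm p + e / 2) * d n" using pnB dpos by (intro mult_right_mono) auto
      finally have "\<bar>pn n \<bullet> (?y - x)\<bar> \<le> (norm p + e / 2) * d n" .
      moreover have "X \<ge> 0" using X dpos e by (meson half_gt_zero less_imp_le mult_pos_pos order_trans)
      ultimately have 2: "\<bar>h n\<bar> \<le> X + (norm p + e / 2) * d n" unfolding X_def by (simp add: abs_if split: if_splits)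
      have small: "\<sigma>1 * \<bar>h n\<bar> * (1 + (norm p + e / 2) / (e / 2)) \<le> \<mu>n n / 2" using elim(2,3) by linarith
      have "(e / 2) * \<mu>n n \<le> 2 * \<sigma>1 * d n"
        by (rule slope_bound[OF 1 2 X dpos _ \<mu>npos _ _ small]) (use \<sigma>1 e in auto)
      moreover have "(e / 2) * (t * \<mu> / 2) \<le> (e / 2) * \<mu>n n" using elim e by (intro mult_left_mono) auto
      ultimately show False using elim by linarith
    qed
    then show False by simp
  qed
  have "(V has_derivative (\<lambda>h. p \<bullet> h)) (at x)"
    unfolding has_derivative_at_alt
  proof (intro conjI allI impI)
    show "bounded_linear ((\<bullet>) p)" by (rule bounded_linear_inner_right)
    fix e :: real assume e: "e > 0"
    obtain d1 d2 where d: "d1 > 0" "d2 > 0"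
      "\<And>y. norm (y - x) < d1 \<Longrightarrow> V y - V x - p \<bullet> (y - x) \<le> e * norm (y - x)"
      "\<And>y. norm (y - x) < d2 \<Longrightarrow> - (V y - V x - p \<bullet> (y - x)) \<le> e * norm (y - x)"
      using upper[OF e] lower[OF e] by blast
    show "\<exists>d>0. \<forall>y. norm (y - x) < d \<longrightarrow> norm (V y - V x - p \<bullet> (y - x)) \<le> e * norm (y - x)"
    proof (intro exI[of _ "min d1 d2"] conjI allI impI)
      fix y assume "norm (y - x) < min d1 d2"
      then show "norm (V y - V x - p \<bullet> (y - x)) \<le> e * norm (y - x)"
        using d(3)[of y] d(4)[of y] by (simp add: abs_le_iff)
    qed (use d in simp)
  qed
  then show ?thesis by (auto simp: differentiable_def)
qed

section \<open>Transport of terminal normals to the initial point\<close>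

context exit_problem
begin

text \<open>Each near-optimal trajectory carries an adjoint arc whose initial covector is almost a
  normal at \<open>(x, V x)\<close> by \<open>value_upper_estimate\<close>; a limit of these
  covectors is a true normal. The bound on the terminal covector says that the normal cannot
  degenerate.\<close>

lemma limit_normal:
  assumes M: "M \<ge> 1"
  obtains \<sigma> where "\<sigma> > 0"
    "\<And>x T xs v \<zeta> \<mu>. limit_end x T xs \<Longrightarrow> x \<notin> S \<Longrightarrow> ball x (1 / M) \<inter> S = {} \<Longrightarrow> 1 / M \<le> T \<Longrightarrow> T \<le> M \<Longrightarrow>
      terminal_data M xs v \<zeta> \<mu> \<Longrightarrow>
      \<exists>q. norm q \<le> \<sigma> \<and> norm ((1 - \<mu>) *\<^sub>R v - \<mu> *\<^sub>R \<zeta>) \<le> \<sigma> * (norm q + \<mu>) \<and> (q, \<mu>) \<in> pnormal (hypograph V) \<sigma> (x, V x)"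
proof -
  \<comment> \<open>Room for the hitting times, which are known only to lie within 1 of
    \<open>T\<close>.\<close>
  define M' where "M' = M + 1"
  have M': "M' \<ge> 1" "M \<le> M'" using M by (auto simp: M'_def)
  obtain C \<rho> where C: "C > 0" "\<rho> > 0" and est:
    "\<And>x u y T \<mu> q xs v \<zeta> z a \<eta>. traj x u y \<Longrightarrow> 0 < T \<Longrightarrow> T \<le> M' \<Longrightarrow> terminal_data M' xs v \<zeta> \<mu> \<Longrightarrow>
      adjoint_arc \<mu> T u y q \<Longrightarrow> q T = (1 - \<mu>) *\<^sub>R v - \<mu> *\<^sub>R \<zeta> \<Longrightarrow> norm (y T - xs) \<le> \<eta> \<Longrightarrow> z \<notin> S \<Longrightarrow>
      (norm (z - x))\<^sup>2 + a\<^sup>2 + \<eta> \<le> \<rho> \<Longrightarrow> C * sqrt ((norm (z - x))\<^sup>2 + a\<^sup>2 + \<eta>) \<le> T \<Longrightarrow>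
      C * ((norm (z - x))\<^sup>2 + a\<^sup>2 + \<eta>) < q 0 \<bullet> (z - x) + \<mu> * a \<Longrightarrow>
      V z \<le> cost T u y + a"
    by (rule value_upper_estimate[OF M'(1)]) (rule that)
  define A where "A = exp (L * M')"
  have A: "A \<ge> 1" using M' L_pos by (simp add: A_def)
  define Qb where "Qb = (M + G + L * M') * A"
  have Qb: "Qb \<ge> 0" using M M' A G_nonneg L_pos by (simp add: Qb_def)
  \<comment> \<open>Below this distance the test point avoids \<open>S\<close>, the estimate is in
    its range \<rho>, and the time condition holds with room for the vanishing errors.\<close>
  define s0 where "s0 = min (1 / M) (min (sqrt \<rho>) (1 / (C * M)))"
  have s0: "s0 > 0" "s0 \<le> 1 / M" "s0 \<le> sqrt \<rho>" "s0 \<le> 1 / (C * M)" using M C by (auto simp: s0_def)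
  define \<sigma> where "\<sigma> = C + (Qb + 1) / s0 + Qb + A * (1 + L * M')"
  have \<sigma>parts: "(Qb + 1) / s0 \<ge> 0" "A * (1 + L * M') \<ge> 0" using Qb s0 A L_pos M' by auto
  have \<sigma>: "\<sigma> > 0" "C \<le> \<sigma>" "(Qb + 1) / s0 \<le> \<sigma>" "Qb \<le> \<sigma>" "A * (1 + L * M') \<le> \<sigma>"
    using \<sigma>parts C Qb unfolding \<sigma>_def by linarith+
  show ?thesis
  proof (rule that[OF \<sigma>(1)])
    fix x T xs v \<zeta> \<mu>
    assume le: "limit_end x T xs" and x: "x \<notin> S" and bx: "ball x (1 / M) \<inter> S = {}" and T: "1 / M \<le> T" "T \<le> M"
      and td: "terminal_data M xs v \<zeta> \<mu>"
    define w where "w = (1 - \<mu>) *\<^sub>R v - \<mu> *\<^sub>R \<zeta>"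
    have \<mu>: "0 \<le> \<mu>" "\<mu> \<le> 1" using td by (auto simp: terminal_data_def)
    have td': "terminal_data M' xs v \<zeta> \<mu>" by (rule terminal_data_mono[OF td M M'(2)])
    have nw: "norm w \<le> M + G"
    proof -
      have "norm w \<le> norm ((1 - \<mu>) *\<^sub>R v) + norm (\<mu> *\<^sub>R \<zeta>)" unfolding w_def by (rule norm_triangle_ineq4)
      moreover have "(1 - \<mu>) * norm v \<le> norm v" "\<mu> * norm \<zeta> \<le> norm \<zeta>" using \<mu> by (auto intro!: mult_left_le_one_le)
      ultimately show ?thesis using td \<mu> by (simp add: terminal_data_def)
    qed
    define \<kappa> where "\<kappa> n = 1 / real (Suc n)" for n
    have \<kappa>: "\<kappa> n > 0" "\<kappa> n \<le> 1" for n by (auto simp: \<kappa>_def)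
    have \<kappa>lim: "\<kappa> \<longlonglongrightarrow> 0" unfolding \<kappa>_def using LIMSEQ_inverse_real_of_nat by (simp add: inverse_eq_divide)
    have "\<exists>u y \<tau> q. near_opt (\<kappa> n) x T xs u y \<tau> \<and> adjoint_arc \<mu> \<tau> u y q \<and> q \<tau> = w" for n
    proof -
      obtain u y \<tau> where 1: "near_opt (\<kappa> n) x T xs u y \<tau>" using le \<kappa>(1)[of n] unfolding limit_end_def by blast
      then have "traj x u y" "\<tau> \<ge> 0" by (auto simp: near_opt_def is_hitting_time_def)
      from adjoint_exists[OF this \<mu>, of w] 1 show ?thesis by blast
    qed
    then obtain u y \<tau> q where no: "\<And>n. near_opt (\<kappa> n) x T xs (u n) (y n) (\<tau> n)"
      and q: "\<And>n. adjoint_arc \<mu> (\<tau> n) (u n) (y n) (q n)" "\<And>n. q n (\<tau> n) = w" by metis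
    have tr: "traj x (u n) (y n)" and hit: "is_hitting_time S (y n) (\<tau> n)" and \<tau>\<kappa>: "\<bar>\<tau> n - T\<bar> \<le> \<kappa> n"
      and yx: "norm (y n (\<tau> n) - xs) \<le> \<kappa> n" and cst: "cost (\<tau> n) (u n) (y n) \<le> V x + \<kappa> n" for n
      using no[of n] by (auto simp: near_opt_def)
    have \<tau>: "0 < \<tau> n" "\<tau> n \<le> M'" for n
      using hitting_point_frontier[OF tr[of n] x hit] \<tau>\<kappa>[of n] T \<kappa>[of n] by (auto simp: M'_def)
    have expA: "exp (L * \<tau> n) \<le> A" for n using \<tau>[of n] L_pos by (simp add: A_def)
    have \<mu>LT: "\<mu> * L * \<tau> n \<le> \<mu> * (L * M')" for n using \<tau>[of n] L_pos \<mu> by (simp add: mult.assoc mult_left_mono)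
    have \<mu>LM: "\<mu> * (L * M') \<le> L * M'" using \<mu> L_pos M' by (intro mult_left_le_one_le) auto
    have qb: "norm (q n 0) \<le> Qb" for n
    proof -
      have "norm (q n 0) \<le> (norm (q n (\<tau> n)) + \<mu> * L * \<tau> n) * exp (L * \<tau> n)"
        by (rule adjoint_bounds(1)[OF q(1) \<mu>(1) tr]) (use \<tau>[of n] in auto)
      also have "\<dots> \<le> (M + G + L * M') * A"
        by (rule mult_mono[OF add_mono[OF _ order_trans[OF \<mu>LT \<mu>LM]] expA])
          (use nw q(2)[of n] M M' G_nonneg L_pos in auto)
      finally show ?thesis by (simp add: Qb_def)
    qed
    \<comment> \<open>Nontriviality comes from the second bound of \<open>adjoint_bounds\<close> and
      survives the passage to the limit.\<close>
    have wb: "norm w \<le> \<sigma> * (norm (q n 0) + \<mu>)" for n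
    proof -
      have "norm w \<le> (norm (q n 0) + \<mu> * L * \<tau> n) * exp (L * \<tau> n)"
        using adjoint_bounds(2)[OF q(1)[of n] \<mu>(1) tr[of n], of 0] \<tau>[of n] q(2)[of n] by auto
      also have "\<dots> \<le> ((1 + L * M') * (norm (q n 0) + \<mu>)) * A"
      proof (rule mult_mono[OF _ expA])
        have "(1 + L * M') * (norm (q n 0) + \<mu>) = norm (q n 0) + \<mu> * (L * M') + (L * M' * norm (q n 0) + \<mu>)"
          by (simp add: algebra_simps)
        moreover have "L * M' * norm (q n 0) + \<mu> \<ge> 0" using L_pos M' \<mu> by simp
        ultimately show "norm (q n 0) + \<mu> * L * \<tau> n \<le> (1 + L * M') * (norm (q n 0) + \<mu>)" using \<mu>LT[of n] by linarith
      qed (use L_pos M' \<mu> in auto)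
      also have "\<dots> = (A * (1 + L * M')) * (norm (q n 0) + \<mu>)" by (simp add: algebra_simps)
      also have "\<dots> \<le> \<sigma> * (norm (q n 0) + \<mu>)" using \<sigma>(5) \<mu> by (intro mult_right_mono) auto
      finally show ?thesis .
    qed
    have "compact (cball (0::real^'d) Qb)" by simp
    moreover have "\<forall>n. q n 0 \<in> cball 0 Qb" using qb by simp
    ultimately obtain ql s where s: "strict_mono s" "((\<lambda>n. q n 0) \<circ> s) \<longlonglongrightarrow> ql" unfolding compact_def by meson
    have ql: "(\<lambda>n. q (s n) 0) \<longlonglongrightarrow> ql" using s(2) by (simp add: o_def)
    have \<kappa>s: "(\<lambda>n. \<kappa> (s n)) \<longlonglongrightarrow> 0" using LIMSEQ_subseq_LIMSEQ[OF \<kappa>lim s(1)] by (simp add: o_def)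
    have nql: "norm ql \<le> Qb" by (rule LIMSEQ_le_const2[OF tendsto_norm[OF ql]]) (use qb in auto)
    have "norm w \<le> \<sigma> * (norm ql + \<mu>)"
      by (rule LIMSEQ_le_const[OF tendsto_mult[OF tendsto_const tendsto_add[OF tendsto_norm[OF ql] tendsto_const]]])
         (use wb in auto)
    moreover have "(ql, \<mu>) \<in> pnormal (hypograph V) \<sigma> (x, V x)"
      unfolding pnormal_hypograph_iff
    proof (intro allI impI)
      fix z a assume a: "a \<le> V z - V x"
      define D where "D = (norm (z - x))\<^sup>2 + a\<^sup>2"
      have D0: "D \<ge> 0" by (simp add: D_def)
      show "ql \<bullet> (z - x) + \<mu> * a \<le> \<sigma> * ((norm (z - x))\<^sup>2 + a\<^sup>2)"
      proof (cases "sqrt D < s0")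
        case True
        have "norm (z - x) \<le> sqrt D" by (rule real_le_rsqrt) (simp add: D_def)
        then have "z \<in> ball x (1 / M)" using True s0 by (simp add: dist_norm norm_minus_commute)
        then have z: "z \<notin> S" using bx by blast
        have "sqrt D < sqrt \<rho>" using True s0 by linarith
        then have D\<rho>: "D < \<rho>" by simp
        have CD: "C * sqrt D < T"
        proof -
          have "C * sqrt D < C * (1 / (C * M))" using True s0 C by (intro mult_strict_left_mono) auto
          also have "\<dots> = 1 / M" using C by simp
          finally show ?thesis using T by linarith
        qed
        have "ql \<bullet> (z - x) + \<mu> * a \<le> C * D"
        proof (rule ccontr)
          assume "\<not> ?thesis"
          then have big: "C * D < ql \<bullet> (z - x) + \<mu> * a" by simp
          \<comment> \<open>The trajectory costs at most V x + \<kappa>, so lowering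
            \<open>a\<close> by twice the tolerance turns the estimate into V z < V x + a, a
            contradiction.\<close>
          define an where "an n = a - 2 * \<kappa> (s n)" for n
          define Dn where "Dn n = (norm (z - x))\<^sup>2 + (an n)\<^sup>2 + \<kappa> (s n)" for n
          have an: "an \<longlonglongrightarrow> a"
            unfolding an_def using tendsto_diff[OF tendsto_const[of a] tendsto_mult[OF tendsto_const[of 2] \<kappa>s]] by simp
          have Dn: "Dn \<longlonglongrightarrow> D"
            unfolding Dn_def D_def
            using tendsto_add[OF tendsto_add[OF tendsto_const[of "(norm (z - x))\<^sup>2"] tendsto_power[OF an, of 2]] \<kappa>s] by simp
          have "\<forall>\<^sub>F n in sequentially. Dn n < \<rho>" by (rule order_tendstoD(2)[OF Dn D\<rho>])
          moreover have "\<forall>\<^sub>F n in sequentially. C * sqrt (Dn n) + \<kappa> (s n) < T"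
          proof (rule order_tendstoD(2))
            show "(\<lambda>n. C * sqrt (Dn n) + \<kappa> (s n)) \<longlonglongrightarrow> C * sqrt D + 0" by (intro tendsto_intros Dn \<kappa>s)
          qed (use CD in simp)
          moreover have "\<forall>\<^sub>F n in sequentially. 0 < q (s n) 0 \<bullet> (z - x) + \<mu> * an n - C * Dn n"
          proof (rule order_tendstoD(1))
            show "(\<lambda>n. q (s n) 0 \<bullet> (z - x) + \<mu> * an n - C * Dn n) \<longlonglongrightarrow> ql \<bullet> (z - x) + \<mu> * a - C * D"
              by (intro tendsto_intros ql an Dn)
          qed (use big in simp)
          ultimately have "\<forall>\<^sub>F n in sequentially. False"
          proof eventually_elim
            case (elim n)
            have "V z \<le> cost (\<tau> (s n)) (u (s n)) (y (s n)) + an n"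
            proof (rule est[OF tr \<tau> td' q(1) _ yx z])
              show "q (s n) (\<tau> (s n)) = (1 - \<mu>) *\<^sub>R v - \<mu> *\<^sub>R \<zeta>" using q(2) by (simp add: w_def)
              show "C * sqrt ((norm (z - x))\<^sup>2 + (an n)\<^sup>2 + \<kappa> (s n)) \<le> \<tau> (s n)"
                using elim \<tau>\<kappa>[of "s n"] by (simp add: Dn_def abs_le_iff)
            qed (use elim in \<open>auto simp: Dn_def\<close>)
            then show False using cst[of "s n"] a \<kappa>(1)[of "s n"] by (simp add: an_def)
          qed
          then show False by simp
        qed
        also have "\<dots> \<le> \<sigma> * D" using \<sigma>(2) D0 by (intro mult_right_mono) auto
        finally show ?thesis by (simp add: D_def)
      next
        case False
        \<comment> \<open>Far from the base point the inequality is trivial: there the linear left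
          side is at most a multiple of D / s0. This makes the local inequality a global
          one.\<close>
        have nz: "norm (z - x) \<le> sqrt D" "\<bar>a\<bar> \<le> sqrt D" by (rule real_le_rsqrt, simp add: D_def)+
        have "ql \<bullet> (z - x) \<le> norm ql * norm (z - x)" by (rule norm_cauchy_schwarz)
        also have "\<dots> \<le> Qb * sqrt D" using nql nz Qb by (intro mult_mono) auto
        finally have 1: "ql \<bullet> (z - x) \<le> Qb * sqrt D" .
        have "\<mu> * a \<le> \<mu> * \<bar>a\<bar>" using \<mu> by (intro mult_left_mono) auto
        also have "\<dots> \<le> \<bar>a\<bar>" using \<mu> by (intro mult_left_le_one_le) auto
        finally have "ql \<bullet> (z - x) + \<mu> * a \<le> (Qb + 1) * sqrt D" using 1 nz by (simp add: algebra_simps)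
        also have "\<dots> \<le> (Qb + 1) * (sqrt D * (sqrt D / s0))"
        proof (rule mult_left_mono)
          have "1 \<le> sqrt D / s0" using False s0(1) by (simp add: pos_le_divide_eq)
          then have "sqrt D * 1 \<le> sqrt D * (sqrt D / s0)" using D0 by (intro mult_left_mono) auto
          then show "sqrt D \<le> sqrt D * (sqrt D / s0)" by simp
        qed (use Qb in simp)
        also have "\<dots> = ((Qb + 1) / s0) * D" using D0 by (simp add: real_sqrt_mult_self)
        also have "\<dots> \<le> \<sigma> * D" using \<sigma>(3) D0 by (intro mult_right_mono) auto
        finally show ?thesis by (simp add: D_def)
      qed
    qed
    ultimately show "\<exists>q. norm q \<le> \<sigma> \<and> norm ((1 - \<mu>) *\<^sub>R v - \<mu> *\<^sub>R \<zeta>) \<le> \<sigma> * (norm q + \<mu>) \<and> (q, \<mu>) \<in> pnormal (hypograph V) \<sigma> (x, V x)"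
      using nql \<sigma>(4) unfolding w_def by (intro exI[of _ ql]) auto
  qed
qed

end

section \<open>Approximate solutions and uniform Lipschitz constants\<close>

text \<open>The defect is small only in mean, which is all that near-optimality gives. The initial
  value is exact and the final one approximate because arcs will be compared backwards from their
  ends.\<close>

definition approx_arc :: "('e::euclidean_space \<Rightarrow> 'e) \<Rightarrow> 'e set \<Rightarrow> real \<Rightarrow> real \<Rightarrow> 'e \<Rightarrow> 'e \<Rightarrow> bool" where
  "approx_arc F K \<kappa> T w0 w1 \<longleftrightarrow> (\<exists>w w' \<delta>. arc_on 0 T w w' \<and> continuous_on {0..T} w \<and>
     (\<forall>t\<in>{0..T}. w t \<in> K \<and> norm (w' t - F (w t)) \<le> \<delta> t) \<and> \<delta> integrable_on {0..T} \<and>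
     integral {0..T} \<delta> \<le> \<kappa> \<and> w 0 = w0 \<and> norm (w T - w1) \<le> \<kappa>)"

lemma norm_add_diff_le:
  fixes a b c :: "'a::real_normed_vector"
  shows "norm (a + b - c) \<le> norm a + norm b + norm c"
  using norm_triangle_ineq4[of "a + b" c] norm_triangle_ineq[of a b] by linarith

text \<open>The arcs are aligned at their final times by shifting the longer one by T' - T, and
  Gronwall runs backwards. Two defects and two end errors give 4 \<kappa>; the uncovered initial
  piece of the longer arc costs B (T' - T) + \<kappa>.\<close>

lemma approx_arc_compare:
  assumes w: "approx_arc F K \<kappa> T a a1" and v: "approx_arc F K \<kappa> T' b b1"
    and T: "0 \<le> T" "T \<le> T'" "T' \<le> M" and \<Lambda>: "\<Lambda> \<ge> 0"
    and lip: "\<And>z z'. z \<in> K \<Longrightarrow> z' \<in> K \<Longrightarrow> norm (F z - F z') \<le> \<Lambda> * norm (z - z')"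
    and B: "\<And>z. z \<in> K \<Longrightarrow> norm (F z) \<le> B"
  shows "norm (a - b) \<le> (norm (a1 - b1) + 4 * \<kappa>) * exp (\<Lambda> * M) + B * (T' - T) + \<kappa>"
proof -
  obtain w w' \<delta> where w: "arc_on 0 T w w'" "continuous_on {0..T} w" "\<And>t. t \<in> {0..T} \<Longrightarrow> w t \<in> K"
    "\<And>t. t \<in> {0..T} \<Longrightarrow> norm (w' t - F (w t)) \<le> \<delta> t" "\<delta> integrable_on {0..T}" "integral {0..T} \<delta> \<le> \<kappa>"
    "w 0 = a" "norm (w T - a1) \<le> \<kappa>" using w unfolding approx_arc_def by blast
  obtain v v' \<epsilon> where v: "arc_on 0 T' v v'" "continuous_on {0..T'} v" "\<And>t. t \<in> {0..T'} \<Longrightarrow> v t \<in> K"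
    "\<And>t. t \<in> {0..T'} \<Longrightarrow> norm (v' t - F (v t)) \<le> \<epsilon> t" "\<epsilon> integrable_on {0..T'}" "integral {0..T'} \<epsilon> \<le> \<kappa>"
    "v 0 = b" "norm (v T' - b1) \<le> \<kappa>" using v unfolding approx_arc_def by blast
  define c where "c = T' - T"
  have c: "c \<ge> 0" "T + c = T'" using T by (auto simp: c_def)
  have \<delta>0: "\<delta> t \<ge> 0" if "t \<in> {0..T}" for t by (rule order_trans[OF norm_ge_zero w(4)[OF that]])
  have \<epsilon>0: "\<epsilon> t \<ge> 0" if "t \<in> {0..T'}" for t by (rule order_trans[OF norm_ge_zero v(4)[OF that]])
  define \<phi> where "\<phi> t = norm (w t - v (t + c))" for t
  have vc: "arc_on 0 T (\<lambda>t. v (t + c)) (\<lambda>t. v' (t + c))"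
    using arc_on_shift[OF v(1), of c] c by (auto elim!: arc_on_subset)
  have vcont: "continuous_on {0..T} (\<lambda>t. v (t + c))"
    by (rule continuous_on_compose2[OF v(2)]) (use c in \<open>auto intro!: continuous_intros\<close>)
  have \<phi>c: "continuous_on {0..T} \<phi>" unfolding \<phi>_def by (intro continuous_intros w(2) vcont)
  have \<epsilon>ci: "(\<lambda>t. \<epsilon> (t + c)) integrable_on {0..T}" "integral {0..T} (\<lambda>t. \<epsilon> (t + c)) \<le> \<kappa>"
  proof -
    have i: "\<epsilon> integrable_on {c..T'}" by (rule integrable_subinterval_real[OF v(5)]) (use c in auto)
    from integrable_integral[OF this] have "((\<lambda>t. \<epsilon> (t + c)) has_integral integral {c..T'} \<epsilon>) {c - c..T' - c}"
      by (rule has_integral_shift_real_ivl)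
    then have h: "((\<lambda>t. \<epsilon> (t + c)) has_integral integral {c..T'} \<epsilon>) {0..T}" using c by (simp add: c_def)
    then show "(\<lambda>t. \<epsilon> (t + c)) integrable_on {0..T}" by blast
    have "integral {c..T'} \<epsilon> \<le> integral {0..T'} \<epsilon>"
      by (rule integral_subset_le[OF _ i v(5)]) (use c \<epsilon>0 in auto)
    then show "integral {0..T} (\<lambda>t. \<epsilon> (t + c)) \<le> \<kappa>" using h v(6) by (simp add: integral_unique)
  qed
  have \<phi>T: "\<phi> T \<le> norm (a1 - b1) + 2 * \<kappa>"
  proof -
    have "w T - v T' = (w T - a1) + (a1 - b1) - (v T' - b1)" by simp
    then have "norm (w T - v T') \<le> norm (w T - a1) + norm (a1 - b1) + norm (v T' - b1)"
      by (simp only: norm_add_diff_le)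
    then show ?thesis using w(8) v(8) c by (simp add: \<phi>_def)
  qed
  have "\<phi> 0 \<le> (norm (a1 - b1) + 4 * \<kappa>) * exp (\<Lambda> * (T - 0))"
  proof (rule gronwall_backward[OF \<phi>c \<Lambda>])
    fix t assume t: "0 \<le> t" "t \<le> T"
    have \<delta>i: "\<delta> integrable_on {t..T}" by (rule integrable_subinterval_real[OF w(5)]) (use t in auto)
    have \<epsilon>i: "(\<lambda>t. \<epsilon> (t + c)) integrable_on {t..T}" by (rule integrable_subinterval_real[OF \<epsilon>ci(1)]) (use t in auto)
    have \<phi>i: "\<phi> integrable_on {t..T}"
      by (rule integrable_continuous_real[OF continuous_on_subset[OF \<phi>c]]) (use t in auto)
    have "norm ((w T - v (T + c)) - (w t - v (t + c))) \<le> integral {t..T} (\<lambda>s. \<Lambda> * \<phi> s + (\<delta> s + \<epsilon> (s + c)))"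
    proof -
      have h: "((\<lambda>s. w' s - v' (s + c)) has_integral (w T - v (T + c)) - (w t - v (t + c))) {t..T}"
        by (rule arc_onD[OF arc_on_diff[OF w(1) vc] t order_refl])
      have "norm (integral {t..T} (\<lambda>s. w' s - v' (s + c))) \<le> integral {t..T} (\<lambda>s. \<Lambda> * \<phi> s + (\<delta> s + \<epsilon> (s + c)))"
      proof (rule integral_norm_bound_integral)
        show "(\<lambda>s. w' s - v' (s + c)) integrable_on {t..T}" using h by blast
        show "(\<lambda>s. \<Lambda> * \<phi> s + (\<delta> s + \<epsilon> (s + c))) integrable_on {t..T}"
          by (intro integrable_add integrable_on_mult_right \<phi>i \<delta>i \<epsilon>i)
        fix s assume s: "s \<in> {t..T}"
        have sT: "s \<in> {0..T}" "s + c \<in> {0..T'}" using s t c by auto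
        have "w' s - v' (s + c) = (w' s - F (w s)) + (F (w s) - F (v (s + c))) - (v' (s + c) - F (v (s + c)))" by simp
        then have "norm (w' s - v' (s + c)) \<le> norm (w' s - F (w s)) + norm (F (w s) - F (v (s + c))) + norm (v' (s + c) - F (v (s + c)))"
          by (simp only: norm_add_diff_le)
        then show "norm (w' s - v' (s + c)) \<le> \<Lambda> * \<phi> s + (\<delta> s + \<epsilon> (s + c))"
          using w(4)[OF sT(1)] v(4)[OF sT(2)] lip[OF w(3)[OF sT(1)] v(3)[OF sT(2)]] by (simp add: \<phi>_def)
      qed
      then show ?thesis using integral_unique[OF h] by simp
    qed
    also have "\<dots> = \<Lambda> * integral {t..T} \<phi> + (integral {t..T} \<delta> + integral {t..T} (\<lambda>s. \<epsilon> (s + c)))"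
      by (simp add: integral_add \<phi>i \<delta>i \<epsilon>i integrable_add integrable_on_mult_right)
    also have "\<dots> \<le> \<Lambda> * integral {t..T} \<phi> + (\<kappa> + \<kappa>)"
    proof (intro add_mono order_refl)
      have "integral {t..T} \<delta> \<le> integral {0..T} \<delta>" by (rule integral_subset_le[OF _ \<delta>i w(5)]) (use t \<delta>0 in auto)
      then show "integral {t..T} \<delta> \<le> \<kappa>" using w(6) by simp
      have "integral {t..T} (\<lambda>s. \<epsilon> (s + c)) \<le> integral {0..T} (\<lambda>s. \<epsilon> (s + c))"
        by (rule integral_subset_le[OF _ \<epsilon>i \<epsilon>ci(1)]) (use t \<epsilon>0 c in auto)
      then show "integral {t..T} (\<lambda>s. \<epsilon> (s + c)) \<le> \<kappa>" using \<epsilon>ci(2) by simp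
    qed
    finally have "norm ((w t - v (t + c)) - (w T - v (T + c))) \<le> \<Lambda> * integral {t..T} \<phi> + 2 * \<kappa>"
      by (simp add: norm_minus_commute)
    then show "\<phi> t \<le> norm (a1 - b1) + 4 * \<kappa> + \<Lambda> * integral {t..T} \<phi>"
      using \<phi>T norm_triangle_sub[of "w t - v (t + c)" "w T - v (T + c)"] by (simp add: \<phi>_def)
  qed (use T in auto)
  also have "\<dots> \<le> (norm (a1 - b1) + 4 * \<kappa>) * exp (\<Lambda> * M)"
  proof (intro mult_left_mono)
    have "\<Lambda> * (T - 0) \<le> \<Lambda> * M" using T \<Lambda> by (intro mult_left_mono) auto
    then show "exp (\<Lambda> * (T - 0)) \<le> exp (\<Lambda> * M)" by simp
    have "\<kappa> \<ge> 0" by (rule order_trans[OF norm_ge_zero w(8)])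
    then show "0 \<le> norm (a1 - b1) + 4 * \<kappa>" by simp
  qed
  finally have 1: "norm (a - v c) \<le> (norm (a1 - b1) + 4 * \<kappa>) * exp (\<Lambda> * M)" using w(7) by (simp add: \<phi>_def)
  have 2: "norm (v c - b) \<le> B * c + \<kappa>"
  proof -
    have ei: "\<epsilon> integrable_on {0..c}" by (rule integrable_subinterval_real[OF v(5)]) (use c T in auto)
    have h: "(v' has_integral v c - v 0) {0..c}" by (rule arc_onD[OF v(1)]) (use c T in auto)
    have "norm (integral {0..c} v') \<le> integral {0..c} (\<lambda>s. B + \<epsilon> s)"
    proof (rule integral_norm_bound_integral)
      show "v' integrable_on {0..c}" using h by blast
      show "(\<lambda>s. B + \<epsilon> s) integrable_on {0..c}" by (intro integrable_add ei) auto
      fix s assume "s \<in> {0..c}"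
      then have s: "s \<in> {0..T'}" using c T by auto
      show "norm (v' s) \<le> B + \<epsilon> s"
        using norm_triangle_sub[of "v' s" "F (v s)"] v(4)[OF s] B[OF v(3)[OF s]] by linarith
    qed
    also have "\<dots> = B * c + integral {0..c} \<epsilon>" using c ei by (subst integral_add) auto
    also have "integral {0..c} \<epsilon> \<le> integral {0..T'} \<epsilon>"
      by (rule integral_subset_le[OF _ ei v(5)]) (use c T \<epsilon>0 in auto)
    finally show ?thesis using integral_unique[OF h] v(6,7) by simp
  qed
  have "norm (a - b) \<le> norm (a - v c) + norm (v c - b)" using norm_triangle_ineq[of "a - v c" "v c - b"] by simp
  then show ?thesis using 1 2 by (simp add: c_def)
qed

text \<open>Uniform constants from a finite subcover. The second point ranges over a full ball and
  not only over \<open>K\<close>, as the Taylor step in \<open>hamiltonian_defect\<close> leaves the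
  annulus.\<close>

lemma locally_lipschitz_compact:
  fixes D :: "'a::euclidean_space \<Rightarrow> 'b::euclidean_space"
  assumes loc: "locally_lipschitz_on W D" and W: "open W" and K: "compact K" "K \<subseteq> W"
  obtains \<rho> C where "\<rho> > 0" "C \<ge> 0" "\<And>z. z \<in> K \<Longrightarrow> ball z \<rho> \<subseteq> W"
    "\<And>z w. z \<in> K \<Longrightarrow> w \<in> ball z \<rho> \<Longrightarrow> norm (D w - D z) \<le> C * norm (w - z)"
proof -
  have "\<exists>\<epsilon> C. \<epsilon> > 0 \<and> C-lipschitz_on (ball z \<epsilon>) D \<and> ball z \<epsilon> \<subseteq> W" if z: "z \<in> K" for z
  proof -
    obtain \<epsilon> C where 1: "\<epsilon> > 0" "C-lipschitz_on (ball z \<epsilon> \<inter> W) D"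
      using loc z K unfolding locally_lipschitz_on_def by blast
    obtain \<epsilon>2 where 2: "\<epsilon>2 > 0" "ball z \<epsilon>2 \<subseteq> W" using W z K open_contains_ball by blast
    have "C-lipschitz_on (ball z (min \<epsilon> \<epsilon>2)) D" by (rule lipschitz_on_subset[OF 1(2)]) (use 2 in auto)
    then show ?thesis using 1 2 by (intro exI[of _ "min \<epsilon> \<epsilon>2"] exI[of _ C]) auto
  qed
  then obtain \<epsilon> C where ec: "\<And>z. z \<in> K \<Longrightarrow> \<epsilon> z > 0 \<and> (C z)-lipschitz_on (ball z (\<epsilon> z)) D \<and> ball z (\<epsilon> z) \<subseteq> W"
    by metis
  obtain I where I: "I \<subseteq> K" "finite I" "K \<subseteq> (\<Union>z\<in>I. ball z (\<epsilon> z / 2))"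
    by (rule compactE_image[OF K(1), of K "\<lambda>z. ball z (\<epsilon> z / 2)"]) (use ec in auto)
  define M where "M = 1 + (\<Sum>z\<in>I. \<bar>C z\<bar> + 2 / \<epsilon> z)"
  have pos: "0 \<le> \<bar>C z\<bar> + 2 / \<epsilon> z" if "z \<in> I" for z
  proof -
    have "\<epsilon> z > 0" using ec that I(1) by blast
    then show ?thesis by simp
  qed
  have Mge: "\<bar>C z\<bar> + 2 / \<epsilon> z \<le> M" if "z \<in> I" for z
    using member_le_sum[of z I "\<lambda>z. \<bar>C z\<bar> + 2 / \<epsilon> z"] pos that I(2) by (auto simp: M_def)
  have M1: "M \<ge> 1" using sum_nonneg[OF pos, of I] by (simp add: M_def)
  have main: "\<exists>z0\<in>I. ball z (1 / M) \<subseteq> ball z0 (\<epsilon> z0)" if "z \<in> K" for z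
  proof -
    obtain z0 where z0: "z0 \<in> I" "dist z0 z < \<epsilon> z0 / 2" using I(3) \<open>z \<in> K\<close> by force
    have ez: "\<epsilon> z0 > 0" using ec z0 I by blast
    have "2 / \<epsilon> z0 \<le> M" using Mge[OF z0(1)] by simp
    then have Me: "1 / M \<le> \<epsilon> z0 / 2" using ez M1 by (simp add: field_simps)
    have "ball z (1 / M) \<subseteq> ball z0 (\<epsilon> z0)"
    proof
      fix p assume "p \<in> ball z (1 / M)"
      then have "dist z p < \<epsilon> z0 / 2" using Me by simp
      then show "p \<in> ball z0 (\<epsilon> z0)" using z0(2) dist_triangle[of z0 p z] by simp
    qed
    then show ?thesis using z0(1) by blast
  qed
  show ?thesis
  proof (rule that[of "1 / M" M])
    fix z assume z: "z \<in> K"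
    obtain z0 where z0: "z0 \<in> I" "ball z (1 / M) \<subseteq> ball z0 (\<epsilon> z0)" using main[OF z] by blast
    have e: "(C z0)-lipschitz_on (ball z0 (\<epsilon> z0)) D" "ball z0 (\<epsilon> z0) \<subseteq> W" "\<epsilon> z0 > 0" using ec z0 I by blast+
    show "ball z (1 / M) \<subseteq> W" using z0 e by blast
    fix w assume w: "w \<in> ball z (1 / M)"
    have zb: "z \<in> ball z (1 / M)" using M1 by simp
    have "dist (D w) (D z) \<le> C z0 * dist w z"
      by (rule lipschitz_onD[OF e(1) subsetD[OF z0(2) w] subsetD[OF z0(2) zb]])
    also have "\<dots> \<le> M * dist w z"
    proof (rule mult_right_mono)
      have "2 / \<epsilon> z0 > 0" using e(3) by simp
      then show "C z0 \<le> M" using Mge[OF z0(1)] by linarith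
    qed simp
    finally show "norm (D w - D z) \<le> M * norm (w - z)" by (simp add: dist_norm)
  qed (use M1 in auto)
qed

text \<open>\<open>K\<close> is not assumed convex, so pairs at distance at least \<rho> are handled
  by the bound on D, which produces the constant \<open>2 * B / \<rho>\<close>.\<close>

lemma locally_lipschitz_compact_global:
  fixes D :: "'a::euclidean_space \<Rightarrow> 'b::euclidean_space"
  assumes loc: "locally_lipschitz_on W D" and W: "open W" and K: "compact K" "K \<subseteq> W"
  obtains \<Lambda> B where "\<Lambda> \<ge> 0" "B \<ge> 0" "\<And>z. z \<in> K \<Longrightarrow> norm (D z) \<le> B"
    "\<And>z w. z \<in> K \<Longrightarrow> w \<in> K \<Longrightarrow> norm (D w - D z) \<le> \<Lambda> * norm (w - z)"
proof -
  obtain \<rho> C where \<rho>: "\<rho> > 0" "C \<ge> 0" "\<And>z. z \<in> K \<Longrightarrow> ball z \<rho> \<subseteq> W"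
    "\<And>z w. z \<in> K \<Longrightarrow> w \<in> ball z \<rho> \<Longrightarrow> norm (D w - D z) \<le> C * norm (w - z)"
    by (rule locally_lipschitz_compact[OF assms]) (rule that)
  have "continuous_on K D"
    unfolding continuous_on_iff
  proof (intro ballI allI impI)
    fix z and e :: real assume z: "z \<in> K" and e: "e > 0"
    have lt: "dist (D w) (D z) < e" if "dist w z < min \<rho> (e / (C + 1))" for w
    proof -
      have "norm (D w - D z) \<le> C * norm (w - z)" by (rule \<rho>(4)[OF z]) (use that in \<open>simp add: dist_commute\<close>)
      also have "\<dots> \<le> (C + 1) * norm (w - z)" by (intro mult_right_mono) auto
      also have "\<dots> < (C + 1) * (e / (C + 1))" using that \<rho>(2) by (intro mult_strict_left_mono) (auto simp: dist_norm)
      also have "\<dots> = e" using \<rho>(2) by simp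
      finally show ?thesis by (simp add: dist_norm)
    qed
    show "\<exists>d>0. \<forall>w\<in>K. dist w z < d \<longrightarrow> dist (D w) (D z) < e"
      by (rule exI[of _ "min \<rho> (e / (C + 1))"]) (use lt \<rho> e in simp)
  qed
  then have "compact (D ` K)" using K(1) by (rule compact_continuous_image)
  from compact_imp_bounded[OF this] obtain B where B0: "B > 0" "\<forall>y\<in>D ` K. norm y \<le> B"
    unfolding bounded_pos by blast
  have B: "B > 0" "\<And>z. z \<in> K \<Longrightarrow> norm (D z) \<le> B" using B0 by auto
  show ?thesis
  proof (rule that[of "C + 2 * B / \<rho>" B])
    fix z w assume zw: "z \<in> K" "w \<in> K"
    show "norm (D w - D z) \<le> (C + 2 * B / \<rho>) * norm (w - z)"
    proof (cases "norm (w - z) < \<rho>")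
      case True
      then have "norm (D w - D z) \<le> C * norm (w - z)" by (intro \<rho>(4)[OF zw(1)]) (simp add: dist_norm norm_minus_commute)
      also have "\<dots> \<le> (C + 2 * B / \<rho>) * norm (w - z)" using B \<rho> by (intro mult_right_mono) auto
      finally show ?thesis .
    next
      case False
      have "norm (D w - D z) \<le> 2 * B" using norm_triangle_ineq4[of "D w" "D z"] B(2)[OF zw(1)] B(2)[OF zw(2)] by linarith
      also have "\<dots> = (2 * B / \<rho>) * \<rho>" using \<rho> by simp
      also have "\<dots> \<le> (2 * B / \<rho>) * norm (w - z)" using False B \<rho> by (intro mult_left_mono) auto
      also have "\<dots> \<le> (C + 2 * B / \<rho>) * norm (w - z)" using \<rho> by (intro mult_right_mono) auto
      finally show ?thesis .
    qed
  qed (use B \<rho> in auto)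
qed

section \<open>Abnormal extremals\<close>

context exit_problem
begin

lemma near_opt_mono: "near_opt \<kappa> x T xs u y \<tau> \<Longrightarrow> \<kappa> \<le> \<kappa>' \<Longrightarrow> near_opt \<kappa>' x T xs u y \<tau>"
  by (auto simp: near_opt_def)

lemma adjoint_arc_shift:
  assumes q: "adjoint_arc \<mu> T u y q" and s: "0 \<le> s" "s \<le> T"
  shows "adjoint_arc \<mu> (T - s) (\<lambda>t. u (t + s)) (\<lambda>t. y (t + s)) (\<lambda>t. q (t + s))"
  unfolding adjoint_arc_def
proof
  show "continuous_on {0..T - s} (\<lambda>t. q (t + s))"
    by (rule continuous_on_compose2[of "{0..T}" q]) (use q s in \<open>auto simp: adjoint_arc_def intro!: continuous_intros\<close>)
  have "arc_on 0 T q (\<lambda>t. Q' \<mu> (y t) (u t) (q t))" using q by (simp add: adjoint_arc_def)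
  from arc_on_shift[OF this, of s]
  show "arc_on 0 (T - s) (\<lambda>t. q (t + s)) (\<lambda>t. Q' \<mu> (y (t + s)) (u (t + s)) (q (t + s)))"
    by (rule arc_on_subset) (use s in auto)
qed

lemma cost_shift:
  assumes t: "traj x u y" and s: "0 \<le> s" "s \<le> T"
  shows "cost (T - s) (\<lambda>t. u (t + s)) (\<lambda>t. y (t + s)) = integral {s..T} (\<lambda>t. r (y t) (u t)) + g (y T)"
proof -
  have "((\<lambda>t. r (y t) (u t)) has_integral integral {s..T} (\<lambda>t. r (y t) (u t))) {s..T}"
    using traj_r_integrable[OF t s(1)] by (simp add: integrable_integral)
  from has_integral_shift_real_ivl[OF this, of s] show ?thesis by (simp add: integral_unique)
qed

lemma near_opt_tail:
  assumes no: "near_opt \<kappa> x T xs u y \<tau>" and s: "0 \<le> s" "s \<le> \<tau>"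
  shows "integral {s..\<tau>} (\<lambda>t. r (y t) (u t)) + g (y \<tau>) \<le> V (y s) + \<kappa>"
proof -
  have t: "traj x u y" and h: "is_hitting_time S y \<tau>" using no by (auto simp: near_opt_def)
  have "V x \<le> integral {0..s} (\<lambda>s. r (y s) (u s)) + V (y s)"
  proof (rule dynamic_programming[OF t s(1)])
    fix c assume c: "0 \<le> c" "c < s"
    show "y c \<notin> S"
    proof
      assume "y c \<in> S"
      then have "\<tau> \<le> c" using h c unfolding is_hitting_time_def by blast
      then show False using c s by simp
    qed
  qed
  then show ?thesis using no r_integral_combine[OF t s] by (simp add: near_opt_def)
qed

lemma inner_velocity_integrable:
  assumes t: "traj x u y" and q: "continuous_on {a..b} q" and a: "0 \<le> a"
  shows "(\<lambda>s. q s \<bullet> f (y s) (u s)) integrable_on {a..b}"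
proof -
  have 1: "continuous_on (UNIV \<times> U) (\<lambda>z :: ((real^'d) \<times> (real^'d)) \<times> (real^'m). f (fst (fst z)) (snd z))"
    by (rule continuous_on_compose2[OF f_cont, where f="\<lambda>z. (fst (fst z), snd z)", simplified split_beta fst_conv snd_conv])
      (auto intro!: continuous_intros)
  have "continuous_on (UNIV \<times> U) (\<lambda>(x, \<omega>). (\<lambda>z \<omega>. snd z \<bullet> f (fst z) \<omega>) x \<omega>)"
    unfolding split_beta by (intro continuous_intros 1)
  from admissible_integrable'[OF _ _ a this, where u=u and y="\<lambda>s. (y s, q s)" and b=b] show ?thesis
    using t traj_continuous[OF t a] q by (auto simp: traj_def intro!: continuous_intros)
qed

text \<open>The maximum principle along minimizing sequences in the abnormal case, obtained by applying
  the upper estimate of \<open>V\<close> at intermediate points of the trajectory: forwards to the end points of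
  short constant-control trajectories, and backwards to earlier points of the trajectory itself.\<close>

lemma abnormal_pontryagin:
  assumes le: "limit_end x T xs" and x: "x \<notin> S" and T: "T > 0" and M: "M \<ge> 1"
    and td: "terminal_data M xs v \<zeta> 0" and \<kappa>: "\<kappa> > 0"
  obtains u y \<tau> q h where "near_opt \<kappa> x T xs u y \<tau>" "adjoint_arc 0 \<tau> u y q" "q \<tau> = v"
    "0 \<le> h" "h \<le> \<kappa>" "h \<le> \<tau>" "\<And>s \<omega>. 0 \<le> s \<Longrightarrow> s \<le> \<tau> - h \<Longrightarrow> \<omega> \<in> U \<Longrightarrow> q s \<bullet> f (y s) \<omega> \<le> \<kappa>"
    "- \<kappa> \<le> integral {0..\<tau> - h} (\<lambda>s. q s \<bullet> f (y s) (u s))"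
proof -
  note GL = G_nonneg L_pos N_pos r0_pos
  define M' where "M' = M + T + 1"
  have M': "M' \<ge> 1" "M \<le> M'" "T + 1 \<le> M'" using M T by (auto simp: M'_def)
  have td': "terminal_data M' xs v \<zeta> 0" by (rule terminal_data_mono[OF td M M'(2)])
  obtain C \<rho> where C: "C > 0" "\<rho> > 0" and est:
    "\<And>x u y T \<mu> q xs v \<zeta> z a \<eta>. traj x u y \<Longrightarrow> 0 < T \<Longrightarrow> T \<le> M' \<Longrightarrow> terminal_data M' xs v \<zeta> \<mu> \<Longrightarrow>
      adjoint_arc \<mu> T u y q \<Longrightarrow> q T = (1 - \<mu>) *\<^sub>R v - \<mu> *\<^sub>R \<zeta> \<Longrightarrow> norm (y T - xs) \<le> \<eta> \<Longrightarrow> z \<notin> S \<Longrightarrow>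
      (norm (z - x))\<^sup>2 + a\<^sup>2 + \<eta> \<le> \<rho> \<Longrightarrow> C * sqrt ((norm (z - x))\<^sup>2 + a\<^sup>2 + \<eta>) \<le> T \<Longrightarrow>
      C * ((norm (z - x))\<^sup>2 + a\<^sup>2 + \<eta>) < q 0 \<bullet> (z - x) + \<mu> * a \<Longrightarrow>
      V z \<le> cost T u y + a"
    by (rule value_upper_estimate[OF M'(1)]) (rule that)
  define Q where "Q = norm v * exp (L * M')"
  have Q: "Q \<ge> 0" by (simp add: Q_def)
  define R1 where "R1 = norm x + N * (M' + 1)"
  have "compact ((\<lambda>(x, \<omega>). r x \<omega>) ` (cball 0 R1 \<times> U))"
    by (intro compact_continuous_image compact_Times compact_cball U_compact continuous_on_subset[OF r_cont]) auto
  from compact_imp_bounded[OF this] obtain Rr where Rr0: "Rr > 0" "\<forall>z\<in>(\<lambda>(x, \<omega>). r x \<omega>) ` (cball 0 R1 \<times> U). norm z \<le> Rr"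
    unfolding bounded_pos by blast
  have Rr: "r z \<omega> \<le> Rr" if "norm z \<le> R1" "\<omega> \<in> U" for z \<omega>
  proof -
    have "(\<lambda>(x, \<omega>). r x \<omega>) (z, \<omega>) \<in> (\<lambda>(x, \<omega>). r x \<omega>) ` (cball 0 R1 \<times> U)" by (rule imageI) (use that in simp)
    then have "norm (r z \<omega>) \<le> Rr" using Rr0(2) by (simp only: split_conv)
    then show ?thesis by simp
  qed
  define kap where "kap = r0 - G * N"
  have kap: "kap > 0" using G_small by (simp add: kap_def)
  \<comment> \<open>In units of the step t: \<open>C2\<close> limits the time to exit whenever a
    side trajectory of duration t can reach \<open>S\<close>; \<open>Dc\<close> bounds the squared
    distances in the estimate; \<open>C4\<close> is the length of the final piece on which nothing
    is claimed; \<open>C3\<close> is the error of both inequalities, including the variation of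
    \<open>f\<close> or \<open>q\<close> during one step. \<open>E\<close> dominates all errors at
    once.\<close>
  define C2 where "C2 = (Rr + 1 + G * N) / kap"
  have C2: "C2 > 0" using Rr0 GL kap by (simp add: C2_def add_pos_nonneg)
  define Dc where "Dc = N\<^sup>2 + (Rr + 2)\<^sup>2 + 1"
  have Dc: "Dc \<ge> 1" by (simp add: Dc_def)
  define C4 where "C4 = C2 + 1 + C * Dc"
  have CDc: "C * Dc > 0" using C Dc by simp
  have C4: "C4 > 0" using C2 CDc by (simp add: C4_def)
  define C3 where "C3 = C * Dc + Q * L * N"
  have C3: "C3 > 0" using CDc Q GL by (simp add: C3_def add_pos_nonneg)
  define E where "E = C3 + C4 + M' * C3 + 2"
  have MC3: "M' * C3 > 0" using M' C3 by simp
  have E: "E > 0" using C3 C4 MC3 by (simp add: E_def)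
  \<comment> \<open>One step size for everything. The trajectory below is optimal up to t^2, so
    after division by t its error is still of order t.\<close>
  define t where "t = min 1 (min (r0 / 2) (min (\<rho> / Dc) (min (\<kappa> / E) (T / (C4 + 2)))))"
  have t: "t \<le> 1" "t \<le> r0 / 2" "t \<le> \<rho> / Dc" "t \<le> \<kappa> / E" "t \<le> T / (C4 + 2)" unfolding t_def by linarith+
  have t0: "t > 0" using GL C Dc \<kappa> E T C4 by (simp add: t_def)
  have Et: "E * t \<le> \<kappa>" using t(4) E by (simp add: pos_le_divide_eq mult.commute)
  have tk: "C3 * t \<le> \<kappa>" "(C4 + 1) * t \<le> \<kappa>" "M' * C3 * t \<le> \<kappa>" "t \<le> \<kappa>"
  proof -
    have "C3 * t \<le> E * t" "(C4 + 1) * t \<le> E * t" "M' * C3 * t \<le> E * t" "1 * t \<le> E * t"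
      using t0 C3 C4 MC3 unfolding E_def by (intro mult_right_mono; linarith)+
    then show "C3 * t \<le> \<kappa>" "(C4 + 1) * t \<le> \<kappa>" "M' * C3 * t \<le> \<kappa>" "t \<le> \<kappa>" using Et by linarith+
  qed
  have t2: "t\<^sup>2 \<le> t" "t\<^sup>2 > 0" using t t0 by (auto simp: power2_eq_square mult_left_le)
  have tT: "(C4 + 2) * t \<le> T" using t(5) C4 by (simp add: pos_le_divide_eq mult.commute)
  have Dt: "Dc * t\<^sup>2 \<le> \<rho>"
  proof -
    have "Dc * t\<^sup>2 \<le> Dc * t" using t2 Dc by (intro mult_left_mono) auto
    also have "\<dots> \<le> \<rho>" using t(3) Dc by (simp add: pos_le_divide_eq mult.commute)
    finally show ?thesis .
  qed
  obtain u y \<tau> where no: "near_opt (t\<^sup>2) x T xs u y \<tau>" using le t2 unfolding limit_end_def by blast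
  have tr: "traj x u y" and hit: "is_hitting_time S y \<tau>" and \<tau>T: "\<bar>\<tau> - T\<bar> \<le> t\<^sup>2" and yx: "norm (y \<tau> - xs) \<le> t\<^sup>2"
    using no by (auto simp: near_opt_def)
  have \<tau>: "\<tau> > 0" "\<tau> \<le> M'" "\<tau> \<ge> T - t"
    using hitting_point_frontier(2)[OF tr x hit] \<tau>T t2 t M' by linarith+
  obtain q where q: "adjoint_arc 0 \<tau> u y q" "q \<tau> = v"
    using adjoint_exists[OF tr, of \<tau> 0 v] \<tau> by auto
  have ntS: "y s \<notin> S" if "0 \<le> s" "s < \<tau>" for s
  proof
    assume "y s \<in> S"
    then have "\<tau> \<le> s" using hit that unfolding is_hitting_time_def by blast
    then show False using that by simp
  qed
  have Qb: "norm (q s) \<le> Q" if "s \<in> {0..\<tau>}" for s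
  proof -
    have "norm (q s) \<le> norm v * exp (L * \<tau>)" using adjoint_bounds(1)[OF q(1) _ tr that] q(2) by simp
    also have "\<dots> \<le> Q" unfolding Q_def using \<tau> GL by (intro mult_left_mono) auto
    finally show ?thesis .
  qed
  have qlip: "norm (q s - q s') \<le> Q * L * t" if "s \<in> {0..\<tau>}" "s' \<in> {0..\<tau>}" "\<bar>s - s'\<bar> \<le> t" for s s'
  proof -
    have "norm (q s - q s') \<le> (L * Q) * \<bar>s - s'\<bar>"
    proof (rule arc_on_lipschitz[OF _ _ that(2,1)])
      show "arc_on 0 \<tau> q (\<lambda>s. Q' 0 (y s) (u s) (q s))" using q by (simp add: adjoint_arc_def)
      fix c assume c: "c \<in> {0..\<tau>}"
      have "norm (Q' 0 (y c) (u c) (q c)) \<le> 0 * L + L * norm (q c)"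
        by (rule Q'_norm0) (use traj_in_U[OF tr] c in auto)
      also have "\<dots> \<le> L * Q" using Qb[OF c] GL by simp
      finally show "norm (Q' 0 (y c) (u c) (q c)) \<le> L * Q" .
    qed
    also have "\<dots> \<le> (L * Q) * t" using that GL Q by (intro mult_left_mono) auto
    finally show ?thesis by (simp add: mult.commute mult.left_commute)
  qed
  have ny: "norm (y s) \<le> norm x + N * s" if "s \<ge> 0" for s
    using traj_lip[OF tr order_refl that] traj_arc(2)[OF tr] norm_triangle_sub[of "y s" x] that by simp
  define J where "J s = integral {s..\<tau>} (\<lambda>t. r (y t) (u t)) + g (y \<tau>)" for s
  have JV: "J s \<le> V (y s) + t\<^sup>2" if "0 \<le> s" "s \<le> \<tau>" for s
    unfolding J_def by (rule near_opt_tail[OF no that])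
  \<comment> \<open>Contraposition of the upper estimate, applied to the tail from
    \<open>y s\<close>. As \<mu> = 0, the number \<open>a\<close> is absent from the conclusion: any
    lower bound for \<open>V z - J s\<close> of order t, however negative, will do.\<close>
  have key: "q s \<bullet> (z - y s) \<le> C * Dc * t\<^sup>2"
    if s: "0 \<le> s" "s \<le> \<tau> - C4 * t" and z: "z \<notin> S" and nz: "norm (z - y s) \<le> N * t" and a: "\<bar>a\<bar> \<le> (Rr + 2) * t"
      and Vz: "V z > J s + a" for s z a
  proof (rule ccontr)
    assume neg: "\<not> ?thesis"
    define D where "D = (norm (z - y s))\<^sup>2 + a\<^sup>2 + t\<^sup>2"
    have "(norm (z - y s))\<^sup>2 \<le> (N * t)\<^sup>2" using nz by (intro power_mono) auto
    moreover have "\<bar>a\<bar>\<^sup>2 \<le> ((Rr + 2) * t)\<^sup>2" using a by (intro power_mono) auto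
    ultimately have "(norm (z - y s))\<^sup>2 \<le> N\<^sup>2 * t\<^sup>2" "a\<^sup>2 \<le> (Rr + 2)\<^sup>2 * t\<^sup>2"
      by (simp_all only: power_mult_distrib power2_abs)
    then have D: "D \<le> Dc * t\<^sup>2" unfolding D_def Dc_def distrib_right by linarith
    have D0: "D \<ge> 0" by (simp add: D_def)
    have s\<tau>: "s < \<tau>" using s C4 t0 by (smt (verit) mult_pos_pos)
    have "V z \<le> cost (\<tau> - s) (\<lambda>c. u (c + s)) (\<lambda>c. y (c + s)) + a"
    proof (rule est[OF traj_shift[OF tr s(1)] _ _ td' adjoint_arc_shift[OF q(1) s(1)] _ _ z, where \<eta>="t\<^sup>2"])
      show "q (\<tau> - s + s) = (1 - 0) *\<^sub>R v - 0 *\<^sub>R \<zeta>" using q(2) by simp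
      show "norm (y (\<tau> - s + s) - xs) \<le> t\<^sup>2" using yx by simp
      show "(norm (z - y s))\<^sup>2 + a\<^sup>2 + t\<^sup>2 \<le> \<rho>" using D Dt by (simp add: D_def)
      have "sqrt D \<le> sqrt ((Dc * t)\<^sup>2)"
      proof (rule real_sqrt_le_mono)
        have "Dc * t\<^sup>2 \<le> Dc * (Dc * t\<^sup>2)" using mult_right_mono[OF Dc, of "Dc * t\<^sup>2"] Dc by simp
        then show "D \<le> (Dc * t)\<^sup>2" using D by (simp add: power2_eq_square algebra_simps)
      qed
      also have "\<dots> = Dc * t" using Dc t0 by simp
      finally have "C * sqrt D \<le> C * Dc * t" using C by simp
      also have "\<dots> \<le> C4 * t" using C2 t0 by (intro mult_right_mono) (auto simp: C4_def)
      also have "\<dots> \<le> \<tau> - s" using s by simp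
      finally show "C * sqrt ((norm (z - y s))\<^sup>2 + a\<^sup>2 + t\<^sup>2) \<le> \<tau> - s" by (simp add: D_def)
      have "C * D \<le> C * (Dc * t\<^sup>2)" using D C by (intro mult_left_mono) auto
      then show "C * ((norm (z - y s))\<^sup>2 + a\<^sup>2 + t\<^sup>2) < q (0 + s) \<bullet> (z - y s) + 0 * a"
        using neg by (simp add: D_def mult.assoc)
    qed (use s\<tau> s \<tau> in auto)
    then show False using Vz cost_shift[OF tr s(1), of \<tau>] s\<tau> by (simp add: J_def)
  qed
  \<comment> \<open>Here \<open>z\<close> is reached from \<open>y s\<close> by the constant control
    \<omega> in time t; dynamic programming lets \<open>V\<close> fall by at most
    \<open>Rr * t\<close> on the way.\<close>
  have upper: "q s \<bullet> f (y s) \<omega> \<le> C3 * t" if s: "0 \<le> s" "s \<le> \<tau> - C4 * t" and \<omega>: "\<omega> \<in> U" for s \<omega>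
  proof -
    have C4t: "C4 * t > 0" using C4 t0 by simp
    have s\<tau>: "s \<le> \<tau>" "s < \<tau>" using s C4t by auto
    obtain Y where Y: "traj (y s) (\<lambda>_. \<omega>) Y" using traj_exists[OF admissible_const[OF \<omega>]] by blast
    have Y0: "Y 0 = y s" by (rule traj_arc(2)[OF Y])
    have Ylip: "norm (Y c - y s) \<le> N * c" if "c \<ge> 0" for c
      using traj_lip[OF Y order_refl that] Y0 that by simp
    have rY: "r (Y c) \<omega> \<le> Rr" if c: "0 \<le> c" "c \<le> t" for c
    proof (rule Rr[OF _ \<omega>])
      have "norm (Y c) \<le> norm (y s) + norm (Y c - y s)" using norm_triangle_sub[of "Y c" "y s"] by linarith
      also have "\<dots> \<le> (norm x + N * s) + N * c" using ny[OF s(1)] Ylip[OF c(1)] by linarith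
      also have "N * s + N * c \<le> N * (M' + 1)"
        unfolding distrib_left[symmetric] using GL c t s\<tau> \<tau> by (intro mult_left_mono) auto
      then have "(norm x + N * s) + N * c \<le> R1" by (simp add: R1_def)
      finally show "norm (Y c) \<le> R1" .
    qed
    have rint: "integral {0..c} (\<lambda>s. r (Y s) \<omega>) \<le> Rr * c" if c: "0 \<le> c" "c \<le> t" for c
    proof -
      have "integral {0..c} (\<lambda>s. r (Y s) \<omega>) \<le> integral {0..c} (\<lambda>s. Rr)"
        by (rule integral_le[OF traj_r_integrable[OF Y]]) (use rY c in auto)
      then show ?thesis using c by (simp add: mult.commute)
    qed
    \<comment> \<open>Reaching \<open>S\<close> within time t would make the cost to go from
      \<open>y s\<close> exceed the terminal cost at the new exit by at most order t. As the
      remaining trajectory costs at least \<tau> - s times \<open>kap\<close> net of terminal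
      savings, \<tau> - s would be at most C2 t.\<close>
    have noS: "Y c \<notin> S" if c: "0 \<le> c" "c \<le> t" for c
    proof
      assume cS: "Y c \<in> S"
      obtain c1 where c1: "is_hitting_time S Y c1" "0 < c1" "c1 \<le> c" "Y c1 \<in> frontier S"
        using hitting_time_exists[OF Y ntS[OF s(1) s\<tau>(2)] c(1) cS] .
      have "J s \<le> V (y s) + t\<^sup>2" by (rule JV[OF s(1) s\<tau>(1)])
      also have "V (y s) \<le> integral {0..c1} (\<lambda>s. r (Y s) \<omega>) + g (Y c1)" by (rule V_le[OF Y c1(1)])
      also have "integral {0..c1} (\<lambda>s. r (Y s) \<omega>) \<le> Rr * t"
        by (rule order_trans[OF rint]) (use c1 c Rr0 in auto)
      finally have 1: "J s \<le> Rr * t + g (Y c1) + t\<^sup>2" by simp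
      have 2: "r0 * (\<tau> - s) + g (y \<tau>) \<le> J s"
        using r_integral_ge[OF tr s(1) s\<tau>(1)] by (simp add: J_def)
      have "norm (Y c1 - y \<tau>) \<le> norm (Y c1 - y s) + norm (y \<tau> - y s)"
        using norm_triangle_ineq4[of "Y c1 - y s" "y \<tau> - y s"] by simp
      also have "\<dots> \<le> N * t + N * (\<tau> - s)"
      proof (rule add_mono)
        show "norm (Y c1 - y s) \<le> N * t"
          by (rule order_trans[OF Ylip]) (use c1 c GL in auto)
        show "norm (y \<tau> - y s) \<le> N * (\<tau> - s)" using traj_lip[OF tr s(1), of \<tau>] s\<tau> s by simp
      qed
      finally have "G * norm (Y c1 - y \<tau>) \<le> G * (N * t + N * (\<tau> - s))" using GL by (intro mult_left_mono) auto
      moreover have "\<bar>g (Y c1) - g (y \<tau>)\<bar> \<le> G * norm (Y c1 - y \<tau>)"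
        by (rule g_lip) (use hitting_point_frontier(1)[OF tr x hit] c1 W in auto)
      ultimately have 3: "g (Y c1) \<le> g (y \<tau>) + G * (N * t + N * (\<tau> - s))" by linarith
      have "kap * (\<tau> - s) \<le> (Rr + 1 + G * N) * t"
        using 1 2 3 t2 by (simp add: kap_def algebra_simps)
      then have "\<tau> - s \<le> C2 * t" using kap by (simp add: C2_def field_simps)
      moreover have "C2 * t < C4 * t" using CDc t0 by (intro mult_strict_right_mono) (auto simp: C4_def)
      ultimately show False using s by simp
    qed
    have "V (y s) \<le> integral {0..t} (\<lambda>s. r (Y s) \<omega>) + V (Y t)"
      by (rule dynamic_programming[OF Y]) (use t0 noS in auto)
    then have "J s - t\<^sup>2 \<le> Rr * t + V (Y t)" using rint[of t] JV[OF s(1) s\<tau>(1)] t0 by simp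
    then have "V (Y t) > J s + (- ((Rr + 2) * t))" using t2 t0 by (simp add: algebra_simps)
    then have k: "q s \<bullet> (Y t - y s) \<le> C * Dc * t\<^sup>2"
      by (rule key[OF s noS, rotated -1]) (use t0 Ylip[of t] Rr0 in auto)
    have "(t - 0) *\<^sub>R (q s \<bullet> f (y s) \<omega> - Q * (L * (N * t))) \<le> q s \<bullet> (Y t - Y 0)"
    proof (rule has_integral_le)
      show "((\<lambda>c. q s \<bullet> f (y s) \<omega> - Q * (L * (N * t))) has_integral (t - 0) *\<^sub>R (q s \<bullet> f (y s) \<omega> - Q * (L * (N * t)))) {0..t}"
        using has_integral_const_real[of "q s \<bullet> f (y s) \<omega> - Q * (L * (N * t))" 0 t] t0 by simp
      show "((\<lambda>c. q s \<bullet> f (Y c) \<omega>) has_integral q s \<bullet> (Y t - Y 0)) {0..t}"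
        by (rule traj_inner_integral[OF Y]) (use t0 in auto)
      fix c assume c: "c \<in> {0..t}"
      have "\<bar>q s \<bullet> (f (Y c) \<omega> - f (y s) \<omega>)\<bar> \<le> norm (q s) * norm (f (Y c) \<omega> - f (y s) \<omega>)" by (rule Cauchy_Schwarz_ineq2)
      also have "\<dots> \<le> Q * (L * (N * t))"
      proof (rule mult_mono)
        show "norm (q s) \<le> Q" using Qb s s\<tau> by simp
        have "norm (f (Y c) \<omega> - f (y s) \<omega>) \<le> L * norm (Y c - y s)" by (rule f_lip[OF \<omega>])
        also have "\<dots> \<le> L * (N * t)" using Ylip[of c] c GL by (intro mult_left_mono) (auto intro: order_trans)
        finally show "norm (f (Y c) \<omega> - f (y s) \<omega>) \<le> L * (N * t)" .
      qed (use Q in auto)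
      finally show "q s \<bullet> f (y s) \<omega> - Q * (L * (N * t)) \<le> q s \<bullet> f (Y c) \<omega>" by (simp add: inner_diff_right)
    qed
    then have "t * (q s \<bullet> f (y s) \<omega>) \<le> t * (C3 * t)"
      using k Y0 by (simp add: C3_def power2_eq_square algebra_simps)
    then show ?thesis using t0 by simp
  qed
  \<comment> \<open>Now \<open>z\<close> is the earlier point \<open>y (s - t)\<close>: its value
    exceeds \<open>J s\<close>, since the running cost of at least r0 t outweighs the tolerance t^2.
    So \<open>key\<close> applies with a = 0.\<close>
  have lower: "- (C3 * t\<^sup>2) \<le> integral {s-t..s} (\<lambda>c. q c \<bullet> f (y c) (u c))" if s: "t \<le> s" "s \<le> \<tau> - C4 * t" for s
  proof -
    have C4t: "C4 * t > 0" using C4 t0 by simp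
    have s': "0 \<le> s - t" "s - t < \<tau>" "0 \<le> s" "s \<le> \<tau>" using s t0 C4t by auto
    have qc: "continuous_on {s-t..s} q"
      by (rule continuous_on_subset[of "{0..\<tau>}"]) (use q(1) s' t0 in \<open>auto simp: adjoint_arc_def\<close>)
    have "J (s - t) = integral {s-t..s} (\<lambda>t. r (y t) (u t)) + J s"
      unfolding J_def using Henstock_Kurzweil_Integration.integral_combine[of "s-t" s \<tau> "\<lambda>t. r (y t) (u t)"]
        traj_r_integrable[OF tr s'(1), of \<tau>] s' t0 by simp
    moreover have "r0 * t \<le> integral {s-t..s} (\<lambda>t. r (y t) (u t))" using r_integral_ge[OF tr s'(1), of s] t0 by simp
    moreover have "J (s - t) \<le> V (y (s - t)) + t\<^sup>2" by (rule JV) (use s' in auto)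
    moreover have "t\<^sup>2 < r0 * t"
    proof -
      have "t < r0" using t(2) GL t0 by linarith
      then show ?thesis using t0 by (simp add: power2_eq_square)
    qed
    ultimately have "V (y (s - t)) > J s + 0" by linarith
    then have "q s \<bullet> (y (s - t) - y s) \<le> C * Dc * t\<^sup>2"
      by (rule key[OF s'(3) s(2) ntS[OF s'(1,2)], rotated -1])
        (use traj_lip[OF tr s'(3,1)] t0 Rr0 in auto)
    then have k: "- (C * Dc * t\<^sup>2) \<le> q s \<bullet> (y s - y (s - t))" by (simp add: inner_diff_right)
    have "q s \<bullet> (y s - y (s - t)) + (s - (s - t)) *\<^sub>R (- (Q * L * t * N)) \<le> integral {s-t..s} (\<lambda>c. q c \<bullet> f (y c) (u c))"
    proof (rule has_integral_le)
      show "((\<lambda>c. q s \<bullet> f (y c) (u c) + - (Q * L * t * N)) has_integral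
          q s \<bullet> (y s - y (s - t)) + (s - (s - t)) *\<^sub>R (- (Q * L * t * N))) {s-t..s}"
        by (intro has_integral_add traj_inner_integral[OF tr])
          (use has_integral_const_real[of "- (Q * L * t * N)" "s-t" s] s' t0 in auto)
      show "((\<lambda>c. q c \<bullet> f (y c) (u c)) has_integral integral {s-t..s} (\<lambda>c. q c \<bullet> f (y c) (u c))) {s-t..s}"
        by (rule integrable_integral[OF inner_velocity_integrable[OF tr qc s'(1)]])
      fix c assume c: "c \<in> {s-t..s}"
      have "\<bar>(q s - q c) \<bullet> f (y c) (u c)\<bar> \<le> norm (q s - q c) * norm (f (y c) (u c))" by (rule Cauchy_Schwarz_ineq2)
      also have "\<dots> \<le> (Q * L * t) * N"
        using qlip[of s c] c s' Q GL t0 f_bound[OF traj_in_U[OF tr], of c "y c"] by (intro mult_mono) auto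
      finally show "q s \<bullet> f (y c) (u c) + - (Q * L * t * N) \<le> q c \<bullet> f (y c) (u c)" by (simp add: inner_diff_left)
    qed
    then show ?thesis using k by (simp add: C3_def power2_eq_square algebra_simps)
  qed
  \<comment> \<open>The number of whole steps before the excluded final piece; rounding down makes
    the uncovered end \<open>h\<close> at most (C4 + 1) t.\<close>
  define m where "m = nat \<lfloor>(\<tau> - C4 * t) / t\<rfloor>"
  have pos: "(\<tau> - C4 * t) / t \<ge> 0"
  proof (rule divide_nonneg_pos[OF _ t0])
    have "C4 * t + 2 * t \<le> T" using tT by (simp add: distrib_right)
    then show "0 \<le> \<tau> - C4 * t" using \<tau>(3) t0 by linarith
  qed
  have m: "real m * t \<le> \<tau> - C4 * t" "\<tau> - C4 * t \<le> (real m + 1) * t"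
  proof -
    have "real m \<le> (\<tau> - C4 * t) / t" unfolding m_def using pos by (simp add: of_nat_floor)
    then show "real m * t \<le> \<tau> - C4 * t" using t0 by (simp add: pos_le_divide_eq)
    have "(\<tau> - C4 * t) / t \<le> real m + 1" unfolding m_def using pos by linarith
    then show "\<tau> - C4 * t \<le> (real m + 1) * t" using t0 by (simp add: pos_divide_le_eq)
  qed
  have C4t: "C4 * t > 0" using C4 t0 by simp
  have sum: "j \<le> m \<Longrightarrow> - (real j * (C3 * t\<^sup>2)) \<le> integral {0..real j * t} (\<lambda>c. q c \<bullet> f (y c) (u c))" for j
  proof (induction j)
    case 0 then show ?case by simp
  next
    case (Suc j)
    have jt: "real (Suc j) * t \<le> real m * t" using Suc.prems t0 by (intro mult_right_mono) auto
    have e: "real (Suc j) * t - t = real j * t" by (simp add: algebra_simps)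
    have j0: "0 \<le> real j * t" using t0 by simp
    have qc: "continuous_on {0..real (Suc j) * t} q"
      by (rule continuous_on_subset[of "{0..\<tau>}"]) (use q(1) jt m C4t in \<open>auto simp: adjoint_arc_def\<close>)
    have "integral {0..real (Suc j) * t} (\<lambda>c. q c \<bullet> f (y c) (u c))
        = integral {0..real j * t} (\<lambda>c. q c \<bullet> f (y c) (u c)) + integral {real (Suc j) * t - t..real (Suc j) * t} (\<lambda>c. q c \<bullet> f (y c) (u c))"
      unfolding e
      by (rule Henstock_Kurzweil_Integration.integral_combine[OF j0 _ inner_velocity_integrable[OF tr qc order_refl], symmetric])
        (use e t0 in linarith)
    moreover have "- (C3 * t\<^sup>2) \<le> integral {real (Suc j) * t - t..real (Suc j) * t} (\<lambda>c. q c \<bullet> f (y c) (u c))"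
      by (rule lower) (use e j0 jt m in linarith)+
    ultimately show ?case using Suc by (simp add: distrib_right)
  qed
  define h where "h = \<tau> - real m * t"
  show ?thesis
  proof (rule that[of u y \<tau> q h])
    show "near_opt \<kappa> x T xs u y \<tau>" by (rule near_opt_mono[OF no]) (use t2 tk in linarith)
    show "0 \<le> h" using m C4t by (simp add: h_def)
    show "h \<le> \<kappa>" using m(2) tk(2) by (simp add: h_def algebra_simps)
    show "h \<le> \<tau>" using t0 by (simp add: h_def)
    show "q s \<bullet> f (y s) \<omega> \<le> \<kappa>" if "0 \<le> s" "s \<le> \<tau> - h" "\<omega> \<in> U" for s \<omega>
      using upper[OF that(1) _ that(3)] that(2) m(1) tk(1) by (simp add: h_def)
    have "real m * t * (C3 * t) \<le> M' * (C3 * t)"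
      using m C4t \<tau> C3 t0 by (intro mult_right_mono) auto
    then have "real m * (C3 * t\<^sup>2) \<le> \<kappa>" using tk(3) by (simp add: power2_eq_square algebra_simps)
    then show "- \<kappa> \<le> integral {0..\<tau> - h} (\<lambda>s. q s \<bullet> f (y s) (u s))" using sum[of m] by (simp add: h_def)
  qed (use q in auto)
qed

end

section \<open>Abnormal extremals as approximate Hamiltonian arcs\<close>

lemma norm_inner_dim1:
  assumes "CARD('d::finite) = 1"
  shows "\<bar>(a :: real^'d) \<bullet> b\<bar> = norm a * norm b"
proof -
  obtain i :: 'd where i: "UNIV = {i}" using assms card_1_singletonE by blast
  have n: "norm c = \<bar>c $ i\<bar>" for c :: "real^'d" by (simp add: norm_vec_def L2_set_def i)
  show ?thesis by (simp add: inner_vec_def i n abs_mult)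
qed

lemma arc_on_minus:
  assumes "arc_on a b y y'"
  shows "arc_on a b (\<lambda>t. - y t) (\<lambda>t. - y' t)"
  unfolding arc_on_def
proof (intro allI impI)
  fix s t assume "a \<le> s" "s \<le> t" "t \<le> b"
  from has_integral_neg[OF arc_onD[OF assms this]]
  show "((\<lambda>t. - y' t) has_integral - y t - - y s) {s..t}" by (simp add: algebra_simps)
qed

text \<open>A compact part of phase space whose covectors stay away from 0, the only place where
  smoothness of \<open>H0\<close> is not assumed.\<close>

definition annulus :: "real \<Rightarrow> (('a::euclidean_space) \<times> ('b::euclidean_space)) set" where
  "annulus R = {(y, p). norm y \<le> R \<and> 1 / R \<le> norm p \<and> norm p \<le> R}"

lemma compact_annulus: "compact (annulus R)"
proof -
  have "annulus R = cball 0 R \<times> {p. 1 / R \<le> norm p \<and> norm p \<le> R}" by (auto simp: annulus_def)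
  moreover have "compact {p::'b. 1 / R \<le> norm p \<and> norm p \<le> R}"
  proof (rule compact_eq_bounded_closed[THEN iffD2], intro conjI)
    show "bounded {p::'b. 1 / R \<le> norm p \<and> norm p \<le> R}" unfolding bounded_iff by blast
    show "closed {p::'b. 1 / R \<le> norm p \<and> norm p \<le> R}" by (intro closed_Collect_conj closed_Collect_le continuous_intros)
  qed
  ultimately show ?thesis by (metis compact_Times compact_cball)
qed

text \<open>Signs for the covector p = - q: \<open>H0\<close> maximizes - p . f, so its gradient in
  p is minus the optimal velocity, and its gradient in x is the derivative of p along the
  extremal.\<close>

definition hamiltonian_field :: "('a \<times> 'b \<Rightarrow> 'a \<times> 'b) \<Rightarrow> 'a \<times> 'b \<Rightarrow> ('b::ab_group_add) \<times> 'a" where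
  "hamiltonian_field DH z = (- snd (DH z), fst (DH z))"

context exit_problem
begin

lemma H0_ge:
  assumes "\<omega> \<in> U" shows "- (p \<bullet> f x \<omega>) \<le> H0 U f x p"
  unfolding H0_def
proof (rule cSUP_upper[OF assms])
  have "- (p \<bullet> f x \<omega>) \<le> norm p * N" if "\<omega> \<in> U" for \<omega>
  proof -
    have "\<bar>p \<bullet> f x \<omega>\<bar> \<le> norm p * norm (f x \<omega>)" by (rule Cauchy_Schwarz_ineq2)
    also have "\<dots> \<le> norm p * N" using f_bound[OF that] by (intro mult_left_mono) auto
    finally show ?thesis by linarith
  qed
  then show "bdd_above ((\<lambda>\<omega>. - (p \<bullet> f x \<omega>)) ` U)" by (auto intro!: bdd_aboveI2)
qed

lemma H0_le: "(\<And>\<omega>. \<omega> \<in> U \<Longrightarrow> - (p \<bullet> f x \<omega>) \<le> c) \<Longrightarrow> H0 U f x p \<le> c"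
  unfolding H0_def by (rule cSUP_least[OF U_ne])

text \<open>For fixed \<open>\<omega>\<close> the function \<open>H0 + p \<bullet> f\<close> is nonnegative with Lipschitz gradient, so its gradient
  is small wherever its value is. Hence an almost optimal velocity almost satisfies the Hamiltonian system.\<close>

lemma hamiltonian_defect:
  assumes DH: "\<And>z. z \<in> UNIV \<times> (UNIV - {0}) \<Longrightarrow> GDERIV (\<lambda>(x, p). H0 U f x p) z :> DH z"
    and loc: "locally_lipschitz_on (UNIV \<times> (UNIV - {0})) DH" and R: "R > 0"
  obtains \<rho> C where "\<rho> > 0" "C \<ge> 0"
    "\<And>y p \<omega> t. (y, p) \<in> annulus R \<Longrightarrow> \<omega> \<in> U \<Longrightarrow> 0 < t \<Longrightarrow> t < \<rho> \<Longrightarrow>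
      norm ((f y \<omega>, - DfT y \<omega> p) - hamiltonian_field DH (y, p)) \<le> (H0 U f y p + p \<bullet> f y \<omega>) / t + C * t"
proof -
  let ?W = "UNIV \<times> (UNIV - {0}) :: ((real^'d) \<times> (real^'d)) set"
  have W: "open ?W" by (intro open_Times open_delete) auto
  have KW: "annulus R \<subseteq> ?W" using R by (auto simp: annulus_def)
  obtain \<rho> C where \<rho>: "\<rho> > 0" "C \<ge> 0" "\<And>z. z \<in> annulus R \<Longrightarrow> ball z \<rho> \<subseteq> ?W"
    "\<And>z w. z \<in> annulus R \<Longrightarrow> w \<in> ball z \<rho> \<Longrightarrow> norm (DH w - DH z) \<le> C * norm (w - z)"
    by (rule locally_lipschitz_compact[OF loc W compact_annulus KW]) (rule that)
  let ?H = "\<lambda>z. case z of (x, p) \<Rightarrow> H0 U f x p"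
  have taylor: "?H w \<le> ?H z + DH z \<bullet> (w - z) + C * (norm (w - z))\<^sup>2" if z: "z \<in> annulus R" and w: "w \<in> ball z \<rho>" for z w
  proof -
    have seg: "closed_segment z w \<subseteq> ball z \<rho>" by (rule closed_segment_subset) (use w \<rho> in auto)
    have "norm (?H w - ?H z - inner (w - z) (DH z)) \<le> norm (w - z) * (C * norm (w - z))"
    proof (rule differentiable_bound_linearization[where S="closed_segment z w" and f'="\<lambda>x h. inner h (DH x)"])
      show "z + t *\<^sub>R (w - z) \<in> closed_segment z w" if "t \<in> {0..1}" for t
        using that by (auto simp: closed_segment_def algebra_simps intro!: exI[of _ t])
      show "(?H has_derivative (\<lambda>h. inner h (DH x))) (at x within closed_segment z w)" if "x \<in> closed_segment z w" for x
        using DH[of x] \<rho>(3)[OF z] seg that unfolding gderiv_def by (blast intro: has_derivative_at_withinI)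
      show "onorm ((\<lambda>h. inner h (DH x)) - (\<lambda>h. inner h (DH z))) \<le> C * norm (w - z)" if x: "x \<in> closed_segment z w" for x
      proof (rule onorm_le)
        fix h
        have "norm (((\<lambda>h. inner h (DH x)) - (\<lambda>h. inner h (DH z))) h) = \<bar>h \<bullet> (DH x - DH z)\<bar>"
          by (simp add: inner_diff_right)
        also have "\<dots> \<le> norm h * norm (DH x - DH z)" by (rule Cauchy_Schwarz_ineq2)
        also have "\<dots> \<le> norm h * (C * norm (w - z))"
        proof (rule mult_left_mono)
          have "norm (DH x - DH z) \<le> C * norm (x - z)" using \<rho>(4)[OF z] seg x by blast
          also have "\<dots> \<le> C * norm (w - z)" using \<rho>(2) segment_bound1[OF x] by (intro mult_left_mono) (auto simp: norm_minus_commute)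
          finally show "norm (DH x - DH z) \<le> C * norm (w - z)" .
        qed simp
        finally show "norm (((\<lambda>h. inner h (DH x)) - (\<lambda>h. inner h (DH z))) h) \<le> C * norm (w - z) * norm h"
          by (simp add: mult.commute)
      qed
    qed simp
    then show ?thesis by (simp add: power2_eq_square inner_commute algebra_simps abs_le_iff)
  qed
  define C1 where "C1 = C + L + R * L"
  have C1: "C1 \<ge> 0" using \<rho>(2) L_pos R by (simp add: C1_def)
  show ?thesis
  proof (rule that[OF \<rho>(1) C1])
    fix y p :: "real^'d" and \<omega> and t :: real assume yp: "(y, p) \<in> annulus R" and \<omega>: "\<omega> \<in> U" and t: "0 < t" "t < \<rho>"
    \<comment> \<open>The gradient at \<open>(y, p)\<close> of \<open>H0\<close> + p . f for fixed
      \<omega>; up to signs of its components it is the defect to be estimated.\<close>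
    define g1 where "g1 = (DfT y \<omega> p + fst (DH (y, p)), f y \<omega> + snd (DH (y, p)))"
    define \<eta> where "\<eta> = H0 U f y p + p \<bullet> f y \<omega>"
    have \<eta>: "\<eta> \<ge> 0" using H0_ge[OF \<omega>, of p y] by (simp add: \<eta>_def)
    have "(norm ((f y \<omega>, - DfT y \<omega> p) - hamiltonian_field DH (y, p)))\<^sup>2 = (norm g1)\<^sup>2"
    proof -
      have "norm (- DfT y \<omega> p - fst (DH (y, p))) = norm (DfT y \<omega> p + fst (DH (y, p)))"
        by (metis minus_add_distrib norm_minus_cancel uminus_add_conv_diff add.commute diff_conv_add_uminus)
      then show ?thesis by (simp add: hamiltonian_field_def g1_def norm_Pair_power2 add.commute)
    qed
    then have ng: "norm ((f y \<omega>, - DfT y \<omega> p) - hamiltonian_field DH (y, p)) = norm g1" by simp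
    have "norm g1 \<le> \<eta> / t + C1 * t"
    proof (cases "g1 = 0")
      case True then show ?thesis using \<eta> t C1 by simp
    next
      case False
      \<comment> \<open>A step of length t against the gradient. The function cannot become
        negative, whence t |g1| \<le> \<eta> + C1 t^2.\<close>
      define D where "D = - (t / norm g1) *\<^sub>R g1"
      have nD: "norm D = t" using t False by (simp add: D_def)
      obtain a b where ab: "D = (a, b)" by (cases D)
      have nab: "norm a \<le> t" "norm b \<le> t" using norm_fst_le[of a b] norm_snd_le[of b a] nD ab by auto
      have inb: "(y, p) + D \<in> ball (y, p) \<rho>" using nD t by (simp add: dist_norm)
      have np: "norm p \<le> R" using yp by (simp add: annulus_def)
      have 1: "H0 U f (y + a) (p + b) \<le> H0 U f y p + DH (y, p) \<bullet> D + C * t\<^sup>2"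
        using taylor[OF yp inb] nD ab by simp
      have 2: "(p + b) \<bullet> f (y + a) \<omega> \<le> p \<bullet> f y \<omega> + DfT y \<omega> p \<bullet> a + b \<bullet> f y \<omega> + (L + R * L) * t\<^sup>2"
      proof -
        have "p \<bullet> (f (y + a) \<omega> - f y \<omega> - Df y \<omega> a) \<le> norm p * norm (f (y + a) \<omega> - f y \<omega> - Df y \<omega> a)"
          by (rule norm_cauchy_schwarz)
        also have "\<dots> \<le> R * (L * t\<^sup>2)"
        proof (rule mult_mono[OF np])
          have "norm (f (y + a) \<omega> - f y \<omega> - Df y \<omega> a) \<le> L * (norm a)\<^sup>2" using f_taylor[OF \<omega>, of "y + a" y] by simp
          also have "\<dots> \<le> L * t\<^sup>2" using nab L_pos by (intro mult_left_mono power_mono) auto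
          finally show "norm (f (y + a) \<omega> - f y \<omega> - Df y \<omega> a) \<le> L * t\<^sup>2" .
        qed (use R in auto)
        finally have a1: "p \<bullet> f (y + a) \<omega> \<le> p \<bullet> f y \<omega> + DfT y \<omega> p \<bullet> a + R * (L * t\<^sup>2)"
          by (simp add: inner_diff_right DfT_inner)
        have "b \<bullet> (f (y + a) \<omega> - f y \<omega>) \<le> norm b * norm (f (y + a) \<omega> - f y \<omega>)" by (rule norm_cauchy_schwarz)
        also have "\<dots> \<le> t * (L * t)"
        proof (rule mult_mono[OF nab(2)])
          have "norm (f (y + a) \<omega> - f y \<omega>) \<le> L * norm a" using f_lip[OF \<omega>, of "y + a" y] by simp
          also have "\<dots> \<le> L * t" using nab L_pos by simp
          finally show "norm (f (y + a) \<omega> - f y \<omega>) \<le> L * t" .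
        qed (use t in auto)
        finally have a2: "b \<bullet> f (y + a) \<omega> \<le> b \<bullet> f y \<omega> + L * t\<^sup>2" by (simp add: inner_diff_right power2_eq_square algebra_simps)
        show ?thesis using a1 a2 by (simp add: inner_add_left algebra_simps)
      qed
      have "g1 \<bullet> D = DH (y, p) \<bullet> D + DfT y \<omega> p \<bullet> a + b \<bullet> f y \<omega>"
        by (simp add: g1_def ab inner_prod_def inner_add_left inner_commute[of b])
      moreover have "g1 \<bullet> D = - (t * norm g1)"
        using False by (simp add: D_def power2_norm_eq_inner[symmetric] power2_eq_square)
      moreover have "0 \<le> H0 U f (y + a) (p + b) + (p + b) \<bullet> f (y + a) \<omega>"
        using H0_ge[OF \<omega>, of "p + b" "y + a"] by simp
      ultimately have "t * norm g1 \<le> \<eta> + C1 * t\<^sup>2" using 1 2 by (simp add: \<eta>_def C1_def algebra_simps)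
      then show ?thesis using t by (simp add: field_simps power2_eq_square)
    qed
    then show "norm ((f y \<omega>, - DfT y \<omega> p) - hamiltonian_field DH (y, p)) \<le> (H0 U f y p + p \<bullet> f y \<omega>) / t + C1 * t"
      unfolding ng \<eta>_def .
  qed
qed

lemma adjoint_lower:
  assumes "adjoint_arc 0 T u y q" "traj x u y" "t \<in> {0..T}"
  shows "norm (q T) * exp (- (L * T)) \<le> norm (q t)"
proof -
  have "norm (q T) \<le> norm (q t) * exp (L * T)" using adjoint_bounds(2)[OF assms(1) _ assms(2,3)] by simp
  then have "norm (q T) * exp (- (L * T)) \<le> norm (q t) * exp (L * T) * exp (- (L * T))" by (intro mult_right_mono) auto
  also have "\<dots> = norm (q t)" by (simp add: mult.assoc exp_add[symmetric])
  finally show ?thesis .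
qed

text \<open>The two inequalities of \<open>abnormal_pontryagin\<close> bound the integral of \<eta>,
  the gap in the maximum condition; \<open>hamiltonian_defect\<close> with a fixed step t turns the
  gap into the defect \<eta> / t + C t of the Hamiltonian system.\<close>

lemma abnormal_approx_arc:
  assumes DH: "\<And>z. z \<in> UNIV \<times> (UNIV - {0}) \<Longrightarrow> GDERIV (\<lambda>(x, p). H0 U f x p) z :> DH z"
    and loc: "locally_lipschitz_on (UNIV \<times> (UNIV - {0})) DH"
    and le: "limit_end x T xs" and x: "x \<notin> S" and T: "T > 0" and M: "M \<ge> 1"
    and td: "terminal_data M xs v \<zeta> 0" and R: "R > 0" "norm x + N * (T + 1) \<le> R"
      "norm v * exp (L * (T + 1)) \<le> R" "1 / R \<le> norm v * exp (- (L * (T + 1)))" and \<kappa>: "\<kappa> > 0"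
  shows "\<exists>T' w0. \<bar>T' - T\<bar> \<le> \<kappa> \<and> 0 < T' \<and> fst w0 = x \<and> approx_arc (hamiltonian_field DH) (annulus R) \<kappa> T' w0 (xs, - v)"
proof -
  obtain \<rho> C where \<rho>: "\<rho> > 0" "C \<ge> 0" and defect:
    "\<And>y p \<omega> t. (y, p) \<in> annulus R \<Longrightarrow> \<omega> \<in> U \<Longrightarrow> 0 < t \<Longrightarrow> t < \<rho> \<Longrightarrow>
      norm ((f y \<omega>, - DfT y \<omega> p) - hamiltonian_field DH (y, p)) \<le> (H0 U f y p + p \<bullet> f y \<omega>) / t + C * t"
    by (rule hamiltonian_defect[OF DH loc R(1)]) (assumption, rule that)
  \<comment> \<open>This fixes the share of C t in the total defect at \<kappa> / 2.\<close>
  define t where "t = min (\<rho> / 2) (\<kappa> / (2 * ((C + 1) * (T + 1))))"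
  have CT: "(C + 1) * (T + 1) > 0" using \<rho> T by simp
  have t: "t > 0" "t < \<rho>" using \<rho> \<kappa> CT by (auto simp: t_def)
  have tC: "C * t * (T + 1) \<le> \<kappa> / 2"
  proof -
    have "C * t * (T + 1) \<le> ((C + 1) * (T + 1)) * t" using T t by (simp add: algebra_simps)
    also have "\<dots> \<le> ((C + 1) * (T + 1)) * (\<kappa> / (2 * ((C + 1) * (T + 1))))"
      using CT by (intro mult_left_mono) (auto simp: t_def)
    also have "\<dots> = \<kappa> / 2"
    proof -
      have "a * (k / (2 * a)) = k / 2" if "a > 0" for a k :: real using that by simp
      then show ?thesis using CT by blast
    qed
    finally show ?thesis .
  qed
  define B1 where "B1 = T + 2 + 2 * R * N"
  have B1: "B1 > 0" using T R N_pos by (simp add: B1_def add_pos_nonneg)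
  \<comment> \<open>Chosen after t, so that the integral of \<eta> divided by t is at most \<kappa>
    / 2; \<open>B1\<close> adds the contributions of \<open>I1\<close> and
    \<open>I2\<close>.\<close>
  define \<kappa>1 where "\<kappa>1 = min 1 (min \<kappa> (\<kappa> * t / (2 * B1)))"
  have "\<kappa> * t / (2 * B1) > 0" using \<kappa> t B1 by simp
  then have \<kappa>1: "\<kappa>1 > 0" using \<kappa> by (simp add: \<kappa>1_def)
  have \<kappa>1': "\<kappa>1 \<le> 1" "\<kappa>1 \<le> \<kappa>" "\<kappa>1 \<le> \<kappa> * t / (2 * B1)" unfolding \<kappa>1_def by linarith+
  obtain u y \<tau> q h where no: "near_opt \<kappa>1 x T xs u y \<tau>" and q: "adjoint_arc 0 \<tau> u y q" "q \<tau> = v"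
    and h: "0 \<le> h" "h \<le> \<kappa>1" "h \<le> \<tau>" and up: "\<And>s \<omega>. 0 \<le> s \<Longrightarrow> s \<le> \<tau> - h \<Longrightarrow> \<omega> \<in> U \<Longrightarrow> q s \<bullet> f (y s) \<omega> \<le> \<kappa>1"
    and low: "- \<kappa>1 \<le> integral {0..\<tau> - h} (\<lambda>s. q s \<bullet> f (y s) (u s))"
    by (rule abnormal_pontryagin[OF le x T M td \<kappa>1]) (rule that)
  have tr: "traj x u y" and hit: "is_hitting_time S y \<tau>" and \<tau>T: "\<bar>\<tau> - T\<bar> \<le> \<kappa>1" and yx: "norm (y \<tau> - xs) \<le> \<kappa>1"
    using no by (auto simp: near_opt_def)
  have \<tau>: "\<tau> > 0" "\<tau> \<le> T + 1" using hitting_point_frontier(2)[OF tr x hit] \<tau>T \<kappa>1' by linarith+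
  have ann: "(y s, - q s) \<in> annulus R" if s: "s \<in> {0..\<tau>}" for s
  proof -
    have "norm (y s) \<le> norm x + N * s"
      using traj_lip[OF tr order_refl, of s] traj_arc(2)[OF tr] norm_triangle_sub[of "y s" x] s by simp
    also have "\<dots> \<le> R"
    proof -
      have "N * s \<le> N * (T + 1)" using s \<tau> N_pos by (intro mult_left_mono) auto
      then show ?thesis using R by linarith
    qed
    finally have 1: "norm (y s) \<le> R" .
    have "norm (q s) \<le> norm v * exp (L * \<tau>)" using adjoint_bounds(1)[OF q(1) _ tr s] q(2) by simp
    also have "\<dots> \<le> norm v * exp (L * (T + 1))" using \<tau> L_pos by (intro mult_left_mono) auto
    finally have 2: "norm (q s) \<le> R" using R by linarith
    have "norm v * exp (- (L * (T + 1))) \<le> norm v * exp (- (L * \<tau>))" using \<tau> L_pos by (intro mult_left_mono) auto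
    also have "\<dots> \<le> norm (q s)" using adjoint_lower[OF q(1) tr s] q(2) by simp
    finally have "1 / R \<le> norm (q s)" using R by linarith
    then show ?thesis using 1 2 by (simp add: annulus_def)
  qed
  define \<eta> where "\<eta> s = H0 U f (y s) (- q s) + (- q s) \<bullet> f (y s) (u s)" for s
  define \<delta> where "\<delta> s = \<eta> s / t + C * t" for s
  have Us: "u s \<in> U" if "s \<in> {0..\<tau>}" for s using traj_in_U[OF tr] that by simp
  have qc: "continuous_on {0..\<tau>} q" using q by (simp add: adjoint_arc_def)
  have yc: "continuous_on {0..\<tau>} y" by (rule traj_continuous[OF tr order_refl])
  have Hc: "continuous_on {0..\<tau>} (\<lambda>s. H0 U f (y s) (- q s))"
  proof -
    have "continuous_on (UNIV \<times> (UNIV - {0})) (\<lambda>(x, p). H0 U f x p)"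
    proof (rule continuous_at_imp_continuous_on, rule ballI)
      fix z :: "(real^'d) \<times> (real^'d)" assume "z \<in> UNIV \<times> (UNIV - {0})"
      from DH[OF this] show "isCont (\<lambda>(x, p). H0 U f x p) z"
        unfolding gderiv_def by (rule has_derivative_continuous)
    qed
    then have "continuous_on {0..\<tau>} (\<lambda>s. (\<lambda>(x, p). H0 U f x p) (y s, - q s))"
    proof -
      have "(\<lambda>s. (y s, - q s)) ` {0..\<tau>} \<subseteq> UNIV \<times> (UNIV - {0})"
      proof
        fix z assume "z \<in> (\<lambda>s. (y s, - q s)) ` {0..\<tau>}"
        then obtain s where s: "s \<in> {0..\<tau>}" "z = (y s, - q s)" by blast
        have "0 < 1 / R" using R by simp
        then have "norm (q s) > 0" using ann[OF s(1)] unfolding annulus_def by auto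
        then show "z \<in> UNIV \<times> (UNIV - {0})" using s by auto
      qed
      then show ?thesis
        by (intro continuous_on_compose2[OF \<open>continuous_on (UNIV \<times> (UNIV - {0})) _\<close>] continuous_intros yc qc)
    qed
    then show ?thesis by simp
  qed
  have Hi: "(\<lambda>s. H0 U f (y s) (- q s)) integrable_on {a..b}" if "0 \<le> a" "b \<le> \<tau>" for a b
    by (rule integrable_continuous_real[OF continuous_on_subset[OF Hc]]) (use that in auto)
  have vi: "(\<lambda>s. q s \<bullet> f (y s) (u s)) integrable_on {a..b}" if "0 \<le> a" "b \<le> \<tau>" for a b
    by (rule inner_velocity_integrable[OF tr continuous_on_subset[OF qc]]) (use that in auto)
  have \<eta>eq: "\<eta> = (\<lambda>s. H0 U f (y s) (- q s) - q s \<bullet> f (y s) (u s))" by (simp add: \<eta>_def fun_eq_iff)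
  have \<eta>i: "\<eta> integrable_on {a..b}" if "0 \<le> a" "b \<le> \<tau>" for a b
    unfolding \<eta>eq by (intro integrable_diff Hi vi that)
  have I1: "integral {0..\<tau> - h} \<eta> \<le> \<kappa>1 * (T + 1) + \<kappa>1"
  proof -
    have "integral {0..\<tau> - h} \<eta> = integral {0..\<tau> - h} (\<lambda>s. H0 U f (y s) (- q s)) - integral {0..\<tau> - h} (\<lambda>s. q s \<bullet> f (y s) (u s))"
      unfolding \<eta>eq by (rule integral_diff) (use Hi vi h in auto)
    moreover have "integral {0..\<tau> - h} (\<lambda>s. H0 U f (y s) (- q s)) \<le> integral {0..\<tau> - h} (\<lambda>s. \<kappa>1)"
    proof (rule integral_le)
      show "H0 U f (y s) (- q s) \<le> \<kappa>1" if "s \<in> {0..\<tau> - h}" for s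
        by (rule H0_le) (use up that in auto)
    qed (use Hi h in auto)
    moreover have "integral {0..\<tau> - h} (\<lambda>s. \<kappa>1) \<le> \<kappa>1 * (T + 1)"
    proof -
      have "(\<tau> - h) * \<kappa>1 \<le> (T + 1) * \<kappa>1" using h \<tau> \<kappa>1 by (intro mult_right_mono) auto
      then show ?thesis using h by (simp add: mult.commute)
    qed
    ultimately show ?thesis using low by linarith
  qed
  \<comment> \<open>No maximum condition is available on the final piece, but there the gap is
    bounded and the piece is no longer than \<kappa>1.\<close>
  have I2: "integral {\<tau> - h..\<tau>} \<eta> \<le> 2 * R * N * \<kappa>1"
  proof -
    have "integral {\<tau> - h..\<tau>} \<eta> \<le> integral {\<tau> - h..\<tau>} (\<lambda>s. 2 * R * N)"
    proof (rule integral_le)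
      fix s assume s: "s \<in> {\<tau> - h..\<tau>}"
      then have s': "s \<in> {0..\<tau>}" using h by auto
      have b: "\<bar>q s \<bullet> f (y s) \<omega>\<bar> \<le> R * N" if "\<omega> \<in> U" for \<omega>
        by (rule order_trans[OF Cauchy_Schwarz_ineq2 mult_mono])
          (use ann[OF s'] f_bound[OF that] R in \<open>auto simp: annulus_def\<close>)
      have "H0 U f (y s) (- q s) \<le> R * N" by (rule H0_le) (use b in force)
      then show "\<eta> s \<le> 2 * R * N" using b[OF Us[OF s']] by (simp add: \<eta>eq)
    qed (use \<eta>i h in auto)
    also have "\<dots> = 2 * R * N * h" using h by simp
    also have "\<dots> \<le> 2 * R * N * \<kappa>1" using h R N_pos by (intro mult_left_mono) auto
    finally show ?thesis .
  qed
  have I: "integral {0..\<tau>} \<eta> \<le> \<kappa>1 * B1"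
    using Henstock_Kurzweil_Integration.integral_combine[of 0 "\<tau> - h" \<tau> \<eta>] \<eta>i[of 0 \<tau>] h I1 I2
    by (simp add: B1_def algebra_simps)
  have \<delta>i: "\<delta> integrable_on {0..\<tau>}" unfolding \<delta>_def
    by (intro integrable_add integrable_on_divide \<eta>i) auto
  have "integral {0..\<tau>} \<delta> = integral {0..\<tau>} \<eta> / t + C * t * \<tau>"
    unfolding \<delta>_def using \<eta>i[of 0 \<tau>] \<tau> by (subst integral_add) (auto intro: integrable_on_divide)
  also have "\<dots> \<le> \<kappa> / 2 + \<kappa> / 2"
  proof (rule add_mono)
    have "\<kappa>1 * B1 \<le> (\<kappa> * t / (2 * B1)) * B1" using \<kappa>1' B1 by (intro mult_right_mono) auto
    also have "\<dots> = \<kappa> * t / 2" using B1 by simp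
    finally show "integral {0..\<tau>} \<eta> / t \<le> \<kappa> / 2" using I t by (simp add: pos_divide_le_eq)
    have "C * t * \<tau> \<le> C * t * (T + 1)" using \<tau> \<rho> t by (intro mult_left_mono) auto
    then show "C * t * \<tau> \<le> \<kappa> / 2" using tC by linarith
  qed
  finally have \<delta>int: "integral {0..\<tau>} \<delta> \<le> \<kappa>" by simp
  have arcq: "arc_on 0 \<tau> (\<lambda>s. - q s) (\<lambda>s. - Q' 0 (y s) (u s) (q s))"
    by (rule arc_on_minus) (use q(1) in \<open>simp add: adjoint_arc_def\<close>)
  have "approx_arc (hamiltonian_field DH) (annulus R) \<kappa> \<tau> (x, - q 0) (xs, - v)"
    unfolding approx_arc_def
  proof (intro exI conjI ballI)
    show "arc_on 0 \<tau> (\<lambda>s. (y s, - q s)) (\<lambda>s. (f (y s) (u s), - Q' 0 (y s) (u s) (q s)))"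
      by (rule arc_on_Pair[OF traj_arc(1)[OF tr] arcq])
    show "continuous_on {0..\<tau>} (\<lambda>s. (y s, - q s))" by (intro continuous_intros yc qc)
    show "(y s, - q s) \<in> annulus R" if "s \<in> {0..\<tau>}" for s by (rule ann[OF that])
    show "norm ((f (y s) (u s), - Q' 0 (y s) (u s) (q s)) - hamiltonian_field DH (y s, - q s)) \<le> \<delta> s" if s: "s \<in> {0..\<tau>}" for s
      using defect[OF ann[OF s] Us[OF s] t] by (simp add: \<delta>_def \<eta>_def Q'_def DfT_minus)
    show "(y 0, - q 0) = (x, - q 0)" using traj_arc(2)[OF tr] by simp
    have "norm ((y \<tau>, - q \<tau>) - (xs, - v)) = norm (y \<tau> - xs)" using q(2) by (simp add: norm_Pair)
    then show "norm ((y \<tau>, - q \<tau>) - (xs, - v)) \<le> \<kappa>" using yx \<kappa>1' by simp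
  qed (use \<delta>i \<delta>int in auto)
  then show ?thesis using \<tau>T \<kappa>1' \<tau> by (intro exI[of _ \<tau>] exI[of _ "(x, - q 0)"]) auto
qed

text \<open>In dimension one |q . f| = |q| |f| with |q| bounded below, so a small integral of |q .
  f| means that the trajectory hardly moves; in the limit \<open>x = xs\<close>, which lies in
  \<open>S\<close>. This settles d = 1, where the truncated \<open>CARD('d) - 2\<close> would be
  misleading.\<close>

lemma abnormal_dim1:
  assumes le: "limit_end x T xs" and x: "x \<notin> S" and T: "T > 0" and M: "M \<ge> 1"
    and td: "terminal_data M xs v \<zeta> 0" and v: "v \<noteq> 0"
  shows "CARD('d) \<noteq> 1"
proof
  assume d1: "CARD('d) = 1"
  define c0 where "c0 = norm v * exp (- (L * (T + 1)))"
  have c0: "c0 > 0" using v by (simp add: c0_def)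
  define E where "E = (2 * (T + 1) + 1) / c0 + N + 1"
  have E: "E > 0" using T c0 N_pos by (simp add: E_def add_pos_pos)
  have bound: "norm (x - xs) \<le> E * \<kappa>1" if \<kappa>1: "0 < \<kappa>1" "\<kappa>1 \<le> 1" for \<kappa>1
  proof -
    obtain u y \<tau> q h where no: "near_opt \<kappa>1 x T xs u y \<tau>" and q: "adjoint_arc 0 \<tau> u y q" "q \<tau> = v"
      and h: "0 \<le> h" "h \<le> \<kappa>1" "h \<le> \<tau>" and up: "\<And>s \<omega>. 0 \<le> s \<Longrightarrow> s \<le> \<tau> - h \<Longrightarrow> \<omega> \<in> U \<Longrightarrow> q s \<bullet> f (y s) \<omega> \<le> \<kappa>1"
      and low: "- \<kappa>1 \<le> integral {0..\<tau> - h} (\<lambda>s. q s \<bullet> f (y s) (u s))"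
      by (rule abnormal_pontryagin[OF le x T M td \<kappa>1(1)]) (rule that)
    have tr: "traj x u y" and hit: "is_hitting_time S y \<tau>" and \<tau>T: "\<bar>\<tau> - T\<bar> \<le> \<kappa>1" and yx: "norm (y \<tau> - xs) \<le> \<kappa>1"
      using no by (auto simp: near_opt_def)
    have \<tau>: "\<tau> > 0" "\<tau> \<le> T + 1" using hitting_point_frontier(2)[OF tr x hit] \<tau>T \<kappa>1 by linarith+
    have qc: "continuous_on {0..\<tau> - h} q"
      by (rule continuous_on_subset[of "{0..\<tau>}"]) (use q h in \<open>auto simp: adjoint_arc_def\<close>)
    have vi: "(\<lambda>s. q s \<bullet> f (y s) (u s)) integrable_on {0..\<tau> - h}"
      by (rule inner_velocity_integrable[OF tr qc order_refl])
    have a: "((\<lambda>s. f (y s) (u s)) has_integral (y (\<tau> - h) - y 0)) {0..\<tau> - h}"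
      by (rule arc_onD[OF traj_arc(1)[OF tr]]) (use h in auto)
    have "norm (integral {0..\<tau> - h} (\<lambda>s. f (y s) (u s))) \<le> integral {0..\<tau> - h} (\<lambda>s. (2 * \<kappa>1 - q s \<bullet> f (y s) (u s)) / c0)"
    proof (rule integral_norm_bound_integral)
      show "(\<lambda>s. f (y s) (u s)) integrable_on {0..\<tau> - h}" using a by blast
      show "(\<lambda>s. (2 * \<kappa>1 - q s \<bullet> f (y s) (u s)) / c0) integrable_on {0..\<tau> - h}"
        by (intro integrable_on_divide integrable_diff vi) auto
      fix s assume s: "s \<in> {0..\<tau> - h}"
      have s': "s \<in> {0..\<tau>}" using s h by auto
      have "norm v * exp (- (L * (T + 1))) \<le> norm v * exp (- (L * \<tau>))" using \<tau> L_pos by (intro mult_left_mono) auto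
      also have "\<dots> \<le> norm (q s)" using adjoint_lower[OF q(1) tr s'] q(2) by simp
      finally have "c0 * norm (f (y s) (u s)) \<le> norm (q s) * norm (f (y s) (u s))"
        unfolding c0_def by (intro mult_right_mono) auto
      also have "\<dots> = \<bar>q s \<bullet> f (y s) (u s)\<bar>" by (rule norm_inner_dim1[OF d1, symmetric])
      \<comment> \<open>A number a \<le> \<kappa>1 satisfies |a| \<le> 2 \<kappa>1 - a, which makes
        the lower bound on the integral usable for the absolute value.\<close>
      also have "\<dots> \<le> 2 * \<kappa>1 - q s \<bullet> f (y s) (u s)"
        using up[of s "u s"] s traj_in_U[OF tr, of s] \<kappa>1 by auto
      finally show "norm (f (y s) (u s)) \<le> (2 * \<kappa>1 - q s \<bullet> f (y s) (u s)) / c0"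
        using c0 by (simp add: pos_le_divide_eq mult.commute)
    qed
    also have "\<dots> = (2 * \<kappa>1 * (\<tau> - h) - integral {0..\<tau> - h} (\<lambda>s. q s \<bullet> f (y s) (u s))) / c0"
    proof -
      have "integral {0..\<tau> - h} (\<lambda>s. 2 * \<kappa>1 - q s \<bullet> f (y s) (u s))
          = integral {0..\<tau> - h} (\<lambda>s. 2 * \<kappa>1) - integral {0..\<tau> - h} (\<lambda>s. q s \<bullet> f (y s) (u s))"
        by (rule integral_diff) (use vi in auto)
      then show ?thesis using h by (simp add: mult.commute)
    qed
    also have "\<dots> \<le> (2 * \<kappa>1 * (T + 1) + \<kappa>1) / c0"
    proof (rule divide_right_mono)
      have "2 * \<kappa>1 * (\<tau> - h) \<le> 2 * \<kappa>1 * (T + 1)" using \<tau> h \<kappa>1 by (intro mult_left_mono) auto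
      then show "2 * \<kappa>1 * (\<tau> - h) - integral {0..\<tau> - h} (\<lambda>s. q s \<bullet> f (y s) (u s)) \<le> 2 * \<kappa>1 * (T + 1) + \<kappa>1"
        using low by linarith
    qed (use c0 in auto)
    also have "\<dots> = ((2 * (T + 1) + 1) / c0) * \<kappa>1" by (simp add: algebra_simps add_divide_distrib)
    finally have 1: "norm (y (\<tau> - h) - x) \<le> ((2 * (T + 1) + 1) / c0) * \<kappa>1"
      using integral_unique[OF a] traj_arc(2)[OF tr] by simp
    have "norm (y \<tau> - y (\<tau> - h)) \<le> N * h" using traj_lip[OF tr, of "\<tau> - h" \<tau>] h \<tau> by simp
    also have "\<dots> \<le> N * \<kappa>1" using h N_pos by simp
    finally have 2: "norm (y \<tau> - y (\<tau> - h)) \<le> N * \<kappa>1" .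
    have e: "x - xs = (y \<tau> - xs) + (- (y \<tau> - y (\<tau> - h))) - (y (\<tau> - h) - x)" by simp
    have "norm (x - xs) \<le> norm (y \<tau> - xs) + norm (- (y \<tau> - y (\<tau> - h))) + norm (y (\<tau> - h) - x)"
      by (subst e) (rule norm_add_diff_le)
    then have "norm (x - xs) \<le> norm (y \<tau> - xs) + norm (y \<tau> - y (\<tau> - h)) + norm (y (\<tau> - h) - x)"
      by (simp only: norm_minus_cancel)
    then show ?thesis using 1 2 yx by (simp add: E_def algebra_simps)
  qed
  have "norm (x - xs) \<le> 0"
  proof (rule field_le_epsilon)
    fix e :: real assume e: "e > 0"
    define k where "k = min 1 (e / E)"
    have "norm (x - xs) \<le> E * k" by (rule bound) (use e E in \<open>auto simp: k_def\<close>)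
    also have "\<dots> \<le> E * (e / E)" using E by (intro mult_left_mono) (auto simp: k_def)
    also have "\<dots> = e" using E by simp
    finally show "norm (x - xs) \<le> 0 + e" by simp
  qed
  then have "x = xs" by simp
  moreover have "xs \<in> S" using td frontier_subset_closed[OF S_closed] by (auto simp: terminal_data_def)
  ultimately show False using x by simp
qed

end

section \<open>Rectifiability\<close>

definition hterm :: "nat \<Rightarrow> 'a::metric_space set \<Rightarrow> ennreal" where
  "hterm k X = (if X = {} then 0 else ennreal (unit_ball_vol (real k) * (diameter X / 2) ^ k))"

lemma hausdorff_null_iff:
  "hausdorff_measure k (E :: 'a::metric_space set) = 0 \<longleftrightarrow>
     (\<forall>\<delta>>0. \<forall>e>0. \<exists>C :: nat \<Rightarrow> 'a set. E \<subseteq> (\<Union>i. C i) \<and> (\<forall>i. bounded (C i) \<and> diameter (C i) \<le> \<delta>) \<and>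
        (\<Sum>i. hterm k (C i)) < ennreal e)" (is "?l \<longleftrightarrow> ?r")
proof
  assume l: ?l
  show ?r
  proof (intro allI impI)
    fix \<delta> e :: real assume \<delta>: "\<delta> > 0" and e: "e > 0"
    have "hausdorff_content k \<delta> E \<le> hausdorff_measure k E"
      unfolding hausdorff_measure_def by (rule SUP_upper) (use \<delta> in simp)
    then have "hausdorff_content k \<delta> E < ennreal e" using l e by simp
    then show "\<exists>C :: nat \<Rightarrow> 'a set. E \<subseteq> (\<Union>i. C i) \<and> (\<forall>i. bounded (C i) \<and> diameter (C i) \<le> \<delta>) \<and> (\<Sum>i. hterm k (C i)) < ennreal e"
      unfolding hausdorff_content_def INF_less_iff hterm_def by blast
  qed
next
  assume r: ?r
  have "hausdorff_content k \<delta> E \<le> 0" if \<delta>: "\<delta> > 0" for \<delta>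
  proof (rule ennreal_le_epsilon)
    fix e :: real assume "e > 0"
    then obtain C :: "nat \<Rightarrow> 'a set" where C: "E \<subseteq> (\<Union>i. C i)" "\<forall>i. bounded (C i) \<and> diameter (C i) \<le> \<delta>" "(\<Sum>i. hterm k (C i)) < ennreal e"
      using r \<delta> by blast
    have "hausdorff_content k \<delta> E \<le> (\<Sum>i. hterm k (C i))"
      unfolding hausdorff_content_def hterm_def by (rule INF_lower) (use C in simp)
    then show "hausdorff_content k \<delta> E \<le> 0 + ennreal e" using C(3) by simp
  qed
  then have "hausdorff_measure k E \<le> 0" unfolding hausdorff_measure_def by (intro SUP_least) auto
  then show ?l by simp
qed

lemma hausdorff_null_subset:
  fixes E :: "'a::metric_space set"
  assumes "hausdorff_measure k F = 0" "E \<subseteq> F"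
  shows "hausdorff_measure k E = 0"
  unfolding hausdorff_null_iff
proof (intro allI impI)
  fix \<delta> e :: real assume "\<delta> > 0" "e > 0"
  then obtain C :: "nat \<Rightarrow> 'a set" where "F \<subseteq> (\<Union>i. C i)" "\<forall>i. bounded (C i) \<and> diameter (C i) \<le> \<delta>"
    "(\<Sum>i. hterm k (C i)) < ennreal e" using assms(1) unfolding hausdorff_null_iff by blast
  then show "\<exists>C :: nat \<Rightarrow> 'a set. E \<subseteq> (\<Union>i. C i) \<and> (\<forall>i. bounded (C i) \<and> diameter (C i) \<le> \<delta>) \<and>
      (\<Sum>i. hterm k (C i)) < ennreal e" using assms(2) by (intro exI[of _ C]) simp
qed

lemma ennreal_geometric_half: "e \<ge> 0 \<Longrightarrow> (\<Sum>i. ennreal (e * (1 / 2) ^ Suc i)) = ennreal e"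
proof (rule suminf_ennreal_eq)
  show "(\<lambda>i. e * (1 / 2) ^ Suc i) sums e"
    using sums_mult[OF power_half_series, of e] by simp
qed auto

lemma hausdorff_null_UN:
  fixes E :: "nat \<Rightarrow> 'a::metric_space set"
  assumes "\<And>i. hausdorff_measure k (E i) = 0"
  shows "hausdorff_measure k (\<Union>i. E i) = 0"
  unfolding hausdorff_null_iff
proof (intro allI impI)
  fix \<delta> e :: real assume \<delta>: "\<delta> > 0" and e: "e > 0"
  \<comment> \<open>The tolerances add up to \<open>e / 2\<close>, which preserves the strict
    inequality after passing to non-strict sums.\<close>
  have "\<forall>i. \<exists>C :: nat \<Rightarrow> 'a set. E i \<subseteq> (\<Union>j. C j) \<and> (\<forall>j. bounded (C j) \<and> diameter (C j) \<le> \<delta>) \<and>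
      (\<Sum>j. hterm k (C j)) < ennreal (e / 2 * (1 / 2) ^ Suc i)"
    using assms \<delta> e unfolding hausdorff_null_iff by simp
  from choice[OF this] obtain C :: "nat \<Rightarrow> nat \<Rightarrow> 'a set" where C:
    "\<And>i. E i \<subseteq> (\<Union>j. C i j)" "\<And>i j. bounded (C i j) \<and> diameter (C i j) \<le> \<delta>"
    "\<And>i. (\<Sum>j. hterm k (C i j)) < ennreal (e / 2 * (1 / 2) ^ Suc i)" by blast
  define D where "D n = (case prod_decode n of (i, j) \<Rightarrow> C i j)" for n
  have "(\<Sum>n. hterm k (D n)) = (\<Sum>n. (\<lambda>(i, j). hterm k (C i j)) (prod_decode n))"
    by (simp add: D_def split_beta)
  also have "\<dots> = (\<Sum>i. \<Sum>j. hterm k (C i j))" by (rule suminf_ennreal_2dimen) simp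
  also have "\<dots> \<le> (\<Sum>i. ennreal (e / 2 * (1 / 2) ^ Suc i))"
    by (intro suminf_le summableI) (use C(3) in \<open>simp add: less_imp_le\<close>)
  also have "\<dots> = ennreal (e / 2)" by (rule ennreal_geometric_half) (use e in simp)
  also have "\<dots> < ennreal e" using e by (simp add: ennreal_less_iff)
  finally have 1: "(\<Sum>n. hterm k (D n)) < ennreal e" .
  have 2: "(\<Union>i. E i) \<subseteq> (\<Union>n. D n)"
  proof
    fix x assume "x \<in> (\<Union>i. E i)"
    then obtain i j where "x \<in> C i j" using C(1) by blast
    then have "x \<in> D (prod_encode (i, j))" by (simp add: D_def)
    then show "x \<in> (\<Union>n. D n)" by blast
  qed
  have 3: "bounded (D n) \<and> diameter (D n) \<le> \<delta>" for n using C(2) by (simp add: D_def split_beta)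
  show "\<exists>C :: nat \<Rightarrow> 'a set. (\<Union>i. E i) \<subseteq> (\<Union>i. C i) \<and> (\<forall>i. bounded (C i) \<and> diameter (C i) \<le> \<delta>) \<and> (\<Sum>i. hterm k (C i)) < ennreal e"
    using 1 2 3 by blast
qed

lemma countably_rectifiable_subset:
  assumes "countably_rectifiable k F" "E \<subseteq> F"
  shows "countably_rectifiable k E"
proof -
  obtain A \<phi> where A: "\<forall>i::nat. lipschitz_from_Rk k (A i) (\<phi> i)" "hausdorff_measure k (F - (\<Union>i. \<phi> i ` A i)) = 0"
    using assms(1) unfolding countably_rectifiable_def by blast
  have "hausdorff_measure k (E - (\<Union>i. \<phi> i ` A i)) = 0"
    by (rule hausdorff_null_subset[OF A(2)]) (use assms(2) in blast)
  then show ?thesis using A(1) unfolding countably_rectifiable_def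
    by (intro exI[of _ A] exI[of _ \<phi>] conjI)
qed

lemma countably_rectifiable_null:
  assumes "hausdorff_measure k E = 0"
  shows "countably_rectifiable k E"
proof -
  have "\<forall>i::nat. lipschitz_from_Rk k {} (\<lambda>_. undefined :: 'a)" by (auto simp: lipschitz_from_Rk_def)
  moreover have "hausdorff_measure k (E - (\<Union>i::nat. (\<lambda>_. undefined) ` {})) = 0" using assms by simp
  ultimately show ?thesis unfolding countably_rectifiable_def
    by (intro exI[of _ "\<lambda>_. {}"] exI[of _ "\<lambda>_ _. undefined"] conjI)
qed

lemma hausdorff_null_empty: "hausdorff_measure k {} = 0"
  unfolding hausdorff_null_iff by (auto intro!: exI[of _ "\<lambda>_. {}"] simp: hterm_def)

lemma countably_rectifiable_empty: "countably_rectifiable k {}"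
  by (rule countably_rectifiable_null[OF hausdorff_null_empty])

lemma countably_rectifiable_UN_nat:
  fixes E :: "nat \<Rightarrow> 'a::metric_space set"
  assumes "\<And>i. countably_rectifiable k (E i)"
  shows "countably_rectifiable k (\<Union>i. E i)"
proof -
  have "\<forall>i. \<exists>p :: (nat \<Rightarrow> (nat \<Rightarrow> real) set) \<times> (nat \<Rightarrow> (nat \<Rightarrow> real) \<Rightarrow> 'a).
      (\<forall>j. lipschitz_from_Rk k (fst p j) (snd p j)) \<and> hausdorff_measure k (E i - (\<Union>j. snd p j ` fst p j)) = 0"
    using assms unfolding countably_rectifiable_def by force
  from choice[OF this] obtain P :: "nat \<Rightarrow> (nat \<Rightarrow> (nat \<Rightarrow> real) set) \<times> (nat \<Rightarrow> (nat \<Rightarrow> real) \<Rightarrow> 'a)" where P: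
    "\<And>i j. lipschitz_from_Rk k (fst (P i) j) (snd (P i) j)"
    "\<And>i. hausdorff_measure k (E i - (\<Union>j. snd (P i) j ` fst (P i) j)) = 0" by blast
  define A where "A n = (case prod_decode n of (i, j) \<Rightarrow> fst (P i) j)" for n
  define \<phi> where "\<phi> n = (case prod_decode n of (i, j) \<Rightarrow> snd (P i) j)" for n
  have "\<forall>n. lipschitz_from_Rk k (A n) (\<phi> n)" using P(1) by (simp add: A_def \<phi>_def split_beta)
  moreover have "hausdorff_measure k ((\<Union>i. E i) - (\<Union>n. \<phi> n ` A n)) = 0"
  proof (rule hausdorff_null_subset[OF hausdorff_null_UN[OF P(2)]])
    show "(\<Union>i. E i) - (\<Union>n. \<phi> n ` A n) \<subseteq> (\<Union>i. E i - (\<Union>j. snd (P i) j ` fst (P i) j))"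
    proof
      fix x assume x: "x \<in> (\<Union>i. E i) - (\<Union>n. \<phi> n ` A n)"
      then obtain i where i: "x \<in> E i" by blast
      have "x \<notin> snd (P i) j ` fst (P i) j" for j
      proof
        assume "x \<in> snd (P i) j ` fst (P i) j"
        then have "x \<in> \<phi> (prod_encode (i, j)) ` A (prod_encode (i, j))" by (simp add: A_def \<phi>_def)
        moreover have "x \<notin> \<phi> n ` A n" for n using x by simp
        ultimately show False by simp
      qed
      then have "x \<in> E i - (\<Union>j. snd (P i) j ` fst (P i) j)" using i by simp
      then show "x \<in> (\<Union>i. E i - (\<Union>j. snd (P i) j ` fst (P i) j))" by (rule UN_I[OF UNIV_I])
    qed
  qed
  ultimately show ?thesis unfolding countably_rectifiable_def
    by (intro exI[of _ A] exI[of _ \<phi>] conjI)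
qed

lemma countably_rectifiable_UN:
  assumes "countable I" "\<And>i. i \<in> I \<Longrightarrow> countably_rectifiable k (E i)"
  shows "countably_rectifiable k (\<Union>i\<in>I. E i)"
proof (cases "I = {}")
  case False
  have "countably_rectifiable k (\<Union>n. E (from_nat_into I n))"
    by (rule countably_rectifiable_UN_nat) (use assms(2) from_nat_into[OF False] in blast)
  moreover have "(\<Union>i\<in>range (from_nat_into I). E i) = (\<Union>i\<in>I. E i)"
    by (simp only: range_from_nat_into[OF False assms(1)])
  ultimately show ?thesis by simp
qed (simp add: countably_rectifiable_empty)

lemma countably_rectifiable_Un:
  assumes "countably_rectifiable k E" "countably_rectifiable k F"
  shows "countably_rectifiable k (E \<union> F)"
proof -
  have "countably_rectifiable k (\<Union>b\<in>{True, False}. if b then E else F)"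
    by (rule countably_rectifiable_UN) (use assms in auto)
  then show ?thesis by (simp add: Un_commute)
qed

text \<open>The coordinates \<open>c\<close>, indexed by any finite set with at most \<open>k\<close> elements, stand for a point of \<open>\<real>\<^sup>k\<close>.\<close>

lemma countably_rectifiable_coordinates:
  fixes \<psi> :: "'b \<Rightarrow> 'a::metric_space" and c :: "'b \<Rightarrow> 'i \<Rightarrow> real"
  assumes I: "finite I" "card I \<le> k" and C: "C \<ge> 0"
    and lip: "\<And>b b'. b \<in> B \<Longrightarrow> b' \<in> B \<Longrightarrow> dist (\<psi> b) (\<psi> b') \<le> C * (\<Sum>i\<in>I. \<bar>c b i - c b' i\<bar>)"
  shows "countably_rectifiable k (\<psi> ` B)"
proof -
  obtain h where h: "bij_betw h {0..<card I} I" using ex_bij_betw_nat_finite[OF I(1)] by blast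
  \<comment> \<open>Padding with zeros from \<open>card I\<close> on places the coordinates in
    \<open>Euclidean_space k\<close> also when \<open>card I < k\<close>.\<close>
  define enc where "enc b n = (if n < card I then c b (h n) else 0)" for b n
  \<comment> \<open>An arbitrary preimage suffices: the Lipschitz bound forces \<psi> to agree on
    points with equal coordinates.\<close>
  define \<phi> where "\<phi> a = \<psi> (inv_into B enc a)" for a
  have sum_eq: "(\<Sum>i\<in>I. \<bar>c b i - c b' i\<bar>) = (\<Sum>n<card I. \<bar>enc b n - enc b' n\<bar>)" for b b'
  proof -
    have "(\<Sum>i\<in>I. \<bar>c b i - c b' i\<bar>) = (\<Sum>n\<in>{0..<card I}. \<bar>c b (h n) - c b' (h n)\<bar>)"
      by (rule sum.reindex_bij_betw[OF h, symmetric])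
    then show ?thesis by (simp add: enc_def lessThan_atLeast0)
  qed
  have enc_bound: "(\<Sum>i\<in>I. \<bar>c b i - c b' i\<bar>) \<le> real k * L2_set (\<lambda>n. enc b n - enc b' n) {..<k}" for b b'
  proof -
    have "(\<Sum>n<card I. \<bar>enc b n - enc b' n\<bar>) \<le> (\<Sum>n<k. \<bar>enc b n - enc b' n\<bar>)"
      by (rule sum_mono2) (use I in auto)
    also have "\<dots> \<le> (\<Sum>n<k. L2_set (\<lambda>n. enc b n - enc b' n) {..<k})"
    proof (rule sum_mono)
      fix n assume "n \<in> {..<k}"
      then have "\<bar>enc b n - enc b' n\<bar> \<le> L2_set (\<lambda>n. \<bar>enc b n - enc b' n\<bar>) {..<k}"
        by (intro member_le_L2_set[where f="\<lambda>n. \<bar>enc b n - enc b' n\<bar>"]) auto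
      then show "\<bar>enc b n - enc b' n\<bar> \<le> L2_set (\<lambda>n. enc b n - enc b' n) {..<k}" by (simp add: L2_set_def)
    qed
    finally show ?thesis using sum_eq[of b b'] by simp
  qed
  have \<phi>enc: "\<phi> (enc b) = \<psi> b" if b: "b \<in> B" for b
  proof -
    define b' where "b' = inv_into B enc (enc b)"
    have b': "b' \<in> B" "enc b' = enc b" using b by (auto simp: b'_def inv_into_into f_inv_into_f)
    have "dist (\<psi> b') (\<psi> b) \<le> C * (\<Sum>i\<in>I. \<bar>c b' i - c b i\<bar>)" by (rule lip[OF b'(1) b])
    also have "\<dots> = 0" using b'(2) by (simp add: sum_eq)
    finally show ?thesis by (simp add: \<phi>_def b'_def)
  qed
  have "lipschitz_from_Rk k (enc ` B) \<phi>"
    unfolding lipschitz_from_Rk_def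
  proof (intro conjI exI[of _ "C * real k"] ballI)
    show "enc ` B \<subseteq> topspace (Euclidean_space k)" using I(2) by (auto simp: topspace_Euclidean_space enc_def)
    show "0 \<le> C * real k" using C by simp
    fix a a' assume "a \<in> enc ` B" "a' \<in> enc ` B"
    then obtain b b' where b: "b \<in> B" "a = enc b" "b' \<in> B" "a' = enc b'" by blast
    have "dist (\<phi> a) (\<phi> a') \<le> C * (\<Sum>i\<in>I. \<bar>c b i - c b' i\<bar>)" using lip[OF b(1,3)] \<phi>enc b by simp
    also have "\<dots> \<le> C * (real k * L2_set (\<lambda>n. a n - a' n) {..<k})" unfolding b by (intro mult_left_mono enc_bound C)
    finally show "dist (\<phi> a) (\<phi> a') \<le> C * real k * L2_set (\<lambda>i. a i - a' i) {..<k}" by (simp add: mult.assoc)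
  qed
  moreover have "\<psi> ` B - (\<Union>i::nat. \<phi> ` (enc ` B)) = {}" using \<phi>enc by (auto simp: image_iff)
  then have "hausdorff_measure k (\<psi> ` B - (\<Union>i::nat. \<phi> ` (enc ` B))) = 0" by (simp only: hausdorff_null_empty)
  ultimately show ?thesis
    unfolding countably_rectifiable_def by (intro exI[of _ "\<lambda>_::nat. enc ` B"] exI[of _ "\<lambda>_. \<phi>"] conjI allI)
qed

lemma hterm_le:
  assumes "\<And>x y. x \<in> X \<Longrightarrow> y \<in> X \<Longrightarrow> dist x y \<le> d" "d \<ge> 0"
  shows "hterm k X \<le> ennreal (unit_ball_vol (real k) * (d / 2) ^ k)"
proof (cases "X = {}")
  case False
  have "diameter X \<le> d"
    unfolding diameter_def using False assms(1) by (auto intro!: cSUP_least)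
  moreover have "diameter X \<ge> 0"
  proof -
    obtain x where "x \<in> X" using False by blast
    have "bounded X" unfolding bounded_any_center[of X x] using assms(1) \<open>x \<in> X\<close> by blast
    then show ?thesis by (rule diameter_ge_0)
  qed
  ultimately show ?thesis unfolding hterm_def using False by (auto intro!: ennreal_leI mult_left_mono power_mono)
qed (simp add: hterm_def)

text \<open>Covering sets of diameter \<open>d\<close> in the second factor produce about \<open>M / d\<close> sets of diameter
  comparable to \<open>d\<close> in the product.\<close>

lemma hausdorff_null_product:
  fixes \<psi> :: "'b \<Rightarrow> 'a::metric_space" and \<eta> :: "'b \<Rightarrow> 'c::metric_space" and \<tau> :: "'b \<Rightarrow> real"
  assumes null: "hausdorff_measure k (\<eta> ` B) = 0" and M: "M \<ge> 0" and C: "C > 0"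
    and \<tau>: "\<And>b. b \<in> B \<Longrightarrow> 0 \<le> \<tau> b \<and> \<tau> b \<le> M"
    and lip: "\<And>b b'. b \<in> B \<Longrightarrow> b' \<in> B \<Longrightarrow> dist (\<psi> b) (\<psi> b') \<le> C * (\<bar>\<tau> b - \<tau> b'\<bar> + dist (\<eta> b) (\<eta> b'))"
  shows "hausdorff_measure (Suc k) (\<psi> ` B) = 0"
  unfolding hausdorff_null_iff
proof (intro allI impI)
  fix \<delta> e :: real assume \<delta>: "\<delta> > 0" and e: "e > 0"
  define v0 where "v0 = unit_ball_vol (real k)"
  define v1 where "v1 = unit_ball_vol (real (Suc k))"
  have v: "v0 > 0" "v1 > 0" by (auto simp: v0_def v1_def)
  define \<delta>0 where "\<delta>0 = min 1 (\<delta> / (2 * C)) / 2"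
  have \<delta>0: "\<delta>0 > 0" "2 * \<delta>0 \<le> 1" "2 * C * (2 * \<delta>0) \<le> \<delta>"
  proof -
    show "\<delta>0 > 0" using \<delta> C by (simp add: \<delta>0_def)
    show "2 * \<delta>0 \<le> 1" by (simp add: \<delta>0_def)
    have "2 * C * (2 * \<delta>0) \<le> 2 * C * (\<delta> / (2 * C))" using C by (intro mult_left_mono) (auto simp: \<delta>0_def)
    then show "2 * C * (2 * \<delta>0) \<le> \<delta>" using C by simp
  qed
  \<comment> \<open>With about (M + 1) / D slabs of diameter 2 C D, the volume terms in dimension k
    + 1 add up to \<open>K\<close> times the term of a set of diameter D in dimension k.\<close>
  define K where "K = v1 * C ^ Suc k * (M + 1) * 2 ^ k / v0"
  have K: "K > 0" using v C M by (simp add: K_def)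
  define e0 where "e0 = e / (4 * K)"
  have e0: "e0 > 0" using e K by (simp add: e0_def)
  obtain X :: "nat \<Rightarrow> 'c set" where X: "\<eta> ` B \<subseteq> (\<Union>i. X i)" "\<And>i. bounded (X i) \<and> diameter (X i) \<le> \<delta>0"
    "(\<Sum>i. hterm k (X i)) < ennreal e0" using null \<delta>0(1) e0 unfolding hausdorff_null_iff by meson
  \<comment> \<open>A covering set may have diameter 0, which is useless as a slab width; by
    continuity a slightly larger positive D costs only a summable excess.\<close>
  have "\<exists>D. diameter (X i) \<le> D \<and> 0 < D \<and> D \<le> 2 * \<delta>0 \<and> v0 * (D / 2) ^ k \<le> v0 * (diameter (X i) / 2) ^ k + e0 * (1 / 2) ^ Suc i" for i
  proof -
    define d where "d = diameter (X i)"
    have d: "d \<ge> 0" "d \<le> \<delta>0" using X(2)[of i] by (auto simp: d_def diameter_ge_0)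
    have "isCont (\<lambda>D. v0 * (D / 2) ^ k) d" by (intro continuous_intros) auto
    then have "\<forall>\<^sub>F D in at_right d. v0 * (D / 2) ^ k < v0 * (d / 2) ^ k + e0 * (1 / 2) ^ Suc i"
      using e0 by (intro order_tendstoD(2)[OF filterlim_mono[OF _ order_refl at_le]]) (auto simp: continuous_at isCont_def)
    moreover have "\<forall>\<^sub>F D in at_right d. D < 2 * \<delta>0"
      using eventually_at_right_less[of d] d \<delta>0 by (intro order_tendstoD(2)[OF tendsto_ident_at]) auto
    moreover have "\<forall>\<^sub>F D in at_right d. d < D" by (rule eventually_at_right_less)
    ultimately have "\<forall>\<^sub>F D in at_right d. d \<le> D \<and> 0 < D \<and> D \<le> 2 * \<delta>0 \<and> v0 * (D / 2) ^ k \<le> v0 * (d / 2) ^ k + e0 * (1 / 2) ^ Suc i"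
      by eventually_elim (use d in auto)
    then show ?thesis unfolding d_def using eventually_happens'[OF trivial_limit_at_right_real] by blast
  qed
  then obtain D where D: "\<And>i. diameter (X i) \<le> D i" "\<And>i. 0 < D i" "\<And>i. D i \<le> 2 * \<delta>0"
    "\<And>i. v0 * (D i / 2) ^ k \<le> v0 * (diameter (X i) / 2) ^ k + e0 * (1 / 2) ^ Suc i" by metis
  \<comment> \<open>The slab indices run from 0 to the floor of M / D i inclusive.\<close>
  define n where "n i = nat \<lfloor>M / D i\<rfloor> + 1" for i
  define Y where "Y i j = (if X i = {} \<or> n i \<le> j then {} else
      \<psi> ` {b \<in> B. \<eta> b \<in> X i \<and> real j * D i \<le> \<tau> b \<and> \<tau> b \<le> (real j + 1) * D i})" for i j
  have Ydist: "dist x y \<le> 2 * C * D i" if "x \<in> Y i j" "y \<in> Y i j" for x y i j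
  proof -
    have m: "x \<in> \<psi> ` {b \<in> B. \<eta> b \<in> X i \<and> real j * D i \<le> \<tau> b \<and> \<tau> b \<le> (real j + 1) * D i}"
      "y \<in> \<psi> ` {b \<in> B. \<eta> b \<in> X i \<and> real j * D i \<le> \<tau> b \<and> \<tau> b \<le> (real j + 1) * D i}"
      using that unfolding Y_def by (simp_all only: empty_iff split: if_splits)
    obtain b where b1: "b \<in> B" "\<eta> b \<in> X i" "real j * D i \<le> \<tau> b" "\<tau> b \<le> (real j + 1) * D i" "x = \<psi> b"
      using m(1) by blast
    obtain b' where b2: "b' \<in> B" "\<eta> b' \<in> X i" "real j * D i \<le> \<tau> b'" "\<tau> b' \<le> (real j + 1) * D i" "y = \<psi> b'"
      using m(2) by blast
    have "dist x y \<le> C * (\<bar>\<tau> b - \<tau> b'\<bar> + dist (\<eta> b) (\<eta> b'))" using lip[OF b1(1) b2(1)] b1(5) b2(5) by simp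
    also have "\<dots> \<le> C * (D i + D i)"
    proof (intro mult_left_mono add_mono)
      have "(real j + 1) * D i = real j * D i + D i" by (simp add: distrib_right)
      then show "\<bar>\<tau> b - \<tau> b'\<bar> \<le> D i" using b1(3,4) b2(3,4) by linarith
      show "dist (\<eta> b) (\<eta> b') \<le> D i"
        using diameter_bounded_bound[of "X i" "\<eta> b" "\<eta> b'"] X(2)[of i] b1(2) b2(2) D(1)[of i] by linarith
    qed (use C in auto)
    finally show ?thesis by simp
  qed
  have Yterm: "hterm (Suc k) (Y i j) \<le> ennreal (v1 * (C * D i) ^ Suc k)" for i j
    using hterm_le[of "Y i j" "2 * C * D i" "Suc k"] Ydist C D(2)[of i] by (simp add: v1_def)
  have Ysum: "(\<Sum>j. hterm (Suc k) (Y i j)) \<le> ennreal K * (hterm k (X i) + ennreal (e0 * (1 / 2) ^ Suc i))" for i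
  proof (cases "X i = {}")
    case True
    then have "(\<Sum>j. hterm (Suc k) (Y i j)) = 0" by (simp add: Y_def hterm_def)
    then show ?thesis by simp
  next
    case False
    have "(\<Sum>j. hterm (Suc k) (Y i j)) = (\<Sum>j<n i. hterm (Suc k) (Y i j))"
      by (rule suminf_finite) (auto simp: Y_def hterm_def)
    also have "\<dots> \<le> (\<Sum>j<n i. ennreal (v1 * (C * D i) ^ Suc k))" by (intro sum_mono Yterm)
    also have "\<dots> = ennreal (real (n i) * (v1 * (C * D i) ^ Suc k))"
      using v C D(2)[of i] by (simp add: ennreal_mult ennreal_of_nat_eq_real_of_nat)
    also have "\<dots> \<le> ennreal (K * (v0 * (diameter (X i) / 2) ^ k + e0 * (1 / 2) ^ Suc i))"
    proof (rule ennreal_leI)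
      have nD: "real (n i) * D i \<le> M + 1"
      proof -
        have "M / D i \<ge> 0" using M D(2)[of i] by simp
        then have "real (n i) \<le> M / D i + 1" by (simp add: n_def)
        then have "real (n i) * D i \<le> (M / D i + 1) * D i" using D(2)[of i] by (intro mult_right_mono) auto
        also have "\<dots> = M + D i" using D(2)[of i] by (simp add: distrib_right)
        finally show ?thesis using D(3)[of i] \<delta>0 by linarith
      qed
      have "real (n i) * (v1 * (C * D i) ^ Suc k) = (real (n i) * D i) * (v1 * C ^ Suc k * D i ^ k)"
        by (simp add: power_mult_distrib algebra_simps)
      also have "\<dots> \<le> (M + 1) * (v1 * C ^ Suc k * D i ^ k)"
        using nD v C D(2)[of i] by (intro mult_right_mono) auto
      also have "\<dots> = K * (v0 * (D i / 2) ^ k)"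
        using v by (simp add: K_def power_divide)
      also have "\<dots> \<le> K * (v0 * (diameter (X i) / 2) ^ k + e0 * (1 / 2) ^ Suc i)"
        using D(4)[of i] K by (intro mult_left_mono) auto
      finally show "real (n i) * (v1 * (C * D i) ^ Suc k) \<le> K * (v0 * (diameter (X i) / 2) ^ k + e0 * (1 / 2) ^ Suc i)" .
    qed
    also have "\<dots> = ennreal K * (hterm k (X i) + ennreal (e0 * (1 / 2) ^ Suc i))"
    proof -
      have a: "0 \<le> v0 * (diameter (X i) / 2) ^ k" using v X(2)[of i] by (simp add: diameter_ge_0)
      have b: "0 \<le> e0 * (1 / 2) ^ Suc i" using e0 by simp
      have "hterm k (X i) = ennreal (v0 * (diameter (X i) / 2) ^ k)" using False by (simp add: hterm_def v0_def)
      then show ?thesis using ennreal_plus[OF a b] ennreal_mult[of K "v0 * (diameter (X i) / 2) ^ k + e0 * (1 / 2) ^ Suc i"] a b K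
        by simp
    qed
    finally show ?thesis .
  qed
  define Z where "Z m = (case prod_decode m of (i, j) \<Rightarrow> Y i j)" for m
  have add: "(\<Sum>i. p i + q i) = (\<Sum>i. p i) + (\<Sum>i. q i)" for p q :: "nat \<Rightarrow> ennreal"
    by (rule suminf_add[symmetric]; rule summableI)
  have scale: "(\<Sum>i. ennreal K * p i) = ennreal K * (\<Sum>i. p i)" for p
    by (rule ennreal_suminf_cmult)
  have "(\<Sum>m. hterm (Suc k) (Z m)) = (\<Sum>m. (\<lambda>(i, j). hterm (Suc k) (Y i j)) (prod_decode m))"
    by (simp add: Z_def split_beta)
  also have "\<dots> = (\<Sum>i. \<Sum>j. hterm (Suc k) (Y i j))" by (rule suminf_ennreal_2dimen) simp
  also have "\<dots> \<le> (\<Sum>i. ennreal K * (hterm k (X i) + ennreal (e0 * (1 / 2) ^ Suc i)))"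
    by (intro suminf_le summableI Ysum)
  also have "\<dots> = ennreal K * ((\<Sum>i. hterm k (X i)) + (\<Sum>i. ennreal (e0 * (1 / 2) ^ Suc i)))"
    by (simp only: scale add)
  also have "\<dots> \<le> ennreal K * (ennreal e0 + ennreal e0)"
    by (intro mult_left_mono add_mono less_imp_le[OF X(3)] eq_refl[OF ennreal_geometric_half])
      (use e0 in simp_all)
  also have "ennreal e0 + ennreal e0 = ennreal (e0 + e0)"
    by (rule ennreal_plus[symmetric]) (use e0 in simp_all)
  also have "ennreal K * ennreal (e0 + e0) = ennreal (K * (e0 + e0))"
    by (rule ennreal_mult[symmetric]) (use e0 K in simp_all)
  also have "K * (e0 + e0) = e / 2" using K by (simp add: e0_def)
  also have "ennreal (e / 2) < ennreal e" using e by (simp add: ennreal_less_iff)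
  finally have 1: "(\<Sum>m. hterm (Suc k) (Z m)) < ennreal e" .
  have 2: "\<psi> ` B \<subseteq> (\<Union>m. Z m)"
  proof
    fix x assume "x \<in> \<psi> ` B"
    then obtain b where b: "b \<in> B" "x = \<psi> b" by blast
    then obtain i where i: "\<eta> b \<in> X i" using X(1) by blast
    define j where "j = nat \<lfloor>\<tau> b / D i\<rfloor>"
    have q: "\<tau> b / D i \<ge> 0" using \<tau>[OF b(1)] D(2)[of i] by simp
    have "real j \<le> \<tau> b / D i" using q by (simp add: j_def)
    then have j1: "real j * D i \<le> \<tau> b" using D(2)[of i] by (simp add: pos_le_divide_eq)
    have "\<tau> b / D i \<le> real j + 1" unfolding j_def using q by linarith
    then have j2: "\<tau> b \<le> (real j + 1) * D i" using D(2)[of i] by (simp add: pos_divide_le_eq)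
    have "\<tau> b / D i \<le> M / D i" using \<tau>[OF b(1)] D(2)[of i] by (intro divide_right_mono) auto
    then have "j < n i" unfolding j_def n_def using nat_mono[OF floor_mono] by (simp add: less_Suc_eq_le)
    then have "x \<in> Y i j" using i b j1 j2 by (auto simp: Y_def)
    then have "x \<in> Z (prod_encode (i, j))" by (simp add: Z_def)
    then show "x \<in> (\<Union>m. Z m)" by blast
  qed
  have 3: "bounded (Y i j) \<and> diameter (Y i j) \<le> \<delta>" for i j
  proof (cases "Y i j = {}")
    case True then show ?thesis using \<delta> by (simp add: diameter_def)
  next
    case False
    then obtain x where x: "x \<in> Y i j" by blast
    have "bounded (Y i j)" unfolding bounded_any_center[of _ x] using Ydist x by blast
    moreover have "diameter (Y i j) \<le> 2 * C * D i" unfolding diameter_def using False Ydist by (auto intro!: cSUP_least)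
    moreover have "2 * C * D i \<le> 2 * C * (2 * \<delta>0)" using D(3)[of i] C by (intro mult_left_mono) auto
    ultimately show ?thesis using \<delta>0(3) by linarith
  qed
  have "bounded (Z m) \<and> diameter (Z m) \<le> \<delta>" for m using 3 by (simp add: Z_def split_beta)
  then show "\<exists>C :: nat \<Rightarrow> 'a set. \<psi> ` B \<subseteq> (\<Union>i. C i) \<and> (\<forall>i. bounded (C i) \<and> diameter (C i) \<le> \<delta>) \<and> (\<Sum>i. hterm (Suc k) (C i)) < ennreal e"
    using 1 2 by blast
qed

section \<open>Feet of proximal normals and corners\<close>

text \<open>The two normal inequalities, each with constant 1/4, consume at most half of |x - y|^2.
  This is the Lipschitz property of nearest-point projection; \<open>Q\<close> need not be convex as
  long as the normals are short relative to their quality.\<close>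

lemma pnormal_foot_lipschitz:
  assumes x: "x \<in> Q" "v \<in> pnormal Q (1/4) x" and y: "y \<in> Q" "w \<in> pnormal Q (1/4) y"
  shows "norm (x - y) \<le> 2 * norm ((x + v) - (y + w))"
proof (cases "x = y")
  case False
  have 1: "v \<bullet> (y - x) \<le> 1/4 * (norm (x - y))\<^sup>2" using x y by (auto simp: pnormal_def norm_minus_commute)
  have 2: "w \<bullet> (x - y) \<le> 1/4 * (norm (x - y))\<^sup>2" using x y by (auto simp: pnormal_def)
  have "((x + v) - (y + w)) \<bullet> (x - y) = (norm (x - y))\<^sup>2 - v \<bullet> (y - x) - w \<bullet> (x - y)"
    by (simp add: power2_norm_eq_inner inner_diff_left inner_diff_right inner_add_left algebra_simps)
  then have "(norm (x - y))\<^sup>2 / 2 \<le> ((x + v) - (y + w)) \<bullet> (x - y)" using 1 2 by linarith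
  also have "\<dots> \<le> norm ((x + v) - (y + w)) * norm (x - y)" by (rule norm_cauchy_schwarz)
  finally have "norm (x - y) * norm (x - y) \<le> (2 * norm ((x + v) - (y + w))) * norm (x - y)"
    by (simp add: power2_eq_square)
  then show ?thesis using False by simp
qed simp

text \<open>Where two independent normals exist, they span a triangle of normals; a suitable normal in it
  puts the point \<open>x + v\<close> into one of countably many coordinate planes of codimension two.\<close>

lemma corner_rational_normal:
  fixes x :: "'a::euclidean_space"
  assumes v: "v1 \<in> pnormal Q \<sigma> x" "v2 \<in> pnormal Q \<sigma> x" and indep: "v1 \<noteq> 0" "\<And>t. v2 \<noteq> t *\<^sub>R v1"
  obtains v b1 b2 where "v \<in> pnormal Q (1/4) x" "v \<noteq> 0" "b1 \<in> Basis" "b2 \<in> Basis" "b1 \<noteq> b2"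
    "(x + v) \<bullet> b1 \<in> \<rat>" "(x + v) \<bullet> b2 \<in> \<rat>"
proof -
  obtain b1 where b1: "b1 \<in> Basis" "v1 \<bullet> b1 \<noteq> 0" using indep(1) euclidean_all_zero_iff[of v1] by blast
  have "\<exists>b2\<in>Basis. (v1 \<bullet> b1) * (v2 \<bullet> b2) - (v1 \<bullet> b2) * (v2 \<bullet> b1) \<noteq> 0"
  proof (rule ccontr)
    assume "\<not> ?thesis"
    then have z: "\<forall>b\<in>Basis. (v1 \<bullet> b1) * (v2 \<bullet> b) - (v1 \<bullet> b) * (v2 \<bullet> b1) = 0" by blast
    have comp: "v2 \<bullet> b = ((v2 \<bullet> b1) / (v1 \<bullet> b1)) * (v1 \<bullet> b)" if "b \<in> Basis" for b
    proof -
      have "(v1 \<bullet> b1) * (v2 \<bullet> b) - (v1 \<bullet> b) * (v2 \<bullet> b1) = 0"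
        by (rule z[rule_format, OF that])
      then have "v2 \<bullet> b * (v1 \<bullet> b1) = (v2 \<bullet> b1) * (v1 \<bullet> b)" by (simp only: eq_iff_diff_eq_0[symmetric] mult.commute)
      then show ?thesis unfolding times_divide_eq_left nonzero_eq_divide_eq[OF b1(2)] .
    qed
    have "v2 = ((v2 \<bullet> b1) / (v1 \<bullet> b1)) *\<^sub>R v1"
      by (rule euclidean_eqI) (simp only: inner_scaleR_left comp)
    then show False using indep(2)[of "(v2 \<bullet> b1) / (v1 \<bullet> b1)"] by (rule notE[rotated])
  qed
  then obtain b2 where b2: "b2 \<in> Basis" and det0: "(v1 \<bullet> b1) * (v2 \<bullet> b2) - (v1 \<bullet> b2) * (v2 \<bullet> b1) \<noteq> 0" by blast
  define det where "det = (v1 \<bullet> b1) * (v2 \<bullet> b2) - (v1 \<bullet> b2) * (v2 \<bullet> b1)"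
  have det: "det \<noteq> 0" using det0 by (simp add: det_def)
  have b12: "b1 \<noteq> b2" using det by (auto simp: det_def)
  \<comment> \<open>Two coefficients below \<epsilon> give a combination of quality at most 2
    \<epsilon> (|\<sigma>| + 1) = 1/4, as \<open>pnormal_foot_lipschitz\<close> requires.\<close>
  define \<epsilon> where "\<epsilon> = 1 / (8 * (\<bar>\<sigma>\<bar> + 1))"
  have \<epsilon>: "\<epsilon> > 0" by (simp add: \<epsilon>_def)
  define m where "m = \<bar>v1 \<bullet> b1\<bar> + \<bar>v1 \<bullet> b2\<bar> + \<bar>v2 \<bullet> b1\<bar> + \<bar>v2 \<bullet> b2\<bar> + 1"
  have m: "m > 0" by (simp add: m_def)
  \<comment> \<open>If the two chosen coordinates move by less than \<theta>, then by Cramer's rule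
    the coefficients move by less than \<epsilon> / 2 and stay positive.\<close>
  define \<theta> where "\<theta> = \<epsilon> * \<bar>det\<bar> / (4 * m)"
  have \<theta>: "\<theta> > 0" using \<epsilon> det m by (simp add: \<theta>_def)
  define c where "c b = x \<bullet> b + (\<epsilon> / 2) * (v1 \<bullet> b) + (\<epsilon> / 2) * (v2 \<bullet> b)" for b
  obtain r1 where r1: "r1 \<in> \<rat>" "c b1 < r1" "r1 < c b1 + \<theta>" using Rats_dense_in_real[of "c b1" "c b1 + \<theta>"] \<theta> by auto
  obtain r2 where r2: "r2 \<in> \<rat>" "c b2 < r2" "r2 < c b2 + \<theta>" using Rats_dense_in_real[of "c b2" "c b2 + \<theta>"] \<theta> by auto
  \<comment> \<open>Cramer's rule for the coefficients that send the two coordinates from their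
    values at the centre (\<epsilon>/2, \<epsilon>/2) of the square of admissible coefficients to
    the rationals \<open>r1\<close> and \<open>r2\<close>.\<close>
  define s where "s = \<epsilon> / 2 + ((r1 - c b1) * (v2 \<bullet> b2) - (r2 - c b2) * (v2 \<bullet> b1)) / det"
  define t where "t = \<epsilon> / 2 + ((r2 - c b2) * (v1 \<bullet> b1) - (r1 - c b1) * (v1 \<bullet> b2)) / det"
  have small: "\<bar>((r1 - c b1) * a - (r2 - c b2) * b) / det\<bar> < \<epsilon> / 2" "\<bar>((r2 - c b2) * a - (r1 - c b1) * b) / det\<bar> < \<epsilon> / 2"
    if "\<bar>a\<bar> + \<bar>b\<bar> < m" for a b
  proof -
    have p: "\<bar>(r1 - c b1) * a\<bar> \<le> \<theta> * \<bar>a\<bar>" "\<bar>(r2 - c b2) * b\<bar> \<le> \<theta> * \<bar>b\<bar>" "\<bar>(r2 - c b2) * a\<bar> \<le> \<theta> * \<bar>a\<bar>" "\<bar>(r1 - c b1) * b\<bar> \<le> \<theta> * \<bar>b\<bar>"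
      unfolding abs_mult using r1 r2 by (auto intro!: mult_right_mono)
    have q: "\<theta> * \<bar>a\<bar> + \<theta> * \<bar>b\<bar> < \<theta> * (2 * m)"
    proof -
      have "\<theta> * (\<bar>a\<bar> + \<bar>b\<bar>) < \<theta> * (2 * m)" using that \<theta> m by (intro mult_strict_left_mono) auto
      then show ?thesis by (simp add: distrib_left)
    qed
    have e: "\<theta> * (2 * m) = (\<epsilon> / 2) * \<bar>det\<bar>" using m by (simp add: \<theta>_def)
    have "\<bar>(r1 - c b1) * a - (r2 - c b2) * b\<bar> < (\<epsilon> / 2) * \<bar>det\<bar>" "\<bar>(r2 - c b2) * a - (r1 - c b1) * b\<bar> < (\<epsilon> / 2) * \<bar>det\<bar>"
      using p q e by linarith+
    then show "\<bar>((r1 - c b1) * a - (r2 - c b2) * b) / det\<bar> < \<epsilon> / 2" "\<bar>((r2 - c b2) * a - (r1 - c b1) * b) / det\<bar> < \<epsilon> / 2"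
      using det by (auto simp: abs_divide pos_divide_less_eq)
  qed
  have mb: "\<bar>v2 \<bullet> b2\<bar> + \<bar>v2 \<bullet> b1\<bar> < m" "\<bar>v1 \<bullet> b1\<bar> + \<bar>v1 \<bullet> b2\<bar> < m" unfolding m_def by linarith+
  have s0: "0 < s" using small(1)[OF mb(1)] unfolding s_def abs_less_iff by linarith
  have s1: "s < \<epsilon>" using small(1)[OF mb(1)] unfolding s_def abs_less_iff by linarith
  note s = s0 s1
  have t0: "0 < t" using small(2)[OF mb(2)] unfolding t_def abs_less_iff by linarith
  have t1: "t < \<epsilon>" using small(2)[OF mb(2)] unfolding t_def abs_less_iff by linarith
  note t = t0 t1
  define v where "v = s *\<^sub>R v1 + t *\<^sub>R v2"
  have "v \<bullet> (y - x) \<le> 1/4 * (norm (y - x))\<^sup>2" if y: "y \<in> Q" for y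
  proof -
    have "v1 \<bullet> (y - x) \<le> \<sigma> * (norm (y - x))\<^sup>2" "v2 \<bullet> (y - x) \<le> \<sigma> * (norm (y - x))\<^sup>2"
      using v y by (auto simp: pnormal_def)
    moreover have "\<sigma> * (norm (y - x))\<^sup>2 \<le> (\<bar>\<sigma>\<bar> + 1) * (norm (y - x))\<^sup>2" by (intro mult_right_mono) auto
    ultimately have a: "v1 \<bullet> (y - x) \<le> (\<bar>\<sigma>\<bar> + 1) * (norm (y - x))\<^sup>2" "v2 \<bullet> (y - x) \<le> (\<bar>\<sigma>\<bar> + 1) * (norm (y - x))\<^sup>2" by linarith+
    have "v \<bullet> (y - x) = s * (v1 \<bullet> (y - x)) + t * (v2 \<bullet> (y - x))" by (simp add: v_def inner_add_left)
    also have "\<dots> \<le> s * ((\<bar>\<sigma>\<bar> + 1) * (norm (y - x))\<^sup>2) + t * ((\<bar>\<sigma>\<bar> + 1) * (norm (y - x))\<^sup>2)"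
      using a s t by (intro add_mono mult_left_mono) auto
    also have "\<dots> \<le> \<epsilon> * ((\<bar>\<sigma>\<bar> + 1) * (norm (y - x))\<^sup>2) + \<epsilon> * ((\<bar>\<sigma>\<bar> + 1) * (norm (y - x))\<^sup>2)"
      using s t by (intro add_mono mult_right_mono) auto
    also have "\<dots> = (2 * (\<epsilon> * (\<bar>\<sigma>\<bar> + 1))) * (norm (y - x))\<^sup>2" by (simp add: algebra_simps)
    also have "\<epsilon> * (\<bar>\<sigma>\<bar> + 1) = 1 / 8" by (simp add: \<epsilon>_def)
    finally show ?thesis by simp
  qed
  then have vn: "v \<in> pnormal Q (1/4) x" by (simp add: pnormal_def)
  have v0: "v \<noteq> 0"
  proof
    assume "v = 0"
    then have "t *\<^sub>R v2 = - (s *\<^sub>R v1)" by (simp add: v_def add_eq_0_iff)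
    then have "(1 / t) *\<^sub>R (t *\<^sub>R v2) = (1 / t) *\<^sub>R (- (s *\<^sub>R v1))" by (rule arg_cong)
    then have "v2 = (- (s / t)) *\<^sub>R v1" using t by simp
    then show False using indep(2)[of "- (s / t)"] by (rule notE[rotated])
  qed
  have comb: "s * a1 + t * a2 = (\<epsilon> / 2) * a1 + (\<epsilon> / 2) * a2 + w"
    if "((r1 - c b1) * (v2 \<bullet> b2) - (r2 - c b2) * (v2 \<bullet> b1)) * a1
      + ((r2 - c b2) * (v1 \<bullet> b1) - (r1 - c b1) * (v1 \<bullet> b2)) * a2 = w * det" for a1 a2 w
  proof -
    have "A / det * a1 + B / det * a2 = w" if "A * a1 + B * a2 = w * det" for A B
      using that det by (simp add: add_divide_distrib[symmetric])
    from this[OF that] show ?thesis unfolding s_def t_def distrib_right by linarith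
  qed
  have eq: "s * (v1 \<bullet> b1) + t * (v2 \<bullet> b1) = (\<epsilon> / 2) * (v1 \<bullet> b1) + (\<epsilon> / 2) * (v2 \<bullet> b1) + (r1 - c b1)"
    by (rule comb) (simp add: det_def algebra_simps)
  have eq2: "s * (v1 \<bullet> b2) + t * (v2 \<bullet> b2) = (\<epsilon> / 2) * (v1 \<bullet> b2) + (\<epsilon> / 2) * (v2 \<bullet> b2) + (r2 - c b2)"
    by (rule comb) (simp add: det_def algebra_simps)
  have "(x + v) \<bullet> b1 = r1" using eq by (simp add: v_def inner_add_left c_def)
  moreover have "(x + v) \<bullet> b2 = r2" using eq2 by (simp add: v_def inner_add_left c_def)
  ultimately show ?thesis using that[OF vn v0 b1(1) b2 b12] r1(1) r2(1) by simp
qed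

lemma norm_le_coordinates_except:
  fixes x :: "'a::euclidean_space"
  assumes "b1 \<in> Basis" "b2 \<in> Basis" "x \<bullet> b1 = 0" "x \<bullet> b2 = 0"
  shows "norm x \<le> (\<Sum>b\<in>Basis - {b1, b2}. \<bar>x \<bullet> b\<bar>)"
proof -
  have "norm x \<le> (\<Sum>b\<in>Basis. \<bar>x \<bullet> b\<bar>)" by (rule norm_le_l1)
  also have "\<dots> = (\<Sum>b\<in>Basis - {b1, b2}. \<bar>x \<bullet> b\<bar>)" by (rule sum.mono_neutral_right) (use assms in auto)
  finally show ?thesis .
qed

lemma pnormal_mono:
  assumes "v \<in> pnormal Q \<sigma> x" "\<sigma> \<le> \<sigma>'" shows "v \<in> pnormal Q \<sigma>' x"
  unfolding pnormal_def
proof (intro CollectI ballI)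
  fix y assume "y \<in> Q"
  then have "v \<bullet> (y - x) \<le> \<sigma> * (norm (y - x))\<^sup>2" using assms(1) by (auto simp: pnormal_def)
  also have "\<dots> \<le> \<sigma>' * (norm (y - x))\<^sup>2" using assms(2) by (intro mult_right_mono) auto
  finally show "v \<bullet> (y - x) \<le> \<sigma>' * (norm (y - x))\<^sup>2" .
qed

lemma sum_insert_Some:
  assumes "finite I"
  shows "(\<Sum>i\<in>insert None (Some ` I). h i) = h None + (\<Sum>i\<in>I. h (Some i))"
proof -
  have "(\<Sum>i\<in>Some ` I. h i) = (\<Sum>i\<in>I. h (Some i))" by (subst sum.reindex) auto
  moreover have "None \<notin> Some ` I" "finite (Some ` I)" using assms by auto
  ultimately show ?thesis by (simp add: sum.insert)
qed

lemma card_insert_Some: "finite I \<Longrightarrow> card (insert None (Some ` I)) = Suc (card I)"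
  by (simp add: card_image card_insert_if image_iff)

definition corner_points :: "('a::euclidean_space \<Rightarrow> real) \<Rightarrow> 'a set" where
  "corner_points V = {x. \<exists>\<sigma> v1 v2. v1 \<in> pnormal (hypograph V) \<sigma> (x, V x) \<and> v2 \<in> pnormal (hypograph V) \<sigma> (x, V x) \<and>
     v1 \<noteq> 0 \<and> (\<forall>t. v2 \<noteq> t *\<^sub>R v1)}"

text \<open>Once two coordinates of \<open>(x, V x) + v\<close> are fixed rationals, d - 1 of the d
  + 1 are free, and \<open>pnormal_foot_lipschitz\<close> makes \<open>(x, V x)\<close>, hence
  \<open>x\<close>, a Lipschitz function of them.\<close>

lemma corner_points_rectifiable:
  fixes V :: "'a::euclidean_space \<Rightarrow> real"
  shows "countably_rectifiable (DIM('a) - 1) (corner_points V)"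
proof -
  define I where "I = {(b1, b2, r1, r2) | b1 b2 r1 r2. b1 \<in> (Basis :: ('a \<times> real) set) \<and> b2 \<in> Basis \<and> b1 \<noteq> b2 \<and> r1 \<in> (\<rat> :: real set) \<and> r2 \<in> (\<rat> :: real set)}"
  define B where "B i = (case i of (b1, b2, r1, r2) \<Rightarrow>
     {(x, v). v \<in> pnormal (hypograph V) (1/4) (x, V x) \<and> ((x, V x) + v) \<bullet> b1 = r1 \<and> ((x, V x) + v) \<bullet> b2 = r2})" for i
  have "countable I"
  proof (rule countable_subset)
    show "I \<subseteq> Basis \<times> Basis \<times> \<rat> \<times> \<rat>" by (auto simp: I_def)
    have b: "countable (Basis :: ('a \<times> real) set)" by (rule countable_finite) simp
    show "countable ((Basis :: ('a \<times> real) set) \<times> (Basis :: ('a \<times> real) set) \<times> (\<rat> :: real set) \<times> (\<rat> :: real set))"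
      by (intro countable_SIGMA b countable_rat)
  qed
  moreover have "countably_rectifiable (DIM('a) - 1) (fst ` B i)" if i: "i \<in> I" for i
  proof -
    obtain b1 b2 r1 r2 where b: "i = (b1, b2, r1, r2)" "b1 \<in> Basis" "b2 \<in> Basis" "b1 \<noteq> b2" using i by (auto simp: I_def)
    show ?thesis
    proof (rule countably_rectifiable_coordinates[where I="Basis - {b1, b2}" and c="\<lambda>(x, v) b. ((x, V x) + v) \<bullet> b" and C=2])
      have "card (Basis - {b1, b2}) = DIM('a \<times> real) - 2" using b by (simp add: card_Diff_subset)
      then show "card (Basis - {b1, b2}) \<le> DIM('a) - 1" by simp
      fix p p' assume p: "p \<in> B i" "p' \<in> B i"
      obtain x v x' v' where xv: "p = (x, v)" "p' = (x', v')" by (cases p, cases p') auto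
      let ?c = "((x, V x) + v) - ((x', V x') + v')"
      have n: "v \<in> pnormal (hypograph V) (1/4) (x, V x)" "v' \<in> pnormal (hypograph V) (1/4) (x', V x')"
        and z: "?c \<bullet> b1 = 0" "?c \<bullet> b2 = 0"
        using p by (auto simp: B_def b xv inner_diff_left)
      have "dist x x' \<le> norm ((x, V x) - (x', V x'))" by (simp add: dist_norm norm_fst_le)
      also have "\<dots> \<le> 2 * norm ?c" by (rule pnormal_foot_lipschitz[OF _ n(1) _ n(2)]) auto
      also have "\<dots> \<le> 2 * (\<Sum>b\<in>Basis - {b1, b2}. \<bar>?c \<bullet> b\<bar>)"
        by (intro mult_left_mono norm_le_coordinates_except[OF b(2,3) z]) auto
      also have "\<dots> = 2 * (\<Sum>b\<in>Basis - {b1, b2}. \<bar>((x, V x) + v) \<bullet> b - ((x', V x') + v') \<bullet> b\<bar>)"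
        by (simp only: inner_diff_left)
      finally show "dist (fst p) (fst p')
          \<le> 2 * (\<Sum>b\<in>Basis - {b1, b2}. \<bar>(case p of (x, v) \<Rightarrow> \<lambda>b. ((x, V x) + v) \<bullet> b) b - (case p' of (x, v) \<Rightarrow> \<lambda>b. ((x, V x) + v) \<bullet> b) b\<bar>)"
        unfolding xv by (simp only: prod.case fst_conv)
    qed auto
  qed
  ultimately have "countably_rectifiable (DIM('a) - 1) (\<Union>i\<in>I. fst ` B i)" by (rule countably_rectifiable_UN)
  moreover have "corner_points V \<subseteq> (\<Union>i\<in>I. fst ` B i)"
  proof
    fix x assume "x \<in> corner_points V"
    then obtain \<sigma> v1 v2 where v: "v1 \<in> pnormal (hypograph V) \<sigma> (x, V x)" "v2 \<in> pnormal (hypograph V) \<sigma> (x, V x)"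
      "v1 \<noteq> 0" "\<And>t. v2 \<noteq> t *\<^sub>R v1" unfolding corner_points_def by blast
    obtain w b1 b2 where w: "w \<in> pnormal (hypograph V) (1/4) (x, V x)" "b1 \<in> Basis" "b2 \<in> Basis" "b1 \<noteq> b2"
      "((x, V x) + w) \<bullet> b1 \<in> \<rat>" "((x, V x) + w) \<bullet> b2 \<in> \<rat>"
      by (rule corner_rational_normal[OF v])
    have "(b1, b2, ((x, V x) + w) \<bullet> b1, ((x, V x) + w) \<bullet> b2) \<in> I" using w unfolding I_def by blast
    moreover have "(x, w) \<in> B (b1, b2, ((x, V x) + w) \<bullet> b1, ((x, V x) + w) \<bullet> b2)" using w(1) by (simp add: B_def)
    then have "x \<in> fst ` B (b1, b2, ((x, V x) + w) \<bullet> b1, ((x, V x) + w) \<bullet> b2)" by (rule image_eqI[rotated]) simp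
    ultimately show "x \<in> (\<Union>i\<in>I. fst ` B i)" by (rule UN_I)
  qed
  ultimately show ?thesis by (rule countably_rectifiable_subset)
qed

section \<open>From singular points to abnormal extremals\<close>

context exit_problem
begin

text \<open>Hitting points of near-optimal trajectories converge to \<open>xs\<close>, and their
  hitting times exceed \<open>T / 2\<close>, which serves as the \<delta> of
  \<open>reachable_boundary\<close>.\<close>

lemma limit_end_reachable:
  assumes le: "limit_end x T xs" and x: "x \<notin> S" and T: "T > 0" and xs: "xs \<in> frontier S"
  shows "xs \<in> reachable_boundary U S f"
proof -
  define \<kappa> where "\<kappa> n = min (T / 2) (1 / real (Suc n))" for n
  have \<kappa>: "\<kappa> n > 0" "\<kappa> n \<le> T / 2" "\<kappa> n \<le> 1 / real (Suc n)" for n using T by (auto simp: \<kappa>_def)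
  have "\<forall>n. \<exists>u y \<tau>. near_opt (\<kappa> n) x T xs u y \<tau>" using le \<kappa>(1) unfolding limit_end_def by blast
  then obtain u y \<tau> where no: "\<And>n. near_opt (\<kappa> n) x T xs (u n) (y n) (\<tau> n)" by metis
  have tr: "traj x (u n) (y n)" and hit: "is_hitting_time S (y n) (\<tau> n)" and \<tau>: "\<bar>\<tau> n - T\<bar> \<le> \<kappa> n"
    and yx: "norm (y n (\<tau> n) - xs) \<le> \<kappa> n" for n using no[of n] by (auto simp: near_opt_def)
  define z where "z n = y n (\<tau> n)" for n
  have "z n \<in> frontier S" for n unfolding z_def by (rule hitting_point_frontier(1)[OF tr x hit])
  moreover have "z \<longlonglongrightarrow> xs"
  proof (rule Lim_null_comparison[THEN Lim_null[THEN iffD2]])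
    show "\<forall>\<^sub>F n in sequentially. norm (z n - xs) \<le> 1 / real (Suc n)"
      using order_trans[OF yx \<kappa>(3)] by (simp add: z_def)
    show "(\<lambda>n. 1 / real (Suc n)) \<longlonglongrightarrow> 0" using LIMSEQ_inverse_real_of_nat by (simp add: inverse_eq_divide)
  qed
  moreover have "\<exists>x u y T'. admissible_control U u \<and> caratheodory_solution f x u y \<and> is_hitting_time S y T' \<and> T / 2 \<le> T' \<and> z n = y T'" for n
  proof (intro exI conjI)
    show "admissible_control U (u n)" "caratheodory_solution f x (u n) (y n)" using tr[of n] by (auto simp: traj_def)
    show "is_hitting_time S (y n) (\<tau> n)" by (rule hit)
    show "T / 2 \<le> \<tau> n" using \<tau>[of n] \<kappa>(2)[of n] by linarith
    show "z n = y n (\<tau> n)" by (simp add: z_def)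
  qed
  ultimately show ?thesis unfolding reachable_boundary_def using xs T half_gt_zero by blast
qed

lemma ball_subset_complement:
  assumes "x \<notin> S" obtains e where "e > 0" "ball x e \<inter> S = {}"
proof -
  have "open (- S)" using S_closed by (rule open_Compl)
  then obtain e where "e > 0" "ball x e \<subseteq> - S" using assms open_contains_ball by blast
  then show ?thesis using that by blast
qed

lemma time_positive:
  assumes "ball x e \<inter> S = {}" "xs \<in> frontier S" "norm (xs - x) \<le> N * T"
  shows "e \<le> N * T"
proof -
  have "xs \<in> S" using assms(2) frontier_subset_closed[OF S_closed] by blast
  then have "xs \<notin> ball x e" using assms(1) by blast
  then show ?thesis using assms(3) by (simp add: dist_norm norm_minus_commute)
qed

lemma frontier_nonempty: assumes "x \<notin> S" obtains x0 where "x0 \<in> frontier S"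
proof -
  have "frontier S \<noteq> {}" using S_ne assms by (auto simp: frontier_eq_empty)
  then show ?thesis using that by blast
qed

lemma terminal_data_for_normal:
  assumes sc: "locally_semiconcave g" and M1: "M1 \<ge> 1" "M1 \<le> M"
    and \<zeta>: "norm \<zeta> \<le> G" "\<forall>p\<in>ball xs (1 / M1). p \<in> W \<and> g p \<le> g xs + \<zeta> \<bullet> (p - xs) + M1 * (norm (p - xs))\<^sup>2"
    and le: "limit_end x T xs" and x: "x \<notin> S" and T: "T > 0" and xs: "xs \<in> frontier S"
    and v: "norm v \<le> M" "v \<in> pnormal (closure (- S)) \<sigma> xs" and \<sigma>: "\<sigma> \<le> M"
  shows "\<exists>\<mu><1. terminal_data M xs v \<zeta> \<mu>"
proof (rule terminal_data_exists[OF xs v(1) _ \<zeta>(1)])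
  have vM: "v \<in> pnormal (closure (- S)) M xs" by (rule pnormal_mono[OF v(2) \<sigma>])
  show vS: "v \<bullet> (p - xs) \<le> M * (norm (p - xs))\<^sup>2" if "p \<notin> S" for p
    using vM that closure_subset[of "- S"] unfolding pnormal_def by blast
  show "\<exists>\<omega>\<in>U. 0 \<le> v \<bullet> f xs \<omega>"
    by (rule normal_velocity_nonneg[OF le x T _ v(1) vS]) (use M1 in auto)
  fix p assume p: "p \<in> ball xs (1 / M)"
  have "1 / M \<le> 1 / M1" using M1 by (simp add: frac_le)
  then have "p \<in> ball xs (1 / M1)" using p by simp
  then have "p \<in> W \<and> g p \<le> g xs + \<zeta> \<bullet> (p - xs) + M1 * (norm (p - xs))\<^sup>2" using \<zeta>(2) by blast
  moreover have "M1 * (norm (p - xs))\<^sup>2 \<le> M * (norm (p - xs))\<^sup>2" using M1 by (intro mult_right_mono) auto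
  ultimately show "p \<in> W \<and> g p \<le> g xs + \<zeta> \<bullet> (p - xs) + M * (norm (p - xs))\<^sup>2" by linarith
qed

text \<open>The inner ball supplies a unit normal \<xi> of fixed quality at every exit point, so one
  \<open>M\<close> serves all \<open>y\<close> near \<open>x\<close> in \<open>limit_normal\<close>.
  The lower bound on length holds because |q| and \<mu> cannot both be small: for small \<mu> the
  terminal covector is close to the unit vector \<xi>.\<close>

lemma uniform_normals:
  assumes sc: "locally_semiconcave g" and ib: "inner_ball_condition S \<rho>0" and \<rho>0: "\<rho>0 > 0" and x: "x \<notin> S"
  obtains \<rho> c B \<sigma> where "\<rho> > 0" "c > 0"
    "\<And>y. y \<in> ball x \<rho> \<Longrightarrow> \<exists>P\<in>pnormal (hypograph V) \<sigma> (y, V y). c \<le> norm P \<and> norm P \<le> B"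
proof -
  obtain x0 where x0: "x0 \<in> frontier S" by (rule frontier_nonempty[OF x])
  obtain e where e: "e > 0" "ball x e \<inter> S = {}" by (rule ball_subset_complement[OF x])
  have "isCont V x" using V_cont by (simp add: continuous_on_eq_continuous_at)
  then obtain d where d: "d > 0" "\<And>y. dist y x < d \<Longrightarrow> dist (V y) (V x) < 1"
    unfolding continuous_at_eps_delta dist_real_def using zero_less_one by (metis dist_norm)
  define kap where "kap = r0 - G * N"
  have kap: "kap > 0" using G_small by (simp add: kap_def)
  define \<rho> where "\<rho> = min (e / 2) d"
  have \<rho>: "\<rho> > 0" "\<rho> \<le> e / 2" "\<rho> \<le> d" using e d by (auto simp: \<rho>_def)
  \<comment> \<open>A bound for the exit times from all points of the ball, where \<open>V\<close>
    exceeds \<open>V x\<close> by at most 1; \<open>K\<close> is then a compact set containing all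
    their exit points.\<close>
  define Tm where "Tm = (V x + 1 - g x0 + G * (norm (x - x0) + \<rho>)) / kap"
  define K where "K = frontier S \<inter> cball 0 (norm x + \<rho> + N * \<bar>Tm\<bar>)"
  have "compact K" unfolding K_def by (intro closed_Int_compact frontier_closed compact_cball)
  moreover have "K \<subseteq> W" using W by (auto simp: K_def)
  ultimately obtain M1 where M1: "M1 \<ge> 1" and sg:
    "\<And>xs. xs \<in> K \<Longrightarrow> \<exists>\<zeta>. norm \<zeta> \<le> G \<and> (\<forall>p\<in>ball xs (1 / M1). p \<in> W \<and> g p \<le> g xs + \<zeta> \<bullet> (p - xs) + M1 * (norm (p - xs))\<^sup>2)"
    by (rule uniform_supergradient[OF sc]) (rule that)
  define M where "M = M1 + \<bar>Tm\<bar> + N / (e / 2) + 1 / (e / 2) + 1 / (2 * \<rho>0)"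
  have Mparts: "N / (e / 2) > 0" "1 / (e / 2) > 0" "1 / (2 * \<rho>0) > 0" using e N_pos \<rho>0 by auto
  have M: "M \<ge> M1" "M \<ge> 1" "M \<ge> \<bar>Tm\<bar>" "M \<ge> N / (e / 2)" "M \<ge> 1 / (e / 2)" "M \<ge> 1 / (2 * \<rho>0)"
    using Mparts M1 unfolding M_def by linarith+
  obtain \<sigma> where \<sigma>: "\<sigma> > 0" and ln:
    "\<And>x T xs v \<zeta> \<mu>. limit_end x T xs \<Longrightarrow> x \<notin> S \<Longrightarrow> ball x (1 / M) \<inter> S = {} \<Longrightarrow> 1 / M \<le> T \<Longrightarrow> T \<le> M \<Longrightarrow>
      terminal_data M xs v \<zeta> \<mu> \<Longrightarrow>
      \<exists>q. norm q \<le> \<sigma> \<and> norm ((1 - \<mu>) *\<^sub>R v - \<mu> *\<^sub>R \<zeta>) \<le> \<sigma> * (norm q + \<mu>) \<and> (q, \<mu>) \<in> pnormal (hypograph V) \<sigma> (x, V x)"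
    by (rule limit_normal[OF M(2)]) (rule that)
  \<comment> \<open>From 1 - \<mu> \<le> \<sigma> (|q| + \<mu>) + \<mu> G follows 1 \<le> (\<sigma>
    + G + 1) (|q| + \<mu>), and |q| + \<mu> is at most twice the norm of the pair.\<close>
  define c where "c = 1 / (2 * (\<sigma> + G + 1))"
  have sG: "\<sigma> + G + 1 > 0" using \<sigma> G_nonneg by simp
  then have c: "c > 0" by (simp add: c_def)
  show ?thesis
  proof (rule that[OF \<rho>(1) c])
    fix y assume y: "y \<in> ball x \<rho>"
    have yx: "norm (y - x) < \<rho>" using y by (simp add: dist_norm norm_minus_commute)
    have bye: "ball y (e / 2) \<inter> S = {}"
    proof -
      have "ball y (e / 2) \<subseteq> ball x e"
      proof
        fix p assume "p \<in> ball y (e / 2)"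
        then have "dist y p < e / 2" by simp
        then show "p \<in> ball x e" using dist_triangle[of x p y] yx \<rho>(2) by (simp add: dist_norm norm_minus_commute)
      qed
      then show ?thesis using e(2) by blast
    qed
    have "y \<in> ball y (e / 2)" using e by simp
    then have yS: "y \<notin> S" using bye by blast
    obtain T xs where le: "limit_end y T xs" and xs: "xs \<in> frontier S" and T0: "T \<ge> 0"
      and Tb: "(r0 - G * N) * T \<le> V y - g x0 + G * norm (y - x0)" and xsy: "norm (xs - y) \<le> N * T"
      by (rule limit_end_exists[OF yS x0])
    have "dist (V y) (V x) < 1" by (rule d(2)) (use yx \<rho>(3) in \<open>simp add: dist_norm\<close>)
    then have "V y \<le> V x + 1" by (simp add: dist_real_def)
    moreover have "G * norm (y - x0) \<le> G * (norm (x - x0) + \<rho>)"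
      using norm_triangle_ineq[of "y - x" "x - x0"] yx G_nonneg by (intro mult_left_mono) auto
    ultimately have "kap * T \<le> V x + 1 - g x0 + G * (norm (x - x0) + \<rho>)" using Tb by (simp add: kap_def)
    then have TTm: "T \<le> Tm" using kap by (simp add: Tm_def pos_le_divide_eq mult.commute)
    have eT: "e / 2 \<le> N * T" by (rule time_positive[OF bye xs xsy])
    have "xs \<in> K"
    proof -
      have "norm xs \<le> norm (xs - y) + norm (y - x) + norm x"
        using norm_triangle_ineq[of "xs - y" "y"] norm_triangle_ineq[of "y - x" x] by simp
      moreover have "N * T \<le> N * \<bar>Tm\<bar>" using TTm N_pos by (intro mult_left_mono) auto
      ultimately show ?thesis using xs xsy yx by (simp add: K_def)
    qed
    then obtain \<zeta> where \<zeta>: "norm \<zeta> \<le> G" "\<forall>p\<in>ball xs (1 / M1). p \<in> W \<and> g p \<le> g xs + \<zeta> \<bullet> (p - xs) + M1 * (norm (p - xs))\<^sup>2"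
      using sg by blast
    obtain \<xi> where \<xi>: "norm \<xi> = 1" "\<forall>p\<in>closure (- S). \<xi> \<bullet> (p - xs) \<le> 1 / (2 * \<rho>0) * (norm (p - xs))\<^sup>2"
      using ib xs unfolding inner_ball_condition_def by blast
    have \<xi>n: "\<xi> \<in> pnormal (closure (- S)) (1 / (2 * \<rho>0)) xs" using \<xi>(2) by (simp add: pnormal_def)
    have TM: "1 / M \<le> T"
    proof -
      have "e / 2 / N \<le> T" using eT N_pos by (simp add: pos_divide_le_eq mult_ac)
      moreover have "1 / M \<le> e / 2 / N"
      proof -
        have "1 / M \<le> 1 / (N / (e / 2))" by (rule frac_le[OF _ _ Mparts(1) M(4)]) auto
        then show ?thesis by simp
      qed
      ultimately show ?thesis by linarith
    qed
    have Tpos: "T > 0"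
    proof -
      have "1 / M > 0" using M by simp
      then show ?thesis using TM by linarith
    qed
    obtain \<mu> where td: "terminal_data M xs \<xi> \<zeta> \<mu>"
      using terminal_data_for_normal[OF sc M1 M(1) \<zeta> le yS Tpos xs _ \<xi>n M(6)] \<xi>(1) M(2) by auto
    have \<mu>: "0 \<le> \<mu>" "\<mu> \<le> 1" using td by (auto simp: terminal_data_def)
    have bM: "ball y (1 / M) \<inter> S = {}"
    proof -
      have "1 / M \<le> 1 / (1 / (e / 2))" by (rule frac_le[OF _ _ Mparts(2) M(5)]) auto
      then have "ball y (1 / M) \<subseteq> ball y (e / 2)" by (intro subset_ball) simp
      then show ?thesis using bye by blast
    qed
    have TM2: "T \<le> M" using TTm M(3) by linarith
    obtain q where q: "norm q \<le> \<sigma>" "norm ((1 - \<mu>) *\<^sub>R \<xi> - \<mu> *\<^sub>R \<zeta>) \<le> \<sigma> * (norm q + \<mu>)"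
      "(q, \<mu>) \<in> pnormal (hypograph V) \<sigma> (y, V y)"
      using ln[OF le yS bM TM TM2 td] by blast
    have "1 - \<mu> = norm ((1 - \<mu>) *\<^sub>R \<xi>)" using \<xi>(1) \<mu> by simp
    also have "\<dots> \<le> norm ((1 - \<mu>) *\<^sub>R \<xi> - \<mu> *\<^sub>R \<zeta>) + norm (\<mu> *\<^sub>R \<zeta>)"
      using norm_triangle_sub[of "(1 - \<mu>) *\<^sub>R \<xi>" "\<mu> *\<^sub>R \<zeta>"] by simp
    also have "norm (\<mu> *\<^sub>R \<zeta>) \<le> \<mu> * G" using \<mu> \<zeta>(1) by (simp add: mult_left_mono)
    finally have "1 - \<mu> \<le> \<sigma> * (norm q + \<mu>) + \<mu> * G" using q(2) by linarith
    moreover have "\<mu> * G + \<mu> \<le> (G + 1) * (norm q + \<mu>)"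
    proof -
      have "(G + 1) * \<mu> \<le> (G + 1) * (norm q + \<mu>)" using G_nonneg by (intro mult_left_mono) auto
      then show ?thesis by (simp add: algebra_simps)
    qed
    ultimately have "1 \<le> (\<sigma> + G + 1) * (norm q + \<mu>)" by (simp add: algebra_simps)
    moreover have "norm q + \<mu> \<le> 2 * norm (q, \<mu>)"
      using norm_fst_le[of q \<mu>] norm_snd_le[of \<mu> q] \<mu> by simp
    ultimately have "1 \<le> (\<sigma> + G + 1) * (2 * norm (q, \<mu>))" using sG by (meson mult_left_mono less_imp_le order_trans)
    then have "c \<le> norm (q, \<mu>)" 
    proof -
      assume a: "1 \<le> (\<sigma> + G + 1) * (2 * norm (q, \<mu>))"
      have "(\<sigma> + G + 1) * (2 * norm (q, \<mu>)) = norm (q, \<mu>) * (2 * (\<sigma> + G + 1))" by (simp only: mult_ac)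
      then have "1 \<le> norm (q, \<mu>) * (2 * (\<sigma> + G + 1))" by (rule order_trans[OF a eq_refl])
      moreover have "0 < 2 * (\<sigma> + G + 1)" using sG by simp
      ultimately show ?thesis unfolding c_def by (simp only: pos_divide_le_eq)
    qed
    moreover have "norm (q, \<mu>) \<le> \<sigma> + 1" using norm_Pair_le[of q \<mu>] q(1) \<mu> by simp
    ultimately show "\<exists>P\<in>pnormal (hypograph V) \<sigma> (y, V y). c \<le> norm P \<and> norm P \<le> \<sigma> + 1" using q(3) by blast
  qed
qed

text \<open>An extremal with \<open>\<mu> > 0\<close> yields a non-horizontal normal to the hypograph, which outside the corner
  set is unique and therefore forces differentiability.\<close>

lemma nondifferentiable_abnormal:
  assumes sc: "locally_semiconcave g" and ib: "inner_ball_condition S \<rho>0" and \<rho>0: "\<rho>0 > 0" and x: "x \<notin> S"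
    and nd: "\<not> V differentiable (at x)" and nc: "x \<notin> corner_points V"
    and le: "limit_end x T xs" and xs: "xs \<in> frontier S" and T: "T > 0"
    and v: "v \<in> pnormal (closure (- S)) \<sigma>v xs" "v \<noteq> 0"
  shows "\<exists>M \<zeta>. M \<ge> 1 \<and> terminal_data M xs v \<zeta> 0"
proof -
  obtain e where e: "e > 0" "ball x e \<inter> S = {}" by (rule ball_subset_complement[OF x])
  have "{xs} \<subseteq> W" using xs W by blast
  obtain M1 where M1: "M1 \<ge> 1" and sg:
    "\<And>xs'. xs' \<in> {xs} \<Longrightarrow> \<exists>\<zeta>. norm \<zeta> \<le> G \<and> (\<forall>p\<in>ball xs' (1 / M1). p \<in> W \<and> g p \<le> g xs' + \<zeta> \<bullet> (p - xs') + M1 * (norm (p - xs'))\<^sup>2)"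
    by (rule uniform_supergradient[OF sc compact_sing \<open>{xs} \<subseteq> W\<close>]) (rule that)
  obtain \<zeta> where \<zeta>: "norm \<zeta> \<le> G" "\<forall>p\<in>ball xs (1 / M1). p \<in> W \<and> g p \<le> g xs + \<zeta> \<bullet> (p - xs) + M1 * (norm (p - xs))\<^sup>2"
    using sg by blast
  define M where "M = M1 + norm v + \<bar>\<sigma>v\<bar> + T + 1 / T + 1 / e"
  have parts: "1 / T > 0" "1 / e > 0" using T e by auto
  have M: "M \<ge> M1" "M \<ge> 1" "M \<ge> norm v" "M \<ge> \<sigma>v" "M \<ge> T" "M \<ge> 1 / T" "M \<ge> 1 / e"
    using parts M1 T norm_ge_zero[of v] unfolding M_def by linarith+
  obtain \<mu> where td: "terminal_data M xs v \<zeta> \<mu>"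
    using terminal_data_for_normal[OF sc M1 M(1) \<zeta> le x T xs M(3) v(1) M(4)] by blast
  have \<mu>: "0 \<le> \<mu>" using td by (auto simp: terminal_data_def)
  have "\<mu> = 0"
  proof (rule ccontr)
    assume "\<mu> \<noteq> 0"
    then have \<mu>pos: "\<mu> > 0" using \<mu> by simp
    obtain \<sigma> where ln:
      "\<And>x T xs v \<zeta> \<mu>. limit_end x T xs \<Longrightarrow> x \<notin> S \<Longrightarrow> ball x (1 / M) \<inter> S = {} \<Longrightarrow> 1 / M \<le> T \<Longrightarrow> T \<le> M \<Longrightarrow>
        terminal_data M xs v \<zeta> \<mu> \<Longrightarrow>
        \<exists>q. norm q \<le> \<sigma> \<and> norm ((1 - \<mu>) *\<^sub>R v - \<mu> *\<^sub>R \<zeta>) \<le> \<sigma> * (norm q + \<mu>) \<and> (q, \<mu>) \<in> pnormal (hypograph V) \<sigma> (x, V x)"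
      by (rule limit_normal[OF M(2)]) (rule that)
    have "1 / M \<le> 1 / (1 / e)" by (rule frac_le[OF _ _ parts(2) M(7)]) auto
    then have "ball x (1 / M) \<subseteq> ball x e" by (intro subset_ball) simp
    then have bM: "ball x (1 / M) \<inter> S = {}" using e by blast
    have "1 / M \<le> 1 / (1 / T)" by (rule frac_le[OF _ _ parts(1) M(6)]) auto
    then have TM: "1 / M \<le> T" by simp
    obtain q where q: "(q, \<mu>) \<in> pnormal (hypograph V) \<sigma> (x, V x)" using ln[OF le x bM TM M(5) td] by blast
    obtain \<rho> c B \<sigma>0 where un: "\<rho> > 0" "c > 0"
      "\<And>y. y \<in> ball x \<rho> \<Longrightarrow> \<exists>P\<in>pnormal (hypograph V) \<sigma>0 (y, V y). c \<le> norm P \<and> norm P \<le> B"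
      by (rule uniform_normals[OF sc ib \<rho>0 x]) (rule that)
    have uni: "\<exists>t. P = t *\<^sub>R (q, \<mu>)" if P: "P \<in> pnormal (hypograph V) \<sigma>' (x, V x)" for P \<sigma>'
    proof (rule ccontr)
      assume "\<nexists>t. P = t *\<^sub>R (q, \<mu>)"
      moreover have "(q, \<mu>) \<in> pnormal (hypograph V) (max \<sigma> \<sigma>') (x, V x)" by (rule pnormal_mono[OF q]) simp
      moreover have "P \<in> pnormal (hypograph V) (max \<sigma> \<sigma>') (x, V x)" by (rule pnormal_mono[OF P]) simp
      moreover have "(q, \<mu>) \<noteq> 0" using \<mu>pos by (simp add: zero_prod_def)
      ultimately show False using nc unfolding corner_points_def by blast
    qed
    have "V differentiable (at x)"
      by (rule hypograph_unique_normal_differentiable[OF V_cont q \<mu>pos uni un])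
    then show False using nd by blast
  qed
  then show ?thesis using td M by blast
qed

text \<open>The hypotheses of \<open>abnormal_approx_arc\<close> with one bound \<open>R\<close>.
  Every abnormal extremal with nonzero \<open>v\<close> satisfies them for some natural number
  \<open>R\<close>, so countably many classes with uniform constants suffice.\<close>

definition abnormal_data :: "real \<Rightarrow> real^'d \<Rightarrow> real \<Rightarrow> real^'d \<Rightarrow> real^'d \<Rightarrow> bool" where
  "abnormal_data R x T xs v \<longleftrightarrow> limit_end x T xs \<and> x \<notin> S \<and> 0 < T \<and> T \<le> R \<and> (\<exists>M \<zeta>. M \<ge> 1 \<and> terminal_data M xs v \<zeta> 0) \<and>
     R > 0 \<and> norm x + N * (T + 1) \<le> R \<and> norm v * exp (L * (T + 1)) \<le> R \<and> 1 / R \<le> norm v * exp (- (L * (T + 1)))"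

lemma abnormal_data_exists:
  assumes "limit_end x T xs" "x \<notin> S" "T > 0" "M \<ge> 1" "terminal_data M xs v \<zeta> 0" "v \<noteq> 0"
  shows "\<exists>n::nat. abnormal_data (real n) x T xs v"
proof -
  define c where "c = norm v * exp (- (L * (T + 1)))"
  have c: "c > 0" using assms by (simp add: c_def)
  obtain n :: nat where n: "real n > T + (norm x + N * (T + 1)) + norm v * exp (L * (T + 1)) + 1 / c"
    using reals_Archimedean2 by blast
  have parts: "norm x + N * (T + 1) \<ge> 0" "norm v * exp (L * (T + 1)) \<ge> 0" "1 / c > 0" using assms c N_pos by auto
  have b: "T \<le> real n" "norm x + N * (T + 1) \<le> real n" "norm v * exp (L * (T + 1)) \<le> real n" "1 / c \<le> real n" "0 < real n"
    using n parts assms(3) by linarith+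
  have "1 / real n \<le> c" using b(4,5) c by (simp add: field_simps)
  then show ?thesis unfolding abnormal_data_def using assms b c_def by blast
qed

text \<open>Both initial points start approximate arcs of accuracy \<kappa> in the same annulus,
  ending near \<open>(xs, - v)\<close> and \<open>(xs', - v')\<close>.
  \<open>approx_arc_compare\<close> bounds their distance up to a multiple of \<kappa>, and \<kappa>
  is arbitrary. Initial covectors may depend on \<kappa>; only the states are compared in the
  conclusion.\<close>

lemma abnormal_data_compare:
  assumes DH: "\<And>z. z \<in> UNIV \<times> (UNIV - {0}) \<Longrightarrow> GDERIV (\<lambda>(x, p). H0 U f x p) z :> DH z"
    and loc: "locally_lipschitz_on (UNIV \<times> (UNIV - {0})) DH" and R: "R > 0"
  obtains C where "C > 0" "\<And>x T xs v x' T' xs' v'. abnormal_data R x T xs v \<Longrightarrow> abnormal_data R x' T' xs' v' \<Longrightarrow>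
     norm (x - x') \<le> C * (\<bar>T - T'\<bar> + norm (xs - xs') + norm (v - v'))"
proof -
  let ?W = "UNIV \<times> (UNIV - {0}) :: ((real^'d) \<times> (real^'d)) set"
  let ?F = "hamiltonian_field DH"
  have W: "open ?W" by (intro open_Times open_delete) auto
  have KW: "annulus R \<subseteq> ?W" using R by (auto simp: annulus_def)
  obtain \<Lambda> B where LB: "\<Lambda> \<ge> 0" "B \<ge> 0" "\<And>z. z \<in> annulus R \<Longrightarrow> norm (DH z) \<le> B"
    "\<And>z w. z \<in> annulus R \<Longrightarrow> w \<in> annulus R \<Longrightarrow> norm (DH w - DH z) \<le> \<Lambda> * norm (w - z)"
    by (rule locally_lipschitz_compact_global[OF loc W compact_annulus KW]) (rule that)
  have swap: "norm (- b, a) = norm (a, b)" for a b :: "real^'d" by (simp add: norm_Pair add.commute)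
  have Fn: "norm (?F z) = norm (DH z)" for z
    using swap[of "snd (DH z)" "fst (DH z)"] by (simp add: hamiltonian_field_def)
  have Fd: "norm (?F z - ?F w) = norm (DH z - DH w)" for z w
    by (simp add: hamiltonian_field_def norm_prod_def norm_minus_commute add.commute)
  have B: "norm (?F z) \<le> B" if "z \<in> annulus R" for z unfolding Fn by (rule LB(3)[OF that])
  have lip: "norm (?F z - ?F w) \<le> \<Lambda> * norm (z - w)" if "z \<in> annulus R" "w \<in> annulus R" for z w
    unfolding Fd by (rule LB(4)[OF that(2,1)])
  define E where "E = exp (\<Lambda> * (R + 1))"
  have E: "E > 0" by (simp add: E_def)
  define C where "C = E + B + 1"
  have C: "C > 0" using E LB by (simp add: C_def)
  show ?thesis
  proof (rule that[OF C])
    fix x T xs v x' T' xs' v' assume a: "abnormal_data R x T xs v" and a': "abnormal_data R x' T' xs' v'"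
    have step: "norm (x - x') \<le> E * (norm (xs - xs') + norm (v - v')) + B * \<bar>T - T'\<bar> + (4 * E + 2 * B + 1) * \<kappa>"
      if \<kappa>: "0 < \<kappa>" "\<kappa> \<le> 1" for \<kappa>
    proof -
      have "\<exists>T1 w0. \<bar>T1 - T\<bar> \<le> \<kappa> \<and> 0 < T1 \<and> fst w0 = x \<and> approx_arc ?F (annulus R) \<kappa> T1 w0 (xs, - v)"
      proof -
        obtain M \<zeta> where "M \<ge> 1" "terminal_data M xs v \<zeta> 0" using a unfolding abnormal_data_def by blast
        then show ?thesis using a unfolding abnormal_data_def
          by (intro abnormal_approx_arc[OF DH loc _ _ _ _ _ _ _ _ _ \<kappa>(1), where M=M and \<zeta>=\<zeta>]) auto
      qed
      then obtain T1 w0 where 1: "\<bar>T1 - T\<bar> \<le> \<kappa>" "0 < T1" "fst w0 = x" "approx_arc ?F (annulus R) \<kappa> T1 w0 (xs, - v)" by blast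
      have "\<exists>T1 w0. \<bar>T1 - T'\<bar> \<le> \<kappa> \<and> 0 < T1 \<and> fst w0 = x' \<and> approx_arc ?F (annulus R) \<kappa> T1 w0 (xs', - v')"
      proof -
        obtain M \<zeta> where "M \<ge> 1" "terminal_data M xs' v' \<zeta> 0" using a' unfolding abnormal_data_def by blast
        then show ?thesis using a' unfolding abnormal_data_def
          by (intro abnormal_approx_arc[OF DH loc _ _ _ _ _ _ _ _ _ \<kappa>(1), where M=M and \<zeta>=\<zeta>]) auto
      qed
      then obtain T2 w2 where 2: "\<bar>T2 - T'\<bar> \<le> \<kappa>" "0 < T2" "fst w2 = x'" "approx_arc ?F (annulus R) \<kappa> T2 w2 (xs', - v')" by blast
      have TR: "T1 \<le> R + 1" "T2 \<le> R + 1" using a a' 1 2 \<kappa> unfolding abnormal_data_def by linarith+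
      have "norm (w0 - w2) \<le> (norm ((xs, - v) - (xs', - v')) + 4 * \<kappa>) * E + B * \<bar>T1 - T2\<bar> + \<kappa>"
      proof (cases "T1 \<le> T2")
        case True
        have "norm (w0 - w2) \<le> (norm ((xs, - v) - (xs', - v')) + 4 * \<kappa>) * exp (\<Lambda> * (R + 1)) + B * (T2 - T1) + \<kappa>"
          by (rule approx_arc_compare[OF 1(4) 2(4) _ True TR(2) LB(1) lip B]) (use 1 in auto)
        then show ?thesis using True by (simp add: E_def)
      next
        case False
        then have le: "T2 \<le> T1" by simp
        have "norm (w2 - w0) \<le> (norm ((xs', - v') - (xs, - v)) + 4 * \<kappa>) * exp (\<Lambda> * (R + 1)) + B * (T1 - T2) + \<kappa>"
          by (rule approx_arc_compare[OF 2(4) 1(4) _ le TR(1) LB(1) lip B]) (use 2 in auto)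
        then show ?thesis using le by (simp only: E_def norm_minus_commute)
      qed
      moreover have "norm (x - x') \<le> norm (w0 - w2)"
      proof -
        have "norm (fst (w0 - w2)) \<le> norm (w0 - w2)"
          using norm_fst_le[of "fst (w0 - w2)" "snd (w0 - w2)"] by (simp only: prod.collapse)
        then show ?thesis using 1(3) 2(3) by simp
      qed
      moreover have "norm ((xs, - v) - (xs', - v')) \<le> norm (xs - xs') + norm (v - v')"
        using norm_Pair_le[of "xs - xs'" "- v + v'"] norm_minus_commute[of v' v] by simp
      then have "(norm ((xs, - v) - (xs', - v')) + 4 * \<kappa>) * E \<le> (norm (xs - xs') + norm (v - v') + 4 * \<kappa>) * E"
        using E by (intro mult_right_mono) auto
      moreover have "B * \<bar>T1 - T2\<bar> \<le> B * (\<bar>T - T'\<bar> + 2 * \<kappa>)"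
        using 1(1) 2(1) LB(2) by (intro mult_left_mono) linarith+
      ultimately show ?thesis by (simp add: algebra_simps)
    qed
    have "norm (x - x') \<le> E * (norm (xs - xs') + norm (v - v')) + B * \<bar>T - T'\<bar>"
    proof (rule field_le_epsilon)
      fix e :: real assume e: "e > 0"
      define D where "D = 4 * E + 2 * B + 1"
      have D: "D > 0" using E LB by (simp add: D_def)
      define \<kappa> where "\<kappa> = min 1 (e / D)"
      have "D * \<kappa> \<le> D * (e / D)" using D by (intro mult_left_mono) (auto simp: \<kappa>_def)
      also have "\<dots> = e" using D by simp
      finally have "D * \<kappa> \<le> e" .
      moreover have "0 < \<kappa>" "\<kappa> \<le> 1" using e D by (auto simp: \<kappa>_def)
      ultimately show "norm (x - x') \<le> E * (norm (xs - xs') + norm (v - v')) + B * \<bar>T - T'\<bar> + e"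
        using step[of \<kappa>] unfolding D_def by linarith
    qed
    also have "\<dots> \<le> C * (norm (xs - xs') + norm (v - v')) + C * \<bar>T - T'\<bar>"
      using E LB by (intro add_mono mult_right_mono) (auto simp: C_def)
    finally show "norm (x - x') \<le> C * (\<bar>T - T'\<bar> + norm (xs - xs') + norm (v - v'))" by (simp add: algebra_simps)
  qed
qed

end

section \<open>The singular set\<close>

lemma proximal_normal_iff: "v \<in> proximal_normal Q x \<longleftrightarrow> (\<exists>\<sigma>\<ge>0. v \<in> pnormal Q \<sigma> x)"
  by (simp add: proximal_normal_def pnormal_def)

context exit_problem
begin

definition corner_ends :: "(real^'d) set" where
  "corner_ends = {x. \<exists>n T xs v b1 b2. abnormal_data (real n) x T xs v \<and> xs \<in> closure (- S) \<and>
     v \<in> pnormal (closure (- S)) (1/4) xs \<and> b1 \<in> Basis \<and> b2 \<in> Basis \<and> b1 \<noteq> b2 \<and>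
     (xs + v) \<bullet> b1 \<in> \<rat> \<and> (xs + v) \<bullet> b2 \<in> \<rat>}"

definition regular_ends :: "(real^'d) set \<Rightarrow> (real^'d \<Rightarrow> real^'d) \<Rightarrow> (real^'d) set" where
  "regular_ends Z \<nu> = {x. \<exists>n T xs. abnormal_data (real n) x T xs (\<nu> xs) \<and> xs \<in> Z}"

text \<open>The parameters are the exit time and the d - 2 coordinates of \<open>xs + v\<close> that
  are not pinned to rationals. They determine \<open>xs\<close> and \<open>v\<close> in a Lipschitz
  way, and \<open>abnormal_data_compare\<close> then determines \<open>x\<close>.\<close>

lemma corner_ends_rectifiable:
  assumes DH: "\<And>z. z \<in> UNIV \<times> (UNIV - {0}) \<Longrightarrow> GDERIV (\<lambda>(x, p). H0 U f x p) z :> DH z"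
    and loc: "locally_lipschitz_on (UNIV \<times> (UNIV - {0})) DH"
  shows "countably_rectifiable (CARD('d) - 1) corner_ends"
proof -
  define I where "I = {(n, b1, b2, r1, r2) | n b1 b2 r1 r2. (n :: nat) \<in> UNIV \<and> b1 \<in> (Basis :: (real^'d) set) \<and> b2 \<in> (Basis :: (real^'d) set) \<and>
    b1 \<noteq> b2 \<and> r1 \<in> (\<rat> :: real set) \<and> r2 \<in> (\<rat> :: real set)}"
  define B where "B i = (case i of (n, b1, b2, r1, r2) \<Rightarrow>
     {(x, T, xs, v). abnormal_data (real n) x T xs v \<and> xs \<in> closure (- S) \<and> v \<in> pnormal (closure (- S)) (1/4) xs \<and>
        (xs + v) \<bullet> b1 = r1 \<and> (xs + v) \<bullet> b2 = r2})" for i :: "nat \<times> (real^'d) \<times> (real^'d) \<times> real \<times> real"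
  have "countable I"
  proof (rule countable_subset)
    show "I \<subseteq> UNIV \<times> Basis \<times> Basis \<times> \<rat> \<times> \<rat>" by (auto simp: I_def)
    have b: "countable (Basis :: (real^'d) set)" by (rule countable_finite) simp
    show "countable ((UNIV :: nat set) \<times> (Basis :: (real^'d) set) \<times> (Basis :: (real^'d) set) \<times> (\<rat> :: real set) \<times> (\<rat> :: real set))"
      by (intro countable_SIGMA b countable_rat countableI_type)
  qed
  moreover have "countably_rectifiable (CARD('d) - 1) (fst ` B i)" if i: "i \<in> I" for i
  proof -
    obtain n b1 b2 r1 r2 where b: "i = (n, b1, b2, r1, r2)" "b1 \<in> Basis" "b2 \<in> Basis" "b1 \<noteq> b2" using i by (auto simp: I_def)
    show ?thesis
    proof (cases "n = 0")
      case True
      then have "B i = {}" by (auto simp: B_def b abnormal_data_def)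
      then show ?thesis by (simp add: countably_rectifiable_empty)
    next
      case False
      then have n: "real n > 0" by simp
      obtain C where C: "C > 0" and cmp: "\<And>x T xs v x' T' xs' v'. abnormal_data (real n) x T xs v \<Longrightarrow> abnormal_data (real n) x' T' xs' v' \<Longrightarrow>
          norm (x - x') \<le> C * (\<bar>T - T'\<bar> + norm (xs - xs') + norm (v - v'))"
        by (rule abnormal_data_compare[OF DH loc n]) (assumption, rule that)
      define J where "J = Basis - {b1, b2}"
      \<comment> \<open>The index \<open>None\<close> stands for the exit time,
        \<open>Some b\<close> for a free coordinate of \<open>xs + v\<close>.\<close>
      define c where "c p l = (case p of (x :: real^'d, T :: real, xs, v) \<Rightarrow> case l of None \<Rightarrow> T | Some b \<Rightarrow> (xs + v) \<bullet> b)" for p and l :: "(real^'d) option"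
      have J: "finite J" by (simp add: J_def)
      show ?thesis
      proof (rule countably_rectifiable_coordinates[where I="insert None (Some ` J)" and c=c and C="5 * C"])
        show "finite (insert None (Some ` J))" using J by simp
        have cB: "card (Basis :: (real^'d) set) = CARD('d)" by simp
        have "card {b1, b2} \<le> card (Basis :: (real^'d) set)" by (rule card_mono) (use b in auto)
        then have "2 \<le> CARD('d)" using b(4) unfolding cB by simp
        moreover have "card J = CARD('d) - 2" unfolding J_def using b cB by (simp add: card_Diff_subset)
        ultimately show "card (insert None (Some ` J)) \<le> CARD('d) - 1" unfolding card_insert_Some[OF J] by simp
        show "0 \<le> 5 * C" using C by simp
        fix p p' assume p: "p \<in> B i" "p' \<in> B i"
        obtain x T xs v where e: "p = (x, T, xs, v)" by (rule prod_cases4)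
        obtain x' T' xs' v' where e': "p' = (x', T', xs', v')" by (rule prod_cases4)
        have a: "abnormal_data (real n) x T xs v" "xs \<in> closure (- S)" "v \<in> pnormal (closure (- S)) (1/4) xs"
          "(xs + v) \<bullet> b1 = r1" "(xs + v) \<bullet> b2 = r2" using p(1) by (auto simp: B_def b e)
        have a': "abnormal_data (real n) x' T' xs' v'" "xs' \<in> closure (- S)" "v' \<in> pnormal (closure (- S)) (1/4) xs'"
          "(xs' + v') \<bullet> b1 = r1" "(xs' + v') \<bullet> b2 = r2" using p(2) by (auto simp: B_def b e')
        let ?c = "(xs + v) - (xs' + v')"
        have 1: "norm (xs - xs') \<le> 2 * norm ?c" by (rule pnormal_foot_lipschitz[OF a(2,3) a'(2,3)])
        have "v - v' = ?c - (xs - xs')" by simp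
        then have 2: "norm (v - v') \<le> norm ?c + norm (xs - xs')" by (simp only: norm_triangle_ineq4)
        have z: "?c \<bullet> b1 = 0" "?c \<bullet> b2 = 0" using a(4,5) a'(4,5) by (simp_all only: inner_diff_left)
        have 3: "norm ?c \<le> (\<Sum>b\<in>J. \<bar>(xs + v) \<bullet> b - (xs' + v') \<bullet> b\<bar>)"
          using norm_le_coordinates_except[OF b(2,3) z] unfolding J_def by (simp only: inner_diff_left)
        have "norm (x - x') \<le> C * (\<bar>T - T'\<bar> + norm (xs - xs') + norm (v - v'))" by (rule cmp[OF a(1) a'(1)])
        also have "\<dots> \<le> C * (5 * (\<bar>T - T'\<bar> + (\<Sum>b\<in>J. \<bar>(xs + v) \<bullet> b - (xs' + v') \<bullet> b\<bar>)))"
        proof (rule mult_left_mono)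
          have gen: "t + a + b \<le> 5 * (t + s)" if "0 \<le> t" "a \<le> 2 * c" "b \<le> c + a" "c \<le> s" for t a b c s :: real
            using that by simp
          show "\<bar>T - T'\<bar> + norm (xs - xs') + norm (v - v')
              \<le> 5 * (\<bar>T - T'\<bar> + (\<Sum>b\<in>J. \<bar>(xs + v) \<bullet> b - (xs' + v') \<bullet> b\<bar>))"
            by (rule gen[OF abs_ge_zero 1 2 3])
        qed (use C in simp)
        also have "\<dots> = 5 * C * (\<Sum>l\<in>insert None (Some ` J). \<bar>c p l - c p' l\<bar>)"
          unfolding sum_insert_Some[OF J] by (simp add: c_def e e')
        finally show "dist (fst p) (fst p') \<le> 5 * C * (\<Sum>l\<in>insert None (Some ` J). \<bar>c p l - c p' l\<bar>)"
          by (simp only: e e' fst_conv dist_norm)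
      qed
    qed
  qed
  ultimately have "countably_rectifiable (CARD('d) - 1) (\<Union>i\<in>I. fst ` B i)" by (rule countably_rectifiable_UN)
  moreover have "corner_ends \<subseteq> (\<Union>i\<in>I. fst ` B i)"
  proof
    fix x assume "x \<in> corner_ends"
    then obtain n T xs v b1 b2 where w: "abnormal_data (real n) x T xs v" "xs \<in> closure (- S)"
      "v \<in> pnormal (closure (- S)) (1/4) xs" "b1 \<in> Basis" "b2 \<in> Basis" "b1 \<noteq> b2" "(xs + v) \<bullet> b1 \<in> \<rat>" "(xs + v) \<bullet> b2 \<in> \<rat>"
      unfolding corner_ends_def by blast
    have "(n, b1, b2, (xs + v) \<bullet> b1, (xs + v) \<bullet> b2) \<in> I" using w unfolding I_def by blast
    moreover have "(x, T, xs, v) \<in> B (n, b1, b2, (xs + v) \<bullet> b1, (xs + v) \<bullet> b2)" using w(1-3) by (simp add: B_def)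
    then have "x \<in> fst ` B (n, b1, b2, (xs + v) \<bullet> b1, (xs + v) \<bullet> b2)" by (rule image_eqI[rotated]) simp
    ultimately show "x \<in> (\<Union>i\<in>I. fst ` B i)" by (rule UN_I)
  qed
  ultimately show ?thesis by (rule countably_rectifiable_subset)
qed

lemma regular_ends_piece_rectifiable:
  assumes DH: "\<And>z. z \<in> UNIV \<times> (UNIV - {0}) \<Longrightarrow> GDERIV (\<lambda>(x, p). H0 U f x p) z :> DH z"
    and loc: "locally_lipschitz_on (UNIV \<times> (UNIV - {0})) DH" and n: "real n > 0" and d: "CARD('d) \<ge> 2"
    and Z: "countably_rectifiable (CARD('d) - 2) Z" and C\<nu>: "C\<nu>-lipschitz_on Y \<nu>" and Y: "Y \<subseteq> Z"
  shows "countably_rectifiable (CARD('d) - 1) (fst ` {(x, T, xs). abnormal_data (real n) x T xs (\<nu> xs) \<and> xs \<in> Y})"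
proof -
  obtain C where C: "C > 0" and cmp: "\<And>x T xs v x' T' xs' v'. abnormal_data (real n) x T xs v \<Longrightarrow> abnormal_data (real n) x' T' xs' v' \<Longrightarrow>
      norm (x - x') \<le> C * (\<bar>T - T'\<bar> + norm (xs - xs') + norm (v - v'))"
    by (rule abnormal_data_compare[OF DH loc n]) (assumption, rule that)
  have C\<nu>0: "C\<nu> \<ge> 0" using C\<nu> by (rule lipschitz_on_nonneg)
  define K where "K = C * (1 + C\<nu>)"
  have K: "K > 0" using C C\<nu>0 by (simp add: K_def)
  have lip: "dist x x' \<le> K * (\<bar>T - T'\<bar> + dist xs xs')"
    if a: "abnormal_data (real n) x T xs (\<nu> xs)" "abnormal_data (real n) x' T' xs' (\<nu> xs')" "xs \<in> Y" "xs' \<in> Y" for x T xs x' T' xs'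
  proof -
    have "norm (\<nu> xs - \<nu> xs') \<le> C\<nu> * norm (xs - xs')" using lipschitz_onD[OF C\<nu> a(3,4)] by (simp add: dist_norm)
    moreover have "0 \<le> C\<nu> * \<bar>T - T'\<bar>" using C\<nu>0 by simp
    ultimately have "\<bar>T - T'\<bar> + norm (xs - xs') + norm (\<nu> xs - \<nu> xs') \<le> (1 + C\<nu>) * (\<bar>T - T'\<bar> + norm (xs - xs'))"
      by (simp add: algebra_simps)
    then have "C * (\<bar>T - T'\<bar> + norm (xs - xs') + norm (\<nu> xs - \<nu> xs')) \<le> C * ((1 + C\<nu>) * (\<bar>T - T'\<bar> + norm (xs - xs')))"
      using C by (intro mult_left_mono) auto
    then show ?thesis using cmp[OF a(1,2)] unfolding K_def dist_norm by (simp only: mult.assoc)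
  qed
  define D where "D = {(x, T, xs). abnormal_data (real n) x T xs (\<nu> xs) \<and> xs \<in> Y}"
  obtain A \<phi> where A: "\<And>i::nat. lipschitz_from_Rk (CARD('d) - 2) (A i) (\<phi> i)"
    and null: "hausdorff_measure (CARD('d) - 2) (Z - (\<Union>i. \<phi> i ` A i)) = 0"
    using Z unfolding countably_rectifiable_def by blast
  have sk: "Suc (CARD('d) - 2) = CARD('d) - 1" using d by simp
  define P where "P i = {(x, T, a). a \<in> A i \<and> (x, T, \<phi> i a) \<in> D}" for i
  have "countably_rectifiable (CARD('d) - 1) (fst ` P i)" for i
  proof -
    obtain C\<phi> where C\<phi>: "C\<phi> \<ge> 0" "\<And>a b. a \<in> A i \<Longrightarrow> b \<in> A i \<Longrightarrow> dist (\<phi> i a) (\<phi> i b) \<le> C\<phi> * L2_set (\<lambda>i. a i - b i) {..<CARD('d) - 2}"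
      using A[of i] unfolding lipschitz_from_Rk_def by blast
    define c where "c p l = (case p of (x :: real^'d, T, a) \<Rightarrow> case l of None \<Rightarrow> T | Some j \<Rightarrow> a j)" for p :: "(real^'d) \<times> real \<times> (nat \<Rightarrow> real)" and l :: "nat option"
    define J where "J = {..<CARD('d) - 2}"
    have J: "finite J" by (simp add: J_def)
    show ?thesis
    proof (rule countably_rectifiable_coordinates[where I="insert None (Some ` J)" and c=c and C="K * (1 + C\<phi>)"])
      show "finite (insert None (Some ` J))" using J by simp
      show "card (insert None (Some ` J)) \<le> CARD('d) - 1" unfolding card_insert_Some[OF J] using sk by (simp add: J_def)
      show "0 \<le> K * (1 + C\<phi>)" using K C\<phi> by simp
      fix p p' assume p: "p \<in> P i" "p' \<in> P i"
      obtain x T a where e: "p = (x, T, a)" by (rule prod_cases3)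
      obtain x' T' a' where e': "p' = (x', T', a')" by (rule prod_cases3)
      have a: "abnormal_data (real n) x T (\<phi> i a) (\<nu> (\<phi> i a))" "\<phi> i a \<in> Y" "a \<in> A i" using p(1) by (auto simp: P_def D_def e)
      have a': "abnormal_data (real n) x' T' (\<phi> i a') (\<nu> (\<phi> i a'))" "\<phi> i a' \<in> Y" "a' \<in> A i" using p(2) by (auto simp: P_def D_def e')
      have 1: "dist x x' \<le> K * (\<bar>T - T'\<bar> + dist (\<phi> i a) (\<phi> i a'))" by (rule lip[OF a(1) a'(1) a(2) a'(2)])
      have "dist (\<phi> i a) (\<phi> i a') \<le> C\<phi> * L2_set (\<lambda>i. a i - a' i) J" unfolding J_def by (rule C\<phi>(2)[OF a(3) a'(3)])
      also have "\<dots> \<le> C\<phi> * (\<Sum>j\<in>J. \<bar>a j - a' j\<bar>)" by (rule mult_left_mono[OF L2_set_le_sum_abs C\<phi>(1)])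
      finally have 2: "dist (\<phi> i a) (\<phi> i a') \<le> C\<phi> * (\<Sum>j\<in>J. \<bar>a j - a' j\<bar>)" .
      have 3: "0 \<le> (\<Sum>j\<in>J. \<bar>a j - a' j\<bar>)" by (rule sum_nonneg) simp
      have gen: "t + d \<le> (1 + C') * (t + s)" if "0 \<le> C' * t" "d \<le> C' * s" "0 \<le> s" for t d s C' :: real
        using that by (simp add: algebra_simps)
      have "0 \<le> C\<phi> * \<bar>T - T'\<bar>" using C\<phi> by simp
      then have "\<bar>T - T'\<bar> + dist (\<phi> i a) (\<phi> i a') \<le> (1 + C\<phi>) * (\<bar>T - T'\<bar> + (\<Sum>j\<in>J. \<bar>a j - a' j\<bar>))"
        using gen[OF _ 2 3] by simp
      then have "K * (\<bar>T - T'\<bar> + dist (\<phi> i a) (\<phi> i a')) \<le> K * ((1 + C\<phi>) * (\<bar>T - T'\<bar> + (\<Sum>j\<in>J. \<bar>a j - a' j\<bar>)))"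
        using K by (intro mult_left_mono) auto
      also have "\<dots> = K * (1 + C\<phi>) * (\<Sum>l\<in>insert None (Some ` J). \<bar>c p l - c p' l\<bar>)"
        unfolding sum_insert_Some[OF J] by (simp add: c_def e e')
      finally show "dist (fst p) (fst p') \<le> K * (1 + C\<phi>) * (\<Sum>l\<in>insert None (Some ` J). \<bar>c p l - c p' l\<bar>)"
        using 1 unfolding e e' fst_conv by (rule order_trans[rotated])
    qed
  qed
  then have rP: "countably_rectifiable (CARD('d) - 1) (\<Union>i. fst ` P i)" by (rule countably_rectifiable_UN_nat)
  define E where "E = {p \<in> D. snd (snd p) \<notin> (\<Union>i. \<phi> i ` A i)}"
  have "hausdorff_measure (Suc (CARD('d) - 2)) (fst ` E) = 0"
  proof (rule hausdorff_null_product[where \<eta>="\<lambda>p. snd (snd p)" and \<tau>="\<lambda>p. fst (snd p)" and M="real n" and C=K])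
    show "hausdorff_measure (CARD('d) - 2) ((\<lambda>p. snd (snd p)) ` E) = 0"
      by (rule hausdorff_null_subset[OF null]) (use Y in \<open>auto simp: E_def D_def\<close>)
    show "0 \<le> real n" by simp
    show "K > 0" by (rule K)
    show "0 \<le> fst (snd p) \<and> fst (snd p) \<le> real n" if "p \<in> E" for p
      using that by (auto simp: E_def D_def abnormal_data_def)
    fix p p' assume "p \<in> E" "p' \<in> E"
    then have "p \<in> D" "p' \<in> D" by (auto simp: E_def)
    then show "dist (fst p) (fst p') \<le> K * (\<bar>fst (snd p) - fst (snd p')\<bar> + dist (snd (snd p)) (snd (snd p')))"
      unfolding D_def using lip by (auto simp only: mem_Collect_eq case_prod_beta)
  qed
  then have "countably_rectifiable (CARD('d) - 1) (fst ` E)" unfolding sk by (rule countably_rectifiable_null)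
  with rP have "countably_rectifiable (CARD('d) - 1) ((\<Union>i. fst ` P i) \<union> fst ` E)" by (rule countably_rectifiable_Un)
  moreover have "fst ` D \<subseteq> (\<Union>i. fst ` P i) \<union> fst ` E"
  proof
    fix x assume "x \<in> fst ` D"
    then obtain T xs where D: "(x, T, xs) \<in> D" by auto
    show "x \<in> (\<Union>i. fst ` P i) \<union> fst ` E"
    proof (cases "xs \<in> (\<Union>i. \<phi> i ` A i)")
      case True
      then obtain i a where "xs = \<phi> i a" "a \<in> A i" by blast
      then have "(x, T, a) \<in> P i" using D by (simp add: P_def)
      then have "x \<in> fst ` P i" by (rule image_eqI[rotated]) simp
      then show ?thesis by blast
    next
      case False
      then have "(x, T, xs) \<in> E" using D by (simp add: E_def)
      then have "x \<in> fst ` E" by (rule image_eqI[rotated]) simp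
      then show ?thesis by blast
    qed
  qed
  ultimately show ?thesis unfolding D_def[symmetric] by (rule countably_rectifiable_subset)
qed

lemma regular_ends_rectifiable:
  assumes DH: "\<And>z. z \<in> UNIV \<times> (UNIV - {0}) \<Longrightarrow> GDERIV (\<lambda>(x, p). H0 U f x p) z :> DH z"
    and loc: "locally_lipschitz_on (UNIV \<times> (UNIV - {0})) DH"
    and Z: "countably_rectifiable (CARD('d) - 2) Z" and \<nu>: "locally_lipschitz_on Z \<nu>"
  shows "countably_rectifiable (CARD('d) - 1) (regular_ends Z \<nu>)"
proof (cases "CARD('d) = 1")
  case True
  have "\<not> abnormal_data R x T xs v" for R x T xs v
  proof
    assume a: "abnormal_data R x T xs v"
    then have "0 < 1 / R" "1 / R \<le> norm v * exp (- (L * (T + 1)))" by (auto simp: abnormal_data_def)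
    then have "v \<noteq> 0" by auto
    then show False using a abnormal_dim1[of x T xs _ v] True unfolding abnormal_data_def by blast
  qed
  then have "regular_ends Z \<nu> = {}" by (simp add: regular_ends_def)
  then show ?thesis by (simp add: countably_rectifiable_empty)
next
  case False
  have "CARD('d) > 0" by simp
  then have d: "CARD('d) \<ge> 2" using False by linarith
  define F where "F = {Y. open Y \<and> (\<exists>C. C-lipschitz_on (Y \<inter> Z) \<nu>)}"
  obtain F' where F': "F' \<subseteq> F" "countable F'" "\<Union>F' = \<Union>F"
    by (rule Lindelof[of F]) (auto simp: F_def)
  have cover: "Z \<subseteq> \<Union>F'"
  proof
    fix z assume z: "z \<in> Z"
    then obtain \<epsilon> C where "\<epsilon> > 0" "C-lipschitz_on (ball z \<epsilon> \<inter> Z) \<nu>" using \<nu> unfolding locally_lipschitz_on_def by blast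
    then have "ball z \<epsilon> \<in> F" "z \<in> ball z \<epsilon>" by (auto simp: F_def)
    then show "z \<in> \<Union>F'" unfolding F'(3) by blast
  qed
  define D where "D i = {(x, T, xs). abnormal_data (real (fst i)) x T xs (\<nu> xs) \<and> xs \<in> snd i \<inter> Z}" for i :: "nat \<times> (real^'d) set"
  have "countable ((UNIV :: nat set) \<times> F')" using F'(2) by (intro countable_SIGMA countableI_type)
  moreover have "countably_rectifiable (CARD('d) - 1) (fst ` D i)" if i: "i \<in> UNIV \<times> F'" for i
  proof (cases "fst i = 0")
    case True
    then have "D i = {}" by (auto simp: D_def abnormal_data_def)
    then show ?thesis by (simp add: countably_rectifiable_empty)
  next
    case False
    have "snd i \<in> F" using i F'(1) by auto
    then obtain C where C: "C-lipschitz_on (snd i \<inter> Z) \<nu>" by (auto simp: F_def)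
    show ?thesis unfolding D_def
      by (rule regular_ends_piece_rectifiable[OF DH loc _ d Z C]) (use False in auto)
  qed
  ultimately have "countably_rectifiable (CARD('d) - 1) (\<Union>i\<in>UNIV \<times> F'. fst ` D i)" by (rule countably_rectifiable_UN)
  moreover have "regular_ends Z \<nu> \<subseteq> (\<Union>i\<in>UNIV \<times> F'. fst ` D i)"
  proof
    fix x assume "x \<in> regular_ends Z \<nu>"
    then obtain n T xs where a: "abnormal_data (real n) x T xs (\<nu> xs)" "xs \<in> Z" unfolding regular_ends_def by blast
    obtain Y where Y: "Y \<in> F'" "xs \<in> Y" using a(2) cover by blast
    have "(x, T, xs) \<in> D (n, Y)" using a Y by (simp add: D_def)
    then have "x \<in> fst ` D (n, Y)" by (rule image_eqI[rotated]) simp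
    moreover have "(n, Y) \<in> UNIV \<times> F'" using Y by simp
    ultimately show "x \<in> (\<Union>i\<in>UNIV \<times> F'. fst ` D i)" by (rule UN_I[rotated])
  qed
  ultimately show ?thesis by (rule countably_rectifiable_subset)
qed

lemma nondifferentiable_cases:
  assumes sc: "locally_semiconcave g" and ib: "inner_ball_condition S \<rho>0" and \<rho>0: "\<rho>0 > 0"
    and \<nu>: "\<And>x. x \<in> reachable_boundary1 U S f \<Longrightarrow>
           norm (\<nu> x) = 1 \<and> proximal_normal (closure (- S)) x = {s *\<^sub>R \<nu> x | s. s \<ge> 0}"
    and x: "x \<notin> S" and nd: "\<not> V differentiable (at x)"
  shows "x \<in> corner_points V \<union> (corner_ends \<union> regular_ends (reachable_boundary10 U S f \<nu>) \<nu>)"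
proof (cases "x \<in> corner_points V")
  case nc: False
  let ?Q = "closure (- S)"
  obtain x0 where x0: "x0 \<in> frontier S" by (rule frontier_nonempty[OF x])
  obtain e where e: "e > 0" "ball x e \<inter> S = {}" by (rule ball_subset_complement[OF x])
  obtain T xs where le: "limit_end x T xs" and xs: "xs \<in> frontier S" and nT: "norm (xs - x) \<le> N * T"
    by (rule limit_end_exists[OF x x0]) (rule that)
  have "0 < N * T" using time_positive[OF e(2) xs nT] e(1) by linarith
  then have T: "T > 0" using N_pos by (rule zero_less_mult_pos)
  have xQ: "xs \<in> ?Q" using xs by (auto simp: frontier_def closure_complement)
  have abn: "\<exists>M \<zeta>. M \<ge> 1 \<and> terminal_data M xs v \<zeta> 0" if "v \<in> pnormal ?Q \<sigma> xs" "v \<noteq> 0" for v \<sigma>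
    by (rule nondifferentiable_abnormal[OF sc ib \<rho>0 x nd nc le xs T that])
  have data: "\<exists>n::nat. abnormal_data (real n) x T xs v" if v: "v \<in> pnormal ?Q \<sigma> xs" "v \<noteq> 0" for v \<sigma>
  proof -
    obtain M \<zeta> where "M \<ge> 1" "terminal_data M xs v \<zeta> 0" using abn[OF v] by blast
    then show ?thesis by (rule abnormal_data_exists[OF le x T _ _ v(2)])
  qed
  obtain \<xi> where \<xi>: "\<xi> \<in> proximal_normal ?Q xs" "norm \<xi> = 1" using ib xs unfolding inner_ball_condition_def by blast
  have \<xi>0: "\<xi> \<noteq> 0" using \<xi>(2) by auto
  obtain \<sigma>1 where \<sigma>1: "\<xi> \<in> pnormal ?Q \<sigma>1 xs" using \<xi>(1) unfolding proximal_normal_iff by blast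
  show ?thesis
  proof (cases "\<exists>v2\<in>proximal_normal ?Q xs. \<forall>t. v2 \<noteq> t *\<^sub>R \<xi>")
    case True
    then obtain v2 where v2P: "v2 \<in> proximal_normal ?Q xs" and ind: "\<forall>t. v2 \<noteq> t *\<^sub>R \<xi>" by (rule bexE)
    obtain \<sigma>2 where v2: "v2 \<in> pnormal ?Q \<sigma>2 xs" using v2P unfolding proximal_normal_iff by blast
    have m: "\<xi> \<in> pnormal ?Q (max \<sigma>1 \<sigma>2) xs" by (rule pnormal_mono[OF \<sigma>1]) simp
    have m2: "v2 \<in> pnormal ?Q (max \<sigma>1 \<sigma>2) xs" by (rule pnormal_mono[OF v2]) simp
    obtain v b1 b2 where v: "v \<in> pnormal ?Q (1/4) xs" "v \<noteq> 0" "b1 \<in> Basis" "b2 \<in> Basis" "b1 \<noteq> b2"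
      "(xs + v) \<bullet> b1 \<in> \<rat>" "(xs + v) \<bullet> b2 \<in> \<rat>"
      by (rule corner_rational_normal[OF m m2 \<xi>0 ind[rule_format]]) (rule that)
    obtain n where "abnormal_data (real n) x T xs v" using data[OF v(1,2)] by blast
    then have "x \<in> corner_ends" using v xQ unfolding corner_ends_def by blast
    then show ?thesis by blast
  next
    case False
    let ?P = "proximal_normal ?Q xs"
    have "?P \<subseteq> span {\<xi>}"
    proof
      fix w assume "w \<in> ?P"
      then obtain t where "w = t *\<^sub>R \<xi>" using False by blast
      then show "w \<in> span {\<xi>}" by (simp add: span_base span_scale)
    qed
    then have "dim ?P \<le> card {\<xi>}" by (rule dim_le_card) simp
    moreover have "dim {\<xi>} \<le> dim ?P" by (rule dim_subset) (use \<xi>(1) in simp)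
    moreover have "dim {\<xi>} = 1" using \<xi>0 by simp
    ultimately have "dim ?P = 1" by simp
    then have rb: "xs \<in> reachable_boundary1 U S f"
      using limit_end_reachable[OF le x T xs] by (simp add: reachable_boundary1_def)
    have n1: "norm (\<nu> xs) = 1" and P: "?P = {s *\<^sub>R \<nu> xs | s. s \<ge> 0}" using \<nu>[OF rb] by auto
    have \<nu>0: "\<nu> xs \<noteq> 0" using n1 by auto
    have "\<nu> xs \<in> ?P" unfolding P by (intro CollectI exI[of _ 1]) simp
    then obtain \<sigma> where \<sigma>: "\<nu> xs \<in> pnormal ?Q \<sigma> xs" unfolding proximal_normal_iff by blast
    obtain M \<zeta> where "terminal_data M xs (\<nu> xs) \<zeta> 0" using abn[OF \<sigma> \<nu>0] by blast
    then have "\<forall>\<omega>\<in>U. \<nu> xs \<bullet> f xs \<omega> \<le> 0" "\<exists>\<omega>\<in>U. \<nu> xs \<bullet> f xs \<omega> = 0" by (auto simp: terminal_data_def)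
    then have "(SUP \<omega>\<in>U. \<nu> xs \<bullet> f xs \<omega>) = 0" by (intro cSup_eq_maximum) force+
    then have "xs \<in> reachable_boundary10 U S f \<nu>" using rb by (simp add: reachable_boundary10_def)
    moreover obtain n where "abnormal_data (real n) x T xs (\<nu> xs)" using data[OF \<sigma> \<nu>0] by blast
    ultimately have "x \<in> regular_ends (reachable_boundary10 U S f \<nu>) \<nu>" unfolding regular_ends_def by blast
    then show ?thesis by blast
  qed
qed simp

theorem singular_set_rectifiable:
  assumes sc: "locally_semiconcave g" and ib: "inner_ball_condition S \<rho>0" and \<rho>0: "\<rho>0 > 0"
    and H: "C11_on (UNIV \<times> (UNIV - {0})) (\<lambda>(x, p). H0 U f x p)"
    and \<nu>: "\<And>x. x \<in> reachable_boundary1 U S f \<Longrightarrow>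
           norm (\<nu> x) = 1 \<and> proximal_normal (closure (- S)) x = {s *\<^sub>R \<nu> x | s. s \<ge> 0}"
    and Z: "countably_rectifiable (CARD('d) - 2) (reachable_boundary10 U S f \<nu>)"
    and \<nu>_lip: "locally_lipschitz_on (reachable_boundary10 U S f \<nu>) \<nu>"
  shows "countably_rectifiable (CARD('d) - 1) {x \<in> - S. \<not> V differentiable (at x)}"
proof -
  obtain DH where DH: "\<And>z. z \<in> UNIV \<times> (UNIV - {0}) \<Longrightarrow> GDERIV (\<lambda>(x, p). H0 U f x p) z :> DH z"
    and loc: "locally_lipschitz_on (UNIV \<times> (UNIV - {0})) DH" using H unfolding C11_on_def by blast
  have "DIM(real^'d) = CARD('d)" by simp
  then have "countably_rectifiable (CARD('d) - 1) (corner_points V)" using corner_points_rectifiable[of V] by metis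
  then have "countably_rectifiable (CARD('d) - 1)
      (corner_points V \<union> (corner_ends \<union> regular_ends (reachable_boundary10 U S f \<nu>) \<nu>))"
    by (intro countably_rectifiable_Un corner_ends_rectifiable[OF DH loc] regular_ends_rectifiable[OF DH loc Z \<nu>_lip])
  then show ?thesis
    by (rule countably_rectifiable_subset) (use nondifferentiable_cases[OF sc ib \<rho>0 \<nu>] in blast)
qed

end

theorem theorem5p2:
  fixes U :: "(real^'m) set" and S :: "(real^'d) set"
    and f :: "real^'d \<Rightarrow> real^'m \<Rightarrow> real^'d"
    and r :: "real^'d \<Rightarrow> real^'m \<Rightarrow> real"
    and g V :: "real^'d \<Rightarrow> real"
    and \<nu> :: "real^'d \<Rightarrow> real^'d"
    and N L r0 \<rho>0 :: real
  assumes "U \<noteq> {}" and "compact U"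
    and "S \<noteq> {}" and "closed S"
    and "N > 0" and "L > 0" and "r0 > 0" and "\<rho>0 > 0"
    and "convexity_condition U f r"
    and "dynamics_condition U f N L"
    and "running_cost_condition U r L r0"
    and "terminal_cost_condition S g N r0"
    and "inner_ball_condition S \<rho>0"
    and "locally_semiconcave g"
    and "\<And>x. value_function U S f r g x = ereal (V x)"
    and "continuous_on UNIV V"
    and "C11_on (UNIV \<times> (UNIV - {0})) (\<lambda>(x, p). H0 U f x p)"
    and "\<And>x. x \<in> reachable_boundary1 U S f \<Longrightarrow>
           norm (\<nu> x) = 1 \<and> proximal_normal (closure (- S)) x = {s *\<^sub>R \<nu> x | s. s \<ge> 0}"
    and "countably_rectifiable (CARD('d) - 2) (reachable_boundary10 U S f \<nu>)"
    and "locally_lipschitz_on (reachable_boundary10 U S f \<nu>) \<nu>"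
  shows "countably_rectifiable (CARD('d) - 1) {x \<in> - S. \<not> V differentiable (at x)}"
proof -
  note a = assms
  obtain Df :: "real^'d \<Rightarrow> real^'m \<Rightarrow> ((real^'d) \<Rightarrow>\<^sub>L (real^'d))" where Df:
    "\<forall>x. \<forall>\<omega>\<in>U. ((\<lambda>z. f z \<omega>) has_derivative blinfun_apply (Df x \<omega>)) (at x)"
    "continuous_on (UNIV \<times> U) (\<lambda>(x, \<omega>). Df x \<omega>)"
    "\<forall>x y. \<forall>\<omega>\<in>U. norm (Df y \<omega> - Df x \<omega>) \<le> L * norm (y - x)"
    using a(10) unfolding dynamics_condition_def by blast
  obtain Dr :: "real^'d \<Rightarrow> real^'m \<Rightarrow> real^'d" where Dr:
    "\<forall>x. \<forall>\<omega>\<in>U. GDERIV (\<lambda>z. r z \<omega>) x :> Dr x \<omega>"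
    "continuous_on (UNIV \<times> U) (\<lambda>(x, \<omega>). Dr x \<omega>)"
    "\<forall>x y. \<forall>\<omega>\<in>U. \<bar>r y \<omega> - r x \<omega>\<bar> + norm (Dr y \<omega> - Dr x \<omega>) \<le> L * norm (y - x)"
    using a(11) unfolding running_cost_condition_def by blast
  obtain W G where W: "open W" "frontier S \<subseteq> W" "0 \<le> G" "G < r0 / N"
    "\<forall>x\<in>W. \<forall>y\<in>W. \<bar>g y - g x\<bar> \<le> G * norm (y - x)"
    using a(12) unfolding terminal_cost_condition_def by blast
  have f: "continuous_on (UNIV \<times> U) (\<lambda>(x, \<omega>). f x \<omega>)" "\<forall>x. \<forall>\<omega>\<in>U. norm (f x \<omega>) < N"
    "\<forall>x y. \<forall>\<omega>\<in>U. norm (f y \<omega> - f x \<omega>) \<le> L * norm (y - x)"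
    using a(10) unfolding dynamics_condition_def by blast+
  have r: "continuous_on (UNIV \<times> U) (\<lambda>(x, \<omega>). r x \<omega>)" "\<forall>x. \<forall>\<omega>\<in>U. r0 \<le> r x \<omega>"
    using a(11) unfolding running_cost_condition_def by blast+
  interpret exit_problem U S f r g V N L r0 G W Df Dr
  proof
    show "G * N < r0" using W(4) a(5) by (simp add: pos_less_divide_eq)
    show "norm (f x \<omega>) \<le> N" if "\<omega> \<in> U" for x \<omega> using f(2) that by (simp add: less_imp_le)
    show "\<bar>r y \<omega> - r x \<omega>\<bar> \<le> L * norm (y - x)" if "\<omega> \<in> U" for x y \<omega>
    proof -
      have "\<bar>r y \<omega> - r x \<omega>\<bar> + norm (Dr y \<omega> - Dr x \<omega>) \<le> L * norm (y - x)" using Dr(3) that by blast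
      then show ?thesis using norm_ge_zero[of "Dr y \<omega> - Dr x \<omega>"] by linarith
    qed
    show "norm (Dr y \<omega> - Dr x \<omega>) \<le> L * norm (y - x)" if "\<omega> \<in> U" for x y \<omega>
    proof -
      have "\<bar>r y \<omega> - r x \<omega>\<bar> + norm (Dr y \<omega> - Dr x \<omega>) \<le> L * norm (y - x)" using Dr(3) that by blast
      then show ?thesis by linarith
    qed
  qed (use a(1-7,15,16) f r W Df Dr in blast)+
  show ?thesis by (rule singular_set_rectifiable[OF a(14,13,8,17,18,19,20)])
qed

end
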